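(* Let $\mathcal M_\delta$ be the (nonempty) locus of connected degree $d$ cyclic covers, with local monodromy $\delta=(d_1,\dots,d_n)\in(\mathbb Z/d\mathbb Z)^n$, branched over a unit area flat torus with $n\ge2$ marked points, normalized to have unit area. Let $d_{abs}$ be the greatest divisor of $d$ coprime to $\gcd(\delta)=\gcd(d_1,\dots,d_n,d)$. Then $$c_{\mathrm{area}}(\mathcal M_\delta)=\frac3{\pi^2}\sum_{\mathfrak d\mid d_{abs}}\frac{\Phi(\mathfrak d)}{\mathfrak d^{2}}=\frac3{\pi^2}\bigl((Id_{-2}\cdot\Phi)\ast 1\bigr)(d_{abs}),$$ where $\Phi$ denotes the Euler totient function.
   Context: The base is the space of unit-area flat tori $(X,\omega)$ ($X$ an elliptic curve, $\omega$ a nonzero holomorphic 1-form) with $n$ distinct labelled marked points $\mathcal B=\{p_1,\dots,p_n\}$ varying freely. A connected degree $d$ cyclic cover branched over $\mathcal B$ is given by a surjection $\alpha:H_1(X\setminus\mathcal B;\mathbb Z)\to\mathbb Z/d\mathbb Z$; its local monodromy at $p_i$ is $d_i=\alpha(\gamma_i)$, $\gamma_i$ a small loop around $p_i$ ($d_i=0$ is allowed). $\mathcal M_\delta$ is the space of all such covers $(\widetilde X,\widetilde\omega)$, $\widetilde\omega$ the pullback of $\omega$ rescaled to unit area, with local monodromy $\delta$, as the marked torus varies; it is a (connected) finite cover of the space of marked tori and carries the induced measure. A cylinder is a maximal open (unoriented) cylinder foliated by parallel closed regular trajectories (avoiding singularities and marked points); $w(cyl)$ is its circumference. $c_{\mathrm{area}}(\mathcal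 M_\delta)=\lim_{L\to\infty}\frac1{\pi L^2}\sum_{cyl\subset\widetilde X,\ w(cyl)<L}\frac{\mathrm{area}(cyl)}{\mathrm{area}(\widetilde X,\widetilde\omega)}$, which exists and is the same for almost every $(\widetilde X,\widetilde\omega)\in\mathcal M_\delta$. $Id_k(m)=m^k$, $1(m)=1$, and $\ast$ is Dirichlet convolution. *)

theory Defs
  imports
    "HOL-Analysis.Analysis"
    "HOL-Homology.Homology"
    "HOL-Number_Theory.Number_Theory"
begin

section \<open>Flat tori with marked points\<close>

text \<open>
  A triple \<open>(a, b, p)\<close> stands for the translation surface \<open>(\<complex> / \<Lambda>, dz)\<close> with
  \<open>\<Lambda> = \<int> a + \<int> b\<close>, marked at the images of the \<open>p $ i\<close>. Every flat torus with labelled marked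
  points arises in this way; \<open>a\<close>, \<open>b\<close> and the \<open>p $ i\<close> are period coordinates, a translation factor
  included.
\<close>

type_synonym 'n marked_torus = "complex \<times> complex \<times> (complex ^ 'n)"

abbreviation (input) per1 :: "'n::finite marked_torus \<Rightarrow> complex" where "per1 x \<equiv> fst x"
abbreviation (input) per2 :: "'n::finite marked_torus \<Rightarrow> complex" where "per2 x \<equiv> fst (snd x)"
abbreviation (input) mark :: "'n::finite marked_torus \<Rightarrow> 'n \<Rightarrow> complex" where "mark x i \<equiv> snd (snd x) $ i"

definition period_lattice :: "'n::finite marked_torus \<Rightarrow> complex set" where
  "period_lattice x = {of_int m * per1 x + of_int n * per2 x | m n. True}"

definition torus_pt :: "'n::finite marked_torus \<Rightarrow> complex \<Rightarrow> complex set" where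
  "torus_pt x z = (\<lambda>l. z + l) ` period_lattice x"

definition torus_area :: "'n::finite marked_torus \<Rightarrow> real" where
  "torus_area x = Im (cnj (per1 x) * per2 x)"

definition fundamental_domain :: "'n::finite marked_torus \<Rightarrow> complex set" where
  "fundamental_domain x =
     {of_real s * per1 x + of_real t * per2 x | s t. 0 \<le> s \<and> s < 1 \<and> 0 \<le> t \<and> t < 1}"

definition torus_topology :: "'n::finite marked_torus \<Rightarrow> complex set topology" where
  "torus_topology x = topology (\<lambda>U. U \<subseteq> range (torus_pt x) \<and> open (torus_pt x -` U))"

lemma istopology_torus:
  "istopology (\<lambda>U. U \<subseteq> range (torus_pt x) \<and> open (torus_pt x -` U))"
  by (auto simp: istopology_def vimage_Int vimage_Union)

lemma openin_torus_topology:
  "openin (torus_topology x) U \<longleftrightarrow> U \<subseteq> range (torus_pt x) \<and> open (torus_pt x -` U)"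
  by (simp add: torus_topology_def topology_inverse'[OF istopology_torus])

lemma quotient_map_torus_pt: "quotient_map euclidean (torus_topology x) (torus_pt x)"
proof -
  have "torus_pt x -` range (torus_pt x) = UNIV"
    by auto
  then have "openin (torus_topology x) (range (torus_pt x))"
    by (simp add: openin_torus_topology)
  then have "topspace (torus_topology x) = range (torus_pt x)"
    by (metis openin_subset openin_topspace openin_torus_topology subset_antisym)
  then show ?thesis
    by (auto simp: quotient_map_def openin_torus_topology vimage_def)
qed

definition marked_pts :: "'n::finite marked_torus \<Rightarrow> complex set set" where
  "marked_pts x = range (\<lambda>i. torus_pt x (mark x i))"

definition unit_area_marked_torus :: "'n::finite marked_torus \<Rightarrow> bool" where
  "unit_area_marked_torus x \<longleftrightarrow> torus_area x = 1 \<and> inj (\<lambda>i. torus_pt x (mark x i))"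

definition punctured_torus :: "'n::finite marked_torus \<Rightarrow> complex set topology" where
  "punctured_torus x = subtopology (torus_topology x) (- marked_pts x)"


section \<open>Cyclic covers\<close>

definition point_chain :: "'a \<Rightarrow> 'a chain" where
  "point_chain y = frag_of (\<lambda>_\<in>standard_simplex 0. y)"

definition path_chain :: "(real \<Rightarrow> 'a) \<Rightarrow> 'a chain" where
  "path_chain g = frag_of (\<lambda>s\<in>standard_simplex 1. g (s 1))"

lemma chain_boundary_path_chain:
  "chain_boundary 1 (path_chain g) = point_chain (g 1) - point_chain (g 0)"
proof -
  have s0: "s = (\<lambda>i. if i = 0 then 1 else 0)" if "s \<in> standard_simplex 0" for s
    using that by (auto simp: standard_simplex_def fun_eq_iff)
  have sf: "simplical_face k s \<in> standard_simplex 1" if "s \<in> standard_simplex 0" "k \<le> 1" for k s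
    using simplical_face_in_standard_simplex[of 1 k s] that by simp
  have 1: "singular_face 1 0 (\<lambda>s\<in>standard_simplex 1. g (s 1)) = (\<lambda>_\<in>standard_simplex 0. g 1)"
  proof
    fix s show "singular_face 1 0 (\<lambda>s\<in>standard_simplex 1. g (s 1)) s = (\<lambda>_\<in>standard_simplex 0. g 1) s"
      using s0[of s] sf[of s 0] by (auto simp: singular_face_def simplical_face_def)
  qed
  have 2: "singular_face 1 1 (\<lambda>s\<in>standard_simplex 1. g (s 1)) = (\<lambda>_\<in>standard_simplex 0. g 0)"
  proof
    fix s show "singular_face 1 1 (\<lambda>s\<in>standard_simplex 1. g (s 1)) s = (\<lambda>_\<in>standard_simplex 0. g 0) s"
      using s0[of s] sf[of s 1] by (auto simp: singular_face_def simplical_face_def)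
  qed
  show ?thesis
    using 1 2 by (simp add: path_chain_def point_chain_def chain_boundary_of)
qed

abbreviation H1 :: "'n::finite marked_torus \<Rightarrow> complex set chain set monoid" where
  "H1 x \<equiv> homology_group 1 (punctured_torus x)"

definition h1_class :: "'n::finite marked_torus \<Rightarrow> complex set chain \<Rightarrow> complex set chain set" where
  "h1_class x c = homologous_rel_set 1 (punctured_torus x) {} c"

definition small_loop :: "'n::finite marked_torus \<Rightarrow> 'n \<Rightarrow> real \<Rightarrow> real \<Rightarrow> complex set" where
  "small_loop x i r t = torus_pt x (mark x i + of_real r * cis (2 * pi * t))"

definition has_local_monodromy ::
  "'n::finite marked_torus \<Rightarrow> (complex set chain set \<Rightarrow> int) \<Rightarrow> ('n \<Rightarrow> int) \<Rightarrow> bool" where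
  "has_local_monodromy x \<alpha> \<delta> \<longleftrightarrow>
     (\<forall>i. \<forall>\<^sub>F r in at_right 0. \<alpha> (h1_class x (path_chain (small_loop x i r))) = \<delta> i)"

text \<open>
  A point of the locus is a unit-area marked torus together with the homomorphism onto \<open>\<int> / d\<close> that
  defines the cover. Extensionality makes each homomorphism correspond to one HOL function.
\<close>

definition cyclic_cover_locus ::
  "nat \<Rightarrow> ('n::finite \<Rightarrow> int) \<Rightarrow> ('n marked_torus \<times> (complex set chain set \<Rightarrow> int)) set" where
  "cyclic_cover_locus d \<delta> =
     {(x, \<alpha>). unit_area_marked_torus x \<and>
              \<alpha> \<in> epi (H1 x) (integer_mod_group d) \<inter> extensional (carrier (H1 x)) \<and>
              has_local_monodromy x \<alpha> \<delta>}"

text \<open>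
  The covering surface, with the fibres over the marked points removed (a finite set, which meets no
  cylinder). A point over \<open>y\<close> is a class of singular 1-chains \<open>c\<close> with boundary \<open>y - y\<^sub>0\<close>, \<open>y\<^sub>0\<close> a
  base point, where two chains are identified if their difference, a 1-cycle, is killed by \<open>\<alpha>\<close>:
  this is the classical construction of a covering from path classes, for the subgroup \<open>ker \<alpha>\<close>.
  In particular the fibres are torsors under the image of \<open>\<alpha>\<close>.
\<close>

definition base_pt :: "'n::finite marked_torus \<Rightarrow> complex set" where
  "base_pt x = (SOME y. y \<in> topspace (punctured_torus x))"

definition chains_to :: "'n::finite marked_torus \<Rightarrow> complex set \<Rightarrow> complex set chain set" where
  "chains_to x y = {c. singular_chain 1 (punctured_torus x) c \<and>
                       chain_boundary 1 c = point_chain y - point_chain (base_pt x)}"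

type_synonym cover_pt = "complex set \<times> complex set chain set"

definition cover ::
  "'n::finite marked_torus \<Rightarrow> (complex set chain set \<Rightarrow> int) \<Rightarrow> cover_pt set" where
  "cover x \<alpha> = {(y, {c' \<in> chains_to x y. \<alpha> (h1_class x (c' - c)) = 0}) | y c.
                 y \<in> topspace (punctured_torus x) \<and> c \<in> chains_to x y}"

text \<open>The translation structure of the cover is given by the lifts of straight segments:
  \<open>straight_move x \<alpha> P u Q\<close> says that the segment from \<open>P\<close> with holonomy \<open>u\<close> stays on the punctured
  surface and ends at \<open>Q\<close>.\<close>

definition segment_from :: "complex set \<Rightarrow> complex \<Rightarrow> real \<Rightarrow> complex set" where
  "segment_from y u t = (\<lambda>z. z + of_real t * u) ` y"

definition straight_move ::
  "'n::finite marked_torus \<Rightarrow> (complex set chain set \<Rightarrow> int) \<Rightarrow> cover_pt \<Rightarrow> complex \<Rightarrow> cover_pt \<Rightarrow> bool" where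
  "straight_move x \<alpha> P u Q \<longleftrightarrow>
     P \<in> cover x \<alpha> \<and> Q \<in> cover x \<alpha> \<and>
     (\<forall>t\<in>{0..1}. segment_from (fst P) u t \<in> topspace (punctured_torus x)) \<and>
     fst Q = segment_from (fst P) u 1 \<and>
     (\<exists>c\<in>snd P. c + path_chain (segment_from (fst P) u) \<in> snd Q)"

text \<open>Area for the pullback of \<open>|dz|\<^sup>2\<close>: the sheets of \<open>S\<close> are counted over each point of the torus.\<close>

definition cover_area :: "'n::finite marked_torus \<Rightarrow> cover_pt set \<Rightarrow> real" where
  "cover_area x S =
     (LINT z:fundamental_domain x|lborel. real (card {P \<in> S. fst P = torus_pt x z}))"


section \<open>Cylinders\<close>

text \<open>
  An open cylinder with core holonomy \<open>v\<close> is the quotient of an open strip parallel to \<open>v\<close> by the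
  translation \<open>v\<close>, embedded in the surface by a map compatible with the translation structures.
  Since \<open>v\<close> and \<open>-v\<close> describe the same subsets, cylinders are unoriented.
\<close>

definition strip :: "complex \<Rightarrow> real \<Rightarrow> complex set" where
  "strip v h = {z. 0 < Im (z / v) * cmod v \<and> Im (z / v) * cmod v < h}"

definition cylinder_with_holonomy ::
  "'n::finite marked_torus \<Rightarrow> (complex set chain set \<Rightarrow> int) \<Rightarrow> cover_pt set \<Rightarrow> complex \<Rightarrow> bool" where
  "cylinder_with_holonomy x \<alpha> C v \<longleftrightarrow> v \<noteq> 0 \<and>
     (\<exists>h>0. \<exists>\<phi>. C = \<phi> ` strip v h \<and>
        (\<forall>z\<in>strip v h. \<forall>z'\<in>strip v h. straight_move x \<alpha> (\<phi> z) (z' - z) (\<phi> z')) \<and>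
        (\<forall>z\<in>strip v h. \<forall>z'\<in>strip v h. \<phi> z = \<phi> z' \<longleftrightarrow> (\<exists>m::int. z' - z = of_int m * v)))"

definition cylinder ::
  "'n::finite marked_torus \<Rightarrow> (complex set chain set \<Rightarrow> int) \<Rightarrow> cover_pt set \<Rightarrow> bool" where
  "cylinder x \<alpha> C \<longleftrightarrow> (\<exists>v. cylinder_with_holonomy x \<alpha> C v)"

definition maximal_cylinder ::
  "'n::finite marked_torus \<Rightarrow> (complex set chain set \<Rightarrow> int) \<Rightarrow> cover_pt set \<Rightarrow> bool" where
  "maximal_cylinder x \<alpha> C \<longleftrightarrow>
     cylinder x \<alpha> C \<and> (\<forall>C'. cylinder x \<alpha> C' \<and> C \<subseteq> C' \<longrightarrow> C' = C)"

text \<open>Circumference for the pullback form rescaled so that the cover has area 1.\<close>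

definition circumference ::
  "'n::finite marked_torus \<Rightarrow> (complex set chain set \<Rightarrow> int) \<Rightarrow> cover_pt set \<Rightarrow> real" where
  "circumference x \<alpha> C =
     (THE l. \<exists>v. cylinder_with_holonomy x \<alpha> C v \<and> l = cmod v) / sqrt (cover_area x (cover x \<alpha>))"

definition cylinder_area_sum ::
  "'n::finite marked_torus \<Rightarrow> (complex set chain set \<Rightarrow> int) \<Rightarrow> real \<Rightarrow> real" where
  "cylinder_area_sum x \<alpha> L =
     (\<Sum>C | maximal_cylinder x \<alpha> C \<and> circumference x \<alpha> C < L.
        cover_area x C / cover_area x (cover x \<alpha>))"


section \<open>The area Siegel--Veech constant\<close>

text \<open>
  The measure on unit-area surfaces is the cone measure: a set is null iff the cone over it is null
  for Lebesgue measure in period coordinates. A subset of the finite cover \<open>cyclic_cover_locus d \<delta>\<close>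
  is null iff its image in the space of marked tori is, so a property holds almost everywhere
  iff over almost every marked torus it holds for all covers.
\<close>

definition rescale_to_unit_area :: "'n::finite marked_torus \<Rightarrow> 'n marked_torus" where
  "rescale_to_unit_area x = (1 / sqrt (torus_area x)) *\<^sub>R x"

definition almost_every_cover ::
  "nat \<Rightarrow> ('n::finite \<Rightarrow> int) \<Rightarrow>
   ('n marked_torus \<Rightarrow> (complex set chain set \<Rightarrow> int) \<Rightarrow> bool) \<Rightarrow> bool" where
  "almost_every_cover d \<delta> P \<longleftrightarrow>
     (AE x in lborel. torus_area x > 0 \<longrightarrow>
        (\<forall>\<alpha>. (rescale_to_unit_area x, \<alpha>) \<in> cyclic_cover_locus d \<delta> \<longrightarrow>
             P (rescale_to_unit_area x) \<alpha>))"

definition has_c_area :: "nat \<Rightarrow> ('n::finite \<Rightarrow> int) \<Rightarrow> real \<Rightarrow> bool" where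
  "has_c_area d \<delta> c \<longleftrightarrow>
     almost_every_cover d \<delta> (\<lambda>x \<alpha>. ((\<lambda>L. cylinder_area_sum x \<alpha> L / (pi * L\<^sup>2)) \<longlongrightarrow> c) at_top)"

definition c_area :: "nat \<Rightarrow> ('n::finite \<Rightarrow> int) \<Rightarrow> real" where
  "c_area d \<delta> = (THE c. has_c_area d \<delta> c)"


section \<open>Arithmetic\<close>

definition d_abs :: "nat \<Rightarrow> ('n::finite \<Rightarrow> int) \<Rightarrow> nat" where
  "d_abs d \<delta> = Max {k. k dvd d \<and> coprime (int k) (Gcd (insert (int d) (range \<delta>)))}"

definition Id_pow :: "int \<Rightarrow> nat \<Rightarrow> real" where
  "Id_pow k m = real m powi k"

definition dirichlet_conv :: "(nat \<Rightarrow> real) \<Rightarrow> (nat \<Rightarrow> real) \<Rightarrow> nat \<Rightarrow> real" where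
  "dirichlet_conv f g m = (\<Sum>k | k dvd m. f k * g (m div k))"

end

theory Submission
  imports Defs
begin

text \<open>
  Fix a primitive lattice vector \<open>v = p a + q b\<close>. The monodromy along the closed geodesic of holonomy \<open>v\<close>
  through \<open>z\<close> is \<open>p A + q B - \<Sum>\<^sub>i d\<^sub>i \<lfloor>v \<times> (z - p\<^sub>i)\<rfloor>\<close> modulo \<open>d\<close>, because crossing a marked point
  changes it by a local monodromy. A geodesic of monodromy \<open>f\<close> lifts to curves of length \<open>ord(f) |v|\<close>, so
  the cylinder area sum is a sum over primitive \<open>v\<close> of areas of sets of points \<open>z\<close> in the torus.

  Expand the condition \<open>ord(f) |v| < R\<close> in characters \<open>e(j f / d)\<close>. If \<open>j\<close> kills all \<open>d\<^sub>i\<close>, the geometric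
  term disappears. Otherwise the sum over \<open>v\<close> is \<open>o(R\<^sup>2)\<close> for almost every torus: moving a marked point
  \<open>p\<^sub>i\<close> such that \<open>d\<close> does not divide \<open>j d\<^sub>i\<close> makes the terms pairwise orthogonal, which yields a strong law of large numbers.
  Hence the count is asymptotically that for \<open>(A, B)\<close> uniformly distributed in its class modulo
  \<open>g = gcd(\<delta>)\<close>, without the floor terms, and what remains
  is a count of primitive vectors in sublattices of \<open>\<int>\<^sup>2\<close> and the average of \<open>gcd(A + x g, B + y g, d)\<close>
  over \<open>x, y\<close>, where \<open>gcd(A, B, g, d) = 1\<close> by surjectivity of \<open>\<alpha>\<close>.

  The constant is unique since the locus meets a set of tori of positive measure: homomorphisms are
  transported along homeomorphisms between nearby marked tori.
\<close>

section \<open>Monodromy as an additive function of paths\<close>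

text \<open>Around a triangle with edges \<open>v\<close>, \<open>v'\<close>, \<open>v + v'\<close>
  the monodromy is the \<delta>-weighted number of enclosed punctures, and the floors fail to be
  additive by the same number. The corrected monodromy thus satisfies Cauchy's functional equation
  in the heights, and solutions with values in \<int> / d are constant; this is where the floor
  formula comes from.

  The integers \<open>A\<close>, \<open>B\<close> depend on the cover, whereas the exceptional null
  set of tori must not. The character sums are therefore formed for arbitrary integers
  \<open>A\<close>, \<open>B\<close>, as functions of the marked torus alone, and countably many
  null sets are discarded before a cover is chosen.

  By orthogonality the sum over |v| < k has second moment O(k^2). Against the normalisation k^4 this
  is summable, so the limit is taken along all integers k at once.

  The constant arises from 6 / (pi d) times the average gcd, the density of primitive vectors
  subject to the length condition; from 1 / 2, since \<open>v\<close> and \<open>- v\<close> give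
  the same cylinder; and from R^2 = d L^2, since the cover has area d before rescaling.\<close>

abbreviation unit_path :: "'a topology \<Rightarrow> (real \<Rightarrow> 'a) \<Rightarrow> bool" where
  "unit_path X g \<equiv> continuous_map (top_of_set {0..1}) X g"

lemma singular_chain_path_chain:
  assumes "unit_path X g"
  shows "singular_chain 1 X (path_chain g)"
proof -
  have "continuous_map (subtopology (powertop_real UNIV) (standard_simplex 1)) (top_of_set {0..1}) (\<lambda>s. s 1)"
    by (auto simp: continuous_map_in_subtopology standard_simplex_def
        intro!: continuous_map_from_subtopology continuous_map_product_projection)
  then have "continuous_map (subtopology (powertop_real UNIV) (standard_simplex 1)) X (g \<circ> (\<lambda>s. s 1))"
    using assms continuous_map_compose by blast
  then have "continuous_map (subtopology (powertop_real UNIV) (standard_simplex 1)) X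
      (\<lambda>s\<in>standard_simplex 1. g (s 1))"
    by (rule continuous_map_eq) (auto simp: topspace_standard_simplex)
  then show ?thesis
    by (simp add: path_chain_def singular_chain_of singular_simplex_def)
qed

lemma chain_map_path_chain: "chain_map 1 f (path_chain g) = path_chain (f \<circ> g)"
  by (auto simp: path_chain_def simplex_map_def intro!: arg_cong[where f = frag_of])

text \<open>A convex set is contractible, and in positive degree reduced and ordinary homology
  agree. Through this lemma the value of a path will depend only on its ends as long as it stays in
  a convex set free of punctures.\<close>

lemma singular_cycle_convex_boundary:
  fixes K :: "'b::real_normed_vector set"
  assumes "convex K" and "singular_relcycle 1 (top_of_set K) {} c"
  shows "singular_relboundary 1 (top_of_set K) {} c"
proof -
  have "contractible_space (top_of_set K)"
    using assms(1) by (simp add: contractible_space_top_of_set convex_imp_contractible)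
  then have "trivial_group (reduced_homology_group 1 (top_of_set K))"
    by (rule trivial_reduced_homology_group_contractible_space)
  then have triv: "trivial_group (relative_homology_group (int 1) (top_of_set K) {})"
    by (simp add: un_reduced_homology_group)
  have "homologous_rel_set 1 (top_of_set K) {} c \<in> carrier (relative_homology_group (int 1) (top_of_set K) {})"
    unfolding carrier_relative_homology_group using assms(2) by blast
  then have "homologous_rel_set 1 (top_of_set K) {} c = singular_relboundary_set 1 (top_of_set K) {}"
    using triv one_relative_homology_group[of 1 "top_of_set K" "{}"] unfolding trivial_group_def by simp
  then show ?thesis
    by (simp add: homologous_rel_set_eq_relboundary)
qed

locale torus_cover =
  fixes x :: "'n::finite marked_torus" and \<alpha> :: "complex set chain set \<Rightarrow> int"
    and d :: nat and \<delta> :: "'n \<Rightarrow> int"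
  assumes d_pos: "1 \<le> d" and in_locus: "(x, \<alpha>) \<in> cyclic_cover_locus d \<delta>"
begin

section \<open>The homomorphism on singular cycles\<close>

abbreviation "X \<equiv> punctured_torus x"

definition cyc_val :: "complex set chain \<Rightarrow> int" where
  "cyc_val c = \<alpha> (h1_class x c)"

abbreviation "cyc c \<equiv> singular_relcycle 1 X {} c"

lemma cyc_iff: "cyc c \<longleftrightarrow> singular_chain 1 X c \<and> chain_boundary 1 c = 0"
  by (simp add: singular_cycle)

lemma alpha_epi: "\<alpha> \<in> epi (H1 x) (integer_mod_group d)"
  using in_locus by (auto simp: cyclic_cover_locus_def)

lemma h1_class_in_carrier: "cyc c \<Longrightarrow> h1_class x c \<in> carrier (H1 x)"
  using carrier_relative_homology_group[of 1 X "{}"] by (auto simp: h1_class_def)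

lemma h1_class_add:
  assumes "cyc c" "cyc c'"
  shows "h1_class x (c + c') = h1_class x c \<otimes>\<^bsub>H1 x\<^esub> h1_class x c'"
proof -
  have "h1_class x c = r_coset (relcycle_group 1 X {}) (singular_relboundary_set 1 X {}) c" for c
    by (simp add: right_coset_singular_relboundary h1_class_def)
  then show ?thesis
    using normal.rcos_sum[OF normal_subgroup_singular_relboundary_relcycle, of c 1 X "{}" c'] assms
      carrier_relcycle_group[of 1 X "{}"]
    using mult_relative_homology_group[of 1 X "{}"]
    by (simp add: set_mult_def) 
qed

lemma cyc_val_add:
  assumes "cyc c" "cyc c'"
  shows "cyc_val (c + c') = (cyc_val c + cyc_val c') mod int d"
  using alpha_epi h1_class_in_carrier[OF assms(1)] h1_class_in_carrier[OF assms(2)]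
  by (auto simp: cyc_val_def h1_class_add[OF assms] epi_def hom_def)

lemma cyc_val_range:
  assumes "cyc c"
  shows "cyc_val c \<in> {0..<int d}"
  using alpha_epi h1_class_in_carrier[OF assms] d_pos
  by (auto simp: cyc_val_def epi_def hom_def carrier_integer_mod_group)

lemma cyc_val_surj:
  assumes "s \<in> {0..<int d}"
  obtains c where "cyc c" "cyc_val c = s"
proof -
  have "s \<in> \<alpha> ` carrier (H1 x)"
    using alpha_epi assms d_pos by (auto simp: epi_def carrier_integer_mod_group)
  then show ?thesis
    using carrier_relative_homology_group[of 1 X "{}"] that
    by (auto simp: cyc_val_def h1_class_def)
qed

lemma cyc_val_boundary:
  assumes "singular_relboundary 1 X {} c"
  shows "cyc_val c = 0"
proof -
  have "h1_class x c = \<one>\<^bsub>H1 x\<^esub>"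
    using assms one_relative_homology_group[of 1 X "{}"]
    by (simp add: h1_class_def homologous_rel_set_eq_relboundary)
  moreover have "group_hom (H1 x) (integer_mod_group d) \<alpha>"
    using alpha_epi by (auto simp: group_hom_def group_hom_axioms_def epi_def)
  ultimately show ?thesis
    using group_hom.hom_one[of "H1 x" "integer_mod_group d" \<alpha>] by (simp add: cyc_val_def)
qed


lemma cyc_val_minus:
  assumes "cyc c"
  shows "[cyc_val (- c) = - cyc_val c] (mod int d)"
proof -
  have c': "cyc (- c)"
    using assms by (simp add: singular_relcycle_minus del: One_nat_def)
  have "cyc_val (c + - c) = 0"
    by (rule cyc_val_boundary) simp
  then have "(cyc_val c + cyc_val (- c)) mod int d = 0"
    using cyc_val_add[OF assms c'] by simp
  then have "int d dvd cyc_val (- c) - (- cyc_val c)"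
    by (simp add: mod_eq_0_iff_dvd add.commute)
  then show ?thesis
    by (simp add: cong_iff_dvd_diff)
qed

text \<open>The value of \<open>\<alpha>\<close> on cycles is extended to all 1-chains by closing them up with a fixed choice
  of chains to the base point. The result is still additive and kills boundaries.\<close>

definition tail :: "complex set \<Rightarrow> complex set chain" where
  "tail y = (if chains_to x y \<noteq> {} then SOME c. c \<in> chains_to x y else 0)"

definition tail_ext :: "complex set chain \<Rightarrow> complex set chain" where
  "tail_ext = frag_extend (\<lambda>f. tail (f (\<lambda>i. if i = 0 then 1 else 0)))"

definition chain_val :: "complex set chain \<Rightarrow> int" where
  "chain_val c = cyc_val (c - tail_ext (chain_boundary 1 c))"

end

text \<open>Taken as the hypothesis of an intermediate locale: the algebra of
  \<open>chain_val\<close> rests on it, while its proof uses the generic segments that come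
  later.\<close>

definition (in torus_cover) all_reachable :: bool where
  "all_reachable \<longleftrightarrow> (\<forall>y \<in> topspace X. chains_to x y \<noteq> {})"

locale torus_cover_reach = torus_cover +
  assumes reach: "all_reachable"
begin

lemma tail_in: "y \<in> topspace X \<Longrightarrow> tail y \<in> chains_to x y"
  using reach unfolding all_reachable_def tail_def by (auto intro: someI)

lemma tail_ext_point [simp]: "tail_ext (point_chain y) = tail y"
proof -
  have "(\<lambda>i. if i = 0 then 1 else 0) \<in> standard_simplex 0"
    by (auto simp: standard_simplex_def)
  then show ?thesis
    by (simp add: tail_ext_def point_chain_def)
qed

lemma tail_ext_add: "tail_ext (b + c) = tail_ext b + tail_ext c"
  by (simp add: tail_ext_def frag_extend_add)

lemma tail_ext_diff: "tail_ext (b - c) = tail_ext b - tail_ext c"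
  by (simp add: tail_ext_def frag_extend_diff)

lemma simplex_1_boundary:
  assumes "singular_simplex 1 X f"
  obtains y y' where "y \<in> topspace X" "y' \<in> topspace X"
    "chain_boundary 1 (frag_of f) = point_chain y - point_chain y'"
proof -
  have s0: "s = (\<lambda>i. if i = 0 then 1 else 0)" if "s \<in> standard_simplex 0" for s
    using that by (auto simp: standard_simplex_def fun_eq_iff)
  have face: "singular_face 1 k f = (\<lambda>_\<in>standard_simplex 0. singular_face 1 k f (\<lambda>i. if i = 0 then 1 else 0))" for k
    by (rule ext) (use s0 in \<open>force simp: singular_face_def restrict_def\<close>)
  have mem: "singular_face 1 k f (\<lambda>i. if i = 0 then 1 else 0) \<in> topspace X" if "k \<le> 1" for k
  proof -
    have "singular_simplex 0 X (singular_face 1 k f)"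
      using singular_simplex_singular_face[OF assms, of k] that by simp
    moreover have "(\<lambda>i. if i = 0 then 1 else 0) \<in> standard_simplex 0"
      by (auto simp: standard_simplex_def)
    ultimately show ?thesis
      by (auto simp: singular_simplex_def continuous_map_def topspace_standard_simplex Pi_iff)
  qed
  show ?thesis
  proof (rule that[OF mem[of 0] mem[of 1]])
    show "chain_boundary 1 (frag_of f) = point_chain (singular_face 1 0 f (\<lambda>i. if i = 0 then 1 else 0))
        - point_chain (singular_face 1 1 f (\<lambda>i. if i = 0 then 1 else 0))"
      unfolding point_chain_def face[of 0, symmetric] face[of 1, symmetric]
      by (simp add: chain_boundary_of)
  qed auto
qed

text \<open>In the boundary of a 1-simplex the two end points have opposite signs, so the base point
  contributed by their tails cancels. Both claims pass to differences, hence to all chains.\<close>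

lemma tail_ext_boundary:
  assumes "singular_chain 1 X c"
  shows "singular_chain 1 X (tail_ext (chain_boundary 1 c)) \<and>
    chain_boundary 1 (tail_ext (chain_boundary 1 c)) = chain_boundary 1 c"
proof -
  have "Poly_Mapping.keys c \<subseteq> singular_simplex_set 1 X"
    using assms by (simp add: singular_chain_def)
  then show ?thesis
  proof (induction c rule: frag_induction)
    case zero
    then show ?case by (simp add: tail_ext_def singular_chain_0)
  next
    case (one f)
    then obtain y y' where y: "y \<in> topspace X" "y' \<in> topspace X"
      "chain_boundary 1 (frag_of f) = point_chain y - point_chain y'"
      using simplex_1_boundary by blast
    show ?case
      using tail_in[OF y(1)] tail_in[OF y(2)] y(3)
      by (auto simp: chains_to_def tail_ext_diff singular_chain_diff chain_boundary_diff)
  next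
    case (diff a b)
    then show ?case
      by (auto simp: chain_boundary_diff tail_ext_diff singular_chain_diff)
  qed
qed

lemma closed_up_cyc: "singular_chain 1 X c \<Longrightarrow> cyc (c - tail_ext (chain_boundary 1 c))"
  using tail_ext_boundary[of c] by (auto simp: cyc_iff singular_chain_diff chain_boundary_diff simp del: One_nat_def)

lemma chain_val_add:
  assumes "singular_chain 1 X b" "singular_chain 1 X c"
  shows "[chain_val (b + c) = chain_val b + chain_val c] (mod int d)"
proof -
  have "chain_val (b + c) = cyc_val ((b - tail_ext (chain_boundary 1 b)) + (c - tail_ext (chain_boundary 1 c)))"
    by (simp add: chain_val_def chain_boundary_add tail_ext_add algebra_simps)
  then show ?thesis
    using cyc_val_add[OF closed_up_cyc[OF assms(1)] closed_up_cyc[OF assms(2)]]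
    by (simp add: chain_val_def cong_def)
qed

lemma chain_val_cyc: "cyc c \<Longrightarrow> chain_val c = cyc_val c"
  by (simp add: chain_val_def cyc_iff tail_ext_def del: One_nat_def)

lemma chain_val_minus:
  assumes "singular_chain 1 X c"
  shows "[chain_val (- c) = - chain_val c] (mod int d)"
proof -
  have "chain_val (- c) = cyc_val (- (c - tail_ext (chain_boundary 1 c)))"
    by (simp add: chain_val_def chain_boundary_minus tail_ext_def frag_extend_minus)
  then show ?thesis
    using cyc_val_minus[OF closed_up_cyc[OF assms]] by (simp add: chain_val_def)
qed

section \<open>Values of paths modulo d\<close>

definition path_val :: "(real \<Rightarrow> complex set) \<Rightarrow> int" where
  "path_val g = chain_val (path_chain g)"

lemma path_val_closed:
  assumes "unit_path X g" "g 0 = g 1"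
  shows "path_val g = cyc_val (path_chain g)" "cyc (path_chain g)"
proof -
  show "cyc (path_chain g)"
    using assms singular_chain_path_chain[of X g] chain_boundary_path_chain[of g] by (simp add: cyc_iff del: One_nat_def)
  then show "path_val g = cyc_val (path_chain g)"
    by (simp add: path_val_def chain_val_cyc)
qed

text \<open>The closed chain \<open>g1 + g2 - g3\<close> bounds in \<open>K\<close>, so its image
  under \<open>f\<close> bounds in \<open>X\<close> and has value 0. The set \<open>K\<close> may
  lie in any normed space: it will be a convex piece of the plane for segments, the real line for
  arcs of a circle, the unit interval for an arbitrary path and a square for a homotopy.\<close>

lemma path_val_convex:
  fixes K :: "'b::real_normed_vector set"
  assumes K: "convex K" and f: "continuous_map (top_of_set K) X f"
    and g: "unit_path (top_of_set K) g1" "unit_path (top_of_set K) g2" "unit_path (top_of_set K) g3"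
    and ends: "g1 1 = g2 0" "g3 0 = g1 0" "g3 1 = g2 1"
  shows "[path_val (f \<circ> g3) = path_val (f \<circ> g1) + path_val (f \<circ> g2)] (mod int d)"
proof -
  let ?Y = "top_of_set K"
  define c where "c = path_chain g1 + path_chain g2 - path_chain g3"
  have ch: "singular_chain 1 ?Y (path_chain g1)" "singular_chain 1 ?Y (path_chain g2)"
    "singular_chain 1 ?Y (path_chain g3)"
    using g by (blast intro: singular_chain_path_chain)+
  have "singular_relcycle 1 ?Y {} c"
    using ch ends chain_boundary_path_chain[of g1] chain_boundary_path_chain[of g2] chain_boundary_path_chain[of g3]
    by (simp add: singular_cycle c_def singular_chain_diff singular_chain_add chain_boundary_diff chain_boundary_add)
  then have "singular_relboundary 1 ?Y {} c"
    by (rule singular_cycle_convex_boundary[OF K])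
  then have bd: "singular_relboundary 1 X {} (chain_map 1 f c)"
    using f by (auto intro: singular_relboundary_chain_map)
  have ch': "singular_chain 1 X (path_chain (f \<circ> g1))" "singular_chain 1 X (path_chain (f \<circ> g2))"
    "singular_chain 1 X (path_chain (f \<circ> g3))"
    using ch f singular_chain_chain_map[of 1 ?Y _ X f] chain_map_path_chain[of f] by metis+
  have eq: "chain_map 1 f c = path_chain (f \<circ> g1) + path_chain (f \<circ> g2) + - path_chain (f \<circ> g3)"
    unfolding c_def chain_map_diff chain_map_add chain_map_path_chain by simp
  have "chain_val (chain_map 1 f c) = 0"
    using bd cyc_val_boundary chain_val_cyc singular_relboundary_imp_relcycle by metis
  moreover have "[chain_val (chain_map 1 f c) = path_val (f \<circ> g1) + path_val (f \<circ> g2) + - path_val (f \<circ> g3)] (mod int d)"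
    unfolding eq path_val_def
    by (meson ch' chain_val_add chain_val_minus cong_add cong_trans cong_refl singular_chain_add singular_chain_minus)
  ultimately have "[0 = path_val (f \<circ> g1) + path_val (f \<circ> g2) - path_val (f \<circ> g3)] (mod int d)"
    by simp
  then show ?thesis
    by (metis cong_diff_iff_cong_0 cong_sym)
qed

end

section \<open>Planar geometry\<close>

text \<open>The oriented area of the parallelogram with sides \<open>e\<close> and \<open>w\<close>.
  For a lattice vector \<open>v\<close>, \<open>crs v z\<close> serves as the height of
  \<open>z\<close> across the direction \<open>v\<close>; between two lattice vectors of a unit area
  torus it is an integer, their intersection number.\<close>

definition crs :: "complex \<Rightarrow> complex \<Rightarrow> real" where
  "crs e w = Im (cnj e * w)"

lemma crs_alt: "crs e w = Re e * Im w - Im e * Re w"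
  by (simp add: crs_def)

lemma crs_simps [simp]:
  "crs 0 w = 0" "crs e 0 = 0" "crs e e = 0"
  "crs (of_real r * e) w = r * crs e w" "crs e (of_real r * w) = r * crs e w"
  by (simp_all add: crs_alt algebra_simps)

lemma crs_of_int [simp]:
  "crs (of_int k * e) w = of_int k * crs e w" "crs e (of_int k * w) = of_int k * crs e w"
  by (simp_all add: crs_alt algebra_simps)

lemma crs_linear:
  "crs (e + f) w = crs e w + crs f w" "crs e (w + z) = crs e w + crs e z"
  "crs (e - f) w = crs e w - crs f w" "crs e (w - z) = crs e w - crs e z"
  "crs (- e) w = - crs e w" "crs e (- w) = - crs e w"
  by (simp_all add: crs_alt algebra_simps)

lemma crs_commute: "crs w e = - crs e w"
  by (simp add: crs_alt)

lemma crs_scaleR [simp]: "crs (r *\<^sub>R e) w = r * crs e w" "crs e (r *\<^sub>R w) = r * crs e w"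
  by (simp_all add: scaleR_conv_of_real)

lemma crs_inner: "crs e w = (\<i> * e) \<bullet> w"
  by (simp add: crs_alt inner_complex_def)

lemma continuous_on_crs [continuous_intros]:
  "continuous_on S f \<Longrightarrow> continuous_on S (\<lambda>z. crs e (f z))"
  unfolding crs_def by (intro continuous_intros)

lemma convex_crs_ge: "convex {z. crs e (z - q) \<ge> 0}" "convex {z. crs (z - q) e \<ge> 0}"
proof -
  have "{z. crs e (z - q) \<ge> 0} = {z. (\<i> * e) \<bullet> z \<ge> crs e q}"
    by (simp add: crs_linear crs_inner[symmetric])
  then show "convex {z. crs e (z - q) \<ge> 0}"
    by (simp add: convex_halfspace_ge)
  have "{z. crs (z - q) e \<ge> 0} = {z. (\<i> * e) \<bullet> z \<le> crs e q}"
    by (subst crs_commute) (simp add: crs_linear crs_inner[symmetric])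
  then show "convex {z. crs (z - q) e \<ge> 0}"
    by (simp add: convex_halfspace_le)
qed

text \<open>Each pair forbids one line. Countably many lines are negligible, a nonempty open set is
  not.\<close>

lemma generic_point:
  assumes "countable F" and "\<And>e c. (e, c) \<in> F \<Longrightarrow> e \<noteq> 0" and "open S" "S \<noteq> {}"
  obtains w where "w \<in> S" "\<And>e c. (e, c) \<in> F \<Longrightarrow> crs e w \<noteq> c"
proof -
  have "negligible (\<Union>((\<lambda>(e, c). {w. crs e w = c}) ` F))"
  proof (rule negligible_countable_Union)
    show "countable ((\<lambda>(e, c). {w. crs e w = c}) ` F)"
      using assms(1) by simp
    fix T assume "T \<in> (\<lambda>(e, c). {w. crs e w = c}) ` F"
    then obtain e c where "(e, c) \<in> F" "T = {w. (\<i> * e) \<bullet> w = c}"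
      by (auto simp: crs_inner)
    then show "negligible T"
      using assms(2) negligible_hyperplane[of "\<i> * e" c] by auto
  qed
  then have "\<not> S \<subseteq> \<Union>((\<lambda>(e, c). {w. crs e w = c}) ` F)"
    using assms(3,4) negligible_subset open_not_negligible by blast
  then show ?thesis
    using that by fastforce
qed

text \<open>The three coefficients are twice the signed areas of the triangles that \<open>z\<close>
  spans with the edges, that is, the barycentric coordinates of \<open>z\<close> scaled by
  \<open>D\<close>.\<close>

lemma barycentric:
  assumes "D = crs (b - a) (c - a)"
  shows "of_real D * z = of_real (crs (c - b) (z - b)) * a + of_real (crs (a - c) (z - c)) * b
    + of_real (crs (b - a) (z - a)) * c"
    and "crs (c - b) (z - b) + crs (a - c) (z - c) + crs (b - a) (z - a) = D"
  unfolding assms by (auto simp: complex_eq_iff crs_alt algebra_simps)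

text \<open>On the line through \<open>a\<close> and \<open>b\<close> the barycentric coordinate of
  \<open>c\<close> vanishes; the other two are nonnegative and, after division by \<open>D\<close>,
  have sum 1.\<close>

lemma in_triangle_edge:
  assumes "crs (b - a) (c - a) > 0" "crs (b - a) (z - a) = 0"
    "crs (c - b) (z - b) \<ge> 0" "crs (a - c) (z - c) \<ge> 0"
  shows "z \<in> closed_segment a b"
proof -
  define D where "D = crs (b - a) (c - a)"
  define t where "t = crs (a - c) (z - c) / D"
  have D: "D > 0"
    using assms(1) by (simp add: D_def)
  have sum: "crs (c - b) (z - b) + crs (a - c) (z - c) = D"
    using barycentric(2)[OF D_def, of z] assms(2) by simp
  have "of_real D * z = of_real (crs (c - b) (z - b)) * a + of_real (crs (a - c) (z - c)) * b"
    using barycentric(1)[OF D_def, of z] assms(2) by simp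
  also have "\<dots> = of_real D * ((1 - t) *\<^sub>R a + t *\<^sub>R b)"
    using D sum by (auto simp: t_def scaleR_conv_of_real field_simps)
  finally have "z = (1 - t) *\<^sub>R a + t *\<^sub>R b"
    using D by simp
  moreover have "0 \<le> t" "t \<le> 1"
    using D sum assms(3,4) by (auto simp: t_def field_simps)
  ultimately show ?thesis
    by (auto simp: in_segment)
qed

text \<open>An interior only for vertices in counterclockwise order. Otherwise the set is empty,
  since the three areas add up to \<open>crs (b - a) (c - a)\<close>.\<close>

definition tri :: "complex \<Rightarrow> complex \<Rightarrow> complex \<Rightarrow> complex set" where
  "tri a b c = {z. crs (b - a) (z - a) > 0 \<and> crs (c - b) (z - b) > 0 \<and> crs (a - c) (z - c) > 0}"

definition ctri :: "complex \<Rightarrow> complex \<Rightarrow> complex \<Rightarrow> complex set" where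
  "ctri a b c = {z. crs (b - a) (z - a) \<ge> 0 \<and> crs (c - b) (z - b) \<ge> 0 \<and> crs (a - c) (z - c) \<ge> 0}"

lemma tri_rotate: "tri b c a = tri a b c" "ctri b c a = ctri a b c"
  by (auto simp: tri_def ctri_def)

lemma crs_rotate: "crs (c - b) (a - b) = crs (b - a) (c - a)"
  by (simp add: crs_alt algebra_simps)

lemma ctri_cases:
  assumes "crs (b - a) (c - a) > 0" "z \<in> ctri a b c"
  shows "z \<in> tri a b c \<or> z \<in> closed_segment a b \<or> z \<in> closed_segment b c \<or> z \<in> closed_segment c a"
proof -
  have "crs (c - b) (a - b) > 0" "crs (a - c) (b - c) > 0"
    using assms(1) by (simp_all add: crs_alt algebra_simps)
  then show ?thesis
    using in_triangle_edge[OF assms(1), of z] in_triangle_edge[of c b a z] in_triangle_edge[of a c b z] assms(2)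
    unfolding tri_def ctri_def mem_Collect_eq by argo
qed

lemma convex_ctri: "convex (ctri a b c)"
proof -
  have "ctri a b c = {z. crs (b - a) (z - a) \<ge> 0} \<inter> ({z. crs (c - b) (z - b) \<ge> 0} \<inter> {z. crs (a - c) (z - c) \<ge> 0})"
    by (auto simp: ctri_def)
  then show ?thesis
    by (simp add: convex_Int convex_crs_ge)
qed

lemma vertices_in_ctri:
  assumes "crs (b - a) (c - a) > 0"
  shows "a \<in> ctri a b c" "b \<in> ctri a b c" "c \<in> ctri a b c"
  using assms by (simp_all add: ctri_def crs_alt algebra_simps)

lemma bounded_tri:
  assumes "crs (b - a) (c - a) > 0"
  shows "bounded (tri a b c)"
proof -
  define D where "D = crs (b - a) (c - a)"
  have D: "D > 0"
    using assms(1) by (simp add: D_def)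
  have "norm z \<le> norm a + norm b + norm c" if "z \<in> tri a b c" for z
  proof -
    have le: "crs (c - b) (z - b) \<le> D" "crs (a - c) (z - c) \<le> D" "crs (b - a) (z - a) \<le> D"
      using barycentric(2)[OF D_def, of z] that by (auto simp: tri_def)
    have "D * norm z = norm (of_real D * z)"
      using D by (simp add: norm_mult)
    also have "\<dots> \<le> crs (c - b) (z - b) * norm a + crs (a - c) (z - c) * norm b + crs (b - a) (z - a) * norm c"
      unfolding barycentric(1)[OF D_def, of z] using that
      by (intro norm_triangle_mono) (auto simp: norm_mult tri_def)
    also have "\<dots> \<le> D * norm a + D * norm b + D * norm c"
      using le by (intro add_mono mult_right_mono) auto
    finally show ?thesis
      using D by (simp add: distrib_left[symmetric])
  qed
  then show ?thesis
    unfolding bounded_iff by blast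
qed

section \<open>Straight segments on the punctured torus\<close>

context torus_cover
begin

abbreviation "\<Lambda> \<equiv> period_lattice x"
abbreviation "pr \<equiv> torus_pt x"

definition punct :: "complex set" where
  "punct = {z. pr z \<in> marked_pts x}"

text \<open>The plane without the punctures covers the punctured torus but is not simply connected:
  closed curves in \<open>U\<close> can have monodromy. Its use is that a segment in
  \<open>U\<close> is given by its end points.\<close>

definition U :: "complex set" where
  "U = - punct"

lemma lattice_0 [simp]: "0 \<in> \<Lambda>"
  unfolding period_lattice_def by (intro CollectI exI[of _ 0]) simp

lemma lattice_add: "k \<in> \<Lambda> \<Longrightarrow> l \<in> \<Lambda> \<Longrightarrow> k + l \<in> \<Lambda>"
proof -
  assume "k \<in> \<Lambda>" "l \<in> \<Lambda>"
  then obtain m n m' n' where "k = of_int m * per1 x + of_int n * per2 x" "l = of_int m' * per1 x + of_int n' * per2 x"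
    unfolding period_lattice_def by blast
  then have "k + l = of_int (m + m') * per1 x + of_int (n + n') * per2 x"
    by (simp add: algebra_simps)
  then show ?thesis
    unfolding period_lattice_def by blast
qed

lemma lattice_minus: "k \<in> \<Lambda> \<Longrightarrow> - k \<in> \<Lambda>"
proof -
  assume "k \<in> \<Lambda>"
  then obtain m n where "k = of_int m * per1 x + of_int n * per2 x"
    unfolding period_lattice_def by blast
  then have "- k = of_int (- m) * per1 x + of_int (- n) * per2 x"
    by (simp add: algebra_simps)
  then show ?thesis
    unfolding period_lattice_def by blast
qed

lemma lattice_diff: "k \<in> \<Lambda> \<Longrightarrow> l \<in> \<Lambda> \<Longrightarrow> k - l \<in> \<Lambda>"
  using lattice_add[of k "- l"] lattice_minus by simp

lemma pr_eq_iff: "pr z = pr w \<longleftrightarrow> w - z \<in> \<Lambda>"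
proof
  assume "pr z = pr w"
  moreover have "w \<in> pr w"
    by (force simp: torus_pt_def image_iff intro!: bexI[of _ 0])
  ultimately have "w \<in> pr z"
    by simp
  then obtain l where "l \<in> \<Lambda>" "w = z + l"
    unfolding torus_pt_def by blast
  then show "w - z \<in> \<Lambda>"
    by simp
next
  assume w: "w - z \<in> \<Lambda>"
  then have w': "z - w \<in> \<Lambda>"
    using lattice_minus by fastforce
  show "pr z = pr w"
  proof (intro equalityI subsetI)
    fix y assume "y \<in> pr z"
    then obtain l where "l \<in> \<Lambda>" "y = w + ((z - w) + l)"
      by (auto simp: torus_pt_def)
    then show "y \<in> pr w"
      unfolding torus_pt_def by (blast intro: lattice_add[OF w'])
  next
    fix y assume "y \<in> pr w"
    then obtain l where "l \<in> \<Lambda>" "y = z + ((w - z) + l)"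
      by (auto simp: torus_pt_def)
    then show "y \<in> pr z"
      unfolding torus_pt_def by (blast intro: lattice_add[OF w])
  qed
qed

lemma pr_shift: "l \<in> \<Lambda> \<Longrightarrow> pr (z + l) = pr z"
  by (metis add_diff_cancel_left' pr_eq_iff)

lemma topspace_torus: "topspace (torus_topology x) = range pr"
  using quotient_map_torus_pt[of x] by (auto simp: quotient_map_def)

lemma topspace_X: "topspace X = pr ` U"
  by (auto simp: punctured_torus_def topspace_torus U_def punct_def)

lemma U_shift: "l \<in> \<Lambda> \<Longrightarrow> z + l \<in> U \<longleftrightarrow> z \<in> U"
  by (simp add: U_def punct_def pr_shift)

lemma pr_in_X [simp]: "pr z \<in> topspace X \<longleftrightarrow> z \<in> U"
  by (auto simp: punctured_torus_def topspace_torus U_def punct_def)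

lemma continuous_pr: "K \<subseteq> U \<Longrightarrow> continuous_map (top_of_set K) X pr"
  unfolding punctured_torus_def
  by (rule continuous_map_into_subtopology)
    (auto intro!: continuous_map_from_subtopology quotient_imp_continuous_map[OF quotient_map_torus_pt]
      simp: U_def punct_def)

lemma area_1: "crs (per1 x) (per2 x) = 1"
  using in_locus by (auto simp: cyclic_cover_locus_def unit_area_marked_torus_def torus_area_def crs_def)

lemma marks_inj: "mark x i - mark x j \<in> \<Lambda> \<Longrightarrow> i = j"
  using in_locus unfolding cyclic_cover_locus_def unit_area_marked_torus_def inj_def
  by (simp add: pr_eq_iff) (metis fst_conv snd_conv)

lemma punct_iff: "p \<in> punct \<longleftrightarrow> (\<exists>i. p - mark x i \<in> \<Lambda>)"
  unfolding punct_def marked_pts_def using pr_eq_iff[of "mark x _" p] by (auto simp: image_iff)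

definition puncture_index :: "complex \<Rightarrow> 'n" where
  "puncture_index p = (THE i. p - mark x i \<in> \<Lambda>)"

lemma puncture_index_eq: "p - mark x i \<in> \<Lambda> \<Longrightarrow> puncture_index p = i"
  unfolding puncture_index_def
proof (rule the_equality)
  fix j assume "p - mark x i \<in> \<Lambda>" "p - mark x j \<in> \<Lambda>"
  then have "mark x j - mark x i \<in> \<Lambda>"
    using lattice_diff[of "p - mark x i" "p - mark x j"] by simp
  then show "j = i"
    by (rule marks_inj)
qed auto

lemma lattice_countable: "countable \<Lambda>"
proof -
  have "\<Lambda> = (\<lambda>(m, n). of_int m * per1 x + of_int n * per2 x) ` (UNIV :: (int \<times> int) set)"
    by (auto simp: period_lattice_def)
  then show ?thesis
    by simp
qed

lemma punct_countable: "countable punct"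
proof -
  have "punct = (\<Union>i. (\<lambda>l. mark x i + l) ` \<Lambda>)"
  proof (intro equalityI subsetI)
    fix p assume "p \<in> punct"
    then obtain i where "p - mark x i \<in> \<Lambda>"
      by (auto simp: punct_iff)
    then show "p \<in> (\<Union>i. (\<lambda>l. mark x i + l) ` \<Lambda>)"
      by (intro UN_I[of i] image_eqI[of _ _ "p - mark x i"]) auto
  next
    fix p assume "p \<in> (\<Union>i. (\<lambda>l. mark x i + l) ` \<Lambda>)"
    then obtain i l where "l \<in> \<Lambda>" "p = mark x i + l"
      by blast
    then show "p \<in> punct"
      by (auto simp: punct_iff intro!: exI[of _ i])
  qed
  then show ?thesis
    using lattice_countable by simp
qed

text \<open>The coordinates of a lattice vector are its cross products with the periods, hence
  bounded by a multiple of its length.\<close>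

lemma lattice_finite_bounded:
  assumes "bounded S"
  shows "finite (\<Lambda> \<inter> S)"
proof -
  obtain C where C: "\<And>z. z \<in> S \<Longrightarrow> norm z \<le> C"
    using assms by (auto simp: bounded_iff)
  define M where "M = \<lceil>(norm (per1 x) + norm (per2 x)) * \<bar>C\<bar>\<rceil>"
  have crs_le: "\<bar>crs e w\<bar> \<le> norm e * norm w" for e w
    unfolding crs_def by (metis abs_Im_le_cmod complex_mod_cnj norm_mult)
  have "\<Lambda> \<inter> S \<subseteq> (\<lambda>(m, n). of_int m * per1 x + of_int n * per2 x) ` ({-M..M} \<times> {-M..M})"
  proof
    fix z assume z: "z \<in> \<Lambda> \<inter> S"
    then obtain m n where zmn: "z = of_int m * per1 x + of_int n * per2 x"
      by (auto simp: period_lattice_def)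
    have "crs (per1 x) z = of_int n" "crs z (per2 x) = of_int m"
      using area_1 by (simp_all add: zmn crs_linear)
    then have "\<bar>of_int n\<bar> \<le> norm (per1 x) * norm z" "\<bar>of_int m\<bar> \<le> norm z * norm (per2 x)"
      using crs_le by metis+
    moreover have "norm (per1 x) * norm z \<le> (norm (per1 x) + norm (per2 x)) * \<bar>C\<bar>"
      "norm z * norm (per2 x) \<le> (norm (per1 x) + norm (per2 x)) * \<bar>C\<bar>"
      using C[of z] z
      by (auto intro!: mult_mono simp: mult.commute[of "norm z"])
    ultimately have "\<bar>n\<bar> \<le> M" "\<bar>m\<bar> \<le> M"
      unfolding M_def by linarith+
    then show "z \<in> (\<lambda>(m, n). of_int m * per1 x + of_int n * per2 x) ` ({-M..M} \<times> {-M..M})"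
      unfolding zmn by (intro image_eqI[of _ _ "(m, n)"]) auto
  qed
  then show ?thesis
    by (rule finite_subset) simp
qed

lemma punct_finite_bounded:
  assumes "bounded S"
  shows "finite (punct \<inter> S)"
proof -
  have "punct \<inter> S \<subseteq> (\<Union>i. (\<lambda>l. l + mark x i) ` (\<Lambda> \<inter> (\<lambda>z. z - mark x i) ` S))"
  proof
    fix p assume p: "p \<in> punct \<inter> S"
    then obtain i where "p - mark x i \<in> \<Lambda>"
      by (auto simp: punct_iff)
    then show "p \<in> (\<Union>i. (\<lambda>l. l + mark x i) ` (\<Lambda> \<inter> (\<lambda>z. z - mark x i) ` S))"
      using p by (intro UN_I[of i] image_eqI[of _ _ "p - mark x i"]) auto
  qed
  moreover have "finite (\<Union>i. (\<lambda>l. l + mark x i) ` (\<Lambda> \<inter> (\<lambda>z. z - mark x i) ` S))"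
    using bounded_translation_minus[OF assms] by (intro finite_UN_I finite_imageI lattice_finite_bounded) auto
  ultimately show ?thesis
    by (rule finite_subset)
qed

text \<open>A point \<open>w\<close> is seen from \<open>z\<close> unless it lies on a line through
  \<open>z\<close> and a puncture. These are countably many lines; the family \<open>F\<close> lets
  further lines be avoided by the same choice.\<close>

lemma visible_point:
  assumes "countable Z" "Z \<subseteq> U" "open S" "S \<noteq> {}" "countable F" "\<And>e c. (e, c) \<in> F \<Longrightarrow> e \<noteq> 0"
  obtains w where "w \<in> S" "\<And>z. z \<in> Z \<Longrightarrow> closed_segment z w \<subseteq> U" "\<And>e c. (e, c) \<in> F \<Longrightarrow> crs e w \<noteq> c"
proof -
  define F' where "F' = (\<lambda>(z, p). (p - z, crs (p - z) z)) ` (Z \<times> punct)"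
  have "countable (F \<union> F')"
    using assms punct_countable by (simp add: F'_def)
  moreover have "e \<noteq> 0" if "(e, c) \<in> F \<union> F'" for e c
    using that assms by (auto simp: F'_def U_def)
  ultimately obtain w where w: "w \<in> S" "\<And>e c. (e, c) \<in> F \<union> F' \<Longrightarrow> crs e w \<noteq> c"
    using generic_point[of "F \<union> F'" S] assms(3,4) by metis
  have "p \<notin> closed_segment z w" if z: "z \<in> Z" and p: "p \<in> punct" for z p
  proof
    assume "p \<in> closed_segment z w"
    then obtain u where "p = (1 - u) *\<^sub>R z + u *\<^sub>R w"
      by (auto simp: in_segment)
    then have pz: "p - z = u *\<^sub>R (w - z)"
      by (simp add: algebra_simps)
    then have "crs (p - z) w = crs (p - z) z"
      using crs_simps(3)[of "w - z"] by (simp add: crs_linear crs_commute[of w z])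
    moreover have "(p - z, crs (p - z) z) \<in> F \<union> F'"
      using z p by (auto simp: F'_def image_iff intro!: bexI)
    ultimately show False
      using w(2) by blast
  qed
  then have "closed_segment z w \<subseteq> U" if "z \<in> Z" for z
    using that by (auto simp: U_def)
  then show ?thesis
    using that[of w] w by blast
qed

lemma unit_path_line:
  assumes "closed_segment z w \<subseteq> U"
  shows "unit_path X (pr \<circ> linepath z w)"
proof -
  have "unit_path (top_of_set (closed_segment z w)) (linepath z w)"
    by (auto simp: linepath_in_path intro!: continuous_on_linepath)
  then show ?thesis
    using continuous_map_compose continuous_pr[OF assms] by blast
qed

text \<open>Two points of \<open>U\<close> both see a generic third point, so two segments join
  them.\<close>

lemma reachable: "all_reachable"
  unfolding all_reachable_def
proof
  fix y assume y: "y \<in> topspace X"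
  have "base_pt x \<in> topspace X"
    unfolding base_pt_def using y by (rule someI)
  then obtain z z0 where z: "y = pr z" "z \<in> U" "base_pt x = pr z0" "z0 \<in> U"
    using y by (auto simp: topspace_X)
  obtain w where w: "closed_segment z w \<subseteq> U" "closed_segment z0 w \<subseteq> U"
    by (rule visible_point[of "{z, z0}" UNIV "{}"]) (use z in auto)
  let ?c = "path_chain (pr \<circ> linepath z0 w) + path_chain (pr \<circ> linepath w z)"
  have "closed_segment w z \<subseteq> U"
    using w by (simp add: closed_segment_commute)
  then have "?c \<in> chains_to x y"
    using singular_chain_path_chain[OF unit_path_line] w z
    by (simp add: chains_to_def singular_chain_add chain_boundary_add chain_boundary_path_chain linepath_0' linepath_1' del: One_nat_def)
  then show "chains_to x y \<noteq> {}"
    by blast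
qed

sublocale torus_cover_reach
  by unfold_locales (rule reachable)

end

section \<open>The monodromy of a triangle\<close>

lemma ctri_subset_convex:
  assumes "crs (b - a) (c - a) > 0" "convex C" "a \<in> C" "b \<in> C" "c \<in> C"
  shows "ctri a b c \<subseteq> C"
proof
  fix z assume z: "z \<in> ctri a b c"
  define D where "D = crs (b - a) (c - a)"
  have D: "D > 0"
    using assms(1) by (simp add: D_def)
  define t1 t2 t3 where "t1 = crs (c - b) (z - b) / D" and "t2 = crs (a - c) (z - c) / D"
    and "t3 = crs (b - a) (z - a) / D"
  have "of_real D * z = of_real D * (t1 *\<^sub>R a + t2 *\<^sub>R b + t3 *\<^sub>R c)"
    using barycentric(1)[OF D_def, of z] D
    by (simp add: t1_def t2_def t3_def scaleR_conv_of_real field_simps)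
  then have "z = t1 *\<^sub>R a + t2 *\<^sub>R b + t3 *\<^sub>R c"
    using D by simp
  moreover have "t1 + t2 + t3 = 1"
    using barycentric(2)[OF D_def, of z] D by (simp add: t1_def t2_def t3_def field_simps)
  moreover have "t1 \<ge> 0" "t2 \<ge> 0" "t3 \<ge> 0"
    using z D by (auto simp: t1_def t2_def t3_def ctri_def)
  ultimately have "z \<in> convex hull {a, b, c}"
    unfolding convex_hull_3 by blast
  moreover have "convex hull {a, b, c} \<subseteq> C"
    using assms by (intro hull_minimal) auto
  ultimately show "z \<in> C"
    by blast
qed

lemma unit_path_linepath:
  fixes p q :: "'a::real_normed_vector"
  assumes "convex K" "p \<in> K" "q \<in> K"
  shows "unit_path (top_of_set K) (linepath p q)"
proof -
  have "linepath p q ` {0..1} \<subseteq> K"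
    using closed_segment_subset[OF assms(2,3,1)] by (simp add: linepath_image_01)
  then show ?thesis
    by (simp add: continuous_on_linepath image_subset_iff_funcset)
qed

text \<open>Angles are measured in turns, so that a full circle is a parameter interval of length
  1.\<close>

definition circ :: "complex \<Rightarrow> real \<Rightarrow> real \<Rightarrow> complex" where
  "circ p r t = p + of_real r * cis (2 * pi * t)"

lemma circ_shift: "circ p r (t + 1) = circ p r t"
  by (simp add: circ_def cis_mult[symmetric] distrib_left)

lemma crs_cis: "crs (cis a) (cis b) = sin (b - a)"
  by (simp add: crs_alt sin_diff)

lemma sin_turn_nonneg: "0 \<le> v \<Longrightarrow> v \<le> 1/2 \<Longrightarrow> sin (2 * pi * v) \<ge> 0"
  using mult_left_mono[of "2 * v" 1 pi] by (intro sin_ge_zero) (auto simp: algebra_simps)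

lemma sin_turn_pos: "0 < v \<Longrightarrow> v < 1/2 \<Longrightarrow> sin (2 * pi * v) > 0"
  using mult_strict_left_mono[of "2 * v" 1 pi] by (intro sin_gt_zero) (auto simp: algebra_simps)

section \<open>Values of segments and circular arcs\<close>

context torus_cover
begin

text \<open>Meaningful only for segments inside \<open>U\<close>. A single value depends on the
  chosen tails, but modulo \<open>d\<close> the sum along a closed polygon does not.\<close>

definition ml :: "complex \<Rightarrow> complex \<Rightarrow> int" where
  "ml z w = path_val (pr \<circ> linepath z w)"

lemma ml_convex:
  assumes "convex K" "K \<subseteq> U" "a \<in> K" "b \<in> K" "c \<in> K"
  shows "[ml a c = ml a b + ml b c] (mod int d)"
proof -
  have "unit_path (top_of_set K) (linepath p q)" if "p \<in> K" "q \<in> K" for p q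
    using unit_path_linepath[OF assms(1) that] .
  then show ?thesis
    unfolding ml_def
    using assms by (intro path_val_convex[OF assms(1) continuous_pr[OF assms(2)]]) (auto simp: linepath_0' linepath_1')
qed

lemma ml_same: "z \<in> U \<Longrightarrow> [ml z z = 0] (mod int d)"
  using ml_convex[of "{z}" z z z] by (simp add: cong_iff_dvd_diff)

lemma ml_rev:
  assumes "closed_segment a b \<subseteq> U"
  shows "[ml b a = - ml a b] (mod int d)"
proof -
  have "[ml a a = ml a b + ml b a] (mod int d)"
    using assms by (intro ml_convex[OF convex_closed_segment]) auto
  moreover have "[ml a a = 0] (mod int d)"
    using assms by (intro ml_same) auto
  ultimately have "int d dvd ml b a - (- ml a b)"
    unfolding cong_iff_dvd_diff
    by (metis (no_types, opaque_lifting) add.commute cong_iff_dvd_diff cong_sym cong_trans diff_0_right diff_minus_eq_add)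
  then show ?thesis
    by (simp add: cong_iff_dvd_diff)
qed

lemma ml_split:
  assumes "closed_segment a b \<subseteq> U" "c \<in> closed_segment a b"
  shows "[ml a b = ml a c + ml c b] (mod int d)"
  using assms by (intro ml_convex[OF convex_closed_segment]) auto

lemma ml_shift:
  assumes "l \<in> \<Lambda>"
  shows "ml (z + l) (w + l) = ml z w"
proof -
  have "linepath (z + l) (w + l) t = linepath z w t + l" for t
    by (simp add: linepath_def algebra_simps)
  then have "pr \<circ> linepath (z + l) (w + l) = pr \<circ> linepath z w"
    by (auto simp: fun_eq_iff pr_shift[OF assms])
  then show ?thesis
    by (simp add: ml_def)
qed

text \<open>The circle is handled as the image of the real line, which is convex. This makes arcs
  additive for all parameters, also beyond a full turn.\<close>

definition arc_val :: "complex \<Rightarrow> real \<Rightarrow> real \<Rightarrow> real \<Rightarrow> int" where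
  "arc_val p r s t = path_val ((pr \<circ> circ p r) \<circ> linepath s t)"

lemma continuous_circ: "continuous_on S (circ p r)"
  unfolding circ_def by (intro continuous_intros)

lemma arc_val_add:
  assumes "\<And>t. circ p r t \<in> U"
  shows "[arc_val p r s u = arc_val p r s t + arc_val p r t u] (mod int d)"
  unfolding arc_val_def
proof (rule path_val_convex[of UNIV])
  have "continuous_map euclidean (top_of_set U) (circ p r)"
    using assms by (auto simp: continuous_map_in_subtopology continuous_circ continuous_map_iff_continuous2)
  then show "continuous_map (top_of_set UNIV) X (pr \<circ> circ p r)"
    using continuous_map_compose[OF _ continuous_pr[of U]] by simp
qed (auto simp: linepath_0' linepath_1' intro!: continuous_on_linepath)

text \<open>The arc over \<open>[0, s + 1]\<close> is split once at \<open>s\<close> and once at 1.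
  The arcs over \<open>[0, s]\<close> and \<open>[1, s + 1]\<close> are the same path, so the two
  remaining full turns agree.\<close>

lemma arc_val_full:
  assumes "\<And>t. circ p r t \<in> U"
  shows "[arc_val p r s (s + 1) = arc_val p r 0 1] (mod int d)"
proof -
  have "(pr \<circ> circ p r) \<circ> linepath 1 (s + 1) = (pr \<circ> circ p r) \<circ> linepath 0 s"
  proof
    fix t
    have "linepath 1 (s + 1) t = linepath 0 s t + 1"
      by (simp add: linepath_def algebra_simps)
    then show "((pr \<circ> circ p r) \<circ> linepath 1 (s + 1)) t = ((pr \<circ> circ p r) \<circ> linepath 0 s) t"
      by (simp add: circ_shift)
  qed
  then have "arc_val p r 1 (s + 1) = arc_val p r 0 s"
    by (simp add: arc_val_def)
  moreover have "[arc_val p r 0 (s + 1) = arc_val p r 0 s + arc_val p r s (s + 1)] (mod int d)"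
    "[arc_val p r 0 (s + 1) = arc_val p r 0 1 + arc_val p r 1 (s + 1)] (mod int d)"
    using assms by (intro arc_val_add; simp)+
  ultimately have "[arc_val p r 0 s + arc_val p r s (s + 1) = arc_val p r 0 1 + arc_val p r 0 s] (mod int d)"
    using cong_trans[OF cong_sym] by auto
  then have "[arc_val p r 0 s + arc_val p r s (s + 1) = arc_val p r 0 s + arc_val p r 0 1] (mod int d)"
    by (simp add: add.commute)
  then show ?thesis
    by (simp add: cong_add_lcancel)
qed

lemma puncture_isolated:
  assumes "p \<in> punct"
  shows "\<forall>\<^sub>F r in at_right 0. \<forall>t. circ p r t \<in> U"
proof -
  have "finite (punct \<inter> ball p 1 - {p})"
    using punct_finite_bounded[of "ball p 1"] by simp
  then obtain e where e: "e > 0" "\<And>q. q \<in> punct \<inter> ball p 1 - {p} \<Longrightarrow> e \<le> dist p q"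
    using finite_set_avoid[of "punct \<inter> ball p 1 - {p}" p] by blast
  have "circ p r t \<in> U" if "0 < r" "r < min e 1" for r t
  proof -
    have "dist p (circ p r t) = r"
      using that by (simp add: circ_def dist_norm norm_mult)
    then show ?thesis
      using e(2)[of "circ p r t"] that by (force simp: U_def)
  qed
  then show ?thesis
    using e(1) by (auto simp: eventually_at_right_field intro!: exI[of _ "min e 1"])
qed

lemma arc_val_puncture:
  assumes "p - mark x i \<in> \<Lambda>"
  shows "\<forall>\<^sub>F r in at_right 0. (\<forall>t. circ p r t \<in> U) \<and> arc_val p r 0 1 = \<delta> i"
proof -
  have "\<forall>\<^sub>F r in at_right 0. cyc_val (path_chain (small_loop x i r)) = \<delta> i"
    using in_locus by (auto simp: cyclic_cover_locus_def has_local_monodromy_def cyc_val_def)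
  moreover have "\<forall>\<^sub>F r in at_right 0. \<forall>t. circ p r t \<in> U"
    using assms by (intro puncture_isolated) (auto simp: punct_iff)
  ultimately show ?thesis
  proof eventually_elim
    case (elim r)
    have "(pr \<circ> circ p r) \<circ> linepath 0 1 = small_loop x i r"
    proof
      fix t :: real
      have "circ p r t = mark x i + of_real r * cis (2 * pi * t) + (p - mark x i)"
        by (simp add: circ_def)
      then have "pr (circ p r t) = pr (mark x i + of_real r * cis (2 * pi * t))"
        using pr_shift[OF assms] by (simp only:)
      then show "((pr \<circ> circ p r) \<circ> linepath 0 1) t = small_loop x i r t"
        by (simp add: small_loop_def linepath_def)
    qed
    moreover have "unit_path X (pr \<circ> circ p r)"
    proof -
      have "continuous_map (top_of_set {0..1}) (top_of_set U) (circ p r)"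
        using elim continuous_circ[of "{0..1}" p r] by (auto simp: image_subset_iff)
      from continuous_map_compose[OF this continuous_pr[of U]] show ?thesis
        by simp
    qed
    moreover have "(pr \<circ> circ p r) \<circ> linepath 0 1 = pr \<circ> circ p r"
      by (auto simp: linepath_def fun_eq_iff)
    moreover have "small_loop x i r 0 = small_loop x i r 1"
      by (simp add: small_loop_def)
    ultimately show ?case
      using elim path_val_closed(1)[of "pr \<circ> circ p r"] by (simp add: arc_val_def)
  qed
qed

text \<open>The edge from \<open>a\<close> to \<open>b\<close> is pushed, inside a convex set free
  of punctures, to the radius from \<open>a\<close> to the circle, the arc between the two radii,
  and the radius out to \<open>b\<close>.\<close>

lemma ml_sector:
  assumes pos: "crs (a - p) (b - p) > 0" and only: "punct \<inter> ctri p a b \<subseteq> {p}"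
    and s: "a - p = of_real A * cis (2 * pi * s)" and t: "b - p = of_real B * cis (2 * pi * t)"
    and AB: "A > 0" "B > 0" and st: "s < t" "t < s + 1/2" and r: "r > 0" "\<And>t. circ p r t \<in> U"
    and inside: "\<And>t. crs (b - a) (circ p r t - a) \<ge> 0"
  shows "[ml a b = ml a (circ p r s) + arc_val p r s t + ml (circ p r t) b] (mod int d)"
    and "[ml (circ p r s) a = - ml a (circ p r s)] (mod int d)"
proof -
  \<comment> \<open>The triangle \<open>p a b\<close> without its vertex \<open>p\<close>: the open
    half-plane bounded by the line through \<open>p\<close> parallel to the opposite edge removes
    just this point and keeps \<open>K\<close> convex.\<close>
  define K where "K = ctri p a b \<inter> {z. (\<i> * (a - b)) \<bullet> z > crs (a - b) p}"
  have Kpos: "(\<i> * (a - b)) \<bullet> z > crs (a - b) p \<longleftrightarrow> crs (a - p) (z - p) + crs (p - b) (z - b) > 0" for z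
    by (simp add: crs_inner[symmetric] crs_alt algebra_simps)
  have K: "convex K"
    unfolding K_def by (intro convex_Int convex_ctri convex_halfspace_gt)
  have KU: "K \<subseteq> U"
  proof
    fix z assume z: "z \<in> K"
    then have "z \<noteq> p"
      by (auto simp: K_def crs_inner)
    then show "z \<in> U"
      using z only by (auto simp: K_def U_def)
  qed
  have arc_in: "circ p r u \<in> K" if "s \<le> u" "u \<le> t" for u
  proof -
    have sn: "sin (2 * pi * (u - s)) \<ge> 0" "sin (2 * pi * (t - u)) \<ge> 0"
      using that st by (auto intro!: sin_turn_nonneg)
    have 1: "crs (a - p) (circ p r u - p) = A * r * sin (2 * pi * (u - s))"
      by (simp add: s circ_def crs_cis right_diff_distrib)
    have 2: "crs (p - b) (circ p r u - b) = B * r * sin (2 * pi * (t - u))"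
    proof -
      have "crs (p - b) (circ p r u - b) = - crs (b - p) (circ p r u - p)"
        by (simp add: crs_alt algebra_simps)
      also have "\<dots> = B * r * - sin (2 * pi * u - 2 * pi * t)"
        by (simp add: t circ_def crs_cis)
      finally show ?thesis
        by (simp add: right_diff_distrib flip: sin_minus)
    qed
    have "sin (2 * pi * (u - s)) + sin (2 * pi * (t - u)) > 0"
    proof (cases "u = s")
      case True
      then show ?thesis
        using st by (auto intro!: sin_turn_pos)
    next
      case False
      then have "sin (2 * pi * (u - s)) > 0"
        using that st by (auto intro!: sin_turn_pos)
      then show ?thesis
        using sn by simp
    qed
    then have "A * r * sin (2 * pi * (u - s)) + B * r * sin (2 * pi * (t - u)) > 0"
      using sn AB r(1) by (smt (verit, best) mult_nonneg_nonneg mult_pos_pos)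
    moreover have "circ p r u \<in> ctri p a b"
      using sn AB r(1) inside[of u] 1 2 by (simp add: ctri_def)
    ultimately show ?thesis
      using 1 2 Kpos by (simp add: K_def)
  qed
  have ends: "a \<in> K" "b \<in> K"
  proof -
    have "crs (p - b) (a - b) = crs (a - p) (b - p)"
      by (simp add: crs_alt algebra_simps)
    then show "a \<in> K" "b \<in> K"
      using vertices_in_ctri[OF pos] pos Kpos[of a] Kpos[of b] by (auto simp: K_def)
  qed
  have path: "unit_path (top_of_set K) (linepath q q')" if "q \<in> K" "q' \<in> K" for q q'
    using unit_path_linepath[OF K that] .
  have arc: "unit_path (top_of_set K) (circ p r \<circ> linepath s t)"
  proof -
    have "linepath s t u \<in> {s..t}" if "u \<in> {0..1}" for u
      using linepath_in_path[OF that, of s t] st by (simp add: closed_segment_eq_real_ivl)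
    then show ?thesis
      using continuous_on_compose[OF continuous_on_linepath continuous_circ] arc_in by (auto simp: comp_def)
  qed
  have ct: "circ p r s \<in> K" "circ p r t \<in> K"
    using arc_in st by auto
  have "[path_val (pr \<circ> linepath (circ p r s) b) = path_val (pr \<circ> (circ p r \<circ> linepath s t)) + path_val (pr \<circ> linepath (circ p r t) b)] (mod int d)"
    by (intro path_val_convex[OF K continuous_pr[OF KU]] path arc ct ends) (auto simp: linepath_0' linepath_1')
  then have "[ml (circ p r s) b = arc_val p r s t + ml (circ p r t) b] (mod int d)"
    by (simp add: ml_def arc_val_def comp_assoc)
  moreover have "[ml a b = ml a (circ p r s) + ml (circ p r s) b] (mod int d)"
    by (intro ml_convex[OF K KU] ends ct)
  ultimately show "[ml a b = ml a (circ p r s) + arc_val p r s t + ml (circ p r t) b] (mod int d)"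
    by (metis (no_types, opaque_lifting) add.assoc cong_add_lcancel cong_trans)
  show "[ml (circ p r s) a = - ml a (circ p r s)] (mod int d)"
    using closed_segment_subset[OF ends(1) ct(1) K] KU by (intro ml_rev) auto
qed


text \<open>The puncture \<open>p\<close> is joined to the corners, which gives three sectors. Their
  radial parts cancel in pairs, and their arcs form one full turn of a small circle, whose value is
  the local monodromy.\<close>

lemma ml_triangle_one:
  assumes pos: "crs (b - a) (c - a) > 0" and p: "p - mark x i \<in> \<Lambda>" "p \<in> tri a b c"
    and only: "punct \<inter> ctri a b c \<subseteq> {p}"
  shows "[ml a b + ml b c + ml c a = \<delta> i] (mod int d)"
proof -
  have posp: "crs (a - p) (b - p) > 0" "crs (b - p) (c - p) > 0" "crs (c - p) (a - p) > 0"
    using p(2) by (auto simp: tri_def crs_alt algebra_simps)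
  then have ne: "a \<noteq> p" "b \<noteq> p" "c \<noteq> p"
    by auto
  have pc: "p \<in> ctri a b c"
    using p(2) by (auto simp: tri_def ctri_def)
  define ang where "ang z w = Arg (w / z) / (2 * pi)" for z w :: complex
  have ang: "0 < ang z w" "ang z w < 1/2" if "crs z w > 0" for z w
  proof -
    have "z \<noteq> 0"
      using that by auto
    then have "Im (w / z) > 0"
      using that by (auto simp: Im_divide crs_alt power2_eq_square sum_squares_gt_zero_iff complex_eq_iff mult.commute intro!: divide_pos_pos)
    then have "0 < Arg (w / z)" "Arg (w / z) < pi"
      using Arg_lt_pi[of "w / z"] by auto
    then show "0 < ang z w" "ang z w < 1/2"
      by (auto simp: ang_def field_simps)
  qed
  have rot: "w = of_real (norm w) * cis (2 * pi * (s + ang z w))"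
    if "z = of_real (norm z) * cis (2 * pi * s)" "z \<noteq> 0" "w \<noteq> 0" for z w s
  proof -
    have "cis (2 * pi * s) = z / of_real (norm z)"
      using that by (metis nonzero_mult_div_cancel_left norm_eq_zero of_real_eq_0_iff)
    moreover have "cis (2 * pi * ang z w) = (w / z) / of_real (norm (w / z))"
      using that cis_Arg[of "w / z"] by (simp add: ang_def sgn_eq)
    ultimately show ?thesis
      using that by (simp add: distrib_left cis_mult[symmetric] norm_divide)
  qed
  define s where "s = Arg (a - p) / (2 * pi)"
  define t where "t = s + ang (a - p) (b - p)"
  define u where "u = t + ang (b - p) (c - p)"
  define s' where "s' = u + ang (c - p) (a - p)"
  have rs: "a - p = of_real (norm (a - p)) * cis (2 * pi * s)"
    using cis_Arg[of "a - p"] ne by (simp add: s_def sgn_eq)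
  have rt: "b - p = of_real (norm (b - p)) * cis (2 * pi * t)"
    unfolding t_def using rs ne by (intro rot) auto
  have ru: "c - p = of_real (norm (c - p)) * cis (2 * pi * u)"
    unfolding u_def using rt ne by (intro rot) auto
  have rs': "a - p = of_real (norm (a - p)) * cis (2 * pi * s')"
    unfolding s'_def using ru ne by (intro rot) auto
  have order: "s < t" "t < s + 1/2" "t < u" "u < t + 1/2" "u < s'" "s' < u + 1/2"
    using ang posp by (auto simp: t_def u_def s'_def)
  \<comment> \<open>Three positive angles below half a turn add up to a whole number of turns
    between 0 and 3/2, hence to one turn.\<close>
  have "s' = s + 1"
  proof -
    have "cis (2 * pi * s) = cis (2 * pi * s')"
      using rs rs' ne by (metis mult_cancel_left norm_eq_zero of_real_eq_0_iff right_minus_eq)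
    then have "cis (2 * pi * (s' - s)) = 1"
      by (simp add: right_diff_distrib flip: cis_divide)
    then have "cos (2 * pi * (s' - s)) = 1"
      by (metis cis.simps(1) one_complex.simps(1))
    then obtain n :: int where n: "2 * pi * (s' - s) = of_int n * (2 * pi)"
      using cos_one_2pi_int by (metis mult.assoc)
    then have "s' - s = of_int n"
      by simp
    moreover have "0 < s' - s" "s' - s < 3/2"
      using order by auto
    ultimately have "n = 1"
      by linarith
    then show ?thesis
      using \<open>s' - s = of_int n\<close> by simp
  qed
  have inner: "ctri p a b \<subseteq> ctri a b c" "ctri p b c \<subseteq> ctri a b c" "ctri p c a \<subseteq> ctri a b c"
    using posp vertices_in_ctri[OF pos] pc by (intro ctri_subset_convex convex_ctri; simp)+
  have ev_inside: "\<forall>\<^sub>F r in at_right 0. \<forall>t. crs (f - e) (circ p r t - e) \<ge> 0" if "crs (f - e) (p - e) > 0" for e f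
  proof -
    have "open {z. crs (f - e) (z - e) > 0}"
      by (intro open_Collect_less continuous_on_crs continuous_on_const continuous_on_diff continuous_on_id)
    moreover have "p \<in> {z. crs (f - e) (z - e) > 0}"
      using that by simp
    ultimately obtain \<epsilon> where \<epsilon>: "\<epsilon> > 0" "ball p \<epsilon> \<subseteq> {z. crs (f - e) (z - e) > 0}"
      by (rule openE)
    have "crs (f - e) (circ p r t - e) \<ge> 0" if "0 < r" "r < \<epsilon>" for r t
    proof -
      have "circ p r t \<in> ball p \<epsilon>"
        using that by (simp add: circ_def dist_norm norm_mult)
      then show ?thesis
        using \<epsilon>(2) by force
    qed
    then show ?thesis
      using \<epsilon>(1) by (auto simp: eventually_at_right_field intro!: exI[of _ \<epsilon>])
  qed
  have "\<forall>\<^sub>F r in at_right 0. ((\<forall>t. circ p r t \<in> U) \<and> arc_val p r 0 1 = \<delta> i) \<and>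
      (\<forall>t. crs (b - a) (circ p r t - a) \<ge> 0) \<and> (\<forall>t. crs (c - b) (circ p r t - b) \<ge> 0) \<and>
      (\<forall>t. crs (a - c) (circ p r t - c) \<ge> 0) \<and> r > 0"
    using p(2) eventually_at_right_less[of "0::real"]
    by (intro eventually_conj arc_val_puncture[OF p(1)] ev_inside) (auto simp: tri_def)
  then obtain r where "((\<forall>t. circ p r t \<in> U) \<and> arc_val p r 0 1 = \<delta> i) \<and>
      (\<forall>t. crs (b - a) (circ p r t - a) \<ge> 0) \<and> (\<forall>t. crs (c - b) (circ p r t - b) \<ge> 0) \<and>
      (\<forall>t. crs (a - c) (circ p r t - c) \<ge> 0) \<and> r > 0"
    using eventually_happens'[OF trivial_limit_at_right_real] by blast
  then have r: "\<And>t. circ p r t \<in> U" "arc_val p r 0 1 = \<delta> i" "r > 0"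
    "\<And>t. crs (b - a) (circ p r t - a) \<ge> 0" "\<And>t. crs (c - b) (circ p r t - b) \<ge> 0"
    "\<And>t. crs (a - c) (circ p r t - c) \<ge> 0"
    by blast+
  let ?A = "circ p r s" and ?B = "circ p r t" and ?C = "circ p r u"
  have n: "norm (a - p) > 0" "norm (b - p) > 0" "norm (c - p) > 0"
    using ne by auto
  have 1: "[ml a b = ml a ?A + arc_val p r s t + ml ?B b] (mod int d)" "[ml ?A a = - ml a ?A] (mod int d)"
    using only inner order r by (intro ml_sector[OF posp(1) _ rs rt n(1,2)]; auto)+
  have 2: "[ml b c = ml b ?B + arc_val p r t u + ml ?C c] (mod int d)" "[ml ?B b = - ml b ?B] (mod int d)"
    using only inner order r by (intro ml_sector[OF posp(2) _ rt ru n(2,3)]; auto)+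
  have 3: "[ml c a = ml c ?C + arc_val p r u s' + ml ?A a] (mod int d)" "[ml ?C c = - ml c ?C] (mod int d)"
    using only inner order r ml_sector[OF posp(3) _ ru rs' n(3,1), of r] \<open>s' = s + 1\<close> circ_shift[of p r s] by auto
  have arcs: "[arc_val p r s s' = arc_val p r s t + arc_val p r t s'] (mod int d)"
    "[arc_val p r t s' = arc_val p r t u + arc_val p r u s'] (mod int d)"
    "[arc_val p r s s' = \<delta> i] (mod int d)"
    using r arc_val_add[of p r] arc_val_full[of p r s] \<open>s' = s + 1\<close> by auto
  obtain k1 k2 k3 where "ml a b - (ml a ?A + arc_val p r s t + ml ?B b) = int d * k1"
    "ml b c - (ml b ?B + arc_val p r t u + ml ?C c) = int d * k2"
    "ml c a - (ml c ?C + arc_val p r u s' + ml ?A a) = int d * k3"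
    using 1(1) 2(1) 3(1) unfolding cong_iff_dvd_diff dvd_def by blast
  moreover obtain k4 k5 k6 where "ml ?A a - - ml a ?A = int d * k4" "ml ?B b - - ml b ?B = int d * k5"
    "ml ?C c - - ml c ?C = int d * k6"
    using 1(2) 2(2) 3(2) unfolding cong_iff_dvd_diff dvd_def by blast
  moreover obtain k7 k8 k9 where "arc_val p r s s' - (arc_val p r s t + arc_val p r t s') = int d * k7"
    "arc_val p r t s' - (arc_val p r t u + arc_val p r u s') = int d * k8"
    "arc_val p r s s' - \<delta> i = int d * k9"
    using arcs unfolding cong_iff_dvd_diff dvd_def by blast
  ultimately have "ml a b + ml b c + ml c a - \<delta> i = int d * (k1 + k2 + k3 + k4 + k5 + k6 - k7 - k8 + k9)"
    unfolding distrib_left right_diff_distrib by linarith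
  then show ?thesis
    unfolding cong_iff_dvd_diff by simp
qed


text \<open>A ray from \<open>a\<close> between the directions of \<open>p\<close> and
  \<open>q\<close> that misses all punctures cuts the triangle into two, each with fewer punctures.
  Additivity along the edge from \<open>b\<close> to \<open>c\<close> and cancellation along the cut
  give the claim from \<open>IH\<close>.\<close>

lemma ml_triangle_cut:
  assumes pos: "crs (b - a) (c - a) > 0"
    and seg: "closed_segment a b \<subseteq> U" "closed_segment b c \<subseteq> U" "closed_segment c a \<subseteq> U"
    and pq: "p \<in> punct \<inter> tri a b c" "q \<in> punct \<inter> tri a b c" "crs (p - a) (q - a) > 0"
    and IH: "\<And>a' b' c'. card (punct \<inter> tri a' b' c') < card (punct \<inter> tri a b c) \<Longrightarrow>
      crs (b' - a') (c' - a') > 0 \<Longrightarrow> closed_segment a' b' \<subseteq> U \<Longrightarrow> closed_segment b' c' \<subseteq> U \<Longrightarrow>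
      closed_segment c' a' \<subseteq> U \<Longrightarrow>
      [ml a' b' + ml b' c' + ml c' a' = (\<Sum>p\<in>punct \<inter> tri a' b' c'. \<delta> (puncture_index p))] (mod int d)"
  shows "[ml a b + ml b c + ml c a = (\<Sum>p\<in>punct \<inter> tri a b c. \<delta> (puncture_index p))] (mod int d)"
proof -
  \<comment> \<open>The part of the open triangle strictly between the rays from \<open>a\<close>
    through \<open>p\<close> and through \<open>q\<close>. It is open and contains the midpoint
    \<open>m\<close>.\<close>
  define S where "S = {w. crs (p - a) (w - a) > 0} \<inter> {w. crs (a - q) (w - a) > 0} \<inter> tri a b c"
  define m where "m = (1/2) *\<^sub>R p + (1/2) *\<^sub>R q"
  have "open S"
    unfolding S_def tri_def by (intro open_Int open_Collect_conj open_Collect_less continuous_intros)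
  moreover have "m \<in> S"
  proof -
    have "crs e (m - z) = (1/2) * crs e (p - z) + (1/2) * crs e (q - z)" for e z
      by (simp add: m_def crs_linear field_simps)
    moreover have "crs (a - q) (p - a) = crs (p - a) (q - a)" "crs (a - q) (q - a) = 0"
      by (simp_all add: crs_alt algebra_simps)
    ultimately show ?thesis
      using pq by (simp add: S_def tri_def)
  qed
  moreover have "countable ((\<lambda>z. (z - a, crs (z - a) a)) ` punct)"
    using punct_countable by simp
  moreover have "a \<in> U"
    using seg(1) by auto
  ultimately obtain w where w: "w \<in> S" "\<And>z. z \<in> punct \<Longrightarrow> crs (z - a) w \<noteq> crs (z - a) a"
    by (rule_tac generic_point[of "(\<lambda>z. (z - a, crs (z - a) a)) ` punct" S]) (auto simp: U_def)
  define f where "f z = crs (c - b) (z - b)" for z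
  have fa: "f a > 0" and fw: "f w > 0" "f w < f a"
    using w pos barycentric(2)[of "crs (b - a) (c - a)" b a c w] crs_rotate[of c b a]
    by (auto simp: f_def S_def tri_def)
  \<comment> \<open>The affine function \<open>f\<close> vanishes on the line through
    \<open>b\<close> and \<open>c\<close>. From \<open>a\<close> to \<open>w\<close> it drops from
    \<open>f a\<close> to \<open>f w\<close>, so along the ray it reaches 0 at the factor
    \<open>k\<close>.\<close>
  define k where "k = f a / (f a - f w)"
  have k: "k > 0"
    using fa fw by (simp add: k_def)
  define D where "D = a + k *\<^sub>R (w - a)"
  have Da: "D - a = k *\<^sub>R (w - a)"
    by (simp add: D_def)
  have fD: "crs (c - b) (D - b) = 0"
  proof -
    have "crs (c - b) (D - b) = f a + k * (f w - f a)"
      by (simp add: f_def D_def crs_linear algebra_simps)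
    then show ?thesis
      using fw by (simp add: k_def field_simps)
  qed
  have D1: "crs (b - a) (D - a) > 0"
    using w k by (simp add: Da S_def tri_def)
  have D2: "crs (D - a) (c - a) > 0"
  proof -
    have "crs (D - a) (c - a) = k * crs (a - c) (w - c)"
      by (simp add: Da) (simp add: crs_alt algebra_simps)
    then show ?thesis
      using w k by (simp add: S_def tri_def)
  qed
  have D3: "crs (a - c) (D - c) > 0"
    using D2 by (simp add: crs_alt algebra_simps)
  have D_in: "D \<in> closed_segment b c"
    using D1 D3 fD pos crs_rotate[of c b a] by (intro in_triangle_edge[of c b a D]) auto
  then obtain s where s: "D = (1 - s) *\<^sub>R b + s *\<^sub>R c" "0 \<le> s" "s \<le> 1"
    by (auto simp: in_segment)
  have "s \<noteq> 0" "s \<noteq> 1"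
    using D1 D2 s by auto
  then have "s > 0" "s < 1"
    using s by auto
  have Db: "D - b = s *\<^sub>R (c - b)" and cD: "c - D = (1 - s) *\<^sub>R (c - b)"
    by (simp_all add: s algebra_simps)
  have aD: "closed_segment a D \<subseteq> U"
  proof
    fix z assume "z \<in> closed_segment a D"
    then obtain v where v: "z = (1 - v) *\<^sub>R a + v *\<^sub>R D"
      by (auto simp: in_segment)
    then have "z - a = v *\<^sub>R (D - a)"
      by (simp add: algebra_simps)
    then have "z - a = (v * k) *\<^sub>R (w - a)"
      by (simp add: Da)
    then have "crs (z - a) w = crs (z - a) a"
      using crs_simps(3)[of "w - a"] by (simp add: crs_linear crs_commute[of w a])
    then show "z \<in> U"
      using w(2)[of z] by (auto simp: U_def)
  qed
  have split: "closed_segment b D \<subseteq> U" "closed_segment D c \<subseteq> U"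
    using D_in seg(2) by (meson closed_segment_subset convex_closed_segment ends_in_segment order_trans)+
  have t1: "tri a b D = {z \<in> tri a b c. crs (D - a) (z - a) < 0}"
  proof (intro equalityI subsetI)
    fix z assume z: "z \<in> tri a b D"
    then have z': "crs (b - a) (z - a) > 0" "crs (c - b) (z - b) > 0" "crs (a - D) (z - D) > 0"
      using \<open>s > 0\<close> by (auto simp: tri_def Db zero_less_mult_iff)
    \<comment> \<open>An identity of affine functions of \<open>z\<close>: the condition for the
      edge from \<open>c\<close> to \<open>a\<close> is a positive combination of those for the cut
      and for the edge from \<open>a\<close> to \<open>b\<close>.\<close>
    have "crs (b - a) (D - a) * crs (a - c) (z - c) = crs (a - D) (z - D) * crs (a - c) (b - c) + crs (b - a) (z - a) * crs (a - c) (D - c)"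
      by (simp add: crs_alt algebra_simps)
    moreover have "crs (a - c) (b - c) > 0"
      using pos by (simp add: crs_alt algebra_simps)
    ultimately have "crs (b - a) (D - a) * crs (a - c) (z - c) > 0"
      using z' D3 by (simp add: add_pos_pos)
    then have "crs (a - c) (z - c) > 0"
      using D1 by (simp add: zero_less_mult_iff)
    moreover have "crs (D - a) (z - a) < 0"
      using z'(3) by (simp add: crs_alt algebra_simps)
    ultimately show "z \<in> {z \<in> tri a b c. crs (D - a) (z - a) < 0}"
      using z' by (auto simp: tri_def)
  next
    fix z assume z: "z \<in> {z \<in> tri a b c. crs (D - a) (z - a) < 0}"
    moreover have "crs (a - D) (z - D) = - crs (D - a) (z - a)"
      by (simp add: crs_alt algebra_simps)
    ultimately show "z \<in> tri a b D"
      using \<open>s > 0\<close> by (auto simp: tri_def Db)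
  qed
  have t2: "tri a D c = {z \<in> tri a b c. crs (D - a) (z - a) > 0}"
  proof (intro equalityI subsetI)
    fix z assume z: "z \<in> tri a D c"
    have eq: "crs (c - D) (z - D) = (1 - s) * crs (c - b) (z - b)"
      using fD by (simp add: cD crs_linear algebra_simps)
    have z': "crs (D - a) (z - a) > 0" "crs (c - b) (z - b) > 0" "crs (a - c) (z - c) > 0"
      using z eq \<open>s < 1\<close> by (auto simp: tri_def zero_less_mult_iff)
    have "crs (D - a) (c - a) * crs (b - a) (z - a) = crs (a - c) (z - c) * crs (b - a) (D - a) + crs (D - a) (z - a) * crs (b - a) (c - a)"
      by (simp add: crs_alt algebra_simps)
    then have "crs (D - a) (c - a) * crs (b - a) (z - a) > 0"
      using z' D1 pos by (simp add: add_pos_pos)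
    then have "crs (b - a) (z - a) > 0"
      using D2 by (simp add: zero_less_mult_iff)
    then show "z \<in> {z \<in> tri a b c. crs (D - a) (z - a) > 0}"
      using z' by (auto simp: tri_def)
  next
    fix z assume z: "z \<in> {z \<in> tri a b c. crs (D - a) (z - a) > 0}"
    moreover have "crs (c - D) (z - D) = (1 - s) * crs (c - b) (z - b)"
      using fD by (simp add: cD crs_linear algebra_simps)
    ultimately show "z \<in> tri a D c"
      using \<open>s < 1\<close> by (auto simp: tri_def)
  qed
  have fin: "finite (punct \<inter> tri a b c)"
    by (rule punct_finite_bounded[OF bounded_tri[OF pos]])
  have off: "crs (D - a) (z - a) \<noteq> 0" if "z \<in> punct" for z
  proof -
    have "crs (D - a) (z - a) = - k * (crs (z - a) w - crs (z - a) a)"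
      by (simp add: Da) (simp add: crs_alt algebra_simps)
    then show ?thesis
      using w(2)[OF that] k by simp
  qed
  have un: "punct \<inter> tri a b c = (punct \<inter> tri a b D) \<union> (punct \<inter> tri a D c)"
    using off by (fastforce simp: t1 t2 linorder_neq_iff)
  have disj: "(punct \<inter> tri a b D) \<inter> (punct \<inter> tri a D c) = {}"
    by (auto simp: t1 t2)
  have pD: "p \<in> tri a b D" and qD: "q \<in> tri a D c"
  proof -
    have "crs (D - a) (p - a) = - k * crs (p - a) (w - a)" "crs (D - a) (q - a) = k * crs (a - q) (w - a)"
      by (simp_all add: Da) (simp_all add: crs_alt algebra_simps)
    then show "p \<in> tri a b D" "q \<in> tri a D c"
      using pq w k by (auto simp: t1 t2 S_def)
  qed
  have less: "card (punct \<inter> tri a b D) < card (punct \<inter> tri a b c)" "card (punct \<inter> tri a D c) < card (punct \<inter> tri a b c)"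
    using un disj pq pD qD by (intro psubset_card_mono fin; blast)+
  have "closed_segment D a \<subseteq> U"
    using aD by (simp add: closed_segment_commute)
  note I = IH[OF less(1) D1 seg(1) split(1) this] IH[OF less(2) D2 aD split(2) seg(3)]
  have sum: "(\<Sum>p\<in>punct \<inter> tri a b c. \<delta> (puncture_index p)) =
    (\<Sum>p\<in>punct \<inter> tri a b D. \<delta> (puncture_index p)) + (\<Sum>p\<in>punct \<inter> tri a D c. \<delta> (puncture_index p))"
    unfolding un using fin disj by (intro sum.union_disjoint) (auto simp: un)
  obtain k1 k2 where "ml a b + ml b D + ml D a - (\<Sum>p\<in>punct \<inter> tri a b D. \<delta> (puncture_index p)) = int d * k1"
    "ml a D + ml D c + ml c a - (\<Sum>p\<in>punct \<inter> tri a D c. \<delta> (puncture_index p)) = int d * k2"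
    using I unfolding cong_iff_dvd_diff dvd_def by blast
  moreover obtain k3 k4 where "ml b c - (ml b D + ml D c) = int d * k3" "ml D a - (- ml a D) = int d * k4"
    using ml_split[OF seg(2) D_in] ml_rev[OF aD] unfolding cong_iff_dvd_diff dvd_def by blast
  ultimately have "ml a b + ml b c + ml c a - (\<Sum>p\<in>punct \<inter> tri a b c. \<delta> (puncture_index p)) = int d * (k1 + k2 + k3 - k4)"
    unfolding sum distrib_left right_diff_distrib by linarith
  then show ?thesis
    unfolding cong_iff_dvd_diff by simp
qed

text \<open>Induction on the number of punctures inside: without punctures the closed triangle is a
  convex subset of \<open>U\<close>, a single puncture is treated by sectors, and two punctures are
  separated by a cut.\<close>

theorem ml_triangle:
  assumes "crs (b - a) (c - a) > 0"
    and "closed_segment a b \<subseteq> U" "closed_segment b c \<subseteq> U" "closed_segment c a \<subseteq> U"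
  shows "[ml a b + ml b c + ml c a = (\<Sum>p\<in>punct \<inter> tri a b c. \<delta> (puncture_index p))] (mod int d)"
  using assms
proof (induction "card (punct \<inter> tri a b c)" arbitrary: a b c rule: less_induct)
  case less
  note pos = less.prems(1) and seg = less.prems(2-4)
  have pos': "crs (c - b) (a - b) > 0"
    using pos by (simp add: crs_alt algebra_simps)
  have fin: "finite (punct \<inter> tri a b c)"
    by (rule punct_finite_bounded[OF bounded_tri[OF pos]])
  have only: "punct \<inter> ctri a b c \<subseteq> punct \<inter> tri a b c"
    using ctri_cases[OF pos] seg unfolding U_def by blast
  have IH: "[ml a' b' + ml b' c' + ml c' a' = (\<Sum>p\<in>punct \<inter> tri a' b' c'. \<delta> (puncture_index p))] (mod int d)"
    if "card (punct \<inter> tri a' b' c') < card (punct \<inter> tri a b c)"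
      "crs (b' - a') (c' - a') > 0" "closed_segment a' b' \<subseteq> U" "closed_segment b' c' \<subseteq> U" "closed_segment c' a' \<subseteq> U" for a' b' c'
    using less.hyps that by blast
  consider "punct \<inter> tri a b c = {}" | p where "punct \<inter> tri a b c = {p}"
    | p q where "p \<in> punct \<inter> tri a b c" "q \<in> punct \<inter> tri a b c" "p \<noteq> q"
    by (metis is_singletonI' is_singleton_the_elem)
  then show ?case
  proof cases
    case 1
    then have "ctri a b c \<subseteq> U"
      using only by (auto simp: U_def)
    then have "[ml a c = ml a b + ml b c] (mod int d)"
      using vertices_in_ctri[OF pos] by (intro ml_convex[OF convex_ctri])
    moreover have "[ml a c = - ml c a] (mod int d)"
      using seg(3) by (rule ml_rev)
    ultimately have "[ml a b + ml b c = - ml c a] (mod int d)"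
      using cong_sym cong_trans by blast
    then have "[ml a b + ml b c + ml c a = 0] (mod int d)"
      by (simp add: cong_iff_dvd_diff)
    then show ?thesis
      using 1 by simp
  next
    case 2
    then have "p \<in> punct"
      by blast
    then obtain i where i: "p - mark x i \<in> \<Lambda>"
      by (auto simp: punct_iff)
    then show ?thesis
      using ml_triangle_one[OF pos i] 2 only puncture_index_eq[OF i] by auto
  next
    case 3
    \<comment> \<open>Two punctures are seen in different directions from \<open>a\<close> or from
      \<open>b\<close>; otherwise \<open>p\<close> would lie on the line through \<open>a\<close>
      and \<open>b\<close>. The order of the two directions only exchanges the roles of
      \<open>p\<close> and \<open>q\<close>.\<close>
    consider "crs (p - a) (q - a) > 0" | "crs (q - a) (p - a) > 0" | "crs (p - b) (q - b) > 0" | "crs (q - b) (p - b) > 0"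
    proof -
      have "crs (p - a) (q - a) \<noteq> 0 \<or> crs (p - b) (q - b) \<noteq> 0"
      proof (rule ccontr)
        assume "\<not> ?thesis"
        then have 0: "crs (p - a) (q - a) = 0" "crs (p - b) (q - b) = 0"
          by auto
        define e where "e = q - p"
        have e: "crs e (a - p) = 0" "crs e (b - p) = 0" "e \<noteq> 0"
          using 0 3 by (simp_all add: e_def crs_alt algebra_simps)
        have "crs (a - p) (b - p) * ((Re e)\<^sup>2 + (Im e)\<^sup>2) =
          (Re (a - p) * Re e + Im (a - p) * Im e) * crs e (b - p) - (Re (b - p) * Re e + Im (b - p) * Im e) * crs e (a - p)"
          by (simp add: crs_alt power2_eq_square algebra_simps)
        then have "crs (a - p) (b - p) = 0"
          using e by (auto simp: complex_eq_iff sum_power2_eq_zero_iff)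
        moreover have "crs (a - p) (b - p) = crs (b - a) (p - a)"
          by (simp add: crs_alt algebra_simps)
        ultimately show False
          using 3 by (auto simp: tri_def)
      qed
      then show ?thesis
        using that crs_commute[of "q - a" "p - a"] crs_commute[of "q - b" "p - b"] by (metis linorder_neqE_linordered_idom neg_0_less_iff_less)
    qed
    then show ?thesis
    proof cases
      case 1 then show ?thesis using ml_triangle_cut[OF pos seg 3(1,2) _ IH] by blast
    next
      case 2 then show ?thesis using ml_triangle_cut[OF pos seg 3(2,1) _ IH] by blast
    next
      case c3: 3
      have "[ml b c + ml c a + ml a b = (\<Sum>p\<in>punct \<inter> tri b c a. \<delta> (puncture_index p))] (mod int d)"
        using 3 by (intro ml_triangle_cut[OF pos' seg(2,3,1) _ _ c3 IH]) (auto simp: tri_rotate)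
      then show ?thesis by (simp add: tri_rotate ac_simps)
    next
      case 4
      have "[ml b c + ml c a + ml a b = (\<Sum>p\<in>punct \<inter> tri b c a. \<delta> (puncture_index p))] (mod int d)"
        using 3 by (intro ml_triangle_cut[OF pos' seg(2,3,1) _ _ 4 IH]) (auto simp: tri_rotate)
      then show ?thesis by (simp add: tri_rotate ac_simps)
    qed
  qed
qed

end

section \<open>The monodromy of closed geodesics\<close>

lemma countable_avoid:
  fixes B :: "real set"
  assumes "countable B"
  obtains t where "t \<notin> B"
  using assms uncountable_UNIV_real by (metis UNIV_eq_I)

text \<open>A solution of Cauchy's functional equation with values in \<open>\<int> / d\<close> is constant, since the
  additive group of the reals is divisible.\<close>

lemma cauchy_torsion_constant:
  fixes g1 g2 g3 :: "real \<Rightarrow> int"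
  assumes d: "1 \<le> (d::nat)" and count: "countable B1" "countable B2" "countable B3"
    and eq: "\<And>x y. x \<notin> B1 \<Longrightarrow> y \<notin> B2 \<Longrightarrow> x + y \<notin> B3 \<Longrightarrow> [g1 x + g2 y = g3 (x + y)] (mod int d)"
    and x: "x1 \<notin> B1" "x2 \<notin> B1"
  shows "[g1 x1 = g1 x2] (mod int d)"
proof -
  \<comment> \<open>Steps of length \<open>t\<close> lead from \<open>x1\<close> to
    \<open>x2\<close> in \<open>d\<close> moves. The increment of \<open>g3\<close> over such a step
    does not depend on where it starts, so the total increment is a multiple of
    \<open>d\<close>.\<close>
  define t where "t = (x2 - x1) / d"
  have cnt: "countable ((\<lambda>b. b - s) ` B)" "countable ((\<lambda>b. s - b) ` B)" if "countable B" for s :: real and B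
    using that by auto
  have const: "[g3 (s + t) - g3 s = g3 (s' + t) - g3 s'] (mod int d)"
    if "s \<notin> B3" "s + t \<notin> B3" "s' \<notin> B3" "s' + t \<notin> B3" for s s'
  proof -
    obtain y where y: "y \<notin> B1 \<union> (\<lambda>b. b - t) ` B1 \<union> (\<lambda>b. s - b) ` B2 \<union> (\<lambda>b. s' - b) ` B2"
      using countable_avoid[of "B1 \<union> (\<lambda>b. b - t) ` B1 \<union> (\<lambda>b. s - b) ` B2 \<union> (\<lambda>b. s' - b) ` B2"] count by auto
    have mem: "y \<notin> B1" "y + t \<notin> B1" "s - y \<notin> B2" "s' - y \<notin> B2"
      using y image_eqI[of y "\<lambda>b. b - t" "y + t" B1] image_eqI[of y "\<lambda>b. s - b" "s - y" B2]
        image_eqI[of y "\<lambda>b. s' - b" "s' - y" B2] by auto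
    have *: "[g3 (r + t) - g3 r = g1 (y + t) - g1 y] (mod int d)" if "r \<notin> B3" "r + t \<notin> B3" "r - y \<notin> B2" for r
    proof -
      have "[g1 (y + t) + g2 (r - y) = g3 (r + t)] (mod int d)" "[g1 y + g2 (r - y) = g3 r] (mod int d)"
        using eq[of "y + t" "r - y"] eq[of y "r - y"] mem that by (simp_all add: add.commute)
      then have "[(g1 (y + t) + g2 (r - y)) - (g1 y + g2 (r - y)) = g3 (r + t) - g3 r] (mod int d)"
        by (rule cong_diff)
      then show ?thesis
        by (simp add: cong_sym)
    qed
    show ?thesis
      using *[of s] *[of s'] that mem cong_sym cong_trans by blast
  qed
  obtain y where y: "y \<notin> B2 \<union> (\<Union>k\<in>{..d}. (\<lambda>b. b - (x1 + real k * t)) ` B3)"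
    using countable_avoid[of "B2 \<union> (\<Union>k\<in>{..d}. (\<lambda>b. b - (x1 + real k * t)) ` B3)"] count by auto
  have yk: "x1 + y + real k * t \<notin> B3" if "k \<le> d" for k
  proof
    assume "x1 + y + real k * t \<in> B3"
    then have "y \<in> (\<lambda>b. b - (x1 + real k * t)) ` B3"
      by (intro image_eqI[of _ _ "x1 + y + real k * t"]) auto
    then show False
      using y that by blast
  qed
  define c where "c = g3 (x1 + y + t) - g3 (x1 + y)"
  have step: "[g3 (x1 + y + real k * t) = g3 (x1 + y) + int k * c] (mod int d)" if "k \<le> d" for k
    using that
  proof (induction k)
    case (Suc k)
    have k: "x1 + y + real (Suc k) * t = (x1 + y + real k * t) + t"
      by (simp add: algebra_simps)
    have "[g3 ((x1 + y + real k * t) + t) - g3 (x1 + y + real k * t) = c] (mod int d)"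
      unfolding c_def using yk[of 0] yk[of 1] yk[of k] yk[of "Suc k"] Suc.prems d k by (intro const) (auto simp: algebra_simps)
    then have "[g3 ((x1 + y + real k * t) + t) - g3 (x1 + y + real k * t) + g3 (x1 + y + real k * t) = c + (g3 (x1 + y) + int k * c)] (mod int d)"
      using Suc by (intro cong_add) auto
    then show ?case
      unfolding k by (simp add: algebra_simps)
  qed simp
  have x2: "x1 + y + real d * t = x2 + y"
    using d by (simp add: t_def)
  have "[g3 (x2 + y) = g3 (x1 + y) + int d * c] (mod int d)"
    using step[of d] x2 by simp
  then have 1: "[g3 (x2 + y) = g3 (x1 + y)] (mod int d)"
    by (simp add: cong_def)
  have "x1 + y \<notin> B3" "x2 + y \<notin> B3" "y \<notin> B2"
    using yk[of 0] yk[of d] x2 y by auto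
  then have "[g1 x1 + g2 y = g3 (x1 + y)] (mod int d)" "[g1 x2 + g2 y = g3 (x2 + y)] (mod int d)"
    using eq x by auto
  then have "[g1 x1 + g2 y = g1 x2 + g2 y] (mod int d)"
    using 1 cong_sym cong_trans by blast
  then show ?thesis
    by (simp add: cong_add_rcancel)
qed

text \<open>The inequalities say that \<open>m\<close> is at least floor \<alpha> + 1,
  \<open>n\<close> at least floor \<beta>, and \<open>m + n\<close> at most the floor of \<alpha> +
  \<beta>. So there is at most one solution, and it exists iff the floor of the sum exceeds the sum
  of the floors by 1.\<close>

lemma lattice_triangle_count:
  fixes \<alpha> \<beta> :: real
  assumes "\<alpha> \<notin> \<int>" "\<beta> \<notin> \<int>" "\<alpha> + \<beta> \<notin> \<int>"
  shows "{(m::int, n::int). of_int m - \<alpha> > 0 \<and> of_int n - \<beta> > - 1 \<and> of_int m - \<alpha> + (of_int n - \<beta>) < 0} =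
    (if \<lfloor>\<alpha> + \<beta>\<rfloor> = \<lfloor>\<alpha>\<rfloor> + \<lfloor>\<beta>\<rfloor> + 1 then {(\<lfloor>\<alpha>\<rfloor> + 1, \<lfloor>\<beta>\<rfloor>)} else {})"
    and "\<lfloor>\<alpha> + \<beta>\<rfloor> - \<lfloor>\<alpha>\<rfloor> - \<lfloor>\<beta>\<rfloor> = (if \<lfloor>\<alpha> + \<beta>\<rfloor> = \<lfloor>\<alpha>\<rfloor> + \<lfloor>\<beta>\<rfloor> + 1 then 1 else 0)"
proof -
  have "of_int m - \<alpha> > 0 \<longleftrightarrow> m \<ge> \<lfloor>\<alpha>\<rfloor> + 1" for m
    by linarith
  moreover have "of_int n - \<beta> > - 1 \<longleftrightarrow> n \<ge> \<lfloor>\<beta>\<rfloor>" for n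
    by linarith
  moreover have "of_int m - \<alpha> + (of_int n - \<beta>) < 0 \<longleftrightarrow> m + n \<le> \<lfloor>\<alpha> + \<beta>\<rfloor>" for m n
  proof -
    have "of_int (m + n) \<noteq> \<alpha> + \<beta>"
      using assms(3) by (metis Ints_of_int)
    then show ?thesis
      by (simp add: le_floor_iff) linarith
  qed
  moreover have "\<lfloor>\<alpha> + \<beta>\<rfloor> = \<lfloor>\<alpha>\<rfloor> + \<lfloor>\<beta>\<rfloor> \<or> \<lfloor>\<alpha> + \<beta>\<rfloor> = \<lfloor>\<alpha>\<rfloor> + \<lfloor>\<beta>\<rfloor> + 1"
    by linarith
  ultimately show "{(m::int, n::int). of_int m - \<alpha> > 0 \<and> of_int n - \<beta> > - 1 \<and> of_int m - \<alpha> + (of_int n - \<beta>) < 0} =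
    (if \<lfloor>\<alpha> + \<beta>\<rfloor> = \<lfloor>\<alpha>\<rfloor> + \<lfloor>\<beta>\<rfloor> + 1 then {(\<lfloor>\<alpha>\<rfloor> + 1, \<lfloor>\<beta>\<rfloor>)} else {})"
    "\<lfloor>\<alpha> + \<beta>\<rfloor> - \<lfloor>\<alpha>\<rfloor> - \<lfloor>\<beta>\<rfloor> = (if \<lfloor>\<alpha> + \<beta>\<rfloor> = \<lfloor>\<alpha>\<rfloor> + \<lfloor>\<beta>\<rfloor> + 1 then 1 else 0)"
    by auto
qed

section \<open>Closed geodesics and their corrected monodromy\<close>

context torus_cover
begin

definition F :: "complex \<Rightarrow> complex \<Rightarrow> int" where
  "F v z = ml z (z + v)"

text \<open>Excludes punctures from the whole line through \<open>z\<close> parallel to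
  \<open>v\<close>, and does so by heights, which makes the condition invariant along that
  line.\<close>

definition clear :: "complex \<Rightarrow> complex \<Rightarrow> bool" where
  "clear v z \<longleftrightarrow> (\<forall>p\<in>punct. crs v z \<noteq> crs v p)"

lemma punct_shift: "l \<in> \<Lambda> \<Longrightarrow> z + l \<in> punct \<longleftrightarrow> z \<in> punct"
  by (simp add: punct_def pr_shift)

lemma clear_shift:
  assumes "l \<in> \<Lambda>"
  shows "clear v (z + l) \<longleftrightarrow> clear v z"
proof -
  have "clear v (z + l)" if "clear v z" "l \<in> \<Lambda>" for z l
    unfolding clear_def
  proof
    fix p assume "p \<in> punct"
    then have "p - l \<in> punct"
      using punct_shift[OF lattice_minus[OF that(2)], of p] by simp
    then show "crs v (z + l) \<noteq> crs v p"
      using that(1) by (force simp: clear_def crs_linear)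
  qed
  from this[of z l] this[of "z + l" "- l"] show ?thesis
    using assms lattice_minus by auto
qed

lemma clear_line: "clear v z \<Longrightarrow> {w. crs v w = crs v z} \<subseteq> U"
  by (auto simp: clear_def U_def)

lemma convex_line: "convex {w. crs v w = c}"
  using convex_hyperplane[of "\<i> * v" c] by (simp add: crs_inner)

text \<open>The two closed geodesics are opposite sides of a parallelogram in \<open>K\<close> whose
  other two sides differ by the period \<open>v\<close> and so have the same value.\<close>

lemma F_const:
  assumes "v \<in> \<Lambda>" "convex K" "K \<subseteq> U" "z \<in> K" "z' \<in> K" "z + v \<in> K" "z' + v \<in> K"
  shows "[F v z = F v z'] (mod int d)"
proof -
  have "[ml z (z' + v) = ml z z' + ml z' (z' + v)] (mod int d)"
    "[ml z (z' + v) = ml z (z + v) + ml (z + v) (z' + v)] (mod int d)"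
    using assms by (intro ml_convex[of K]; simp)+
  then have "[ml z (z + v) + ml (z + v) (z' + v) = ml z z' + ml z' (z' + v)] (mod int d)"
    using cong_sym cong_trans by blast
  then have "[ml z z' + ml z (z + v) = ml z z' + ml z' (z' + v)] (mod int d)"
    unfolding ml_shift[OF assms(1)] by (simp add: add.commute)
  then show ?thesis
    by (simp add: F_def cong_add_lcancel)
qed

lemma F_height:
  assumes "v \<in> \<Lambda>" "clear v z" "crs v z' = crs v z"
  shows "[F v z = F v z'] (mod int d)"
  using assms by (intro F_const[OF assms(1) convex_line clear_line[OF assms(2)]]) (auto simp: crs_linear)

lemma F_shift: "l \<in> \<Lambda> \<Longrightarrow> F v (z + l) = F v z"
  using ml_shift[of l z "z + v"] by (simp add: F_def add.commute add.left_commute)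

lemma clear_segment: "clear v z \<Longrightarrow> closed_segment z (z + v) \<subseteq> U"
  using closed_segment_subset[of z "{w. crs v w = crs v z}" "z + v"] clear_line convex_line
  by (auto simp: crs_linear)

lemma F_minus:
  assumes "v \<in> \<Lambda>" "clear v z"
  shows "[F (- v) z = - F v z] (mod int d)"
proof -
  have "F (- v) z = ml (z + v) z"
    using ml_shift[OF assms(1), of z "z - v"] by (simp add: F_def)
  then show ?thesis
    using ml_rev[OF clear_segment[OF assms(2)]] by (simp add: F_def)
qed

lemma crs_lattice_Ints: "k \<in> \<Lambda> \<Longrightarrow> l \<in> \<Lambda> \<Longrightarrow> crs k l \<in> \<int>"
proof -
  assume "k \<in> \<Lambda>" "l \<in> \<Lambda>"
  then obtain m n m' n' where "k = of_int m * per1 x + of_int n * per2 x" "l = of_int m' * per1 x + of_int n' * per2 x"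
    unfolding period_lattice_def by blast
  then have "crs k l = of_int (m * n' - n * m')"
    using area_1 crs_commute[of "per2 x" "per1 x"] by (simp add: crs_linear algebra_simps)
  then show ?thesis
    by simp
qed

lemma lattice_of_int: "l \<in> \<Lambda> \<Longrightarrow> of_int k * l \<in> \<Lambda>"
proof -
  assume "l \<in> \<Lambda>"
  then obtain m n where "l = of_int m * per1 x + of_int n * per2 x"
    unfolding period_lattice_def by blast
  then have "of_int k * l = of_int (k * m) * per1 x + of_int (k * n) * per2 x"
    by (simp add: algebra_simps)
  then show ?thesis
    unfolding period_lattice_def by blast
qed

lemma basis_expand:
  assumes "crs v v' = 1"
  shows "z = of_real (crs z v') * v + of_real (crs v z) * v'"
proof -
  have "of_real (crs v v') * z = of_real (crs z v') * v + of_real (crs v z) * v'"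
    by (simp add: complex_eq_iff crs_alt algebra_simps)
  then show ?thesis
    using assms by simp
qed

text \<open>For primitive \<open>v\<close> the summand of \<open>i\<close> jumps by \<delta> i
  whenever \<open>z\<close> crosses a line in direction \<open>v\<close> through a translate of the
  mark \<open>i\<close>. Up to sign this will be the whole dependence of the monodromy on
  \<open>z\<close>.\<close>

definition heights :: "complex \<Rightarrow> complex \<Rightarrow> int" where
  "heights v z = (\<Sum>i\<in>UNIV. \<delta> i * \<lfloor>crs v (z - mark x i)\<rfloor>)"

text \<open>Primitivity enters here: multiples of \<open>v'\<close> carry the mark to punctures at
  every integer height difference.\<close>

lemma clear_not_int:
  assumes "v \<in> \<Lambda>" "v' \<in> \<Lambda>" "crs v v' = 1" "clear v z"
  shows "crs v (z - mark x i) \<notin> \<int>"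
proof
  assume "crs v (z - mark x i) \<in> \<int>"
  then obtain m where m: "crs v (z - mark x i) = of_int m"
    by (auto elim: Ints_cases)
  have "mark x i + of_int m * v' \<in> punct"
    using lattice_of_int[OF assms(2), of m] by (auto simp: punct_iff intro!: exI[of _ i])
  moreover have "crs v z = crs v (mark x i + of_int m * v')"
    using m assms(3) by (simp add: crs_linear)
  ultimately show False
    using assms(4) by (auto simp: clear_def)
qed

text \<open>Measured by \<open>crs v\<close> and \<open>crs v'\<close> relative to a mark, the
  translates of the mark are the integer points, and the triangle becomes that of
  \<open>lattice_triangle_count\<close>. The number of punctures is the defect of additivity of the
  floors.\<close>

lemma triangle_puncture_count:
  assumes v: "v \<in> \<Lambda>" "v' \<in> \<Lambda>" "crs v v' = 1"
    and cl: "clear v z" "clear v' z" "clear (v + v') z"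
  shows "(\<Sum>p\<in>punct \<inter> tri z (z + v) (z + v + v'). \<delta> (puncture_index p)) =
    heights (v + v') z - heights v z - heights v' z"
proof -
  let ?T = "tri z (z + v) (z + v + v')"
  have v'v: "crs v' v = - 1"
    using v crs_commute[of v' v] by simp
  have pos: "crs (z + v - z) (z + v + v' - z) > 0"
    using v by (simp add: crs_linear)
  have fin: "finite (punct \<inter> ?T)"
    by (rule punct_finite_bounded[OF bounded_tri[OF pos]])
  have inT: "p \<in> ?T \<longleftrightarrow> crs v (p - z) > 0 \<and> crs v' (p - z) > - 1 \<and> crs v (p - z) + crs v' (p - z) < 0" for p
  proof -
    have "crs v' (p - (z + v)) = crs v' (p - z) + 1"
      using v'v by (simp add: crs_linear)
    moreover have "crs (z - (z + v + v')) (p - (z + v + v')) = - (crs v (p - z) + crs v' (p - z))"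
      using v v'v by (simp add: crs_linear)
    ultimately show ?thesis
      by (auto simp: tri_def)
  qed
  have idx: "(\<Sum>p | p \<in> punct \<inter> ?T \<and> puncture_index p = i. \<delta> (puncture_index p)) =
     \<delta> i * (\<lfloor>crs (v + v') (z - mark x i)\<rfloor> - \<lfloor>crs v (z - mark x i)\<rfloor> - \<lfloor>crs v' (z - mark x i)\<rfloor>)" for i
  proof -
    define \<alpha> \<beta> where "\<alpha> = crs v (z - mark x i)" and "\<beta> = crs v' (z - mark x i)"
    have nonint: "\<alpha> \<notin> \<int>" "\<beta> \<notin> \<int>" "\<alpha> + \<beta> \<notin> \<int>"
    proof -
      show "\<alpha> \<notin> \<int>" unfolding \<alpha>_def by (rule clear_not_int[OF v cl(1)])
      show "\<beta> \<notin> \<int>" unfolding \<beta>_def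
        using v v'v by (intro clear_not_int[OF v(2) lattice_minus[OF v(1)] _ cl(2)]) (simp add: crs_linear)
      have "crs (v + v') (z - mark x i) \<notin> \<int>"
        using v v'v by (intro clear_not_int[OF lattice_add[OF v(1,2)] v(2) _ cl(3)]) (simp add: crs_linear)
      then show "\<alpha> + \<beta> \<notin> \<int>"
        by (simp add: \<alpha>_def \<beta>_def crs_linear algebra_simps)
    qed
    define S where "S = {(m::int, n::int). of_int m - \<alpha> > 0 \<and> of_int n - \<beta> > - 1 \<and> of_int m - \<alpha> + (of_int n - \<beta>) < 0}"
    \<comment> \<open>The translate at heights \<open>m\<close> for \<open>v\<close> and
      \<open>n\<close> for \<open>v'\<close> relative to the mark; the minus sign comes from
      \<open>crs v' v = - 1\<close>.\<close>
    define h where "h = (\<lambda>(m::int, n::int). mark x i + (of_int m * v' - of_int n * v))"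
    have crs_h: "crs v (h (m, n) - z) = of_int m - \<alpha>" "crs v' (h (m, n) - z) = of_int n - \<beta>" for m n
      using v v'v by (simp_all add: h_def \<alpha>_def \<beta>_def crs_linear)
    have "{p. p \<in> punct \<inter> ?T \<and> puncture_index p = i} = h ` S"
    proof (intro equalityI subsetI)
      fix p assume p: "p \<in> {p. p \<in> punct \<inter> ?T \<and> puncture_index p = i}"
      then have l: "p - mark x i \<in> \<Lambda>"
        using puncture_index_eq by (auto simp: punct_iff)
      obtain m n where mn: "crs v (p - mark x i) = of_int m" "crs v' (p - mark x i) = of_int n"
        using crs_lattice_Ints[OF v(1) l] crs_lattice_Ints[OF v(2) l] by (auto elim!: Ints_cases)
      have "p - mark x i = of_int m * v' - of_int n * v"
        using basis_expand[OF v(3), of "p - mark x i"] mn crs_commute[of "p - mark x i" v'] by simp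
      then have ph: "p = h (m, n)"
        by (simp add: h_def algebra_simps)
      moreover have "(m, n) \<in> S"
        using p crs_h[of m n] inT[of p] ph by (simp add: S_def)
      ultimately show "p \<in> h ` S"
        by blast
    next
      fix p assume "p \<in> h ` S"
      then obtain m n where mn: "(m, n) \<in> S" "p = h (m, n)"
        by auto
      have l: "p - mark x i \<in> \<Lambda>"
        using lattice_diff[OF lattice_of_int[OF v(2)] lattice_of_int[OF v(1)]] by (simp add: mn h_def)
      then show "p \<in> {p. p \<in> punct \<inter> ?T \<and> puncture_index p = i}"
        using mn inT[of p] crs_h[of m n] puncture_index_eq[OF l] by (auto simp: punct_iff S_def)
    qed
    moreover have "S = (if \<lfloor>\<alpha> + \<beta>\<rfloor> = \<lfloor>\<alpha>\<rfloor> + \<lfloor>\<beta>\<rfloor> + 1 then {(\<lfloor>\<alpha>\<rfloor> + 1, \<lfloor>\<beta>\<rfloor>)} else {})"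
      unfolding S_def by (rule lattice_triangle_count(1)[OF nonint])
    moreover have "crs (v + v') (z - mark x i) = \<alpha> + \<beta>"
      by (simp add: \<alpha>_def \<beta>_def crs_linear)
    moreover have "(\<Sum>p | p \<in> punct \<inter> ?T \<and> puncture_index p = i. \<delta> (puncture_index p)) =
        \<delta> i * int (card {p. p \<in> punct \<inter> ?T \<and> puncture_index p = i})"
      by (simp add: mult.commute)
    ultimately show ?thesis
      using lattice_triangle_count(2)[OF nonint] by (simp add: \<alpha>_def \<beta>_def)
  qed
  have "(\<Sum>p\<in>punct \<inter> ?T. \<delta> (puncture_index p)) =
    (\<Sum>i\<in>UNIV. \<Sum>p | p \<in> punct \<inter> ?T \<and> puncture_index p = i. \<delta> (puncture_index p))"
    by (rule sum.group[symmetric]) (use fin in auto)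
  then show ?thesis
    unfolding idx by (simp add: heights_def sum_subtractf right_diff_distrib)
qed

definition G :: "complex \<Rightarrow> complex \<Rightarrow> int" where
  "G v z = F v z + heights v z"

text \<open>The triangle formula gives the failure of additivity of \<open>F\<close>, the puncture
  count that of \<open>heights\<close>; the two are opposite.\<close>

lemma G_add:
  assumes v: "v \<in> \<Lambda>" "v' \<in> \<Lambda>" "crs v v' = 1"
    and cl: "clear v z" "clear v' z" "clear (v + v') z"
  shows "[G v z + G v' z = G (v + v') z] (mod int d)"
proof -
  have cl': "clear v' (z + v)"
    using cl clear_shift v by blast
  have seg: "closed_segment z (z + v) \<subseteq> U" "closed_segment (z + v) (z + v + v') \<subseteq> U" "closed_segment z (z + v + v') \<subseteq> U"
    using clear_segment[OF cl(1)] clear_segment[OF cl'] clear_segment[OF cl(3)] by (simp_all add: add.assoc)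
  have "[ml z (z + v) + ml (z + v) (z + v + v') + ml (z + v + v') z =
      heights (v + v') z - heights v z - heights v' z] (mod int d)"
    unfolding triangle_puncture_count[OF v cl, symmetric]
    using v seg by (intro ml_triangle) (auto simp: crs_linear closed_segment_commute)
  moreover have "ml (z + v) (z + v + v') = F v' z"
    using F_shift[OF v(1), of v' z] by (simp add: F_def)
  moreover have "[ml (z + v + v') z = - F (v + v') z] (mod int d)"
    using ml_rev[OF seg(3)] by (simp add: F_def add.assoc)
  ultimately obtain k1 k2 where "F v z + F v' z + ml (z + v + v') z - (heights (v + v') z - heights v z - heights v' z) = int d * k1"
    "ml (z + v + v') z - (- F (v + v') z) = int d * k2"
    unfolding cong_iff_dvd_diff dvd_def by (auto simp: F_def)
  then have "G v z + G v' z - G (v + v') z = int d * (k1 - k2)"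
    unfolding G_def right_diff_distrib by linarith
  then show ?thesis
    unfolding cong_iff_dvd_diff by simp
qed

lemma G_height:
  assumes "v \<in> \<Lambda>" "clear v z" "crs v z' = crs v z"
  shows "[G v z = G v z'] (mod int d)"
proof -
  have "heights v z = heights v z'"
    using assms(3) by (simp add: heights_def crs_linear)
  then show ?thesis
    using F_height[OF assms] by (simp add: G_def cong_add_rcancel)
qed

text \<open>\<open>G v\<close> depends on the height only. With independent heights \<open>s\<close>
  for \<open>v\<close> and \<open>t\<close> for \<open>v'\<close>, \<open>G_add\<close> is Cauchy's
  equation in \<open>s\<close> and \<open>t\<close>, valid off the countably many heights of
  punctures.\<close>

lemma G_const:
  assumes v: "v \<in> \<Lambda>" "v' \<in> \<Lambda>" "crs v v' = 1" and z: "clear v z1" "clear v z2"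
  shows "[G v z1 = G v z2] (mod int d)"
proof -
  define P where "P s t = of_real s * v' - of_real t * v" for s t
  have P: "crs v (P s t) = s" "crs v' (P s t) = t" "crs (v + v') (P s t) = s + t" for s t
    using v crs_commute[of v' v] by (simp_all add: P_def crs_linear)
  have "[G v (P (crs v z1) 0) = G v (P (crs v z2) 0)] (mod int d)"
  proof (rule cauchy_torsion_constant[OF d_pos, where ?g2.0 = "\<lambda>t. G v' (P 0 t)" and ?g3.0 = "\<lambda>s. G (v + v') (P s 0)" and ?g1.0 = "\<lambda>s. G v (P s 0)"
        and ?B1.0 = "crs v ` punct" and ?B2.0 = "crs v' ` punct" and ?B3.0 = "crs (v + v') ` punct"])
    fix s t assume st: "s \<notin> crs v ` punct" "t \<notin> crs v' ` punct" "s + t \<notin> crs (v + v') ` punct"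
    then have cl: "clear v (P s t)" "clear v' (P s t)" "clear (v + v') (P s t)"
      unfolding clear_def P by blast+
    have "[G v (P s t) = G v (P s 0)] (mod int d)" "[G v' (P s t) = G v' (P 0 t)] (mod int d)"
      "[G (v + v') (P s t) = G (v + v') (P (s + t) 0)] (mod int d)"
      using cl v lattice_add by (intro G_height; simp add: P)+
    then show "[G v (P s 0) + G v' (P 0 t) = G (v + v') (P (s + t) 0)] (mod int d)"
      using G_add[OF v cl] by (meson cong_add cong_sym cong_trans)
  qed (use z punct_countable in \<open>auto simp: clear_def\<close>)
  moreover have "[G v z = G v (P (crs v z) 0)] (mod int d)" if "clear v z" for z
    using that v by (intro G_height) (auto simp: P)
  ultimately show ?thesis
    using z by (meson cong_sym cong_trans)
qed


section \<open>The constant as a linear function of primitive vectors\<close>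

definition prim :: "complex \<Rightarrow> bool" where
  "prim v \<longleftrightarrow> v \<in> \<Lambda> \<and> (\<exists>v'\<in>\<Lambda>. crs v v' = 1)"

definition Gc :: "complex \<Rightarrow> int" where
  "Gc v = G v (SOME z. clear v z)"

lemma prim_nonzero: "prim v \<Longrightarrow> v \<noteq> 0"
  by (auto simp: prim_def)

lemma clear_exists:
  assumes "finite V" "0 \<notin> V"
  obtains z where "\<And>v. v \<in> V \<Longrightarrow> clear v z"
proof -
  have "countable (\<Union>v\<in>V. (\<lambda>p. (v, crs v p)) ` punct)"
    using assms punct_countable by (intro countable_UN countable_image) (simp_all add: countable_finite)
  then obtain z where "\<And>e c. (e, c) \<in> (\<Union>v\<in>V. (\<lambda>p. (v, crs v p)) ` punct) \<Longrightarrow> crs e z \<noteq> c"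
    using generic_point[of "\<Union>v\<in>V. (\<lambda>p. (v, crs v p)) ` punct" UNIV] assms by auto
  then show ?thesis
    by (intro that) (auto simp: clear_def)
qed

lemma G_eq_Gc:
  assumes "prim v" "clear v z"
  shows "[G v z = Gc v] (mod int d)"
proof -
  obtain v' where v': "v \<in> \<Lambda>" "v' \<in> \<Lambda>" "crs v v' = 1"
    using assms(1) by (auto simp: prim_def)
  have "clear v (SOME z. clear v z)"
    using assms(2) by (rule someI)
  then show ?thesis
    unfolding Gc_def using G_const[OF v'] assms(2) by blast
qed

lemma prim_minus: "prim v \<Longrightarrow> prim (- v)"
  unfolding prim_def by (metis crs_linear(5) crs_linear(6) lattice_minus minus_minus)

lemma basis_prim:
  assumes "v \<in> \<Lambda>" "v' \<in> \<Lambda>" "crs v v' = 1"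
  shows "prim v" "prim v'" "prim (v + v')"
proof -
  show "prim v"
    using assms by (auto simp: prim_def)
  show "prim v'"
    unfolding prim_def using assms lattice_minus[of v] crs_commute[of v' v]
    by (intro conjI bexI[of _ "- v"]) (auto simp: crs_linear)
  show "prim (v + v')"
    unfolding prim_def using assms lattice_add
    by (intro conjI bexI[of _ v']) (auto simp: crs_linear)
qed

lemma per_in_lattice: "per1 x \<in> \<Lambda>" "per2 x \<in> \<Lambda>"
proof -
  have "per1 x = of_int 1 * per1 x + of_int 0 * per2 x" "per2 x = of_int 0 * per1 x + of_int 1 * per2 x"
    by simp_all
  then show "per1 x \<in> \<Lambda>" "per2 x \<in> \<Lambda>"
    unfolding period_lattice_def by blast+
qed

text \<open>The relation between the small loops on a closed surface, read off from
  \<open>G\<close>: translating \<open>z\<close> by the second period leaves \<open>F\<close>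
  unchanged and raises every floor by 1, while \<open>G\<close> is constant modulo
  \<open>d\<close>.\<close>

lemma delta_sum: "[(\<Sum>i\<in>UNIV. \<delta> i) = 0] (mod int d)"
proof -
  let ?v = "per1 x" and ?l = "per2 x"
  have p: "prim ?v"
    using basis_prim per_in_lattice area_1 by blast
  obtain z where z: "clear ?v z"
    using clear_exists[of "{?v}"] prim_nonzero[OF p] by auto
  have "heights ?v (z + ?l) = heights ?v z + (\<Sum>i\<in>UNIV. \<delta> i)"
  proof -
    have "crs ?v (z + ?l - mark x i) = crs ?v (z - mark x i) + 1" for i
      using area_1 by (simp add: crs_linear)
    then show ?thesis
      by (simp add: heights_def sum.distrib distrib_left)
  qed
  then have "G ?v (z + ?l) = G ?v z + (\<Sum>i\<in>UNIV. \<delta> i)"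
    using F_shift[OF per_in_lattice(2)] by (simp add: G_def)
  moreover have "[G ?v (z + ?l) = G ?v z] (mod int d)"
    using G_eq_Gc[OF p] z clear_shift[OF per_in_lattice(2)] by (meson cong_sym cong_trans)
  ultimately show ?thesis
    by (simp add: cong_iff_dvd_diff)
qed

lemma floor_minus_nonint: "(t::real) \<notin> \<int> \<Longrightarrow> \<lfloor>- t\<rfloor> = - \<lfloor>t\<rfloor> - 1"
  by (cases "t = of_int \<lfloor>t\<rfloor>") (metis Ints_of_int, simp add: floor_minus ceiling_altdef)

text \<open>For a non-integer \<open>t\<close> the floor of \<open>- t\<close> is one less than
  minus the floor of \<open>t\<close>. The surplus is the sum of all \<delta> i, which vanishes
  modulo \<open>d\<close>.\<close>

lemma Gc_minus:
  assumes "prim v"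
  shows "[Gc (- v) = - Gc v] (mod int d)"
proof -
  obtain v' where v': "v \<in> \<Lambda>" "v' \<in> \<Lambda>" "crs v v' = 1"
    using assms(1) by (auto simp: prim_def)
  obtain z where z: "clear v z"
    using clear_exists[of "{v}"] prim_nonzero[OF assms] by auto
  then have z': "clear (- v) z"
    by (auto simp: clear_def crs_linear)
  have "heights (- v) z = - heights v z - (\<Sum>i\<in>UNIV. \<delta> i)"
  proof -
    have "\<lfloor>crs (- v) (z - mark x i)\<rfloor> = - \<lfloor>crs v (z - mark x i)\<rfloor> - 1" for i
      using floor_minus_nonint[OF clear_not_int[OF v' z, of i]] by (simp only: crs_linear(5))
    then show ?thesis
      by (simp add: heights_def right_diff_distrib sum_subtractf sum_negf)
  qed
  moreover obtain k1 k2 k3 k4 where "F (- v) z - - F v z = int d * k1" "(\<Sum>i\<in>UNIV. \<delta> i) - 0 = int d * k2"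
    "G v z - Gc v = int d * k3" "G (- v) z - Gc (- v) = int d * k4"
    using F_minus[OF v'(1) z] delta_sum G_eq_Gc[OF assms z] G_eq_Gc[OF prim_minus[OF assms] z']
    unfolding cong_iff_dvd_diff dvd_def by auto
  ultimately have "Gc (- v) - - Gc v = int d * (k1 - k2 - k3 - k4)"
    unfolding G_def right_diff_distrib by linarith
  then show ?thesis
    unfolding cong_iff_dvd_diff by simp
qed

lemma Gc_add:
  assumes v: "v \<in> \<Lambda>" "v' \<in> \<Lambda>" "crs v v' = 1"
  shows "[Gc (v + v') = Gc v + Gc v'] (mod int d)"
proof -
  note p = basis_prim[OF v]
  obtain z where z: "clear v z" "clear v' z" "clear (v + v') z"
    by (rule clear_exists[of "{v, v', v + v'}"]) (use p[THEN prim_nonzero] in auto)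
  have "[Gc v + Gc v' = G v z + G v' z] (mod int d)"
    using G_eq_Gc[OF p(1) z(1)] G_eq_Gc[OF p(2) z(2)] by (intro cong_add) (simp_all add: cong_sym)
  then show ?thesis
    using G_add[OF v z] G_eq_Gc[OF p(3) z(3)] by (meson cong_sym cong_trans)
qed

lemma Gc_add_multiple:
  assumes v: "v \<in> \<Lambda>" "v' \<in> \<Lambda>" "crs v v' = 1"
  shows "[Gc (v' + of_int k * v) = Gc v' + k * Gc v] (mod int d)"
proof (induction k rule: int_induct[where k = 0])
  have step: "[Gc (v' + of_int (k + 1) * v) = Gc v + Gc (v' + of_int k * v)] (mod int d)" for k
  proof -
    have "crs v (v' + of_int k * v) = 1"
      using v by (simp add: crs_linear)
    from Gc_add[OF v(1) lattice_add[OF v(2) lattice_of_int[OF v(1), of k]] this] show ?thesis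
      by (simp add: algebra_simps)
  qed
  {
    case (step1 k)
    have "[Gc (v' + of_int (k + 1) * v) = Gc v + (Gc v' + k * Gc v)] (mod int d)"
      using step[of k] step1(2) by (meson cong_add cong_refl cong_trans)
    then show ?case by (simp add: algebra_simps)
  next
    case (step2 k)
    have "[Gc (v' + of_int k * v) = Gc v + Gc (v' + of_int (k - 1) * v)] (mod int d)"
      using step[of "k - 1"] by simp
    then have "[Gc v + Gc (v' + of_int (k - 1) * v) = Gc v' + k * Gc v] (mod int d)"
      using step2(2) by (meson cong_sym cong_trans)
    then show ?case by (simp add: cong_iff_dvd_diff algebra_simps)
  }
qed simp

text \<open>Additivity is known only for the two members of an oriented basis, so linearity is
  reached by the Euclidean algorithm: if \<open>p = k * q + r\<close>, the vector has coordinates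
  \<open>q\<close> and \<open>- r\<close> in the basis formed by \<open>v' + k v\<close> and
  \<open>- v\<close>.\<close>

lemma Gc_basis:
  assumes v: "v \<in> \<Lambda>" "v' \<in> \<Lambda>" "crs v v' = 1" and cop: "coprime p q"
  shows "[Gc (of_int p * v + of_int q * v') = p * Gc v + q * Gc v'] (mod int d)"
  using assms
proof (induction "nat \<bar>q\<bar>" arbitrary: v v' p q rule: less_induct)
  case less
  note v = less.prems(1-3)
  show ?case
  proof (cases "q = 0")
    case True
    then have "p = 1 \<or> p = - 1"
      using less.prems(4) by auto
    then show ?thesis
      using True Gc_minus[OF basis_prim(1)[OF v]] by auto
  next
    case False
    define k r where "k = p div q" and "r = p mod q"
    have pq: "p = k * q + r"
      by (simp add: k_def r_def)
    have r: "nat \<bar>- r\<bar> < nat \<bar>q\<bar>"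
      using False by (simp add: r_def abs_mod_less)
    let ?w = "v' + of_int k * v"
    have w: "?w \<in> \<Lambda>" "- v \<in> \<Lambda>" "crs ?w (- v) = 1"
      using v lattice_add lattice_of_int lattice_minus crs_commute[of v' v] by (auto simp: crs_linear)
    have "coprime q (- r)"
      using less.prems(4) False by (simp add: r_def coprime_mod_right_iff coprime_commute[of p q])
    then have IH: "[Gc (of_int q * ?w + of_int (- r) * (- v)) = q * Gc ?w + (- r) * Gc (- v)] (mod int d)"
      using less.hyps[OF r w] by blast
    have eq: "of_int q * ?w + of_int (- r) * (- v) = of_int p * v + of_int q * v'"
      by (simp add: pq algebra_simps)
    have "[q * Gc ?w + (- r) * Gc (- v) = q * (Gc v' + k * Gc v) + (- r) * (- Gc v)] (mod int d)"
      using Gc_add_multiple[OF v, of k] Gc_minus[OF basis_prim(1)[OF v]] by (intro cong_add cong_scalar_left)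
    from cong_trans[OF IH this] have "[Gc (of_int p * v + of_int q * v') = q * (Gc v' + k * Gc v) + (- r) * (- Gc v)] (mod int d)"
      unfolding eq .
    moreover have "q * (Gc v' + k * Gc v) + (- r) * (- Gc v) = p * Gc v + q * Gc v'"
      by (simp add: pq algebra_simps)
    ultimately show ?thesis
      by (simp only:)
  qed
qed

definition gA :: int where "gA = Gc (per1 x)"
definition gB :: int where "gB = Gc (per2 x)"

abbreviation vec :: "int \<Rightarrow> int \<Rightarrow> complex" where
  "vec p q \<equiv> of_int p * per1 x + of_int q * per2 x"

lemma vec_in_lattice: "vec p q \<in> \<Lambda>"
  unfolding period_lattice_def by blast

lemma crs_vec: "crs (vec p q) (vec r s) = of_int (p * s - q * r)"
  using area_1 crs_commute[of "per2 x" "per1 x"] by (simp add: crs_linear algebra_simps)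

lemma prim_vec: "coprime p q \<Longrightarrow> prim (vec p q)"
proof -
  assume "coprime p q"
  then have "gcd p q = 1"
    by simp
  then obtain u w where "u * p + w * q = 1"
    using bezout_int[of p q] by auto
  then show ?thesis
    unfolding prim_def using vec_in_lattice crs_vec[of p q "- w" u]
    by (intro conjI bexI[of _ "vec (- w) u"]) (simp_all only: mult.commute[of p u] mult.commute[of q "- w"] mult_minus_left diff_minus_eq_add of_int_1)
qed

lemma prim_iff: "prim v \<longleftrightarrow> (\<exists>p q. coprime p q \<and> v = vec p q)"
proof
  assume "prim v"
  then obtain v' where v: "v \<in> \<Lambda>" "v' \<in> \<Lambda>" "crs v v' = 1"
    by (auto simp: prim_def)
  then obtain p q r s where pq: "v = vec p q" "v' = vec r s"
    unfolding period_lattice_def by blast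
  then have "p * s - q * r = 1"
    using v(3) crs_vec by (metis of_int_eq_1_iff)
  then have "coprime p q"
    by (metis coprimeI dvd_diff dvd_mult2)
  then show "\<exists>p q. coprime p q \<and> v = vec p q"
    using pq by blast
qed (auto simp: prim_vec)

theorem monodromy_formula:
  assumes "coprime p q" "clear (vec p q) z"
  shows "[F (vec p q) z = p * gA + q * gB - heights (vec p q) z] (mod int d)"
proof -
  have "[G (vec p q) z = p * gA + q * gB] (mod int d)"
    unfolding gA_def gB_def
    by (rule cong_trans[OF G_eq_Gc[OF prim_vec[OF assms(1)] assms(2)] Gc_basis[OF per_in_lattice area_1 assms(1)]])
  then show ?thesis
    by (simp add: G_def cong_iff_dvd_diff algebra_simps)
qed

end

section \<open>Surjectivity of the monodromy\<close>

context torus_cover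
begin

lemma chain_val_simplex:
  assumes "singular_simplex 1 X f"
  obtains g where "unit_path X g" "frag_of f = path_chain g"
proof -
  define h where "h t = (\<lambda>i::nat. if i = 0 then 1 - t else if i = 1 then t else 0)" for t :: real
  have h_in: "h t \<in> standard_simplex 1" if "t \<in> {0..1}" for t
    using that by (auto simp: h_def standard_simplex_def)
  have h_s: "h (s 1) = s" if "s \<in> standard_simplex 1" for s
  proof
    fix i
    have "s 0 + s 1 = 1" "\<forall>i>1. s i = 0"
      using that by (auto simp: standard_simplex_def)
    then show "h (s 1) i = s i"
      by (auto simp: h_def)
  qed
  have "continuous_map (top_of_set {0..1}) (subtopology (powertop_real UNIV) (standard_simplex 1)) h"
  proof -
    have "continuous_on {0..1} (\<lambda>t. h t i)" for i
      by (cases "i = 0"; cases "i = 1") (auto simp: h_def intro!: continuous_intros)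
    then show ?thesis
      using h_in by (auto simp: continuous_map_in_subtopology continuous_map_componentwise_UNIV)
  qed
  moreover have "continuous_map (subtopology (powertop_real UNIV) (standard_simplex 1)) X f"
    using assms by (simp add: singular_simplex_def)
  ultimately have "unit_path X (f \<circ> h)"
    by (rule continuous_map_compose)
  moreover have "f = (\<lambda>s\<in>standard_simplex 1. (f \<circ> h) (s 1))"
  proof
    fix s
    show "f s = (\<lambda>s\<in>standard_simplex 1. (f \<circ> h) (s 1)) s"
      using assms h_s[of s] by (auto simp: singular_simplex_def extensional_def)
  qed
  ultimately show ?thesis
    using that[of "f \<circ> h"] by (simp add: path_chain_def)
qed

lemma path_val_cong:
  assumes "\<And>t. t \<in> {0..1} \<Longrightarrow> g t = h t"
  shows "path_val g = path_val h"
proof -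
  have "(\<lambda>s\<in>standard_simplex 1. g (s 1)) = (\<lambda>s\<in>standard_simplex 1. h (s 1))"
    using assms by (intro restrict_ext) (auto simp: standard_simplex_def)
  then show ?thesis
    by (simp add: path_val_def path_chain_def)
qed

lemma open_map_pr: "open B \<Longrightarrow> B \<subseteq> U \<Longrightarrow> openin X (pr ` B)"
proof -
  assume B: "open B" "B \<subseteq> U"
  have "pr -` pr ` B = (\<Union>l\<in>\<Lambda>. (\<lambda>z. z + l) ` B)"
  proof (intro equalityI subsetI)
    fix z assume "z \<in> pr -` pr ` B"
    then obtain b where "b \<in> B" "z - b \<in> \<Lambda>"
      using pr_eq_iff by fastforce
    then show "z \<in> (\<Union>l\<in>\<Lambda>. (\<lambda>z. z + l) ` B)"
      by (intro UN_I[of "z - b"] image_eqI[of _ _ b]) auto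
  qed (auto simp: pr_shift)
  moreover have "open (\<Union>l\<in>\<Lambda>. (\<lambda>z. z + l) ` B)"
    using open_translation[OF B(1)] by (intro open_UN ballI) (simp add: add.commute)
  ultimately have "open (pr -` pr ` B)"
    by simp
  then have "openin (torus_topology x) (pr ` B)"
    by (auto simp: openin_torus_topology)
  moreover have "pr ` B \<subseteq> - marked_pts x"
    using B(2) by (auto simp: U_def punct_def)
  ultimately show ?thesis
    by (auto simp: punctured_torus_def openin_subtopology)
qed

lemma lattice_discrete:
  obtains e where "e > 0" "\<And>l. l \<in> \<Lambda> \<Longrightarrow> norm l < e \<Longrightarrow> l = 0"
proof -
  have "finite (\<Lambda> \<inter> ball 0 1 - {0})"
    using lattice_finite_bounded[of "ball 0 1"] by simp
  then obtain e where e: "e > 0" "\<And>q. q \<in> \<Lambda> \<inter> ball 0 1 - {0} \<Longrightarrow> e \<le> dist 0 q"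
    using finite_set_avoid[of "\<Lambda> \<inter> ball 0 1 - {0}" 0] by blast
  show ?thesis
    by (rule that[of "min e 1"]) (use e in force)+
qed

lemma open_U: "open U"
proof -
  have "\<exists>e>0. ball z e \<subseteq> U" if "z \<in> U" for z
  proof -
    obtain e where e: "e > 0" "\<And>q. q \<in> punct \<inter> ball z 1 \<Longrightarrow> q \<noteq> z \<Longrightarrow> e \<le> dist z q"
      using finite_set_avoid[OF punct_finite_bounded[OF bounded_ball], of z 1 z] by blast
    have "ball z (min e 1) \<subseteq> U"
      using e(2) that by (force simp: U_def)
    then show ?thesis
      using e(1) by (intro exI[of _ "min e 1"]) auto
  qed
  then show ?thesis
    by (simp add: open_contains_ball)
qed

lemma small_ball:
  assumes "z \<in> U"
  obtains e where "e > 0" "ball z e \<subseteq> U" "inj_on pr (ball z e)"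
proof -
  obtain e1 where e1: "e1 > 0" "ball z e1 \<subseteq> U"
    using open_U assms openE by blast
  obtain e2 where e2: "e2 > 0" "\<And>l. l \<in> \<Lambda> \<Longrightarrow> norm l < e2 \<Longrightarrow> l = 0"
    using lattice_discrete by blast
  define e where "e = min e1 (e2 / 2)"
  have "inj_on pr (ball z e)"
  proof
    fix a b assume ab: "a \<in> ball z e" "b \<in> ball z e" "pr a = pr b"
    have "norm (b - a) < e2"
      using ab dist_triangle_half_r[of z b e2 a] by (auto simp: e_def dist_norm norm_minus_commute)
    then show "a = b"
      using e2(2)[of "b - a"] ab(3) by (simp add: pr_eq_iff)
  qed
  moreover have "ball z e \<subseteq> U" "e > 0"
    using subset_ball[of e e1 z] e1 e2 by (auto simp: e_def)
  ultimately show ?thesis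
    using that by blast
qed

text \<open>Modulo a common divisor \<open>l\<close> of \<open>d\<close> and all \<delta> i every
  triangle has trivial value, so the value of a segment seen from \<open>w\<close> is the difference
  of the values of the two sight lines.\<close>

lemma ml_fan:
  assumes l: "l dvd int d" "\<And>i. l dvd \<delta> i"
    and seg: "closed_segment a b \<subseteq> U" "closed_segment a w \<subseteq> U" "closed_segment b w \<subseteq> U"
    and gen: "a \<noteq> b \<Longrightarrow> crs (b - a) (w - a) \<noteq> 0"
  shows "l dvd ml a b - (ml w b - ml w a)"
proof -
  have mod: "l dvd s - t" if "[s = t] (mod int d)" for s t
    using that l(1) by (meson cong_iff_dvd_diff dvd_trans)
  have rev: "l dvd ml q p + ml p q" if "closed_segment p q \<subseteq> U" for p q
    using mod[OF ml_rev[OF that]] by simp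
  have seg': "closed_segment w a \<subseteq> U" "closed_segment w b \<subseteq> U" "closed_segment b a \<subseteq> U"
    using seg by (simp_all add: closed_segment_commute)
  have sum: "l dvd (\<Sum>p\<in>S. \<delta> (puncture_index p))" for S
    by (intro dvd_sum) (simp add: l)
  consider "a = b" | "crs (b - a) (w - a) > 0" | "crs (a - b) (w - b) > 0"
  proof -
    have "crs (a - b) (w - b) = - crs (b - a) (w - a)"
      by (simp add: crs_alt algebra_simps)
    then show ?thesis
      using that gen by (cases "a = b") (auto simp: linorder_neq_iff)
  qed
  then show ?thesis
  proof cases
    case 1
    then show ?thesis
      using mod[OF ml_same[of a]] seg(1) by auto
  next
    case 2
    have "l dvd ml a b + ml b w + ml w a"
      using dvd_add[OF mod[OF ml_triangle[OF 2 seg(1) seg(3) seg'(1)]] sum[of "punct \<inter> tri a b w"]] by simp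
    from dvd_diff[OF this rev[OF seg(3)]] show ?thesis
      by (simp add: algebra_simps)
  next
    case 3
    have "l dvd ml b a + ml a w + ml w b"
      using dvd_add[OF mod[OF ml_triangle[OF 3 seg'(3) seg(2) seg'(2)]] sum[of "punct \<inter> tri b a w"]] by simp
    from dvd_diff[OF dvd_add[OF rev[OF seg(1)] rev[OF seg(2)]] this] show ?thesis
      by (simp add: algebra_simps)
  qed
qed

text \<open>Modulo \<open>l\<close> the value of a path is the difference of a potential at its
  ends: on \<open>U\<close> because triangles have value 0, on the torus because the periods have
  value 0. Cycles then have values divisible by \<open>l\<close>, whereas \<alpha> is onto.\<close>

lemma monodromy_generates:
  assumes l: "l dvd int d" "\<And>i. l dvd \<delta> i" "l dvd gA" "l dvd gB"
  shows "is_unit l"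
proof -
  have mod: "l dvd s - t" if "[s = t] (mod int d)" for s t
    using that l(1) by (meson cong_iff_dvd_diff dvd_trans)
  obtain z0 where z0: "z0 \<in> U"
    using visible_point[of "{}" UNIV "{}"] punct_countable
    by (metis U_def ComplI UNIV_I countable_subset uncountable_UNIV_complex subsetI)
  \<comment> \<open>The potential of \<open>z\<close> will be the value of a path of two segments
    from \<open>z0\<close> to \<open>z\<close> over the intermediate point
    \<open>see z\<close>.\<close>
  define see where "see z = (SOME w. closed_segment z0 w \<subseteq> U \<and> closed_segment z w \<subseteq> U)" for z
  have see: "closed_segment z0 (see z) \<subseteq> U \<and> closed_segment z (see z) \<subseteq> U" if "z \<in> U" for z
  proof -
    have "\<exists>w. closed_segment z0 w \<subseteq> U \<and> closed_segment z w \<subseteq> U"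
      by (rule visible_point[of "{z0, z}" UNIV "{}"]) (use that z0 in auto)
    then show ?thesis
      unfolding see_def by (rule someI_ex)
  qed
  define \<psi> where "\<psi> z = ml z0 (see z) + ml (see z) z" for z
  have \<psi>_seg: "l dvd ml z z' - (\<psi> z' - \<psi> z)" if zz': "closed_segment z z' \<subseteq> U" for z z'
  proof -
    have zU: "z \<in> U" "z' \<in> U"
      using zz' by auto
    \<comment> \<open>The closed pentagon formed by the segment and the two chosen paths. All five
      edges are seen from one generic \<open>w\<close>, and the values of the sight lines
      telescope.\<close>
    define E where "E = {(z0, see z), (see z, z), (z, z'), (z0, see z'), (see z', z')}"
    define F where "F = (\<lambda>(a, b). (b - a, crs (b - a) a)) ` {(a, b) \<in> E. a \<noteq> b}"
    have fin: "finite E"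
      by (simp add: E_def)
    have E_U: "closed_segment a b \<subseteq> U" if "(a, b) \<in> E" for a b
      using that see[OF zU(1)] see[OF zU(2)] zz' by (auto simp: E_def closed_segment_commute)
    obtain w where w: "\<And>y. y \<in> {z0, z, z', see z, see z'} \<Longrightarrow> closed_segment y w \<subseteq> U"
      "\<And>e c. (e, c) \<in> F \<Longrightarrow> crs e w \<noteq> c"
    proof (rule visible_point[of "{z0, z, z', see z, see z'}" UNIV F])
      show "countable F"
        using fin unfolding F_def by (intro countable_image countable_finite finite_subset[OF _ fin]) auto
      show "{z0, z, z', see z, see z'} \<subseteq> U"
        using z0 zU see[OF zU(1)] see[OF zU(2)] by auto
    qed (auto simp: F_def)
    have fan: "l dvd ml a b - (ml w b - ml w a)" if "(a, b) \<in> E" for a b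
    proof (rule ml_fan[OF l(1,2) E_U[OF that]])
      show "closed_segment a w \<subseteq> U" "closed_segment b w \<subseteq> U"
        using that w(1)[of z0] w(1)[of z] w(1)[of z'] w(1)[of "see z"] w(1)[of "see z'"] unfolding E_def by blast+
      assume "a \<noteq> b"
      then have "(b - a, crs (b - a) a) \<in> F"
        using that by (force simp: F_def)
      then have "crs (b - a) w \<noteq> crs (b - a) a"
        using w(2) by blast
      then show "crs (b - a) (w - a) \<noteq> 0"
        by (simp add: crs_linear(4))
    qed
    have "l dvd (ml z0 (see z) - (ml w (see z) - ml w z0)) + (ml (see z) z - (ml w z - ml w (see z)))
        + (ml z z' - (ml w z' - ml w z)) - (ml z0 (see z') - (ml w (see z') - ml w z0))
        - (ml (see z') z' - (ml w z' - ml w (see z')))"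
      by (intro dvd_diff dvd_add fan) (auto simp: E_def)
    then show ?thesis
      by (simp add: \<psi>_def algebra_simps)
  qed
  \<comment> \<open>The point \<open>z\<close> is first moved to \<open>y\<close> on a clear line.
    There the period is given by the monodromy formula, in which all terms are divisible by
    \<open>l\<close>.\<close>
  have per1: "l dvd \<psi> (z + vec p q) - \<psi> z" if z: "z \<in> U" and pq: "coprime p q" for z p q
  proof -
    let ?v = "vec p q"
    have ne: "?v \<noteq> 0"
      using prim_nonzero[OF prim_vec[OF pq]] .
    obtain y where y: "closed_segment z y \<subseteq> U" "\<And>e c. (e, c) \<in> (\<lambda>p. (?v, crs ?v p)) ` punct \<Longrightarrow> crs e y \<noteq> c"
      by (rule visible_point[of "{z}" UNIV "(\<lambda>p. (?v, crs ?v p)) ` punct"]) (use z ne punct_countable in auto)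
    have cl: "clear ?v y"
      using y(2) by (auto simp: clear_def)
    have seg2: "closed_segment (y + ?v) (z + ?v) \<subseteq> U"
    proof
      fix u assume "u \<in> closed_segment (y + ?v) (z + ?v)"
      then have "u - ?v \<in> closed_segment y z"
        using closed_segment_translation_eq[of "?v" "u - ?v" y z] by (simp add: add.commute)
      then show "u \<in> U"
        using y(1) U_shift[OF vec_in_lattice, of "u - ?v" p q] by (auto simp: closed_segment_commute)
    qed
    have "l dvd F ?v y"
    proof -
      have "l dvd F ?v y - (p * gA + q * gB - heights ?v y)"
        by (rule mod[OF monodromy_formula[OF pq cl]])
      moreover have "l dvd p * gA + q * gB - heights ?v y"
        unfolding heights_def using l by (intro dvd_diff dvd_add dvd_sum) auto
      ultimately show ?thesis
        by (metis dvd_add diff_add_cancel)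
    qed
    moreover have "ml (y + ?v) (z + ?v) = ml y z"
      by (rule ml_shift[OF vec_in_lattice])
    moreover have "l dvd ml y z + ml z y"
      using mod[OF ml_rev[OF y(1)]] by simp
    ultimately have s1: "l dvd F ?v y + (ml (y + ?v) (z + ?v) + ml z y)"
      by simp
    have s2: "l dvd ml z y - (\<psi> y - \<psi> z)" "l dvd F ?v y - (\<psi> (y + ?v) - \<psi> y)"
      "l dvd ml (y + ?v) (z + ?v) - (\<psi> (z + ?v) - \<psi> (y + ?v))"
      unfolding F_def using y(1) seg2 clear_segment[OF cl] by (auto intro!: \<psi>_seg)
    from dvd_diff[OF dvd_diff[OF dvd_diff[OF s1 s2(1)] s2(2)] s2(3)] show ?thesis
      by (simp add: algebra_simps)
  qed
  have per: "l dvd \<psi> z' - \<psi> z" if z: "z \<in> U" "pr z = pr z'" for z z'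
  proof -
    obtain m n where mn: "z' - z = vec m n"
      using z(2) unfolding pr_eq_iff period_lattice_def by blast
    \<comment> \<open>Every lattice vector is a sum of two primitive ones:
      \<open>(m, n) = (m - 1, 1) + (1, n - 1)\<close>.\<close>
    have z': "z' = z + vec (m - 1) 1 + vec 1 (n - 1)"
      using mn by (simp add: algebra_simps)
    have "z + vec (m - 1) 1 \<in> U"
      using U_shift[OF vec_in_lattice] z by blast
    then have "l dvd \<psi> (z + vec (m - 1) 1 + vec 1 (n - 1)) - \<psi> (z + vec (m - 1) 1)" "l dvd \<psi> (z + vec (m - 1) 1) - \<psi> z"
      using z by (intro per1; simp)+
    from dvd_add[OF this] show ?thesis
      unfolding z' by simp
  qed
  define \<Psi> where "\<Psi> y = \<psi> (SOME z. z \<in> U \<and> pr z = y)" for y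
  have \<Psi>: "l dvd \<psi> z - \<Psi> (pr z)" if "z \<in> U" for z
  proof -
    have "(SOME z'. z' \<in> U \<and> pr z' = pr z) \<in> U \<and> pr (SOME z'. z' \<in> U \<and> pr z' = pr z) = pr z"
      by (rule someI) (use that in auto)
    then show ?thesis
      unfolding \<Psi>_def using that by (intro per) auto
  qed
  have path: "l dvd path_val g - (\<Psi> (g 1) - \<Psi> (g 0))" if g: "unit_path X g" for g
  proof -
    define P where "P s t \<longleftrightarrow> (0 \<le> s \<and> t \<le> 1 \<longrightarrow> l dvd path_val (g \<circ> linepath s t) - (\<Psi> (g t) - \<Psi> (g s)))" for s t
    have "P 0 1"
    \<comment> \<open>A path need not be piecewise straight. By subdivision it suffices to treat
      short pieces; these lift to a disc on which the projection is a homeomorphism and are there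
      replaced by a segment.\<close>
    proof (rule Bolzano[of 0 1 P])
      fix a b c assume trans: "P a b" "P b c" "a \<le> b" "b \<le> c"
      show "P a c"
        unfolding P_def
      proof
        assume ac: "0 \<le> a \<and> c \<le> 1"
        have "[path_val (g \<circ> linepath a c) = path_val (g \<circ> linepath a b) + path_val (g \<circ> linepath b c)] (mod int d)"
          using trans ac by (intro path_val_convex[OF _ g] unit_path_linepath) (auto simp: linepath_0' linepath_1')
        note m = mod[OF this]
        have "l dvd path_val (g \<circ> linepath a b) - (\<Psi> (g b) - \<Psi> (g a))" "l dvd path_val (g \<circ> linepath b c) - (\<Psi> (g c) - \<Psi> (g b))"
          using trans ac by (auto simp: P_def)
        from dvd_add[OF m dvd_add[OF this]] show "l dvd path_val (g \<circ> linepath a c) - (\<Psi> (g c) - \<Psi> (g a))"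
          by (simp add: algebra_simps)
      qed
    next
      fix t :: real assume local: "0 \<le> t" "t \<le> 1"
      then have "g t \<in> topspace X"
        using g by (auto simp: continuous_map_def Pi_iff)
      then obtain z where z: "z \<in> U" "g t = pr z"
        by (auto simp: topspace_X)
      obtain e where e: "e > 0" "ball z e \<subseteq> U" "inj_on pr (ball z e)"
        using small_ball[OF z(1)] .
      let ?V = "pr ` ball z e"
      have V: "openin X ?V"
        using e by (intro open_map_pr) auto
      have hom: "homeomorphic_map (top_of_set (ball z e)) (subtopology X ?V) pr"
      proof (rule bijective_open_imp_homeomorphic_map)
        show "continuous_map (top_of_set (ball z e)) (subtopology X ?V) pr"
          using continuous_pr[OF e(2)] by (simp add: continuous_map_in_subtopology)
        show "open_map (top_of_set (ball z e)) (subtopology X ?V) pr"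
          unfolding open_map_def
        proof (intro allI impI)
          fix B assume "openin (top_of_set (ball z e)) B"
          then have B: "open B" "B \<subseteq> ball z e"
            using openin_open_eq[OF open_ball] by auto
          then have "openin X (pr ` B)"
            using e(2) by (intro open_map_pr) auto
          then show "openin (subtopology X ?V) (pr ` B)"
            using B(2) by (auto simp: openin_subtopology intro!: exI[of _ "pr ` B"])
        qed
        show "pr ` topspace (top_of_set (ball z e)) = topspace (subtopology X ?V)"
          using openin_subset[OF V] by auto
        show "inj_on pr (topspace (top_of_set (ball z e)))"
          using e(3) by simp
      qed
      then obtain h where h: "homeomorphic_maps (top_of_set (ball z e)) (subtopology X ?V) pr h"
        using homeomorphic_map_maps by blast
      have "openin (top_of_set {0..1}) {s \<in> {0..1}. g s \<in> ?V}"
        using openin_continuous_map_preimage[OF g V] by simp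
      then obtain T where T: "open T" "{s \<in> {0..1}. g s \<in> ?V} = {0..1} \<inter> T"
        by (auto simp: openin_open)
      have "g t \<in> ?V"
        unfolding z(2) using e(1) by (intro imageI) simp
      then have "t \<in> T"
        using T(2) local by (metis (mono_tags, lifting) IntD2 atLeastAtMost_iff mem_Collect_eq)
      then obtain r where r: "r > 0" "ball t r \<subseteq> T"
        using T(1) openE by blast
      have "P a b" if ab: "a \<le> t" "t \<le> b" "b - a < r" for a b
        unfolding P_def
      proof
        assume ab': "0 \<le> a \<and> b \<le> 1"
        have sub: "{a..b} \<subseteq> {0..1} \<inter> T"
        proof
          fix s assume s: "s \<in> {a..b}"
          then have "s \<in> ball t r"
            using ab by (auto simp: dist_real_def)
          then show "s \<in> {0..1} \<inter> T"
            using s ab' r(2) by auto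
        qed
        have lp: "linepath a b u \<in> {a..b}" if "u \<in> {0..1}" for u
          using linepath_in_path[OF that, of a b] ab by (simp add: closed_segment_eq_real_ivl)
        have inV: "g (linepath a b u) \<in> ?V" if "u \<in> {0..1}" for u
          using sub lp[OF that] T(2) by blast
        have "unit_path (top_of_set {0..1}) (linepath a b)"
          using ab ab' by (intro unit_path_linepath) auto
        then have "unit_path (subtopology X ?V) (g \<circ> linepath a b)"
          using continuous_map_compose[OF _ g, of "top_of_set {0..1}" "linepath a b"] inV
          by (simp add: continuous_map_in_subtopology image_subset_iff_funcset Pi_iff)
        moreover have "continuous_map (subtopology X ?V) (top_of_set (ball z e)) h"
          using h by (simp add: homeomorphic_maps_def)
        ultimately have hp: "unit_path (top_of_set (ball z e)) (h \<circ> (g \<circ> linepath a b))"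
          by (rule continuous_map_compose)
        define q where "q = h \<circ> (g \<circ> linepath a b)"
        have hq: "unit_path (top_of_set (ball z e)) q"
          unfolding q_def by (rule hp)
        have inv: "pr (h y) = y" if "y \<in> topspace (subtopology X ?V)" for y
          using h that unfolding homeomorphic_maps_def by blast
        have prq: "pr (q u) = g (linepath a b u)" if "u \<in> {0..1}" for u
        proof -
          have "g (linepath a b u) \<in> topspace (subtopology X ?V)"
            using inV[OF that] openin_subset[OF V] by auto
          then show ?thesis
            using inv by (simp add: q_def)
        qed
        have qe: "q 0 \<in> ball z e" "q 1 \<in> ball z e"
          using continuous_map_funspace[OF hq] by auto
        have "path_val (g \<circ> linepath a b) = path_val (pr \<circ> q)"
          using prq by (intro path_val_cong) auto
        moreover have m1: "[path_val (pr \<circ> q) = path_val (pr \<circ> linepath (q 0) (q 1)) + path_val (pr \<circ> linepath (q 1) (q 1))] (mod int d)"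
          by (intro path_val_convex[OF convex_ball continuous_pr[OF e(2)]] hq unit_path_linepath convex_ball qe)
            (simp_all add: linepath_0' linepath_1')
        moreover have m2: "l dvd ml (q 0) (q 1) - (\<psi> (q 1) - \<psi> (q 0))"
          using e(2) closed_segment_subset[OF qe convex_ball] by (intro \<psi>_seg) blast
        moreover have m3: "l dvd ml (q 1) (q 1) - 0"
          using qe(2) e(2) by (intro mod ml_same) auto
        moreover have m4: "l dvd \<psi> (q 0) - \<Psi> (g a)" "l dvd \<psi> (q 1) - \<Psi> (g b)"
          using \<Psi>[OF subsetD[OF e(2) qe(1)]] \<Psi>[OF subsetD[OF e(2) qe(2)]] prq[of 0] prq[of 1] by (simp_all add: linepath_0' linepath_1')
        ultimately have "path_val (g \<circ> linepath a b) = path_val (pr \<circ> q)"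
          by simp
        with dvd_diff[OF dvd_add[OF dvd_add[OF dvd_add[OF mod[OF m1] m3] m2] m4(2)] m4(1)]
        show "l dvd path_val (g \<circ> linepath a b) - (\<Psi> (g b) - \<Psi> (g a))"
          unfolding ml_def
          by (simp add: algebra_simps)
      qed
      then show "\<exists>d>0. \<forall>a b. a \<le> t \<and> t \<le> b \<and> b - a < d \<longrightarrow> P a b"
        using r(1) by blast
    qed simp
    moreover have "g \<circ> linepath 0 1 = g"
      by (auto simp: linepath_def fun_eq_iff)
    ultimately show ?thesis
      by (simp add: P_def)
  qed
  \<comment> \<open>The linear extension of the potential to 0-chains, obtained as the coefficient
    of the only generator of a free abelian group of rank one.\<close>
  define \<Phi> where "\<Phi> b = Poly_Mapping.lookup (frag_extend (\<lambda>\<sigma>::(nat \<Rightarrow> real) \<Rightarrow> complex set. frag_cmul (\<Psi> (\<sigma> (\<lambda>i. if i = 0 then 1 else 0))) (frag_of ())) b) ()" for b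
  have \<Phi>_diff: "\<Phi> (b - c) = \<Phi> b - \<Phi> c" for b c
    by (simp add: \<Phi>_def frag_extend_diff lookup_minus)
  have \<Phi>_point: "\<Phi> (point_chain y) = \<Psi> y" for y
  proof -
    have "(\<lambda>i. if i = 0 then 1 else 0) \<in> standard_simplex 0"
      by (auto simp: standard_simplex_def)
    then show ?thesis
      by (simp add: \<Phi>_def point_chain_def)
  qed
  have chain: "l dvd chain_val c - \<Phi> (chain_boundary 1 c)" if "singular_chain 1 X c" for c
  proof -
    have "Poly_Mapping.keys c \<subseteq> singular_simplex_set 1 X"
      using that by (simp add: singular_chain_def)
    then have "singular_chain 1 X c \<and> l dvd chain_val c - \<Phi> (chain_boundary 1 c)"
    proof (induction c rule: frag_induction)
      case zero
      have "chain_val 0 = 0"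
        using chain_val_cyc[of 0] cyc_val_boundary[of 0] by (simp add: cyc_iff singular_chain_0)
      then show ?case
        using \<Phi>_diff[of 0 0] by (simp add: singular_chain_0)
    next
      case (one f)
      then obtain g where g: "unit_path X g" "frag_of f = path_chain g"
        using chain_val_simplex by auto
      show ?case
        using path[OF g(1)] singular_chain_path_chain[OF g(1)] chain_boundary_path_chain[of g]
        by (simp add: g(2) path_val_def \<Phi>_diff \<Phi>_point del: One_nat_def)
    next
      case (diff a b)
      have "[chain_val (a - b) = chain_val a - chain_val b] (mod int d)"
      proof -
        have "[chain_val (a + - b) = chain_val a + chain_val (- b)] (mod int d)"
          using diff by (intro chain_val_add) (auto simp: singular_chain_minus)
        moreover have "[chain_val (- b) = - chain_val b] (mod int d)"
          using diff by (intro chain_val_minus) auto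
        ultimately show ?thesis
          by (metis (no_types, opaque_lifting) ab_group_add_class.ab_diff_conv_add_uminus cong_add_lcancel cong_trans)
      qed
      note m = mod[OF this]
      have ab: "l dvd chain_val a - \<Phi> (chain_boundary 1 a)" "l dvd chain_val b - \<Phi> (chain_boundary 1 b)"
        using diff by auto
      from dvd_diff[OF dvd_add[OF m ab(1)] ab(2)] show ?case
        using diff by (simp add: singular_chain_diff chain_boundary_diff \<Phi>_diff algebra_simps)
    qed
    then show ?thesis ..
  qed
  \<comment> \<open>The reduction covers \<open>d = 1\<close>, where 0 is the only value. Since
    \<open>l\<close> divides \<open>d\<close>, divisibility of the residue still gives that
    \<open>l\<close> divides 1.\<close>
  have "1 mod int d \<in> {0..<int d}"
    using d_pos by auto
  then obtain c where c: "cyc c" "cyc_val c = 1 mod int d"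
    using cyc_val_surj by blast
  then have "l dvd 1 mod int d"
    using chain[of c] chain_val_cyc[OF c(1)] \<Phi>_diff[of 0 0] by (auto simp: cyc_iff simp del: One_nat_def)
  then show "is_unit l"
    using l(1) by (simp add: dvd_mod_iff)
qed

end

section \<open>Sheets of the cover\<close>

context torus_cover
begin

text \<open>The sheets over a point are labelled by the value of a chain relative to the chosen
  tail. The labelling is global but jumps with the tail from point to point; along segments
  \<open>ml\<close> accounts for this.\<close>

definition pt :: "complex \<Rightarrow> int \<Rightarrow> cover_pt" where
  "pt z s = (pr z, {c \<in> chains_to x (pr z). [cyc_val (c - tail (pr z)) = s] (mod int d)})"

lemma fst_pt [simp]: "fst (pt z s) = pr z"
  by (simp add: pt_def)

lemma chains_to_diff: "c \<in> chains_to x y \<Longrightarrow> c' \<in> chains_to x y \<Longrightarrow> cyc (c' - c)"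
  by (auto simp: chains_to_def cyc_iff singular_chain_diff chain_boundary_diff simp del: One_nat_def)

lemma chains_to_add_cyc: "c \<in> chains_to x y \<Longrightarrow> cyc b \<Longrightarrow> c + b \<in> chains_to x y"
  by (auto simp: chains_to_def cyc_iff singular_chain_add chain_boundary_add simp del: One_nat_def)

lemma cyc_val_add_cong: "cyc b \<Longrightarrow> cyc c \<Longrightarrow> [cyc_val (b + c) = cyc_val b + cyc_val c] (mod int d)"
  using cyc_val_add by (simp add: cong_def)

lemma pt_witness:
  assumes "z \<in> U"
  obtains c where "c \<in> snd (pt z s)"
proof -
  obtain b where b: "cyc b" "cyc_val b = s mod int d"
    using cyc_val_surj[of "s mod int d"] d_pos by auto
  have "tail (pr z) + b \<in> chains_to x (pr z)"
    using chains_to_add_cyc[OF tail_in b(1)] assms by simp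
  then show ?thesis
    using that[of "tail (pr z) + b"] b by (simp add: pt_def cong_def)
qed

lemma cover_sheet:
  assumes "c \<in> chains_to x (pr z)" "z \<in> U"
  shows "(pr z, {c' \<in> chains_to x (pr z). \<alpha> (h1_class x (c' - c)) = 0}) = pt z (cyc_val (c - tail (pr z)))"
proof -
  let ?t = "tail (pr z)"
  have t: "?t \<in> chains_to x (pr z)"
    using assms(2) by (intro tail_in) simp
  have "\<alpha> (h1_class x (c' - c)) = 0 \<longleftrightarrow> [cyc_val (c' - ?t) = cyc_val (c - ?t)] (mod int d)"
    if c': "c' \<in> chains_to x (pr z)" for c'
  proof -
    have cc: "cyc (c' - c)" "cyc (c - ?t)"
      using chains_to_diff assms c' t by blast+
    have "[cyc_val (c' - ?t) = cyc_val (c' - c) + cyc_val (c - ?t)] (mod int d)"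
      using cyc_val_add_cong[OF cc] by simp
    then have "[cyc_val (c' - ?t) = cyc_val (c - ?t)] (mod int d) \<longleftrightarrow> [cyc_val (c' - c) + cyc_val (c - ?t) = 0 + cyc_val (c - ?t)] (mod int d)"
      by (simp add: cong_def)
    also have "\<dots> \<longleftrightarrow> [cyc_val (c' - c) = 0] (mod int d)"
      by (rule cong_add_rcancel)
    also have "\<dots> \<longleftrightarrow> cyc_val (c' - c) = 0"
      using cyc_val_range[OF cc(1)] by (simp add: cong_def)
    finally show ?thesis
      by (simp add: cyc_val_def)
  qed
  then show ?thesis
    by (auto simp: pt_def)
qed

lemma cover_eq: "cover x \<alpha> = {pt z s | z s. z \<in> U}"
proof (intro equalityI subsetI)
  fix P assume "P \<in> cover x \<alpha>"
  then show "P \<in> {pt z s | z s. z \<in> U}"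
    using cover_sheet by (auto simp: cover_def topspace_X)
next
  fix P assume "P \<in> {pt z s | z s. z \<in> U}"
  then obtain z s where P: "P = pt z s" "z \<in> U"
    by blast
  obtain c where c: "c \<in> snd (pt z s)"
    using pt_witness[OF P(2)] .
  then have c': "c \<in> chains_to x (pr z)" "[cyc_val (c - tail (pr z)) = s] (mod int d)"
    by (auto simp: pt_def)
  have "pt z (cyc_val (c - tail (pr z))) = pt z s"
    using c'(2) by (simp add: pt_def cong_def)
  then have "P = (pr z, {c' \<in> chains_to x (pr z). \<alpha> (h1_class x (c' - c)) = 0})"
    using cover_sheet[OF c'(1) P(2)] P by simp
  then show "P \<in> cover x \<alpha>"
    using c'(1) P(2) by (auto simp: cover_def)
qed

lemma pt_in_cover [simp]: "z \<in> U \<Longrightarrow> pt z s \<in> cover x \<alpha>"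
  by (auto simp: cover_eq)

lemma pt_eq_iff:
  assumes "z \<in> U"
  shows "pt z s = pt z' s' \<longleftrightarrow> z' - z \<in> \<Lambda> \<and> [s = s'] (mod int d)"
proof
  assume eq: "pt z s = pt z' s'"
  then have "pr z = pr z'"
    by (metis fst_pt)
  obtain c where c: "c \<in> snd (pt z s)"
    using pt_witness[OF assms] .
  then have "[cyc_val (c - tail (pr z)) = s] (mod int d)" "[cyc_val (c - tail (pr z')) = s'] (mod int d)"
    using eq by (auto simp: pt_def)
  then show "z' - z \<in> \<Lambda> \<and> [s = s'] (mod int d)"
    using \<open>pr z = pr z'\<close> by (simp add: pr_eq_iff cong_def)
next
  assume *: "z' - z \<in> \<Lambda> \<and> [s = s'] (mod int d)"
  then have "pr z = pr z'"
    by (simp add: pr_eq_iff)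
  moreover have "[k = s] (mod int d) \<longleftrightarrow> [k = s'] (mod int d)" for k
    using * by (simp add: cong_def)
  ultimately show "pt z s = pt z' s'"
    by (simp add: pt_def)
qed

lemma segment_from_pr: "segment_from (pr z) u = pr \<circ> linepath z (z + u)"
proof
  fix t
  show "segment_from (pr z) u t = (pr \<circ> linepath z (z + u)) t"
    by (auto simp: segment_from_def torus_pt_def linepath_def image_image scaleR_conv_of_real algebra_simps)
qed

text \<open>Appending the segment to a chain changes its class relative to the tails by the
  closed-up segment, whose value is \<open>ml\<close>. With it the geometry of the cover becomes
  arithmetic of labels.\<close>

lemma straight_move_iff:
  assumes "z \<in> U"
  shows "straight_move x \<alpha> (pt z s) u Q \<longleftrightarrow>
    closed_segment z (z + u) \<subseteq> U \<and> Q = pt (z + u) (s + ml z (z + u))"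
proof -
  have seg: "(\<forall>t\<in>{0..1}. segment_from (pr z) u t \<in> topspace X) \<longleftrightarrow> closed_segment z (z + u) \<subseteq> U"
    unfolding segment_from_pr linepath_image_01[symmetric] by auto
  have key: "c + path_chain (segment_from (pr z) u) \<in> chains_to x (pr (z + u)) \<and>
      [cyc_val (c + path_chain (segment_from (pr z) u) - tail (pr (z + u))) = s + ml z (z + u)] (mod int d)"
    if c: "c \<in> snd (pt z s)" and su: "closed_segment z (z + u) \<subseteq> U" for c
  proof -
    let ?p = "path_chain (pr \<circ> linepath z (z + u))" and ?t = "tail (pr z)" and ?t' = "tail (pr (z + u))"
    have c': "c \<in> chains_to x (pr z)" "[cyc_val (c - ?t) = s] (mod int d)"
      using c by (auto simp: pt_def)
    have zu: "z + u \<in> U"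
      using su by auto
    have t: "?t \<in> chains_to x (pr z)" "?t' \<in> chains_to x (pr (z + u))"
      using assms zu by (auto intro: tail_in)
    have p: "singular_chain 1 X ?p" "chain_boundary 1 ?p = point_chain (pr (z + u)) - point_chain (pr z)"
      using singular_chain_path_chain[OF unit_path_line[OF su]] chain_boundary_path_chain[of "pr \<circ> linepath z (z + u)"]
      by (simp_all add: linepath_0' linepath_1')
    have to: "c + ?p \<in> chains_to x (pr (z + u))" "?t + ?p \<in> chains_to x (pr (z + u))"
      using c'(1) t(1) p by (auto simp: chains_to_def singular_chain_add chain_boundary_add simp del: One_nat_def)
    have "ml z (z + u) = cyc_val ((?t + ?p) - ?t')"
      unfolding ml_def path_val_def chain_val_def p(2) tail_ext_diff tail_ext_point by (simp add: algebra_simps)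
    moreover have "cyc (c - ?t)" "cyc ((?t + ?p) - ?t')"
      using chains_to_diff c'(1) t to by blast+
    then have "[cyc_val ((c - ?t) + ((?t + ?p) - ?t')) = cyc_val (c - ?t) + cyc_val ((?t + ?p) - ?t')] (mod int d)"
      by (rule cyc_val_add_cong)
    moreover have "(c - ?t) + ((?t + ?p) - ?t') = c + ?p - ?t'"
      by simp
    ultimately have "[cyc_val (c + ?p - ?t') = cyc_val (c - ?t) + ml z (z + u)] (mod int d)"
      by (simp only:)
    then have "[cyc_val (c + ?p - ?t') = s + ml z (z + u)] (mod int d)"
      using c'(2) by (meson cong_add cong_refl cong_trans)
    then show ?thesis
      using to by (simp add: segment_from_pr)
  qed
  show ?thesis
  proof
    assume m: "straight_move x \<alpha> (pt z s) u Q"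
    then have su: "closed_segment z (z + u) \<subseteq> U"
      using seg by (simp add: straight_move_def)
    then have zu: "z + u \<in> U"
      by auto
    obtain w s' where Q: "Q = pt w s'" "w \<in> U"
      using m by (auto simp: straight_move_def cover_eq)
    have "pr w = segment_from (pr z) u 1"
      using m by (simp add: straight_move_def Q)
    then have w: "pr w = pr (z + u)"
      by (simp add: segment_from_pr linepath_1')
    obtain c where c: "c \<in> snd (pt z s)" "c + path_chain (segment_from (pr z) u) \<in> snd Q"
      using m by (auto simp: straight_move_def)
    then have "[cyc_val (c + path_chain (segment_from (pr z) u) - tail (pr (z + u))) = s'] (mod int d)"
      by (simp add: Q pt_def w)
    then have "[s' = s + ml z (z + u)] (mod int d)"
      using key[OF c(1) su] by (simp add: cong_def)
    then have "Q = pt (z + u) (s + ml z (z + u))"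
      unfolding Q using pt_eq_iff[OF Q(2)] w pr_eq_iff by blast
    then show "closed_segment z (z + u) \<subseteq> U \<and> Q = pt (z + u) (s + ml z (z + u))"
      using su by simp
  next
    assume m: "closed_segment z (z + u) \<subseteq> U \<and> Q = pt (z + u) (s + ml z (z + u))"
    then have zu: "z + u \<in> U"
      by auto
    obtain c where c: "c \<in> snd (pt z s)"
      using pt_witness[OF assms] .
    have "c + path_chain (segment_from (pr z) u) \<in> snd Q"
      using key[OF c] m by (simp add: pt_def)
    then show "straight_move x \<alpha> (pt z s) u Q"
      unfolding straight_move_def fst_pt seg using m c zu assms
      by (auto simp: segment_from_pr linepath_1')
  qed
qed

end

section \<open>Cylinders of the cover\<close>

context torus_cover
begin

section \<open>Orders in the cyclic group and strips without punctures\<close>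

definition ordn :: "int \<Rightarrow> nat" where
  "ordn f = nat (int d div gcd f (int d))"

lemma ordn_pos: "ordn f \<ge> 1"
proof -
  have "gcd f (int d) \<le> int d" "gcd f (int d) > 0"
    using d_pos by (auto intro!: zdvd_imp_le)
  then have "int d div gcd f (int d) > 0"
    by (simp add: pos_imp_zdiv_pos_iff)
  then show ?thesis
    by (simp add: ordn_def)
qed

lemma ordn_le: "ordn f \<le> d"
proof -
  have "gcd f (int d) > 0"
    using d_pos by simp
  then have "int d div gcd f (int d) \<le> int d div 1"
    by (intro zdiv_mono2) linarith+
  then show ?thesis
    by (simp add: ordn_def)
qed

lemma ordn_dvd: "int d dvd j * f \<longleftrightarrow> int (ordn f) dvd j"
proof -
  let ?g = "gcd f (int d)"
  have g: "?g \<noteq> 0"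
    using d_pos by simp
  obtain f' d' where fd: "f = f' * ?g" "int d = d' * ?g" "coprime f' d'"
    using gcd_coprime_exists[OF g] by blast
  have o: "int (ordn f) = d'"
  proof -
    have "int d div ?g = d'"
      using fd(2) g by (metis nonzero_mult_div_cancel_right)
    moreover have "d' \<ge> 0"
      using fd(2) d_pos g by (metis gcd_ge_0_int of_nat_0_le_iff mult_less_0_iff not_le order_le_less)
    ultimately show ?thesis
      by (simp add: ordn_def)
  qed
  have "int d dvd j * f \<longleftrightarrow> d' * ?g dvd j * f' * ?g"
    using fd by (metis mult.assoc)
  also have "\<dots> \<longleftrightarrow> d' dvd j * f'"
    by (simp only: dvd_mult_cancel_right g simp_thms)
  also have "\<dots> \<longleftrightarrow> d' dvd j"
    using fd(3) by (simp add: coprime_dvd_mult_left_iff coprime_commute)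
  finally show ?thesis
    by (simp add: o)
qed

lemma ordn_cong: "[f = f'] (mod int d) \<Longrightarrow> ordn f = ordn f'"
  unfolding ordn_def by (metis cong_gcd_eq)

lemma ordn_minus: "ordn (- f) = ordn f"
  by (simp add: ordn_def)

text \<open>The open strip in direction \<open>v\<close> that contains \<open>z\<close> and lies
  between consecutive lines with punctures; it is empty if \<open>z\<close> is itself on such a
  line.\<close>

definition band :: "complex \<Rightarrow> complex \<Rightarrow> complex set" where
  "band v z = {w. \<forall>p\<in>punct. crs v p \<notin> closed_segment (crs v z) (crs v w)}"

lemma band_real: "closed_segment (a::real) c \<subseteq> closed_segment a b \<union> closed_segment b c"
  by (auto simp: closed_segment_eq_real_ivl)

lemma band_refl: "clear v z \<longleftrightarrow> z \<in> band v z"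
  by (auto simp: band_def clear_def)

lemma band_sym: "w \<in> band v z \<longleftrightarrow> z \<in> band v w"
  by (simp add: band_def closed_segment_commute)

lemma band_trans: "w \<in> band v z \<Longrightarrow> u \<in> band v w \<Longrightarrow> u \<in> band v z"
  unfolding band_def using band_real[of "crs v z" "crs v u" "crs v w"] by blast

lemma band_clear: "w \<in> band v z \<Longrightarrow> clear v w" "w \<in> band v z \<Longrightarrow> clear v z"
  by (auto simp: band_def clear_def)

lemma band_eq: "w \<in> band v z \<Longrightarrow> band v w = band v z"
  using band_sym band_trans by blast

lemma band_U: "band v z \<subseteq> U"
  by (auto simp: band_def U_def)

lemma convex_band: "convex (band v z)"
  unfolding convex_contains_segment
proof (intro ballI subsetI)
  fix a b c assume ab: "a \<in> band v z" "b \<in> band v z" "c \<in> closed_segment a b"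
  then obtain t where t: "c = (1 - t) *\<^sub>R a + t *\<^sub>R b" "0 \<le> t" "t \<le> 1"
    by (auto simp: in_segment)
  then have "crs v c = (1 - t) *\<^sub>R crs v a + t *\<^sub>R crs v b"
    by (simp add: crs_linear)
  then have "crs v c \<in> closed_segment (crs v a) (crs v b)"
    using t by (auto simp: in_segment)
  then have "closed_segment (crs v z) (crs v c) \<subseteq> closed_segment (crs v z) (crs v a) \<union> closed_segment (crs v z) (crs v b)"
    by (auto simp: closed_segment_eq_real_ivl split: if_splits)
  then show "c \<in> band v z"
    using ab by (auto simp: band_def)
qed

lemma band_height: "w \<in> band v z \<Longrightarrow> crs v w' = crs v w \<Longrightarrow> w' \<in> band v z"
  by (simp add: band_def)

lemma band_shift: "l \<in> \<Lambda> \<Longrightarrow> w + l \<in> band v (z + l) \<longleftrightarrow> w \<in> band v z"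
proof -
  have "w + l \<in> band v (z + l)" if "w \<in> band v z" "l \<in> \<Lambda>" for w z l
    unfolding band_def
  proof (intro CollectI ballI)
    fix p assume "p \<in> punct"
    then have "p - l \<in> punct"
      using punct_shift[OF lattice_minus[OF that(2)], of p] by simp
    then have "crs v (p - l) \<notin> closed_segment (crs v z) (crs v w)"
      using that(1) by (simp add: band_def)
    then show "crs v p \<notin> closed_segment (crs v (z + l)) (crs v (w + l))"
      by (auto simp: closed_segment_eq_real_ivl crs_linear split: if_splits)
  qed
  from this[of w z l] this[of "w + l" "z + l" "- l"] show "l \<in> \<Lambda> \<Longrightarrow> ?thesis"
    using lattice_minus by auto
qed

lemma ml_band:
  assumes "a \<in> band v z" "b \<in> band v z" "c \<in> band v z"
  shows "[ml a c = ml a b + ml b c] (mod int d)"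
  using assms by (intro ml_convex[OF convex_band band_U])

lemma F_band: "v \<in> \<Lambda> \<Longrightarrow> w \<in> band v z \<Longrightarrow> [F v w = F v z] (mod int d)"
proof -
  assume v: "v \<in> \<Lambda>" and w: "w \<in> band v z"
  have z: "z \<in> band v z"
    using band_clear(2)[OF w] by (simp add: band_refl)
  show ?thesis
    by (rule F_const[OF v convex_band band_U w z band_height[OF w] band_height[OF z]]) (simp_all add: crs_linear)
qed

lemma ml_multiple:
  assumes v: "v \<in> \<Lambda>" and w: "clear v w"
  shows "[ml w (w + of_int j * v) = j * F v w] (mod int d)"
proof -
  have b: "w + of_int j * v \<in> band v w" for j
    using w by (intro band_height[OF iffD1[OF band_refl]]) (simp_all add: crs_linear)
  have step: "[ml w (w + of_int (j + 1) * v) = ml w (w + of_int j * v) + F v w] (mod int d)" for j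
  proof -
    have "[ml w (w + of_int (j + 1) * v) = ml w (w + of_int j * v) + ml (w + of_int j * v) (w + of_int (j + 1) * v)] (mod int d)"
      using b[of j] b[of "j + 1"] w band_refl by (intro ml_band[of _ v w]) auto
    moreover have "ml (w + of_int j * v) (w + of_int (j + 1) * v) = F v w"
      using ml_shift[OF lattice_of_int[OF v, of j], of w "w + v"] by (simp add: F_def algebra_simps)
    ultimately show ?thesis by simp
  qed
  show ?thesis
  proof (induction j rule: int_induct[where k = 0])
    case base
    show ?case
      using ml_same[of w] w band_refl subsetD[OF band_U[of v w], of w] by auto
  next
    case (step1 j)
    then have "[ml w (w + of_int (j + 1) * v) = j * F v w + F v w] (mod int d)"
      using step[of j] by (meson cong_add cong_refl cong_trans)
    then show ?case by (simp add: algebra_simps)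
  next
    case (step2 j)
    have "[ml w (w + of_int (j - 1) * v) + F v w = j * F v w] (mod int d)"
      using step[of "j - 1"] step2 by (simp add: cong_def)
    then show ?case by (simp add: cong_iff_dvd_diff algebra_simps)
  qed
qed

text \<open>The lift of the strip that, for clear \<open>z\<close>, passes through the point over
  \<open>z\<close> with label \<open>s\<close>. The cylinder is described unrolled, so different
  \<open>w\<close> may name the same point.\<close>

definition Cyl :: "complex \<Rightarrow> complex \<Rightarrow> int \<Rightarrow> cover_pt set" where
  "Cyl v z s = {pt w (s + ml z w) | w. w \<in> band v z}"

lemma Cyl_move:
  assumes "w \<in> band v z"
  shows "Cyl v w (s + ml z w) = Cyl v z s"
proof -
  have "pt u (s + ml z w + ml w u) = pt u (s + ml z u)" if "u \<in> band v z" for u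
    using that assms ml_band[of z v z w u] band_U band_clear(2)[OF assms] band_refl[of v z]
    by (subst pt_eq_iff) (auto simp: cong_iff_dvd_diff dvd_diff_commute algebra_simps)
  then show ?thesis
    unfolding Cyl_def band_eq[OF assms] by (metis (no_types, lifting))
qed

lemma Cyl_shift:
  assumes "l \<in> \<Lambda>"
  shows "Cyl v (z + l) s = Cyl v z s"
proof -
  have sub: "Cyl v z s \<subseteq> Cyl v (z + l) s" if "l \<in> \<Lambda>" for z l
  proof
    fix P assume "P \<in> Cyl v z s"
    then obtain w where w: "w \<in> band v z" "P = pt w (s + ml z w)"
      by (auto simp: Cyl_def)
    have "P = pt (w + l) (s + ml (z + l) (w + l))"
      unfolding w(2) using w(1) band_U that ml_shift by (subst pt_eq_iff) auto
    then show "P \<in> Cyl v (z + l) s"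
      using band_shift[OF that] w(1) by (auto simp: Cyl_def)
  qed
  from sub[OF assms, of z] sub[OF lattice_minus[OF assms], of "z + l"] show ?thesis
    by auto
qed

lemma Cyl_cong:
  assumes "[s = s'] (mod int d)"
  shows "Cyl v z s = Cyl v z s'"
proof -
  have "pt w (s + ml z w) = pt w (s' + ml z w)" if "w \<in> band v z" for w
    using that assms band_U by (subst pt_eq_iff) (auto simp: cong_add_rcancel)
  then show ?thesis
    unfolding Cyl_def by (metis (no_types, lifting))
qed

lemma Cyl_minus: "Cyl (- v) z s = Cyl v z s"
proof -
  have "band (- v) z = band v z"
    unfolding band_def by (auto simp: crs_linear closed_segment_eq_real_ivl split: if_splits)
  then show ?thesis
    by (simp add: Cyl_def)
qed

lemma pt_in_Cyl: "clear v z \<Longrightarrow> pt z s \<in> Cyl v z s"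
proof -
  assume c: "clear v z"
  then have z: "z \<in> band v z"
    by (simp add: band_refl)
  then have "pt z s = pt z (s + ml z z)"
    using ml_same[of z] band_U by (subst pt_eq_iff) (auto simp: cong_iff_dvd_diff)
  then show ?thesis
    using z by (auto simp: Cyl_def)
qed

text \<open>Moving the base point within the strip, by a lattice vector, or the label by a multiple
  of \<open>d\<close> does not change a cylinder, so together with the direction any of its points
  determines it.\<close>

lemma Cyl_determined:
  assumes "pt z s \<in> Cyl v z' s'" "z \<in> U"
  shows "Cyl v z s = Cyl v z' s'" "\<exists>l\<in>\<Lambda>. z + l \<in> band v z'"
proof -
  obtain w where w: "w \<in> band v z'" "pt z s = pt w (s' + ml z' w)"
    using assms by (auto simp: Cyl_def)
  then have l: "w - z \<in> \<Lambda>" "[s = s' + ml z' w] (mod int d)"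
    using pt_eq_iff[OF assms(2)] by auto
  have "Cyl v z s = Cyl v (z + (w - z)) s"
    using Cyl_shift[OF l(1), of v z s] by simp
  also have "\<dots> = Cyl v w (s' + ml z' w)"
    using Cyl_cong[OF l(2)] by simp
  also have "\<dots> = Cyl v z' s'"
    by (rule Cyl_move[OF w(1)])
  finally show "Cyl v z s = Cyl v z' s'" .
  show "\<exists>l\<in>\<Lambda>. z + l \<in> band v z'"
    using l w(1) by (intro bexI[of _ "w - z"]) auto
qed

lemma punct_height:
  assumes "v \<in> \<Lambda>" "v' \<in> \<Lambda>" "crs v v' = 1" "p \<in> punct"
  shows "\<exists>q\<in>punct. crs v q = crs v p + of_int m"
  using assms lattice_of_int[OF assms(2), of m] punct_shift[of "of_int m * v'" p]
  by (intro bexI[of _ "p + of_int m * v'"]) (auto simp: crs_linear)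

lemma punct_nonempty: "mark x i \<in> punct"
  by (auto simp: punct_iff intro!: exI[of _ i])

text \<open>Multiples of \<open>v\<close> do not change the height and bring a puncture into the
  parallelogram \<open>S\<close>, which is bounded.\<close>

lemma heights_finite:
  assumes v': "v \<in> \<Lambda>" "v' \<in> \<Lambda>" "crs v v' = 1"
  shows "finite (crs v ` punct \<inter> {a..b})"
proof -
  define S where "S = {w. \<exists>s t. 0 \<le> s \<and> s \<le> 1 \<and> a \<le> t \<and> t \<le> b \<and> w = of_real s * v + of_real t * v'}"
  have "norm w \<le> norm v + (\<bar>a\<bar> + \<bar>b\<bar>) * norm v'" if "w \<in> S" for w
  proof -
    obtain s t where st: "0 \<le> s" "s \<le> 1" "a \<le> t" "t \<le> b" "w = of_real s * v + of_real t * v'"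
      using \<open>w \<in> S\<close> by (auto simp: S_def)
    have "norm w \<le> \<bar>s\<bar> * norm v + \<bar>t\<bar> * norm v'"
      unfolding st(5) by (rule order_trans[OF norm_triangle_ineq]) (simp add: norm_mult)
    also have "\<dots> \<le> 1 * norm v + (\<bar>a\<bar> + \<bar>b\<bar>) * norm v'"
      using st by (intro add_mono mult_right_mono) auto
    finally show ?thesis by simp
  qed
  then have "bounded S"
    unfolding bounded_iff by blast
  have "crs v ` punct \<inter> {a..b} \<subseteq> crs v ` (punct \<inter> S)"
  proof
    fix h assume "h \<in> crs v ` punct \<inter> {a..b}"
    then obtain p where p: "p \<in> punct" "h = crs v p" "a \<le> h" "h \<le> b"
      by auto
    define q where "q = p + of_int (- \<lfloor>crs p v'\<rfloor>) * v"
    have q: "q \<in> punct" "crs v q = h"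
      using punct_shift[OF lattice_of_int[OF v'(1)], of p "- \<lfloor>crs p v'\<rfloor>"] p by (auto simp: q_def crs_linear)
    have "crs q v' = frac (crs p v')"
      using v'(3) by (simp add: q_def crs_linear frac_def)
    then have "q = of_real (frac (crs p v')) * v + of_real h * v'"
      using basis_expand[OF v'(3), of q] q(2) by simp
    then have "q \<in> S"
      unfolding S_def using p frac_ge_0[of "crs p v'"] frac_lt_1[of "crs p v'"] by (intro CollectI exI[of _ "frac (crs p v')"] exI[of _ h]) auto
    then show "h \<in> crs v ` (punct \<inter> S)"
      using q by blast
  qed
  then show ?thesis
    using finite_subset punct_finite_bounded[OF \<open>bounded S\<close>] by blast
qed

text \<open>The heights of punctures are periodic with period 1, because some \<open>v'\<close> in
  the lattice raises heights by 1. The bound 1 on the width will force two points of a strip over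
  the same torus point to have equal height.\<close>

lemma band_bounds:
  assumes v: "prim v" and z: "clear v z"
  obtains lo hi where "lo < crs v z" "crs v z < hi" "hi \<le> lo + 1" "band v z = {w. lo < crs v w \<and> crs v w < hi}"
proof -
  obtain v' where v': "v \<in> \<Lambda>" "v' \<in> \<Lambda>" "crs v v' = 1"
    using v by (auto simp: prim_def)
  let ?H = "crs v ` punct" and ?c = "crs v z"
  obtain i0 :: 'n where True by blast
  have near: "\<exists>h\<in>?H. t \<le> h \<and> h < t + 1" for t
  proof -
    define m where "m = \<lceil>t - crs v (mark x i0)\<rceil>"
    have "t \<le> crs v (mark x i0) + of_int m" "crs v (mark x i0) + of_int m < t + 1"
      unfolding m_def by linarith+
    then show ?thesis
      using punct_height[OF v' punct_nonempty[of i0], of m] by (auto simp: image_iff) metis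
  qed
  have fin: "finite (?H \<inter> {a..b})" for a b
    by (rule heights_finite[OF v'])
  define lo where "lo = Max (?H \<inter> {?c - 1..?c})"
  define hi where "hi = Min (?H \<inter> {?c..?c + 1})"
  have ne: "?H \<inter> {?c - 1..?c} \<noteq> {}" "?H \<inter> {?c..?c + 1} \<noteq> {}"
    using near[of "?c - 1"] near[of ?c] by fastforce+
  have lo: "lo \<in> ?H \<inter> {?c - 1..?c}" and hi: "hi \<in> ?H \<inter> {?c..?c + 1}"
    unfolding lo_def hi_def using Max_in[OF fin ne(1)] Min_in[OF fin ne(2)] by auto
  have c: "?c \<notin> ?H"
    using z by (auto simp: clear_def)
  have bet: "h \<le> lo \<or> hi \<le> h" if "h \<in> ?H" for h
  proof (rule ccontr)
    assume n: "\<not> ?thesis"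
    show False
    proof (cases "h \<le> ?c")
      case True
      then have "h \<in> ?H \<inter> {?c - 1..?c}"
        using n lo that by auto
      then show False
        using n Max_ge[OF fin, of h "?c - 1" ?c] by (auto simp: lo_def)
    next
      case False
      then have "h \<in> ?H \<inter> {?c..?c + 1}"
        using n hi that by auto
      then show False
        using n Min_le[OF fin, of h ?c "?c + 1"] by (auto simp: hi_def)
    qed
  qed
  have strict: "lo < ?c" "?c < hi"
  proof -
    have "lo \<noteq> ?c" "hi \<noteq> ?c"
      using lo hi c by blast+
    then show "lo < ?c" "?c < hi"
      using lo hi by auto
  qed
  have "hi \<le> lo + 1"
  proof -
    obtain p where "p \<in> punct" "lo = crs v p"
      using lo by auto
    then have "lo + 1 \<in> ?H"
      using punct_height[OF v', of p 1] by (auto simp: image_iff) metis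
    then show ?thesis
      using bet by fastforce
  qed
  moreover have "band v z = {w. lo < crs v w \<and> crs v w < hi}"
  proof (intro equalityI subsetI)
    fix w assume w: "w \<in> band v z"
    have "h \<notin> closed_segment ?c (crs v w)" if "h \<in> ?H" for h
      using w that by (auto simp: band_def)
    from this[of lo] this[of hi] show "w \<in> {w. lo < crs v w \<and> crs v w < hi}"
      using lo hi c by (auto simp: closed_segment_eq_real_ivl split: if_splits)
  next
    fix w assume w: "w \<in> {w. lo < crs v w \<and> crs v w < hi}"
    show "w \<in> band v z"
      unfolding band_def
    proof (intro CollectI ballI)
      fix p assume "p \<in> punct"
      then show "crs v p \<notin> closed_segment ?c (crs v w)"
        using bet[of "crs v p"] w strict by (auto simp: closed_segment_eq_real_ivl split: if_splits)
    qed
  qed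
  ultimately show ?thesis
    using that strict by blast
qed

lemma lattice_parallel:
  assumes "v \<in> \<Lambda>" "v' \<in> \<Lambda>" "crs v v' = 1" "l \<in> \<Lambda>" "crs v l = 0"
  obtains j where "l = of_int j * v"
proof -
  obtain j where "crs l v' = of_int j"
    using crs_lattice_Ints[OF assms(4,2)] by (auto elim: Ints_cases)
  then have "l = of_int j * v"
    using basis_expand[OF assms(3), of l] assms(5) by simp
  then show ?thesis
    using that by blast
qed

lemma strip_crs:
  assumes "V \<noteq> 0"
  shows "z \<in> strip V h \<longleftrightarrow> 0 < crs V z \<and> crs V z < h * norm V"
proof -
  have "Im (z / V) = crs V z / (norm V)\<^sup>2"
    by (simp add: Im_divide crs_alt cmod_power2 mult.commute)
  then have "Im (z / V) * norm V = crs V z / norm V"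
    using assms by (simp add: power2_eq_square)
  then show ?thesis
    using assms by (simp add: strip_def pos_divide_less_eq zero_less_divide_iff)
qed

text \<open>Lattice vectors have integral height and the strip has width at most 1, so two points
  over the same torus point differ by some \<open>j v\<close>. Their labels agree iff
  \<open>d\<close> divides \<open>j\<close> times the monodromy along the core.\<close>

lemma Cyl_same_sheet:
  assumes v: "prim v" and z: "clear v z" and w: "w \<in> band v z" "w' \<in> band v z"
  shows "pt w (s + ml z w) = pt w' (s + ml z w') \<longleftrightarrow> (\<exists>j::int. w' - w = of_int (j * int (ordn (F v z))) * v)"
proof -
  obtain v' where v': "v \<in> \<Lambda>" "v' \<in> \<Lambda>" "crs v v' = 1"
    using v by (auto simp: prim_def)
  obtain lo hi where lohi: "hi \<le> lo + 1" "band v z = {w. lo < crs v w \<and> crs v w < hi}"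
    using band_bounds[OF v z] by metis
  have zb: "z \<in> band v z"
    using z band_refl by simp
  have "[ml z w' = ml z w + ml w w'] (mod int d)"
    by (rule ml_band[OF zb w])
  then have m: "[s + ml z w = s + ml z w'] (mod int d) \<longleftrightarrow> int d dvd ml w w'"
    by (smt (verit, ccfv_threshold) cong_add_lcancel cong_add_lcancel_0 cong_dvd_iff cong_iff_dvd_diff cong_sym cong_trans dvd_minus_iff cong_0_iff)
  have ordj: "int d dvd ml w (w + of_int j * v) \<longleftrightarrow> int (ordn (F v z)) dvd j" for j
  proof -
    have "[ml w (w + of_int j * v) = j * F v w] (mod int d)"
      using ml_multiple[OF v'(1) band_clear(1)[OF w(1)]] .
    then have "int d dvd ml w (w + of_int j * v) \<longleftrightarrow> int d dvd j * F v w"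
      by (simp add: cong_dvd_iff)
    also have "\<dots> \<longleftrightarrow> int (ordn (F v w)) dvd j"
      by (rule ordn_dvd)
    also have "ordn (F v w) = ordn (F v z)"
      by (rule ordn_cong[OF F_band[OF v'(1) w(1)]])
    finally show ?thesis .
  qed
  have "pt w (s + ml z w) = pt w' (s + ml z w') \<longleftrightarrow> w' - w \<in> \<Lambda> \<and> int d dvd ml w w'"
    using pt_eq_iff[of w] w band_U m by blast
  also have "\<dots> \<longleftrightarrow> (\<exists>j::int. w' - w = of_int (j * int (ordn (F v z))) * v)"
  proof
    assume *: "w' - w \<in> \<Lambda> \<and> int d dvd ml w w'"
    obtain k where k: "crs v (w' - w) = of_int k"
      using crs_lattice_Ints[OF v'(1), of "w' - w"] * by (auto elim: Ints_cases)
    moreover have "\<bar>crs v (w' - w)\<bar> < 1"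
      using w lohi by (auto simp: crs_linear)
    ultimately have "crs v (w' - w) = 0"
      by simp
    then obtain j where j: "w' - w = of_int j * v"
      using lattice_parallel[OF v'] * by blast
    then have "w' = w + of_int j * v"
      by (simp add: algebra_simps)
    then have "int (ordn (F v z)) dvd j"
      using * ordj by simp
    then show "\<exists>j::int. w' - w = of_int (j * int (ordn (F v z))) * v"
      using j by (metis dvd_def mult.commute)
  next
    assume "\<exists>j::int. w' - w = of_int (j * int (ordn (F v z))) * v"
    then obtain j where j: "w' - w = of_int (j * int (ordn (F v z))) * v"
      by blast
    then have "w' = w + of_int (j * int (ordn (F v z))) * v"
      by (simp add: algebra_simps)
    then have "int d dvd ml w w'"
      using ordj[of "j * int (ordn (F v z))"] by simp
    then show "w' - w \<in> \<Lambda> \<and> int d dvd ml w w'"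
      using j lattice_of_int[OF v'(1)] by metis
  qed
  finally show ?thesis .
qed

lemma Cyl_cylinder:
  assumes v: "prim v" and z: "clear v z"
  shows "cylinder_with_holonomy x \<alpha> (Cyl v z s) (of_int (int (ordn (F v z))) * v)"
proof -
  let ?k = "of_int (int (ordn (F v z))) :: complex" and ?kr = "real (ordn (F v z))"
  obtain lo hi where lohi: "lo < crs v z" "crs v z < hi" "hi \<le> lo + 1" "band v z = {w. lo < crs v w \<and> crs v w < hi}"
    using band_bounds[OF v z] by metis
  have v0: "v \<noteq> 0"
    by (rule prim_nonzero[OF v])
  have k: "?kr > 0"
    using ordn_pos[of "F v z"] by simp
  have V0: "?k * v \<noteq> 0"
    using v0 k by auto
  \<comment> \<open>The function \<open>crs v\<close> is \<open>norm v\<close> times the Euclidean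
    distance across the strip.\<close>
  define h where "h = (hi - lo) / norm v"
  have h: "h > 0"
    using lohi v0 by (simp add: h_def)
  have strip: "\<zeta> \<in> strip (?k * v) h \<longleftrightarrow> 0 < crs v \<zeta> \<and> crs v \<zeta> < hi - lo" for \<zeta>
    unfolding strip_crs[OF V0] crs_of_int using k v0
    by (simp add: norm_mult h_def zero_less_mult_iff)
  \<comment> \<open>The model strip starts at height 0 and is moved into place by a point on the
    lower edge of the band.\<close>
  obtain z1 where z1: "crs v z1 = lo"
  proof
    show "crs v (of_real (lo / (norm v)\<^sup>2) * (\<i> * v)) = lo"
    proof -
      have "crs v (\<i> * v) = (norm v)\<^sup>2"
        unfolding cmod_power2 by (simp add: crs_alt power2_eq_square)
      then show ?thesis
        using v0 by (simp only: crs_simps) simp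
    qed
  qed
  define \<phi> where "\<phi> \<zeta> = pt (z1 + \<zeta>) (s + ml z (z1 + \<zeta>))" for \<zeta>
  have inb: "z1 + \<zeta> \<in> band v z" if "\<zeta> \<in> strip (?k * v) h" for \<zeta>
    using that z1 unfolding strip lohi(4) by (simp add: crs_linear)
  have zb: "z \<in> band v z"
    using z band_refl by simp
  show ?thesis
    unfolding cylinder_with_holonomy_def
  proof (intro conjI exI[of _ h] exI[of _ \<phi>] V0 h ballI)
    show "Cyl v z s = \<phi> ` strip (?k * v) h"
    proof (intro equalityI subsetI)
      fix P assume "P \<in> Cyl v z s"
      then obtain w where w: "w \<in> band v z" "P = pt w (s + ml z w)"
        by (auto simp: Cyl_def)
      have "P = \<phi> (w - z1)"
        by (simp add: w \<phi>_def)
      moreover have "w - z1 \<in> strip (?k * v) h"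
        using w(1) z1 unfolding strip lohi(4) by (simp add: crs_linear)
      ultimately show "P \<in> \<phi> ` strip (?k * v) h"
        by blast
    next
      fix P assume "P \<in> \<phi> ` strip (?k * v) h"
      then show "P \<in> Cyl v z s"
        using inb by (auto simp: Cyl_def \<phi>_def)
    qed
  next
    fix a b assume ab: "a \<in> strip (?k * v) h" "b \<in> strip (?k * v) h"
    have seg: "closed_segment (z1 + a) (z1 + a + (b - a)) \<subseteq> U"
      using closed_segment_subset[OF inb[OF ab(1)] inb[OF ab(2)] convex_band] band_U by (auto simp: add.commute)
    have "pt (z1 + b) (s + ml z (z1 + b)) = pt (z1 + b) (s + ml z (z1 + a) + ml (z1 + a) (z1 + b))"
      using ml_band[OF zb inb[OF ab(1)] inb[OF ab(2)]] inb[OF ab(2)] band_U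
      by (subst pt_eq_iff) (auto simp: add.assoc cong_add_lcancel)
    then show "straight_move x \<alpha> (\<phi> a) (b - a) (\<phi> b)"
      using seg by (simp add: \<phi>_def straight_move_iff[OF subsetD[OF band_U inb[OF ab(1)]]] add.assoc)
    have "\<phi> a = \<phi> b \<longleftrightarrow> (\<exists>j::int. b - a = of_int (j * int (ordn (F v z))) * v)"
      unfolding \<phi>_def using Cyl_same_sheet[OF v z inb[OF ab(1)] inb[OF ab(2)]] by simp
    then show "\<phi> a = \<phi> b \<longleftrightarrow> (\<exists>m::int. b - a = of_int m * (?k * v))"
      by (simp add: mult.assoc)
  qed
qed

end

section \<open>Maximal cylinders\<close>

context torus_cover
begin

lemma lattice_primitive_multiple:
  assumes "V \<in> \<Lambda>" "V \<noteq> 0"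
  obtains v k where "prim v" "k > 0" "V = of_int k * v"
proof -
  obtain m n where mn: "V = vec m n"
    using assms(1) unfolding period_lattice_def by blast
  have g: "gcd m n \<noteq> 0"
    using mn assms(2) by auto
  then obtain p q where pq: "m = p * gcd m n" "n = q * gcd m n" "coprime p q"
    using gcd_coprime_exists[OF g] by blast
  have "V = of_int (gcd m n) * vec p q"
    unfolding mn by (subst (1) pq(1), subst (2) pq(2)) (simp add: algebra_simps)
  then show ?thesis
    using that[OF prim_vec[OF pq(3)], of "gcd m n"] g by (simp add: order_less_le)
qed

text \<open>The cylinder is developed into the plane from a point \<open>a\<close> of its strip.
  Since \<phi> closes up after \<open>V\<close>, this is a lattice vector; since the strip avoids
  punctures, it develops into a band; since \<phi> identifies exactly the multiples of
  \<open>V\<close>, these are the periods found in \<open>Cyl_same_sheet\<close>.\<close>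

lemma cylinder_subset_Cyl:
  assumes "cylinder_with_holonomy x \<alpha> C V"
  obtains v z s where "prim v" "clear v z" "C \<subseteq> Cyl v z s" "V = of_int (int (ordn (F v z))) * v"
proof -
  obtain h \<phi> where V: "V \<noteq> 0" and h: "h > 0" and C: "C = \<phi> ` strip V h"
    and move: "\<And>a b. a \<in> strip V h \<Longrightarrow> b \<in> strip V h \<Longrightarrow> straight_move x \<alpha> (\<phi> a) (b - a) (\<phi> b)"
    and inj: "\<And>a b. a \<in> strip V h \<Longrightarrow> b \<in> strip V h \<Longrightarrow> \<phi> a = \<phi> b \<longleftrightarrow> (\<exists>m::int. b - a = of_int m * V)"
    using assms unfolding cylinder_with_holonomy_def by auto
  \<comment> \<open>A point on the middle line of the strip.\<close>
  define a where "a = of_real (h / (2 * norm V)) * (\<i> * V)"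
  have "crs V (\<i> * V) = (norm V)\<^sup>2"
    unfolding cmod_power2 by (simp add: crs_alt power2_eq_square)
  then have "crs V a = h * norm V / 2"
    unfolding a_def crs_simps using V by (simp add: power2_eq_square)
  moreover have "h * norm V > 0"
    using h V by simp
  ultimately have a: "a \<in> strip V h"
    unfolding strip_crs[OF V] by linarith
  have "\<phi> a \<in> cover x \<alpha>"
    using move[OF a a] by (simp add: straight_move_def)
  then obtain z s where z: "z \<in> U" "\<phi> a = pt z s"
    by (auto simp: cover_eq)
  have phi: "closed_segment z (z + (b - a)) \<subseteq> U \<and> \<phi> b = pt (z + (b - a)) (s + ml z (z + (b - a)))" if "b \<in> strip V h" for b
    using move[OF a that] straight_move_iff[OF z(1)] z(2) by simp
  have period: "b + of_real t * V \<in> strip V h" if "b \<in> strip V h" for b t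
    using that V by (simp add: strip_crs crs_linear)
  have aV: "a + V \<in> strip V h"
    using period[OF a, of 1] by simp
  have "\<phi> a = \<phi> (a + V)"
    using inj[OF a aV] by (auto intro: exI[of _ 1])
  then have "pt z s = pt (z + V) (s + ml z (z + V))"
    using phi[OF aV] z(2) by simp
  then have "V \<in> \<Lambda>"
    using pt_eq_iff[OF z(1)] by simp
  then obtain v k where v: "prim v" "k > 0" "V = of_int k * v"
    using lattice_primitive_multiple V by blast
  have vL: "v \<in> \<Lambda>"
    using v(1) by (simp add: prim_def)
  have band: "z + (b - a) \<in> band v z" if b: "b \<in> strip V h" for b
    unfolding band_def
  proof (intro CollectI ballI notI)
    fix p assume p: "p \<in> punct" "crs v p \<in> closed_segment (crs v z) (crs v (z + (b - a)))"
    obtain t where t: "0 \<le> t" "t \<le> 1" "crs v p = (1 - t) * crs v z + t * crs v (z + (b - a))"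
      using p(2) by (auto simp: in_segment)
    have e1: "crs v (p - z) = t * (crs v b - crs v a)"
      using t(3) by (simp add: crs_linear algebra_simps)
    have cV: "crs V e = of_int k * crs v e" for e
      by (simp add: v(3))
    have "crs V (p - z) = t * (crs V b - crs V a)"
      unfolding cV e1 by (simp add: algebra_simps)
    then have eq: "crs V (a + (p - z)) = (1 - t) * crs V a + t * crs V b"
      unfolding crs_linear(2)[of V a "p - z"] by (simp add: algebra_simps)
    have "(1 - t) * crs V a + t * crs V b < h * norm V" "(1 - t) * - crs V a + t * - crs V b < 0"
      using a b t V by (intro convex_bound_lt; simp add: strip_crs)+
    then have "a + (p - z) \<in> strip V h"
      unfolding strip_crs[OF V] eq by linarith
    then have "p \<in> U"
      using phi[of "a + (p - z)"] by auto
    then show False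
      using p(1) by (simp add: U_def)
  qed
  have cl: "clear v z"
    using band[OF a] band_clear(2) by blast
  have sub: "C \<subseteq> Cyl v z s"
    unfolding C Cyl_def using phi band by blast
  have mult: "\<phi> (a + of_int j * v) = pt (z + of_int j * v) (s + ml z (z + of_int j * v))"
    "a + of_int j * v \<in> strip V h" for j
  proof -
    have "of_int j * v = of_real (of_int j / of_int k) * V"
      using v by simp
    then show st: "a + of_int j * v \<in> strip V h"
      using period[OF a] by metis
    show "\<phi> (a + of_int j * v) = pt (z + of_int j * v) (s + ml z (z + of_int j * v))"
      using phi[OF st] by simp
  qed
  have zb: "z \<in> band v z"
    using cl band_refl by simp
  \<comment> \<open>Two descriptions of the \<open>j\<close> for which \<phi> takes the same value
    at \<open>a\<close> and at \<open>a + j v\<close>.\<close>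
  have key: "(\<exists>m::int. of_int j * v = of_int m * V) \<longleftrightarrow> (\<exists>i::int. of_int j * v = of_int (i * int (ordn (F v z))) * v)" for j
  proof -
    have "z + of_int j * v \<in> band v z"
      by (rule band_height[OF zb]) (simp add: crs_linear)
    from Cyl_same_sheet[OF v(1) cl zb this, of s]
    have "pt z (s + ml z z) = \<phi> (a + of_int j * v) \<longleftrightarrow> (\<exists>i::int. of_int j * v = of_int (i * int (ordn (F v z))) * v)"
      by (simp add: mult)
    moreover have "pt z (s + ml z z) = \<phi> a"
      using phi[OF a] by simp
    ultimately show ?thesis
      using inj[OF a mult(2)[of j]] by simp
  qed
  have v0: "v \<noteq> 0"
    by (rule prim_nonzero[OF v(1)])
  let ?o = "int (ordn (F v z))"
  have "?o dvd k"
  proof -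
    have "of_int k * v = of_int 1 * V"
      using v(3) by simp
    then obtain i :: int where "of_int k * v = of_int (i * ?o) * v"
      using key[of k] by blast
    then have "k = i * ?o"
      using v0 by (metis mult_cancel_right of_int_eq_iff)
    then show ?thesis
      by simp
  qed
  moreover have "k dvd ?o"
  proof -
    have "of_int ?o * v = of_int (1 * ?o) * v"
      by simp
    then obtain m :: int where "of_int ?o * v = of_int m * V"
      using key[of ?o] by blast
    then have "of_int ?o * v = of_int (m * k) * v"
      by (simp add: v(3))
    then have "?o = m * k"
      using v0 by (metis mult_cancel_right of_int_eq_iff)
    then show ?thesis
      by simp
  qed
  ultimately have "k = ?o"
    using v(2) by (intro zdvd_antisym_nonneg) auto
  then show ?thesis
    using that[OF v(1) cl sub] v(3) by simp
qed

lemma prim_parallel: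
  assumes "prim v" "prim v'" "crs v v' = 0"
  shows "v' = v \<or> v' = - v"
proof -
  obtain w where w: "v \<in> \<Lambda>" "w \<in> \<Lambda>" "crs v w = 1"
    using assms(1) by (auto simp: prim_def)
  obtain w' where w': "v' \<in> \<Lambda>" "w' \<in> \<Lambda>" "crs v' w' = 1"
    using assms(2) by (auto simp: prim_def)
  obtain j where j: "v' = of_int j * v"
    using lattice_parallel[OF w w'(1) assms(3)] .
  obtain m where "crs v w' = of_int m"
    using crs_lattice_Ints[OF w(1) w'(2)] by (auto elim: Ints_cases)
  then have "of_int (j * m) = (1::real)"
    using w'(3) by (simp add: j)
  then have "j * m = 1"
    by (metis of_int_eq_1_iff)
  then have "j = 1 \<or> j = - 1"
    using zmult_eq_1_iff by auto
  then show ?thesis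
    using j by auto
qed

text \<open>If \<open>v'\<close> were not parallel to \<open>v\<close>, the line through
  \<open>z\<close> in direction \<open>v\<close> would attain every height for \<open>v'\<close>,
  among them that of a puncture, and could not stay in strips of direction
  \<open>v'\<close>.\<close>

lemma Cyl_subset:
  assumes v: "prim v" "clear v z" and v': "prim v'" "clear v' z'" and sub: "Cyl v z s \<subseteq> Cyl v' z' s'"
  shows "v' = v \<or> v' = - v" "Cyl v z s = Cyl v' z' s'" "ordn (F v z) = ordn (F v' z')"
proof -
  have zb: "z \<in> band v z"
    using v(2) band_refl by simp
  have line: "clear v' (z + of_real t * v)" for t
  proof -
    have w: "z + of_real t * v \<in> band v z"
      by (rule band_height[OF zb]) (simp add: crs_linear)
    then have "pt (z + of_real t * v) (s + ml z (z + of_real t * v)) \<in> Cyl v' z' s'"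
      using sub by (auto simp: Cyl_def)
    then obtain l where "l \<in> \<Lambda>" "z + of_real t * v + l \<in> band v' z'"
      using Cyl_determined(2) w band_U by blast
    then show ?thesis
      using band_clear(1) clear_shift by blast
  qed
  have "crs v' v = 0"
  proof (rule ccontr)
    assume ne: "crs v' v \<noteq> 0"
    obtain i :: 'n where True by blast
    define t where "t = (crs v' (mark x i) - crs v' z) / crs v' v"
    have "crs v' (z + of_real t * v) = crs v' z + t * crs v' v"
      by (simp add: crs_linear)
    also have "\<dots> = crs v' (mark x i)"
      using ne by (simp add: t_def)
    finally have "crs v' (z + of_real t * v) = crs v' (mark x i)" .
    then show False
      using line[of t] punct_nonempty[of i] by (auto simp: clear_def)
  qed
  then have "crs v v' = 0"
    by (simp add: crs_commute[of v v'])
  then show par: "v' = v \<or> v' = - v"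
    by (rule prim_parallel[OF v(1) v'(1)])
  have "pt z s \<in> Cyl v z s"
    by (rule pt_in_Cyl[OF v(2)])
  then have mem: "pt z s \<in> Cyl v' z' s'"
    using sub by blast
  have zU: "z \<in> U"
    using zb band_U by blast
  have "Cyl v' z s = Cyl v z s"
    using par Cyl_minus by auto
  then show "Cyl v z s = Cyl v' z' s'"
    using Cyl_determined(1)[OF mem zU] by simp
  obtain l where l: "l \<in> \<Lambda>" "z + l \<in> band v' z'"
    using Cyl_determined(2)[OF mem zU] by blast
  have v'L: "v' \<in> \<Lambda>" "v \<in> \<Lambda>"
    using v' v by (auto simp: prim_def)
  have "ordn (F v' z') = ordn (F v' (z + l))"
    by (rule ordn_cong[OF cong_sym[OF F_band[OF v'L(1) l(2)]]])
  also have "\<dots> = ordn (F v' z)"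
    by (simp add: F_shift[OF l(1)])
  also have "\<dots> = ordn (F v z)"
    using par ordn_cong[OF F_minus[OF v'L(2) v(2)]] ordn_minus by auto
  finally show "ordn (F v z) = ordn (F v' z')"
    by simp
qed

lemma maximal_cylinder_iff:
  "maximal_cylinder x \<alpha> C \<longleftrightarrow> (\<exists>v z s. prim v \<and> clear v z \<and> C = Cyl v z s)"
proof
  assume m: "maximal_cylinder x \<alpha> C"
  then obtain V where "cylinder_with_holonomy x \<alpha> C V"
    by (auto simp: maximal_cylinder_def cylinder_def)
  then obtain v z s where v: "prim v" "clear v z" "C \<subseteq> Cyl v z s"
    by (rule cylinder_subset_Cyl)
  then have "cylinder x \<alpha> (Cyl v z s)"
    using Cyl_cylinder cylinder_def by blast
  then have "Cyl v z s = C"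
    using m v(3) by (auto simp: maximal_cylinder_def)
  then show "\<exists>v z s. prim v \<and> clear v z \<and> C = Cyl v z s"
    using v by blast
next
  assume "\<exists>v z s. prim v \<and> clear v z \<and> C = Cyl v z s"
  then obtain v z s where v: "prim v" "clear v z" "C = Cyl v z s"
    by blast
  show "maximal_cylinder x \<alpha> C"
    unfolding maximal_cylinder_def
  proof (intro conjI allI impI)
    show "cylinder x \<alpha> C"
      using v Cyl_cylinder cylinder_def by blast
    fix C' assume C': "cylinder x \<alpha> C' \<and> C \<subseteq> C'"
    then obtain V where "cylinder_with_holonomy x \<alpha> C' V"
      by (auto simp: cylinder_def)
    then obtain v' z' s' where v': "prim v'" "clear v' z'" "C' \<subseteq> Cyl v' z' s'"
      by (rule cylinder_subset_Cyl)
    have "Cyl v z s = Cyl v' z' s'"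
      using C' v v' by (intro Cyl_subset(2)[OF v(1,2) v'(1,2)]) auto
    then show "C' = C"
      using C' v v' by auto
  qed
qed

lemma holonomy_length:
  assumes v: "prim v" "clear v z"
  shows "(THE l. \<exists>V. cylinder_with_holonomy x \<alpha> (Cyl v z s) V \<and> l = cmod V) = real (ordn (F v z)) * cmod v"
proof (rule the_equality)
  show "\<exists>V. cylinder_with_holonomy x \<alpha> (Cyl v z s) V \<and> real (ordn (F v z)) * cmod v = cmod V"
    using Cyl_cylinder[OF v] by (intro exI[of _ "of_int (int (ordn (F v z))) * v"]) (simp add: norm_mult)
  fix l assume "\<exists>V. cylinder_with_holonomy x \<alpha> (Cyl v z s) V \<and> l = cmod V"
  then obtain V where V: "cylinder_with_holonomy x \<alpha> (Cyl v z s) V" "l = cmod V"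
    by blast
  obtain v' z' s' where v': "prim v'" "clear v' z'" "Cyl v z s \<subseteq> Cyl v' z' s'" "V = of_int (int (ordn (F v' z'))) * v'"
    using cylinder_subset_Cyl[OF V(1)] by metis
  note sub = Cyl_subset[OF v v'(1,2,3)]
  have "cmod v' = cmod v"
    using sub(1) by auto
  then show "l = real (ordn (F v z)) * cmod v"
    using V(2) v'(4) sub(3) by (simp add: norm_mult)
qed

lemma sheets_over:
  assumes "z \<in> U"
  shows "{P \<in> cover x \<alpha>. fst P = pr z} = pt z ` {0..<int d}" "card (pt z ` {0..<int d}) = d"
proof -
  show "{P \<in> cover x \<alpha>. fst P = pr z} = pt z ` {0..<int d}"
  proof (intro equalityI subsetI)
    fix P assume "P \<in> {P \<in> cover x \<alpha>. fst P = pr z}"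
    then obtain w s where P: "P = pt w s" "w \<in> U" "pr w = pr z"
      by (auto simp: cover_eq)
    then have "P = pt z (s mod int d)"
      using pt_eq_iff[OF P(2)] by (simp add: pr_eq_iff cong_def)
    then show "P \<in> pt z ` {0..<int d}"
      using d_pos by auto
  qed (use assms in auto)
  have "inj_on (pt z) {0..<int d}"
    using pt_eq_iff[OF assms] by (auto simp: inj_on_def cong_def)
  then show "card (pt z ` {0..<int d}) = d"
    by (simp add: card_image)
qed

lemma Cyl_in_cover: "Cyl v z s \<subseteq> cover x \<alpha>"
  unfolding Cyl_def by (auto intro!: pt_in_cover subsetD[OF band_U] simp del: split_paired_All)

text \<open>The points over \<zeta> are reached from one of them by multiples of \<open>v\<close>,
  and \<open>Cyl_same_sheet\<close> says which of these coincide.\<close>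

lemma Cyl_sheets:
  assumes v: "prim v" "clear v z"
  shows "card {P \<in> Cyl v z s. fst P = pr \<zeta>} = (if \<exists>l\<in>\<Lambda>. \<zeta> + l \<in> band v z then ordn (F v z) else 0)"
proof (cases "\<exists>l\<in>\<Lambda>. \<zeta> + l \<in> band v z")
  case False
  have emp: "{P \<in> Cyl v z s. fst P = pr \<zeta>} = {}"
  proof (rule ccontr)
    assume "{P \<in> Cyl v z s. fst P = pr \<zeta>} \<noteq> {}"
    then obtain P where P: "P \<in> Cyl v z s" "fst P = pr \<zeta>"
      by blast
    then obtain w where w': "w \<in> band v z" "P = pt w (s + ml z w)"
      unfolding Cyl_def by blast
    then have w: "w \<in> band v z" "pr \<zeta> = pr w"
      using P by simp_all
    then have "w - \<zeta> \<in> \<Lambda>" "\<zeta> + (w - \<zeta>) \<in> band v z"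
      by (simp_all add: pr_eq_iff)
    then show False
      using False by blast
  qed
  show ?thesis
    unfolding emp using False by simp
next
  case True
  then obtain l where l: "l \<in> \<Lambda>" "\<zeta> + l \<in> band v z"
    by blast
  obtain v' where v': "v \<in> \<Lambda>" "v' \<in> \<Lambda>" "crs v v' = 1"
    using v by (auto simp: prim_def)
  let ?o = "int (ordn (F v z))"
  define w where "w j = \<zeta> + l + of_int j * v" for j
  have wb: "w j \<in> band v z" for j
    unfolding w_def by (rule band_height[OF l(2)]) (simp add: crs_linear)
  define P where "P j = pt (w j) (s + ml z (w j))" for j
  have Peq: "P i = P j \<longleftrightarrow> ?o dvd j - i" for i j
  proof -
    have "P i = P j \<longleftrightarrow> (\<exists>k::int. w j - w i = of_int (k * ?o) * v)"
      unfolding P_def by (rule Cyl_same_sheet[OF v wb wb])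
    also have "\<dots> \<longleftrightarrow> (\<exists>k::int. j - i = k * ?o)"
    proof -
      have "w j - w i = of_int (j - i) * v"
        by (simp add: w_def algebra_simps)
      then show ?thesis
        using prim_nonzero[OF v(1)] by (metis mult_cancel_right of_int_eq_iff)
    qed
    finally show ?thesis
      by (auto simp: dvd_def mult.commute)
  qed
  have "{P \<in> Cyl v z s. fst P = pr \<zeta>} = P ` {0..<?o}"
  proof (intro equalityI subsetI)
    fix Q assume "Q \<in> {P \<in> Cyl v z s. fst P = pr \<zeta>}"
    then have Q: "Q \<in> Cyl v z s" "fst Q = pr \<zeta>"
      by blast+
    then obtain u where u': "u \<in> band v z" "Q = pt u (s + ml z u)"
      unfolding Cyl_def by blast
    then have u: "u \<in> band v z" "Q = pt u (s + ml z u)" "pr u = pr \<zeta>"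
      using Q by simp_all
    have uL: "u - (\<zeta> + l) \<in> \<Lambda>"
      using u(3) l(1) pr_eq_iff[of \<zeta> u] lattice_diff[of "u - \<zeta>" l] by (simp add: algebra_simps)
    obtain lo hi where lohi: "hi \<le> lo + 1" "band v z = {w. lo < crs v w \<and> crs v w < hi}"
      using band_bounds[OF v] by metis
    obtain k where "crs v (u - (\<zeta> + l)) = of_int k"
      using crs_lattice_Ints[OF v'(1) uL] by (auto elim: Ints_cases)
    moreover have "\<bar>crs v (u - (\<zeta> + l))\<bar> < 1"
      using u(1) l(2) lohi by (auto simp: crs_linear)
    ultimately have "crs v (u - (\<zeta> + l)) = 0"
      by simp
    then obtain j where "u - (\<zeta> + l) = of_int j * v"
      using lattice_parallel[OF v' uL] by blast
    then have "u = w j"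
      by (simp add: w_def algebra_simps)
    then have "Q = P j"
      using u by (simp add: P_def)
    also have "P j = P (j mod ?o)"
      using Peq[of j "j mod ?o"] by (simp add: mod_eq_dvd_iff[symmetric])
    finally show "Q \<in> P ` {0..<?o}"
      using ordn_pos[of "F v z"] by auto
  next
    fix Q assume "Q \<in> P ` {0..<?o}"
    then obtain j where j: "Q = P j"
      by blast
    have "pr (w j) = pr \<zeta>"
      unfolding w_def using l(1) v'(1) by (simp add: pr_shift lattice_of_int)
    then show "Q \<in> {P \<in> Cyl v z s. fst P = pr \<zeta>}"
      using wb by (auto simp: j P_def Cyl_def)
  qed
  moreover have "inj_on P {0..<?o}"
  proof (rule inj_onI)
    fix i j assume ij: "i \<in> {0..<?o}" "j \<in> {0..<?o}" "P i = P j"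
    then have "j mod ?o = i mod ?o"
      unfolding Peq mod_eq_dvd_iff by simp
    then show "i = j"
      using ij(1,2) by (metis atLeastLessThan_iff mod_pos_pos_trivial)
  qed
  ultimately show ?thesis
    using True by (simp add: card_image)
qed

end

section \<open>The area of a parallelogram\<close>

definition cell :: "complex \<Rightarrow> complex \<Rightarrow> complex set" where
  "cell a b = {of_real s * a + of_real t * b | s t. 0 \<le> s \<and> s < 1 \<and> 0 \<le> t \<and> t < 1}"

lemma cell_iff:
  assumes "crs a b \<noteq> 0"
  shows "z \<in> cell a b \<longleftrightarrow> 0 \<le> crs z b / crs a b \<and> crs z b / crs a b < 1 \<and>
    0 \<le> crs a z / crs a b \<and> crs a z / crs a b < 1"
proof
  assume "z \<in> cell a b"
  then obtain s t where st: "z = of_real s * a + of_real t * b" "0 \<le> s" "s < 1" "0 \<le> t" "t < 1"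
    by (auto simp: cell_def)
  have "crs z b = s * crs a b" "crs a z = t * crs a b"
    by (simp_all add: st(1) crs_linear)
  then show "0 \<le> crs z b / crs a b \<and> crs z b / crs a b < 1 \<and> 0 \<le> crs a z / crs a b \<and> crs a z / crs a b < 1"
    using st assms by simp
next
  assume *: "0 \<le> crs z b / crs a b \<and> crs z b / crs a b < 1 \<and> 0 \<le> crs a z / crs a b \<and> crs a z / crs a b < 1"
  have "of_real (crs a b) * z = of_real (crs z b) * a + of_real (crs a z) * b"
    by (simp add: complex_eq_iff crs_alt algebra_simps)
  then have "z = of_real (crs z b / crs a b) * a + of_real (crs a z / crs a b) * b"
    using assms by (simp add: field_simps)
  then show "z \<in> cell a b"
    unfolding cell_def using * by blast
qed

lemma crs_measurable [measurable]:
  assumes [measurable]: "f \<in> borel_measurable M" "g \<in> borel_measurable M"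
  shows "(\<lambda>x. crs (f x) (g x)) \<in> borel_measurable M"
  unfolding crs_alt by measurable

lemma cell_borel:
  assumes "crs a b \<noteq> 0"
  shows "cell a b \<in> sets borel"
proof -
  have "cell a b = {z \<in> space borel. 0 \<le> crs z b / crs a b \<and> crs z b / crs a b < 1 \<and>
    0 \<le> crs a z / crs a b \<and> crs a z / crs a b < 1}"
    using cell_iff[OF assms] by auto
  then show ?thesis
    by simp
qed

text \<open>The parallelogram is the image of the unit square under a linear map of determinant
  \<open>crs a b\<close>. The map \<iota> carries the Lebesgue measure of \<open>real ^ 2\<close> to
  that of the complex numbers, since the two agree on boxes.\<close>

lemma emeasure_cell:
  assumes "crs a b \<noteq> 0"
  shows "emeasure lborel (cell a b) = ennreal \<bar>crs a b\<bar>"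
proof -
  define \<iota> where "\<iota> v = Complex (v $ 1) (v $ 2)" for v :: "real ^ 2"
  have \<iota>m: "\<iota> \<in> borel_measurable borel"
    unfolding \<iota>_def by (intro borel_measurable_continuous_onI continuous_on_Complex continuous_intros)
  have dist: "(lborel :: complex measure) = distr lborel borel \<iota>"
  proof (rule lborel_eqI)
    fix l u :: complex
    assume le: "\<And>b. b \<in> Basis \<Longrightarrow> l \<bullet> b \<le> u \<bullet> b"
    have pre: "\<iota> -` box l u = box (vector [Re l, Im l]) (vector [Re u, Im u])"
      by (auto simp: \<iota>_def box_def Basis_complex_def inner_complex_def Basis_vec_def inner_axis axis_eq_axis UNIV_2)
    have "emeasure (distr lborel borel \<iota>) (box l u) = emeasure lborel (box (vector [Re l, Im l] :: real ^ 2) (vector [Re u, Im u]))"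
      using \<iota>m by (subst emeasure_distr) (auto simp: pre)
    also have "\<dots> = (\<Prod>b\<in>Basis. (vector [Re u, Im u] - vector [Re l, Im l] :: real ^ 2) \<bullet> b)"
      using le[of 1] le[of "\<i>"] by (intro emeasure_lborel_box) (auto simp: Basis_complex_def inner_complex_def Basis_vec_def inner_axis UNIV_2)
    also have "\<dots> = (\<Prod>b\<in>Basis. (u - l) \<bullet> b)"
    proof -
      have B: "(Basis :: (real ^ 2) set) = {axis 1 1, axis 2 1}"
        by (auto simp: Basis_vec_def UNIV_2)
      have "axis 1 1 \<noteq> (axis 2 1 :: real ^ 2)"
        by (simp add: axis_eq_axis)
      then show ?thesis
        by (simp add: B Basis_complex_def inner_axis inner_complex_def)
    qed
    finally show "emeasure (distr lborel borel \<iota>) (box l u) = (\<Prod>b\<in>Basis. (u - l) \<bullet> b)" .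
  qed simp
  define f :: "real ^ 2 \<Rightarrow> real ^ 2" where "f v = (\<chi> i. if i = 1 then v $ 1 * Re a + v $ 2 * Re b else v $ 1 * Im a + v $ 2 * Im b)" for v
  define Q :: "(real ^ 2) set" where "Q = {v. 0 \<le> v $ 1 \<and> v $ 1 < 1 \<and> 0 \<le> v $ 2 \<and> v $ 2 < 1}"
  have lin: "linear f"
    by (auto simp: f_def linear_iff vec_eq_iff algebra_simps)
  have one: "(1 :: real ^ 2) = vector [1, 1]"
    by (simp add: vec_eq_iff forall_2)
  have Qs: "box 0 1 \<subseteq> Q" "Q \<subseteq> cbox 0 1"
    by (auto simp: Q_def mem_box_cart forall_2 less_imp_le)
  have Qb: "Q \<in> sets borel"
    unfolding Q_def by measurable
  have cont: "measure lborel (cbox (0::real^2) 1) = 1"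
    by (subst content_cbox_cart) (auto simp: interval_ne_empty_cart UNIV_2)
  have c1: "emeasure lborel (cbox (0::real^2) 1) = 1" "emeasure lborel (box (0::real^2) 1) = 1"
    using cont emeasure_lborel_cbox_finite[of 0 "1::real^2"] emeasure_lborel_box_finite[of 0 "1::real^2"]
      measure_lborel_box_eq[of 0 "1::real^2"] measure_lborel_cbox_eq[of 0 "1::real^2"]
    by (auto simp: emeasure_eq_ennreal_measure less_top split: if_splits)
  have Q1: "emeasure lborel Q = 1"
    using emeasure_mono[OF Qs(1), of lborel] emeasure_mono[OF Qs(2), of lborel] Qb c1 by (auto intro!: antisym)
  have Ql: "Q \<in> lmeasurable" "measure lebesgue Q = 1"
    using Q1 Qb by (auto simp: fmeasurable_def measure_def)
  have "det (matrix f) = crs a b"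
    by (simp add: det_2 matrix_def f_def axis_def crs_alt)
  then have fQ: "measure lebesgue (f ` Q) = \<bar>crs a b\<bar>" "f ` Q \<in> lmeasurable"
    using measure_linear_image[OF lin Ql(1)] measurable_linear_image[OF lin Ql(1)] Ql(2) by auto
  have pre: "\<iota> -` cell a b = f ` Q"
  proof (intro equalityI subsetI)
    fix w assume "w \<in> \<iota> -` cell a b"
    then obtain s t where st: "\<iota> w = of_real s * a + of_real t * b" "0 \<le> s" "s < 1" "0 \<le> t" "t < 1"
      by (auto simp: cell_def)
    have "w = f (vector [s, t])"
      using st(1) by (simp add: vec_eq_iff forall_2 f_def \<iota>_def complex_eq_iff)
    moreover have "vector [s, t] \<in> Q"
      using st by (simp add: Q_def)
    ultimately show "w \<in> f ` Q"
      by blast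
  next
    fix w assume "w \<in> f ` Q"
    then obtain v where v: "v \<in> Q" "w = f v"
      by blast
    have "\<iota> w = of_real (v $ 1) * a + of_real (v $ 2) * b"
      by (simp add: v f_def \<iota>_def complex_eq_iff)
    then show "w \<in> \<iota> -` cell a b"
      using v(1) unfolding cell_def Q_def by blast
  qed
  have "emeasure lborel (cell a b) = emeasure lborel (\<iota> -` cell a b)"
    using \<iota>m cell_borel[OF assms] by (subst dist, subst emeasure_distr) auto
  also have "\<dots> = emeasure lebesgue (f ` Q)"
    using pre measurable_sets[OF \<iota>m cell_borel[OF assms]] by simp
  also have "\<dots> = ennreal \<bar>crs a b\<bar>"
    using fQ by (simp add: emeasure_eq_measure2)
  finally show ?thesis .
qed

lemma fundamental_domain_cell: "fundamental_domain x = cell (per1 x) (per2 x)"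
  by (simp add: fundamental_domain_def cell_def)

section \<open>The area of the cylinders of bounded circumference\<close>

context torus_cover
begin

abbreviation "fd \<equiv> fundamental_domain x"

lemma fd_measure: "fd \<in> sets borel" "emeasure lborel fd = 1" "measure lborel fd = 1"
proof -
  show "fd \<in> sets borel" "emeasure lborel fd = 1"
    unfolding fundamental_domain_cell using cell_borel emeasure_cell area_1 by auto
  then show "measure lborel fd = 1"
    by (simp add: measure_def)
qed

definition generic_pt :: "complex \<Rightarrow> bool" where
  "generic_pt \<zeta> \<longleftrightarrow> (\<forall>v. prim v \<longrightarrow> clear v \<zeta>)"

lemma AE_generic: "AE \<zeta> in lborel. generic_pt \<zeta>"
proof -
  have "negligible (\<Union>(v, p)\<in>{v. prim v} \<times> punct. {w. (\<i> * v) \<bullet> w = crs v p})"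
  proof (rule negligible_countable_Union)
    have "countable {v. prim v}"
      by (rule countable_subset[OF _ lattice_countable]) (auto simp: prim_def)
    then show "countable ((\<lambda>(v, p). {w. (\<i> * v) \<bullet> w = crs v p}) ` ({v. prim v} \<times> punct))"
      using punct_countable by auto
    fix T assume "T \<in> (\<lambda>(v, p). {w. (\<i> * v) \<bullet> w = crs v p}) ` ({v. prim v} \<times> punct)"
    then obtain v p where "prim v" "T = {w. (\<i> * v) \<bullet> w = crs v p}"
      by auto
    then show "negligible T"
      using negligible_hyperplane[of "\<i> * v" "crs v p"] prim_nonzero by auto
  qed
  then have "(\<Union>(v, p)\<in>{v. prim v} \<times> punct. {w. (\<i> * v) \<bullet> w = crs v p}) \<in> null_sets lebesgue"
    by (simp add: negligible_iff_null_sets)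
  from AE_not_in[OF this] have "AE \<zeta> in lebesgue. generic_pt \<zeta>"
    by eventually_elim (auto simp: generic_pt_def clear_def crs_inner[symmetric])
  then show ?thesis
    by (simp add: AE_completion_iff)
qed

lemma generic_U: "generic_pt \<zeta> \<Longrightarrow> \<zeta> \<in> U"
  using basis_prim(1)[OF per_in_lattice area_1] band_refl subsetD[OF band_U] unfolding generic_pt_def by blast

lemma cover_area_cover: "cover_area x (cover x \<alpha>) = real d"
proof -
  have [measurable]: "U \<in> sets borel"
    using open_U by simp
  have eq: "real (card {P \<in> cover x \<alpha>. fst P = pr z}) = real d * indicator U z" for z
  proof (cases "z \<in> U")
    case True
    then show ?thesis
      using sheets_over[OF True] by simp
  next
    case False
    have "fst P \<noteq> pr z" if P: "P \<in> cover x \<alpha>" for P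
    proof -
      obtain w s where "P = pt w s" "w \<in> U"
        using P unfolding cover_eq by blast
      then show ?thesis
        using False pr_in_X by (metis fst_pt)
    qed
    then have emp: "{P \<in> cover x \<alpha>. fst P = pr z} = {}"
      by blast
    show ?thesis
      unfolding emp using False by simp
  qed
  have "cover_area x (cover x \<alpha>) = (LINT z:fd|lborel. real d)"
    unfolding cover_area_def set_lebesgue_integral_def eq
  proof (rule integral_cong_AE)
    show "AE z in lborel. indicat_real fd z *\<^sub>R (real d * indicator U z) = indicat_real fd z *\<^sub>R real d"
      using AE_generic by eventually_elim (simp add: generic_U)
  qed (use fd_measure in \<open>auto intro!: borel_measurable_times borel_measurable_scaleR\<close>)
  also have "\<dots> = real d"
    using fd_measure by (simp add: set_lebesgue_integral_def)
  finally show ?thesis .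
qed

lemma circumference_Cyl:
  "prim v \<Longrightarrow> clear v z \<Longrightarrow> circumference x \<alpha> (Cyl v z s) = real (ordn (F v z)) * cmod v / sqrt (real d)"
  by (simp add: circumference_def holonomy_length cover_area_cover)

definition short_cyls :: "real \<Rightarrow> cover_pt set set" where
  "short_cyls R = {Cyl v z s | v z s. prim v \<and> clear v z \<and> real (ordn (F v z)) * cmod v < R}"

section \<open>Double count of the cylinders over a point\<close>

lemma short_prims_finite: "finite {v. prim v \<and> cmod v < R}"
  by (rule finite_subset[OF _ lattice_finite_bounded[of "ball 0 R"]]) (auto simp: prim_def)

text \<open>A lattice translation brings the strip to a height between 1 and 2. There it is
  characterised by the set of punctured heights in \<open>[0, 3]\<close> below it, for which there
  are finitely many choices.\<close>

lemma short_cyls_finite: "finite (short_cyls R)"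
proof -
  define H where "H v = crs v ` punct \<inter> {0..3}" for v
  define rep where "rep v A = (SOME z. clear v z \<and> 1 \<le> crs v z \<and> crs v z < 2 \<and> {h \<in> H v. h < crs v z} = A)" for v A
  have fin: "finite (H v)" if "prim v" for v
    using that heights_finite[of v] by (auto simp: prim_def H_def)
  have "short_cyls R \<subseteq> (\<Union>v\<in>{v. prim v \<and> cmod v < R}. (\<lambda>(A, s). Cyl v (rep v A) s) ` (Pow (H v) \<times> {0..<int d}))"
  proof
    fix C assume "C \<in> short_cyls R"
    then obtain v z s where v: "prim v" "clear v z" "real (ordn (F v z)) * cmod v < R" "C = Cyl v z s"
      by (auto simp: short_cyls_def)
    have "cmod v \<le> real (ordn (F v z)) * cmod v"
      using ordn_pos[of "F v z"] mult_right_mono[of 1 "real (ordn (F v z))" "cmod v"] by simp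
    then have vR: "cmod v < R"
      using v(3) by simp
    obtain v' where v': "v \<in> \<Lambda>" "v' \<in> \<Lambda>" "crs v v' = 1"
      using v by (auto simp: prim_def)
    define z' where "z' = z + of_int (1 - \<lfloor>crs v z\<rfloor>) * v'"
    have z': "clear v z'" "1 \<le> crs v z'" "crs v z' < 2"
    proof -
      show "clear v z'"
        unfolding z'_def using clear_shift[OF lattice_of_int[OF v'(2)]] v(2) by blast
      have "crs v z' = crs v z + of_int (1 - \<lfloor>crs v z\<rfloor>)"
        unfolding z'_def crs_linear crs_of_int v'(3) by simp
      then show "1 \<le> crs v z'" "crs v z' < 2"
        by linarith+
    qed
    have Cz': "C = Cyl v z' s"
      unfolding v(4) z'_def by (rule Cyl_shift[OF lattice_of_int[OF v'(2)], symmetric])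
    define A where "A = {h \<in> H v. h < crs v z'}"
    define r where "r = rep v A"
    have r: "clear v r \<and> 1 \<le> crs v r \<and> crs v r < 2 \<and> {h \<in> H v. h < crs v r} = A"
      unfolding r_def rep_def by (rule someI[of _ z']) (use z' A_def in auto)
    have z'b: "z' \<in> band v r"
      unfolding band_def
    proof (intro CollectI ballI notI)
      fix p assume p: "p \<in> punct" "crs v p \<in> closed_segment (crs v r) (crs v z')"
      then have "crs v p \<in> H v"
        using r z' by (auto simp: H_def closed_segment_eq_real_ivl split: if_splits)
      then have "crs v p < crs v r \<longleftrightarrow> crs v p < crs v z'"
        using r unfolding A_def by blast
      moreover have "crs v p \<noteq> crs v r" "crs v p \<noteq> crs v z'"
        using p(1) r z'(1) by (auto simp: clear_def)
      ultimately show False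
        using p(2) by (auto simp: closed_segment_eq_real_ivl split: if_splits)
    qed
    have "C = Cyl v r (s - ml r z')"
      using Cyl_move[OF z'b, of "s - ml r z'"] Cz' by simp
    also have "\<dots> = Cyl v r ((s - ml r z') mod int d)"
      by (rule Cyl_cong) (simp add: cong_def)
    finally have "C = (\<lambda>(A, s). Cyl v (rep v A) s) (A, (s - ml r z') mod int d)"
      by (simp add: r_def)
    moreover have "(A, (s - ml r z') mod int d) \<in> Pow (H v) \<times> {0..<int d}"
      using d_pos by (auto simp: A_def)
    ultimately show "C \<in> (\<Union>v\<in>{v. prim v \<and> cmod v < R}. (\<lambda>(A, s). Cyl v (rep v A) s) ` (Pow (H v) \<times> {0..<int d}))"
      using v(1) vR by blast
  qed
  moreover have "finite (\<Union>v\<in>{v. prim v \<and> cmod v < R}. (\<lambda>(A, s). Cyl v (rep v A) s) ` (Pow (H v) \<times> {0..<int d}))"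
    using fin short_prims_finite by auto
  ultimately show ?thesis
    by (rule finite_subset)
qed

text \<open>Pairs of a point over \<zeta> and a short cylinder through it are counted in two ways.
  Through each of the \<open>d\<close> points there is one cylinder for every pair \<open>v\<close>,
  \<open>- v\<close>, whence the factor \<open>d / 2\<close>.\<close>

lemma short_cyls_count:
  assumes \<zeta>: "generic_pt \<zeta>"
  shows "(\<Sum>C\<in>short_cyls R. real (card {P \<in> C. fst P = pr \<zeta>})) =
    real d / 2 * real (card {v. prim v \<and> real (ordn (F v \<zeta>)) * cmod v < R})"
proof -
  define W where "W = {v. prim v \<and> real (ordn (F v \<zeta>)) * cmod v < R}"
  have cl: "clear v \<zeta>" if "prim v" for v
    using \<zeta> that by (simp add: generic_pt_def)
  have \<zeta>U: "\<zeta> \<in> U"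
    by (rule generic_U[OF \<zeta>])
  have "W \<subseteq> {v. prim v \<and> cmod v < R}"
  proof
    fix v assume v: "v \<in> W"
    have "cmod v \<le> real (ordn (F v \<zeta>)) * cmod v"
      using ordn_pos[of "F v \<zeta>"] mult_right_mono[of 1 "real (ordn (F v \<zeta>))" "cmod v"] by simp
    then show "v \<in> {v. prim v \<and> cmod v < R}"
      using v by (auto simp: W_def)
  qed
  then have finW: "finite W"
    using short_prims_finite finite_subset by blast
  have Wneg: "- v \<in> W" if "v \<in> W" for v
  proof -
    have "ordn (F (- v) \<zeta>) = ordn (F v \<zeta>)"
      using that cl ordn_cong[OF F_minus[of v \<zeta>]] ordn_minus by (auto simp: W_def prim_def)
    then show ?thesis
      using that prim_minus by (simp add: W_def)
  qed
  let ?T = "pt \<zeta> ` {0..<int d}"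
  have through: "{C \<in> short_cyls R. pt \<zeta> s \<in> C} = (\<lambda>v. Cyl v \<zeta> s) ` W" for s
  proof (intro equalityI subsetI)
    fix C assume "C \<in> {C \<in> short_cyls R. pt \<zeta> s \<in> C}"
    then obtain v z t where v: "prim v" "clear v z" "real (ordn (F v z)) * cmod v < R" "C = Cyl v z t" "pt \<zeta> s \<in> Cyl v z t"
      by (auto simp: short_cyls_def)
    have eq: "Cyl v \<zeta> s = Cyl v z t"
      by (rule Cyl_determined(1)[OF v(5) \<zeta>U])
    have "ordn (F v \<zeta>) = ordn (F v z)"
      by (rule Cyl_subset(3)[OF v(1) cl[OF v(1)] v(1,2)]) (use eq in auto)
    then show "C \<in> (\<lambda>v. Cyl v \<zeta> s) ` W"
      using v eq by (auto simp: W_def)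
  next
    fix C assume "C \<in> (\<lambda>v. Cyl v \<zeta> s) ` W"
    then show "C \<in> {C \<in> short_cyls R. pt \<zeta> s \<in> C}"
      using cl pt_in_Cyl by (auto simp: short_cyls_def W_def)
  qed
  have card2: "2 * card ((\<lambda>v. Cyl v \<zeta> s) ` W) = card W" for s
  proof -
    have "card {v \<in> W. Cyl v \<zeta> s = C} = 2" if C: "C \<in> (\<lambda>v. Cyl v \<zeta> s) ` W" for C
    proof -
      obtain v where v: "v \<in> W" "C = Cyl v \<zeta> s"
        using C by blast
      have "{v \<in> W. Cyl v \<zeta> s = C} = {v, - v}"
      proof (intro equalityI subsetI)
        fix u assume u: "u \<in> {v \<in> W. Cyl v \<zeta> s = C}"
        have "u = v \<or> u = - v"
          using u v cl by (intro Cyl_subset(1)[of v \<zeta> u \<zeta> s s]) (auto simp: W_def)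
        then show "u \<in> {v, - v}"
          by blast
      qed (use v Wneg Cyl_minus in auto)
      moreover have "v \<noteq> - v"
        using v prim_nonzero by (auto simp: W_def)
      ultimately show ?thesis
        by simp
    qed
    then have "(\<Sum>C\<in>(\<lambda>v. Cyl v \<zeta> s) ` W. card {v \<in> W. Cyl v \<zeta> s = C}) = (\<Sum>C\<in>(\<lambda>v. Cyl v \<zeta> s) ` W. 2)"
      by (intro sum.cong) auto
    moreover have "card W = (\<Sum>C\<in>(\<lambda>v. Cyl v \<zeta> s) ` W. card {v \<in> W. Cyl v \<zeta> s = C})"
      using sum.image_gen[OF finW, of "\<lambda>_. 1::nat" "\<lambda>v. Cyl v \<zeta> s"] by simp
    ultimately show ?thesis
      by simp
  qed
  have "(\<Sum>C\<in>short_cyls R. card {P \<in> C. fst P = pr \<zeta>}) = (\<Sum>C\<in>short_cyls R. \<Sum>P\<in>?T. if P \<in> C then 1 else 0)"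
  proof (intro sum.cong refl)
    fix C assume C: "C \<in> short_cyls R"
    then have "C \<subseteq> cover x \<alpha>"
      using Cyl_in_cover by (auto simp: short_cyls_def simp del: split_paired_All)
    then have "{P \<in> C. fst P = pr \<zeta>} = {P \<in> ?T. P \<in> C}"
      unfolding sheets_over(1)[OF \<zeta>U, symmetric] by blast
    then show "card {P \<in> C. fst P = pr \<zeta>} = (\<Sum>P\<in>?T. if P \<in> C then 1 else 0)"
      by (simp add: sum.If_cases Int_def)
  qed
  also have "\<dots> = (\<Sum>P\<in>?T. \<Sum>C\<in>short_cyls R. if P \<in> C then 1 else 0)"
    by (rule sum.swap)
  also have "\<dots> = (\<Sum>P\<in>?T. card {C \<in> short_cyls R. P \<in> C})"
    using short_cyls_finite by (simp add: sum.If_cases Int_def)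
  finally have "2 * (\<Sum>C\<in>short_cyls R. card {P \<in> C. fst P = pr \<zeta>}) = (\<Sum>P\<in>?T. 2 * card {C \<in> short_cyls R. P \<in> C})"
    by (simp add: sum_distrib_left)
  also have "\<dots> = (\<Sum>P\<in>?T. card W)"
    using through card2 by (intro sum.cong) auto
  also have "\<dots> = d * card W"
    using sheets_over(2)[OF \<zeta>U] by simp
  finally have "real (2 * (\<Sum>C\<in>short_cyls R. card {P \<in> C. fst P = pr \<zeta>})) = real (d * card W)"
    by simp
  then show ?thesis
    by (simp add: W_def)
qed

text \<open>The monodromy is replaced by its formula, which is measurable in \<zeta>; for coprime
  \<open>p\<close>, \<open>q\<close> the two have the same order at generic points.\<close>

definition good_set :: "real \<Rightarrow> int \<Rightarrow> int \<Rightarrow> complex set" where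
  "good_set R p q = {\<zeta>. real (ordn (p * gA + q * gB - heights (vec p q) \<zeta>)) * cmod (vec p q) < R}"

lemma vec_inj: "vec p q = vec r s \<longleftrightarrow> p = r \<and> q = s"
proof
  assume *: "vec p q = vec r s"
  have "crs (vec p q) (per2 x) = of_int p" "crs (per1 x) (vec p q) = of_int q"
    "crs (vec r s) (per2 x) = of_int r" "crs (per1 x) (vec r s) = of_int s"
    using area_1 by (simp_all add: crs_linear)
  then show "p = r \<and> q = s"
    using * by (metis of_int_eq_iff)
qed auto

lemma good_set_measurable [measurable]: "good_set R p q \<in> sets borel"
proof -
  have [measurable]: "heights (vec p q) \<in> measurable borel (count_space UNIV)"
  proof -
    have [measurable]: "(\<lambda>\<zeta>. real_of_int (heights (vec p q) \<zeta>)) \<in> borel_measurable borel"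
      unfolding heights_def of_int_sum of_int_mult by measurable
    have "{\<zeta> \<in> space borel. real_of_int (heights (vec p q) \<zeta>) = real_of_int k} \<in> sets borel" for k
      by measurable
    moreover have "heights (vec p q) -` {k} = {\<zeta> \<in> space borel. real_of_int (heights (vec p q) \<zeta>) = real_of_int k}" for k
      by auto
    ultimately have "heights (vec p q) -` {k} \<in> sets borel" for k
      by simp
    then show ?thesis
      by (simp add: measurable_count_space_eq2_countable)
  qed
  have "good_set R p q = {\<zeta> \<in> space borel. real (ordn (p * gA + q * gB - heights (vec p q) \<zeta>)) * cmod (vec p q) < R}"
    by (auto simp: good_set_def)
  then show ?thesis
    by simp
qed

text \<open>Integrating the double count over the fundamental domain gives the areas. Division by
  the area \<open>d\<close> of the cover turns \<open>d / 2\<close> into 1 / 2, and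
  \<open>R = L * sqrt (real d)\<close> undoes the normalisation of the circumference.\<close>

theorem cylinder_area_sum_eq:
  assumes R: "R = L * sqrt (real d)"
  shows "cylinder_area_sum x \<alpha> L =
    1 / 2 * (\<Sum>(p, q) | coprime p q \<and> cmod (vec p q) < R. measure lborel (fd \<inter> good_set R p q))"
proof -
  have sd: "sqrt (real d) > 0"
    using d_pos by simp
  have S: "{C. maximal_cylinder x \<alpha> C \<and> circumference x \<alpha> C < L} = short_cyls R"
    unfolding maximal_cylinder_iff short_cyls_def R
    using circumference_Cyl sd by (auto simp: pos_divide_less_eq simp del: split_paired_Ex split_paired_All) (metis pos_divide_less_eq sd)+
  define K where "K = {(p, q). coprime p q \<and> cmod (vec p q) < R}"
  have K_img: "(\<lambda>(p, q). vec p q) ` K = {v. prim v \<and> cmod v < R}"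
    by (auto simp: K_def prim_iff)
  have injK: "inj_on (\<lambda>(p, q). vec p q) K"
    using vec_inj by (auto simp: inj_on_def)
  have finK: "finite K"
    using finite_imageD[OF _ injK] short_prims_finite K_img by simp
  have meas: "(\<lambda>z. real (card {P \<in> C. fst P = pr z})) \<in> borel_measurable lborel \<and> (\<forall>z. card {P \<in> C. fst P = pr z} \<le> d)"
    if C: "C \<in> short_cyls R" for C
  proof -
    obtain v z s where v: "prim v" "clear v z" "C = Cyl v z s"
      using C by (auto simp: short_cyls_def)
    obtain lo hi where lohi: "band v z = {w. lo < crs v w \<and> crs v w < hi}"
      using band_bounds[OF v(1,2)] by metis
    have "{\<zeta>. \<exists>l\<in>\<Lambda>. \<zeta> + l \<in> band v z} = (\<Union>l\<in>\<Lambda>. {\<zeta> \<in> space borel. lo < crs v (\<zeta> + l) \<and> crs v (\<zeta> + l) < hi})"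
      by (auto simp: lohi)
    also have "\<dots> \<in> sets borel"
      using lattice_countable by (intro sets.countable_UN'') measurable
    finally have [measurable]: "{\<zeta>. \<exists>l\<in>\<Lambda>. \<zeta> + l \<in> band v z} \<in> sets borel" .
    have eq: "real (card {P \<in> C. fst P = pr \<zeta>}) = real (ordn (F v z)) * indicator {\<zeta>. \<exists>l\<in>\<Lambda>. \<zeta> + l \<in> band v z} \<zeta>" for \<zeta>
      using Cyl_sheets[OF v(1,2)] by (simp add: v(3) indicator_def)
    have "(\<lambda>\<zeta>. real (card {P \<in> C. fst P = pr \<zeta>})) \<in> borel_measurable lborel"
      unfolding eq by measurable
    moreover have "card {P \<in> C. fst P = pr \<zeta>} \<le> d" for \<zeta>
      using Cyl_sheets[OF v(1,2), of s \<zeta>] ordn_le[of "F v z"] by (simp add: v(3))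
    ultimately show ?thesis
      by blast
  qed
  have int: "integrable lborel (\<lambda>z. indicat_real fd z *\<^sub>R real (card {P \<in> C. fst P = pr z}))" if "C \<in> short_cyls R" for C
  proof (rule integrableI_bounded_set[where A = fd and B = "real d"])
    show "(\<lambda>z. indicat_real fd z *\<^sub>R real (card {P \<in> C. fst P = pr z})) \<in> borel_measurable lborel"
      using meas[OF that] fd_measure(1) by auto
    show "AE z in lborel. z \<in> fd \<longrightarrow> norm (indicat_real fd z *\<^sub>R real (card {P \<in> C. fst P = pr z})) \<le> real d"
      using meas[OF that] by auto
  qed (use fd_measure in auto)
  have "cylinder_area_sum x \<alpha> L = (\<Sum>C\<in>short_cyls R. cover_area x C) / real d"
    unfolding cylinder_area_sum_def S cover_area_cover by (simp add: sum_divide_distrib)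
  also have "(\<Sum>C\<in>short_cyls R. cover_area x C) = (LINT z|lborel. (\<Sum>C\<in>short_cyls R. indicat_real fd z *\<^sub>R real (card {P \<in> C. fst P = pr z})))"
    unfolding cover_area_def set_lebesgue_integral_def using int by (intro Bochner_Integration.integral_sum[symmetric]) auto
  also have "\<dots> = (LINT z|lborel. (\<Sum>(p, q)\<in>K. real d / 2 * indicat_real (fd \<inter> good_set R p q) z))"
  proof (rule integral_cong_AE)
    show "(\<lambda>z. \<Sum>C\<in>short_cyls R. indicat_real fd z *\<^sub>R real (card {P \<in> C. fst P = pr z})) \<in> borel_measurable lborel"
      using int by (intro borel_measurable_sum) auto
    show "(\<lambda>z. \<Sum>(p, q)\<in>K. real d / 2 * indicat_real (fd \<inter> good_set R p q) z) \<in> borel_measurable lborel"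
      using fd_measure(1) by (intro borel_measurable_sum) (auto split: prod.splits)
    show "AE z in lborel. (\<Sum>C\<in>short_cyls R. indicat_real fd z *\<^sub>R real (card {P \<in> C. fst P = pr z})) =
        (\<Sum>(p, q)\<in>K. real d / 2 * indicat_real (fd \<inter> good_set R p q) z)"
      using AE_generic
    proof eventually_elim
      case (elim z)
      let ?W = "{v. prim v \<and> real (ordn (F v z)) * cmod v < R}"
      have ord: "ordn (F (vec p q) z) = ordn (p * gA + q * gB - heights (vec p q) z)" if "coprime p q" for p q
        using monodromy_formula[OF that, of z] elim prim_vec[OF that] by (intro ordn_cong) (auto simp: generic_pt_def)
      have short: "cmod v < R" if "real (ordn f) * cmod v < R" for f v
        using that ordn_pos[of f] mult_right_mono[of 1 "real (ordn f)" "cmod v"] by simp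
      have "?W = (\<lambda>(p, q). vec p q) ` {(p, q) \<in> K. z \<in> good_set R p q}"
        using ord short by (auto simp: K_def good_set_def prim_iff image_iff)
      then have "card ?W = card {(p, q) \<in> K. z \<in> good_set R p q}"
        by (simp only:) (rule card_image, rule inj_on_subset[OF injK], auto)
      also have "\<dots> = (\<Sum>(p, q)\<in>K. if z \<in> good_set R p q then 1 else 0)"
        using finK by (simp add: sum.If_cases case_prod_unfold Int_def conj_commute)
      finally have cW: "real (card ?W) = (\<Sum>(p, q)\<in>K. if z \<in> good_set R p q then 1 else 0)"
        by (auto simp: case_prod_unfold intro!: sum.cong)
      show ?case
      proof (cases "z \<in> fd")
        case True
        then show ?thesis
          using short_cyls_count[OF elim, of R] cW
          by (simp add: sum_distrib_left case_prod_unfold indicator_def of_bool_def)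
      qed (simp add: case_prod_unfold)
    qed
  qed
  also have "\<dots> = (\<Sum>(p, q)\<in>K. real d / 2 * measure lborel (fd \<inter> good_set R p q))"
  proof -
    have "integrable lborel (\<lambda>z. real d / 2 * indicat_real (fd \<inter> good_set R p q) z)" for p q
      using fd_measure emeasure_mono[of "fd \<inter> good_set R p q" fd lborel]
      by (intro integrable_mult_right integrable_real_indicator) (auto simp: less_top[symmetric] top_unique)
    then show ?thesis
      by (subst Bochner_Integration.integral_sum) (auto simp: case_prod_unfold)
  qed
  finally show ?thesis
    using d_pos by (simp add: K_def sum_divide_distrib sum_distrib_left case_prod_unfold)
qed

end

section \<open>Counting lattice points\<close>

lemma cell_norm: "z \<in> cell a b \<Longrightarrow> norm z \<le> norm a + norm b"
proof -
  assume "z \<in> cell a b"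
  then obtain s t where st: "z = of_real s * a + of_real t * b" "0 \<le> s" "s < 1" "0 \<le> t" "t < 1"
    by (auto simp: cell_def)
  have "norm z \<le> \<bar>s\<bar> * norm a + \<bar>t\<bar> * norm b"
    unfolding st(1) by (rule order_trans[OF norm_triangle_ineq]) (simp add: norm_mult)
  also have "\<dots> \<le> 1 * norm a + 1 * norm b"
    using st by (intro add_mono mult_right_mono) auto
  finally show ?thesis by simp
qed

lemma cell_tiles:
  assumes "crs a b > 0"
  shows "\<exists>!mn. z - (of_int (fst mn) * a + of_int (snd mn) * b) \<in> cell a b"
proof (rule ex1I[of _ "(\<lfloor>crs z b / crs a b\<rfloor>, \<lfloor>crs a z / crs a b\<rfloor>)"])
  have co: "crs (z - (of_int m * a + of_int n * b)) b / crs a b = crs z b / crs a b - of_int m"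
    "crs a (z - (of_int m * a + of_int n * b)) / crs a b = crs a z / crs a b - of_int n" for m n
  proof -
    have "crs (z - (of_int m * a + of_int n * b)) b = crs z b - of_int m * crs a b"
      "crs a (z - (of_int m * a + of_int n * b)) = crs a z - of_int n * crs a b"
      by (simp_all add: crs_linear)
    then show "crs (z - (of_int m * a + of_int n * b)) b / crs a b = crs z b / crs a b - of_int m"
      "crs a (z - (of_int m * a + of_int n * b)) / crs a b = crs a z / crs a b - of_int n"
      using assms by (simp_all add: diff_divide_distrib)
  qed
  show "z - (of_int (fst (\<lfloor>crs z b / crs a b\<rfloor>, \<lfloor>crs a z / crs a b\<rfloor>)) * a + of_int (snd (\<lfloor>crs z b / crs a b\<rfloor>, \<lfloor>crs a z / crs a b\<rfloor>)) * b) \<in> cell a b"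
    using assms by (subst cell_iff) (simp, simp only: co fst_conv snd_conv, linarith)
  fix mn assume "z - (of_int (fst mn) * a + of_int (snd mn) * b) \<in> cell a b"
  then have "0 \<le> crs z b / crs a b - of_int (fst mn)" "crs z b / crs a b - of_int (fst mn) < 1"
    "0 \<le> crs a z / crs a b - of_int (snd mn)" "crs a z / crs a b - of_int (snd mn) < 1"
    using assms by (subst (asm) cell_iff, simp, simp only: co)+
  then have "fst mn = \<lfloor>crs z b / crs a b\<rfloor>" "snd mn = \<lfloor>crs a z / crs a b\<rfloor>"
    by linarith+
  then show "mn = (\<lfloor>crs z b / crs a b\<rfloor>, \<lfloor>crs a z / crs a b\<rfloor>)"
    by (simp add: prod_eq_iff)
qed

lemma emeasure_ball_complex: "r \<ge> 0 \<Longrightarrow> emeasure lborel (ball (z::complex) r) = ennreal (pi * r\<^sup>2)"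
  by (simp add: emeasure_ball unit_ball_vol_2)

text \<open>The translates of a fundamental cell by the lattice points in a disc cover a slightly smaller
  disc and are contained in a slightly larger one.\<close>

lemma lattice_count_bounds:
  fixes a b w :: complex
  assumes ab: "crs a b > 0"
  defines "S \<equiv> \<lambda>R. {(m::int, n::int). cmod (w + of_int m * a + of_int n * b) < R}"
  defines "K \<equiv> norm a + norm b"
  shows "finite (S R)" and "R \<ge> 0 \<Longrightarrow> crs a b * real (card (S R)) \<le> pi * (R + K)\<^sup>2"
    and "R \<ge> K \<Longrightarrow> pi * (R - K)\<^sup>2 \<le> crs a b * real (card (S R))"
proof -
  define c where "c = (\<lambda>(m::int, n::int). w + of_int m * a + of_int n * b)"
  define T where "T i = (+) (c i) ` cell a b" for i
  have K0: "K \<ge> 0"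
    by (simp add: K_def)
  have Tmeas: "T i \<in> sets borel" "emeasure lborel (T i) = ennreal (crs a b)" for i
  proof -
    have cb: "cell a b \<in> sets lborel"
      using cell_borel ab by simp
    have eq: "T i = (\<lambda>z. z - c i) -` cell a b"
      by (auto simp: T_def image_iff algebra_simps) (metis add.commute diff_add_cancel)+
    then have "T i = (\<lambda>z. - c i + z) -` cell a b \<inter> space lborel"
      by auto
    have m: "(\<lambda>z. - c i + z) \<in> borel_measurable lborel"
      by simp
    show "T i \<in> sets borel"
      using \<open>T i = (\<lambda>z. - c i + z) -` cell a b \<inter> space lborel\<close> measurable_sets[OF m] cb by simp
    have "emeasure lborel (cell a b) = emeasure (distr lborel borel (\<lambda>z. - c i + z)) (cell a b)"
      by (subst lborel_distr_plus) (rule refl)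
    also have "\<dots> = emeasure lborel (T i)"
    proof -
      have "T i = (+) (- c i) -` cell a b"
        by (auto simp: eq)
      then show ?thesis
        using cb m by (subst emeasure_distr) simp_all
    qed
    finally show "emeasure lborel (T i) = ennreal (crs a b)"
      using emeasure_cell[of a b] ab by simp
  qed
  have Tiff: "z \<in> T i \<longleftrightarrow> (z - w) - (of_int (fst i) * a + of_int (snd i) * b) \<in> cell a b" for z i
    by (auto simp: T_def c_def image_iff case_prod_unfold algebra_simps) (metis add.commute add_diff_cancel_left' add_diff_eq diff_add_eq_diff_diff_swap)+
  have Tdisj: "disjoint_family T"
    unfolding disjoint_family_on_def
  proof (intro ballI impI)
    fix i j :: "int \<times> int" assume "i \<noteq> j"
    then show "T i \<inter> T j = {}"
      using cell_tiles[OF ab] Tiff by blast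
  qed
  have Tnorm: "cmod (z - c i) \<le> K" if "z \<in> T i" for z i
    using that cell_norm[of _ a b] by (auto simp: T_def K_def)
  \<comment> \<open>Stated for finite subsets, since finiteness of \<open>S R\<close> is itself
    deduced from this bound.\<close>
  have sum_le: "ennreal (crs a b * real (card I)) \<le> ennreal (pi * (R + K)\<^sup>2)" if I: "finite I" "I \<subseteq> S R" "R \<ge> 0" for I R
  proof -
    have "(\<Union>i\<in>I. T i) \<subseteq> ball 0 (R + K)"
    proof
      fix z assume "z \<in> (\<Union>i\<in>I. T i)"
      then obtain i where i: "i \<in> I" "z \<in> T i"
        by blast
      have "cmod (c i) < R"
        using i(1) I(2) by (auto simp: S_def c_def)
      moreover have "cmod z \<le> cmod (c i) + cmod (z - c i)"
        by (metis add.commute diff_add_cancel norm_triangle_ineq)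
      ultimately show "z \<in> ball 0 (R + K)"
        using Tnorm[OF i(2)] by simp
    qed
    then have "emeasure lborel (\<Union>i\<in>I. T i) \<le> ennreal (pi * (R + K)\<^sup>2)"
      using emeasure_mono[of "\<Union>i\<in>I. T i" "ball 0 (R + K)" lborel] K0 I(3) by (simp add: emeasure_ball_complex)
    moreover have "emeasure lborel (\<Union>i\<in>I. T i) = (\<Sum>i\<in>I. emeasure lborel (T i))"
      using Tmeas(1) Tdisj I(1) by (intro sum_emeasure[symmetric]) (auto intro: disjoint_family_on_mono[OF _ Tdisj])
    ultimately show ?thesis
      using ab by (simp add: Tmeas(2) ennreal_of_nat_eq_real_of_nat ennreal_mult'[symmetric] mult.commute)
  qed
  have bound: "crs a b * real (card I) \<le> pi * (R + K)\<^sup>2" if I: "finite I" "I \<subseteq> S R" "R \<ge> 0" for I R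
    using sum_le[OF that] by (simp add: ennreal_le_iff)
  have fin: "finite (S R)" for R
  proof (rule ccontr)
    assume inf: "infinite (S R)"
    then have "S R \<noteq> {}"
      by auto
    then obtain m n where "cmod (w + of_int m * a + of_int n * b) < R"
      by (auto simp: S_def)
    then have "R \<ge> 0"
      using norm_ge_zero[of "w + of_int m * a + of_int n * b"] by linarith
    obtain n :: nat where n: "pi * (R + K)\<^sup>2 / crs a b < real n"
      using reals_Archimedean2 by blast
    obtain I where I: "I \<subseteq> S R" "finite I" "card I = n"
      using infinite_arbitrarily_large[OF inf] by blast
    then show False
      using bound[OF I(2,1) \<open>R \<ge> 0\<close>] n ab by (simp add: field_simps)
  qed
  show "finite (S R)"
    by (rule fin)
  show "R \<ge> 0 \<Longrightarrow> crs a b * real (card (S R)) \<le> pi * (R + K)\<^sup>2"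
    by (rule bound[OF fin]) auto
  show "pi * (R - K)\<^sup>2 \<le> crs a b * real (card (S R))" if R: "R \<ge> K"
  proof -
    have "ball 0 (R - K) \<subseteq> (\<Union>i\<in>S R. T i)"
    proof
      fix z :: complex assume z: "z \<in> ball 0 (R - K)"
      obtain i where i: "z \<in> T i"
        using cell_tiles[OF ab, of "z - w"] Tiff by blast
      have "cmod (c i) \<le> cmod z + cmod (z - c i)"
        by (metis norm_triangle_sub norm_minus_commute)
      then have "cmod (c i) < R"
        using Tnorm[OF i] z by simp
      then have "i \<in> S R"
        by (simp add: S_def c_def case_prod_unfold)
      then show "z \<in> (\<Union>i\<in>S R. T i)"
        using i by blast
    qed
    then have "ennreal (pi * (R - K)\<^sup>2) \<le> emeasure lborel (\<Union>i\<in>S R. T i)"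
      using emeasure_mono[of "ball 0 (R - K)" "\<Union>i\<in>S R. T i" lborel] fin[of R] Tmeas(1) R
      by (simp add: emeasure_ball_complex)
    also have "\<dots> = (\<Sum>i\<in>S R. emeasure lborel (T i))"
      using Tmeas(1) Tdisj fin by (intro sum_emeasure[symmetric]) (auto intro: disjoint_family_on_mono[OF _ Tdisj])
    also have "\<dots> = ennreal (crs a b * real (card (S R)))"
      using ab by (simp add: Tmeas(2) ennreal_of_nat_eq_real_of_nat ennreal_mult'[symmetric] mult.commute)
    finally show ?thesis
      using ab by (simp add: ennreal_le_iff)
  qed
qed

lemma lattice_count_asymp:
  fixes a b w :: complex
  assumes ab: "crs a b > 0"
  shows "((\<lambda>R. real (card {(m::int, n::int). cmod (w + of_int m * a + of_int n * b) < R}) / R\<^sup>2) \<longlongrightarrow> pi / crs a b) at_top"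
proof (rule tendsto_sandwich)
  let ?K = "norm a + norm b" and ?N = "\<lambda>R. real (card {(m::int, n::int). cmod (w + of_int m * a + of_int n * b) < R})"
  note bnd = lattice_count_bounds[OF ab, where w = w]
  show "\<forall>\<^sub>F R in at_top. pi * (R - ?K)\<^sup>2 / crs a b / R\<^sup>2 \<le> ?N R / R\<^sup>2"
    using eventually_ge_at_top[of ?K]
  proof eventually_elim
    case (elim R)
    have "pi * (R - ?K)\<^sup>2 / crs a b \<le> ?N R"
      using bnd(3)[OF elim] by (subst pos_divide_le_eq[OF ab]) (simp only: mult.commute[of "?N R"])
    then show ?case
      by (rule divide_right_mono) simp
  qed
  show "\<forall>\<^sub>F R in at_top. ?N R / R\<^sup>2 \<le> pi * (R + ?K)\<^sup>2 / crs a b / R\<^sup>2"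
    using eventually_ge_at_top[of 0]
  proof eventually_elim
    case (elim R)
    have "?N R \<le> pi * (R + ?K)\<^sup>2 / crs a b"
      using bnd(2)[OF elim] by (subst pos_le_divide_eq[OF ab]) (simp only: mult.commute[of "?N R"])
    then show ?case
      by (rule divide_right_mono) simp
  qed
  have *: "((\<lambda>R. (R + c)\<^sup>2 / R\<^sup>2) \<longlongrightarrow> 1) at_top" for c :: real
  proof -
    have "((\<lambda>R. (1 + c / R)\<^sup>2) \<longlongrightarrow> (1 + 0)\<^sup>2) at_top"
      by (intro tendsto_intros tendsto_divide_0[OF tendsto_const] filterlim_at_top_imp_at_infinity filterlim_ident)
    then have "((\<lambda>R. (1 + c / R)\<^sup>2) \<longlongrightarrow> 1) at_top"
      by simp
    moreover have "\<forall>\<^sub>F R in at_top. (1 + c / R)\<^sup>2 = (R + c)\<^sup>2 / R\<^sup>2"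
      using eventually_gt_at_top[of 0]
      by eventually_elim (simp add: power_divide[symmetric] add_divide_distrib)
    ultimately show ?thesis
      by (rule Lim_transform_eventually)
  qed
  have lim: "((\<lambda>R. pi * (R + c)\<^sup>2 / crs a b / R\<^sup>2) \<longlongrightarrow> pi / crs a b) at_top" for c :: real
    using tendsto_mult[OF tendsto_const[of "pi / crs a b"] *[of c]] by simp
  show "((\<lambda>R. pi * (R + ?K)\<^sup>2 / crs a b / R\<^sup>2) \<longlongrightarrow> pi / crs a b) at_top"
    by (rule lim)
  show "((\<lambda>R. pi * (R - ?K)\<^sup>2 / crs a b / R\<^sup>2) \<longlongrightarrow> pi / crs a b) at_top"
    using lim[of "- ?K"] by (simp only: add_uminus_conv_diff)
qed

section \<open>From all vectors to primitive vectors\<close>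

text \<open>If \<open>|e| \<le> s\<close> eventually, the relation \<open>e(R) = \<eta>(R) - \<Sum>k\<ge>2. e(R / k) / k\<^sup>2\<close> improves the bound to
  \<open>(\<zeta>(2) - 1) s + \<epsilon>\<close>; since \<open>\<zeta>(2) < 2\<close>, the limes superior of \<open>|e|\<close> vanishes. This replaces
  Moebius inversion.\<close>

lemma contraction_limit:
  fixes e \<eta> :: "real \<Rightarrow> real"
  assumes bnd: "\<And>R. R > 0 \<Longrightarrow> \<bar>e R\<bar> \<le> B"
    and eq: "\<And>R. R > 0 \<Longrightarrow> (\<lambda>k. e (R / real (Suc k)) / (real (Suc k))\<^sup>2) sums \<eta> R"
    and lim: "(\<eta> \<longlongrightarrow> 0) at_top"
  shows "(e \<longlongrightarrow> 0) at_top"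
proof -
  define z where "z k = 1 / (real (Suc k))\<^sup>2" for k
  have z_sums: "z sums (pi\<^sup>2 / 6)"
  proof -
    have "z = (\<lambda>k. 1 / (real (Suc k))\<^sup>2)"
      by (simp add: z_def fun_eq_iff)
    then show ?thesis
      using inverse_squares_sums by (simp add: add.commute)
  qed
  define \<theta> where "\<theta> = pi\<^sup>2 / 6 - 1"
  have tail: "(\<lambda>k. z (Suc k)) sums \<theta>"
    using sums_split_initial_segment[OF z_sums, of 1] by (simp add: z_def \<theta>_def)
  have \<theta>: "0 \<le> \<theta>" "\<theta> < 1"
  proof -
    show "0 \<le> \<theta>"
      using sums_le[OF _ sums_zero tail] by (simp add: z_def)
    \<comment> \<open>This accuracy suffices: the square of 3.2 is 10.24, which is less than
      12.\<close>
    have "pi < 3.2"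
      using pi_less_4 pi_approx by simp
    then have "pi * pi < 3.2 * 3.2"
      by (intro mult_strict_mono) auto
    then show "\<theta> < 1"
      by (simp add: \<theta>_def power2_eq_square)
  qed
  have B0: "B \<ge> 0"
    using bnd[of 1] by simp
  \<comment> \<open>The eventual upper bounds of the modulus of \<open>e\<close>; their infimum is
    its limes superior.\<close>
  define S where "S = {s. s \<ge> 0 \<and> (\<forall>\<^sub>F R in at_top. \<bar>e R\<bar> \<le> s)}"
  have improve: "\<theta> * s + \<epsilon> \<in> S" if s: "s \<in> S" and \<epsilon>: "\<epsilon> > 0" for s \<epsilon>
  proof -
    obtain r1 where r1: "\<And>R. R \<ge> r1 \<Longrightarrow> \<bar>e R\<bar> \<le> s"
      using s by (auto simp: S_def eventually_at_top_linorder)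
    have s0: "s \<ge> 0"
      using s by (simp add: S_def)
    have "(\<lambda>K. \<Sum>k<K. z (Suc k)) \<longlonglongrightarrow> \<theta>"
      using tail by (simp add: sums_def)
    then have "\<forall>\<^sub>F K in sequentially. dist (\<Sum>k<K. z (Suc k)) \<theta> < \<epsilon> / (2 * (B + 1))"
      using \<epsilon> B0 by (intro tendstoD) auto
    then obtain K where K: "dist (\<Sum>k<K. z (Suc k)) \<theta> < \<epsilon> / (2 * (B + 1))"
      by (auto simp: eventually_sequentially)
    have "\<forall>\<^sub>F R in at_top. \<bar>\<eta> R\<bar> < \<epsilon> / 2"
      using tendstoD[OF lim, of "\<epsilon> / 2"] \<epsilon> by simp
    moreover have "\<forall>\<^sub>F R in at_top. R \<ge> max 1 (r1 * real (Suc K))"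
      by (rule eventually_ge_at_top)
    ultimately have "\<forall>\<^sub>F R in at_top. \<bar>e R\<bar> \<le> \<theta> * s + \<epsilon>"
    proof eventually_elim
      case (elim R)
      then have R: "R > 0" "R \<ge> r1 * real (Suc K)"
        by auto
      define f where "f k = e (R / real (Suc k)) / (real (Suc k))\<^sup>2" for k
      have f_sums: "(\<lambda>k. f (Suc k)) sums (\<eta> R - e R)"
        using sums_split_initial_segment[OF eq[OF R(1)], of 1] by (simp add: f_def)
      have f_small: "\<bar>f (Suc k)\<bar> \<le> s * z (Suc k)" if "k < K" for k
      proof -
        have "r1 \<le> R / real (Suc (Suc k))"
        proof (cases "r1 \<ge> 0")
          case True
          then have "r1 * real (Suc (Suc k)) \<le> r1 * real (Suc K)"
            using that by (intro mult_left_mono) auto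
          then show ?thesis
            using R(2) by (simp add: pos_le_divide_eq)
        next
          case False
          moreover have "0 \<le> R / real (Suc (Suc k))"
            using R(1) by simp
          ultimately show ?thesis
            by linarith
        qed
        then show ?thesis
          using r1[of "R / real (Suc (Suc k))"] by (simp add: f_def z_def divide_right_mono)
      qed
      have f_big: "\<bar>f (Suc k)\<bar> \<le> B * z (Suc k)" for k
        using bnd[of "R / real (Suc (Suc k))"] R(1) by (simp add: f_def z_def divide_right_mono)
      have z_tail: "(\<lambda>k. z (Suc (k + K))) sums (\<theta> - (\<Sum>k<K. z (Suc k)))"
        by (rule sums_split_initial_segment[OF tail])
      have f_tail: "(\<lambda>k. f (Suc (k + K))) sums (\<eta> R - e R - (\<Sum>k<K. f (Suc k)))"
        by (rule sums_split_initial_segment[OF f_sums])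
      have "\<bar>\<eta> R - e R - (\<Sum>k<K. f (Suc k))\<bar> \<le> B * (\<theta> - (\<Sum>k<K. z (Suc k)))"
      proof -
        have up: "\<eta> R - e R - (\<Sum>k<K. f (Suc k)) \<le> B * (\<theta> - (\<Sum>k<K. z (Suc k)))"
          using f_big by (intro sums_le[OF _ f_tail sums_mult[OF z_tail]]) (simp add: abs_le_iff)
        have "- (\<eta> R - e R - (\<Sum>k<K. f (Suc k))) \<le> B * (\<theta> - (\<Sum>k<K. z (Suc k)))"
          using f_big by (intro sums_le[OF _ sums_minus[OF f_tail] sums_mult[OF z_tail]]) (simp add: abs_le_iff)
        then show ?thesis
          using up by simp
      qed
      also have "\<dots> \<le> (B + 1) * (\<epsilon> / (2 * (B + 1)))"
      proof (rule mult_mono)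
        show "\<theta> - (\<Sum>k<K. z (Suc k)) \<le> \<epsilon> / (2 * (B + 1))"
          using K by (simp add: dist_real_def)
        show "0 \<le> \<theta> - (\<Sum>k<K. z (Suc k))"
          using sums_le[OF _ sums_zero z_tail] by (simp add: z_def)
      qed (use B0 in auto)
      also have "\<dots> = \<epsilon> / 2"
        using B0 by (simp add: field_simps)
      finally have t: "\<bar>\<eta> R - e R - (\<Sum>k<K. f (Suc k))\<bar> \<le> \<epsilon> / 2" .
      have "\<bar>\<Sum>k<K. f (Suc k)\<bar> \<le> (\<Sum>k<K. s * z (Suc k))"
        using f_small by (intro order_trans[OF sum_abs] sum_mono) auto
      also have "\<dots> = s * (\<Sum>k<K. z (Suc k))"
        by (simp add: sum_distrib_left)
      also have "\<dots> \<le> s * \<theta>"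
        using s0 sums_le[OF _ sums_zero z_tail] by (intro mult_left_mono) (auto simp: z_def)
      finally have "\<bar>\<Sum>k<K. f (Suc k)\<bar> \<le> \<theta> * s"
        by (simp add: mult.commute)
      then show ?case
        using t elim(1) by linarith
    qed
    then show ?thesis
      using \<theta> s0 \<epsilon> by (simp add: S_def add_nonneg_nonneg)
  qed
  have BS: "B \<in> S"
  proof -
    have "\<forall>\<^sub>F R in at_top. \<bar>e R\<bar> \<le> B"
      using eventually_gt_at_top[of 0] by eventually_elim (rule bnd)
    then show ?thesis
      using B0 by (simp add: S_def)
  qed
  have bdd: "bdd_below S"
    by (rule bdd_belowI[of _ 0]) (simp add: S_def)
  have "Inf S \<ge> 0"
    using BS by (intro cInf_greatest) (auto simp: S_def)
  have "Inf S = 0"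
  proof (rule ccontr)
    assume "Inf S \<noteq> 0"
    then have pos: "Inf S > 0"
      using \<open>Inf S \<ge> 0\<close> by simp
    \<comment> \<open>For some \<open>s < Inf S + \<epsilon>\<close> the improved bound is at most
      \<open>\<theta> * Inf S + 2 * \<epsilon>\<close>, and two thirds of the gap below
      \<open>Inf S\<close> do not fill it.\<close>
    define \<epsilon> where "\<epsilon> = (1 - \<theta>) * Inf S / 3"
    have \<epsilon>: "\<epsilon> > 0"
      using pos \<theta> by (simp add: \<epsilon>_def)
    have "Inf S < Inf S + \<epsilon>"
      using \<epsilon> by simp
    then obtain s where s: "s \<in> S" "s < Inf S + \<epsilon>"
      using BS by (metis cInf_lessD empty_iff)
    have "Inf S \<le> \<theta> * s + \<epsilon>"
      by (rule cInf_lower[OF improve[OF s(1) \<epsilon>] bdd])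
    also have "\<theta> * s \<le> \<theta> * (Inf S + \<epsilon>)"
      using s(2) \<theta> by (intro mult_left_mono) auto
    also have "\<theta> * (Inf S + \<epsilon>) \<le> \<theta> * Inf S + \<epsilon>"
      using \<theta> \<epsilon> mult_right_mono[of \<theta> 1 \<epsilon>] by (simp add: distrib_left)
    finally have "(1 - \<theta>) * Inf S \<le> 2 * \<epsilon>"
      by (simp add: algebra_simps)
    then show False
      using pos \<theta> by (simp add: \<epsilon>_def)
  qed
  show ?thesis
  proof (rule tendstoI)
    fix \<epsilon> :: real assume "\<epsilon> > 0"
    then obtain s where s: "s \<in> S" "s < \<epsilon>"
      using \<open>Inf S = 0\<close> BS by (metis cInf_lessD empty_iff)
    then have "\<forall>\<^sub>F R in at_top. \<bar>e R\<bar> \<le> s"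
      by (simp add: S_def)
    then show "\<forall>\<^sub>F R in at_top. dist (e R) 0 < \<epsilon>"
      by eventually_elim (use s in simp)
  qed
qed

text \<open>If \<open>P R\<close> were exactly \<open>c' R^2\<close>, the sum over the dilates would
  be \<open>c' R^2\<close> times pi^2 / 6, which fixes \<open>c'\<close>. The error relative to this
  guess satisfies the relation of \<open>contraction_limit\<close>.\<close>

lemma primitive_count_asymp:
  fixes P N :: "real \<Rightarrow> real"
  assumes P: "\<And>R. R > 0 \<Longrightarrow> 0 \<le> P R" "\<And>R. R > 0 \<Longrightarrow> P R \<le> C * R\<^sup>2"
    and eq: "\<And>R. R > 0 \<Longrightarrow> (\<lambda>k. P (R / real (Suc k))) sums N R"
    and lim: "((\<lambda>R. N R / R\<^sup>2) \<longlongrightarrow> c) at_top"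
  shows "((\<lambda>R. P R / R\<^sup>2) \<longlongrightarrow> c * 6 / pi\<^sup>2) at_top"
proof -
  define c' where "c' = c * 6 / pi\<^sup>2"
  define e where "e R = P R / R\<^sup>2 - c'" for R
  have z_sums: "(\<lambda>k. 1 / (real (Suc k))\<^sup>2) sums (pi\<^sup>2 / 6)"
    using inverse_squares_sums by (simp add: add.commute)
  have "(e \<longlongrightarrow> 0) at_top"
  proof (rule contraction_limit)
    fix R :: real assume R: "R > 0"
    have "0 \<le> P R / R\<^sup>2" "P R / R\<^sup>2 \<le> C"
      using P[OF R] R by (simp_all add: pos_divide_le_eq)
    then show "\<bar>e R\<bar> \<le> \<bar>C\<bar> + \<bar>c'\<bar>"
      by (simp add: e_def)
    have "(\<lambda>k. P (R / real (Suc k)) / R\<^sup>2 - c' * (1 / (real (Suc k))\<^sup>2)) sums (N R / R\<^sup>2 - c' * (pi\<^sup>2 / 6))"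
      by (intro sums_diff sums_mult sums_divide eq[OF R] z_sums)
    moreover have "P (R / real (Suc k)) / R\<^sup>2 - c' * (1 / (real (Suc k))\<^sup>2) = e (R / real (Suc k)) / (real (Suc k))\<^sup>2" for k
      using R by (simp add: e_def diff_divide_distrib power_divide)
    moreover have "c' * (pi\<^sup>2 / 6) = c"
      by (simp add: c'_def)
    ultimately show "(\<lambda>k. e (R / real (Suc k)) / (real (Suc k))\<^sup>2) sums (N R / R\<^sup>2 - c)"
      by simp
  next
    show "((\<lambda>R. N R / R\<^sup>2 - c) \<longlongrightarrow> 0) at_top"
      using tendsto_diff[OF lim tendsto_const[of c]] by simp
  qed
  then have "((\<lambda>R. e R + c') \<longlongrightarrow> 0 + c') at_top"
    by (intro tendsto_add tendsto_const)
  then show ?thesis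
    by (simp add: e_def c'_def)
qed

section \<open>Characters of the cyclic group\<close>

definition ech :: "nat \<Rightarrow> int \<Rightarrow> complex" where
  "ech d m = cis (2 * pi * real_of_int m / real d)"

lemma ech_add: "ech d (m + n) = ech d m * ech d n"
  by (simp add: ech_def cis_mult add_divide_distrib distrib_left)

lemma ech_0 [simp]: "ech d 0 = 1"
  by (simp add: ech_def)

lemma norm_ech [simp]: "norm (ech d m) = 1"
  by (simp add: ech_def)

lemma ech_eq_1_iff:
  assumes "d \<ge> 1"
  shows "ech d m = 1 \<longleftrightarrow> int d dvd m"
proof
  assume "ech d m = 1"
  then have "cos (2 * pi * real_of_int m / real d) = 1"
    unfolding ech_def by (metis cis.simps(1) one_complex.simps(1))
  then obtain n :: int where "2 * pi * real_of_int m / real d = of_int n * 2 * pi"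
    using cos_one_2pi_int by blast
  then have "real_of_int m = of_int n * real d"
    using assms by (simp add: field_simps)
  then have "m = n * int d"
    by (metis of_int_eq_iff of_int_mult of_int_of_nat_eq)
  then show "int d dvd m"
    by simp
next
  assume "int d dvd m"
  then obtain n where "m = int d * n"
    by (auto elim: dvdE)
  then have "ech d m = cis (2 * pi * of_int n)"
    using assms by (simp add: ech_def mult.assoc)
  then show "ech d m = 1"
    by (simp add: cis_multiple_2pi)
qed

lemma ech_mult_nat: "ech d (int j * m) = ech d m ^ j"
  by (induction j) (simp_all add: distrib_right ech_add)

lemma ech_orthogonal:
  assumes "d \<ge> 1"
  shows "(\<Sum>j<d. ech d (int j * m)) = (if int d dvd m then of_nat d else 0)"
proof (cases "int d dvd m")
  case True
  then have "ech d (int j * m) = 1" for j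
    using ech_eq_1_iff[OF assms] by simp
  then show ?thesis
    using True by simp
next
  case False
  then have ne: "ech d m \<noteq> 1"
    using ech_eq_1_iff[OF assms] by simp
  have "ech d m ^ d = 1"
    unfolding ech_mult_nat[symmetric] using ech_eq_1_iff[OF assms] by simp
  then have "(\<Sum>j<d. ech d m ^ j) = 0"
    using geometric_sum[OF ne, of d] by simp
  then show ?thesis
    using False by (simp add: ech_mult_nat)
qed

section \<open>Congruences and the average of a gcd\<close>

lemma card_residue_class:
  assumes "k > 0" "k dvd d" "r < k"
  shows "card {x. x < d \<and> x mod k = (r::nat)} = d div k"
proof -
  obtain m where m: "d = k * m"
    using assms(2) by blast
  have "{x. x < d \<and> x mod k = r} = (\<lambda>i. r + k * i) ` {..<m}"
  proof (intro equalityI subsetI)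
    fix x assume x: "x \<in> {x. x < d \<and> x mod k = r}"
    then have "x = r + k * (x div k)"
      using mod_mult_div_eq[of x k] by simp
    moreover have "x div k < m"
      using x m by (simp add: less_mult_imp_div_less mult.commute)
    ultimately show "x \<in> (\<lambda>i. r + k * i) ` {..<m}"
      by blast
  next
    fix x assume "x \<in> (\<lambda>i. r + k * i) ` {..<m}"
    then obtain i where i: "x = r + k * i" "i < m"
      by blast
    have "r + k * i < k * Suc i"
      using assms(3) by simp
    also have "\<dots> \<le> k * m"
      using i(2) by (intro mult_le_mono2) simp
    finally show "x \<in> {x. x < d \<and> x mod k = r}"
      using i m assms(3) by simp
  qed
  moreover have "inj_on (\<lambda>i. r + k * i) {..<m}"
    using assms(1) by (simp add: inj_on_def)
  ultimately show ?thesis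
    using m assms(1) by (simp add: card_image)
qed

lemma card_linear_congruence:
  assumes "k > 0" "k dvd d" "coprime (int k) g"
  shows "card {x. x < d \<and> int k dvd A + int x * g} = d div k"
proof -
  obtain h where h: "[g * h = 1] (mod int k)"
    using cong_solve_coprime_int[of g "int k"] assms(3) by (auto simp: coprime_commute)
  define r where "r = nat ((- A * h) mod int k)"
  have r: "int r = (- A * h) mod int k" "r < k"
    using assms(1) by (simp_all add: r_def nat_less_iff)
  have "int k dvd A + int x * g \<longleftrightarrow> x mod k = r" for x
  proof -
    have "coprime (int k) h"
      using h by (metis cong_imp_coprime coprime_1_left coprime_commute coprime_mult_left_iff cong_sym)
    then have "int k dvd A + int x * g \<longleftrightarrow> int k dvd (A + int x * g) * h"
      by (simp add: coprime_dvd_mult_left_iff)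
    also have "\<dots> \<longleftrightarrow> [A * h + int x * (g * h) = 0] (mod int k)"
      by (simp add: cong_0_iff algebra_simps)
    also have "\<dots> \<longleftrightarrow> [A * h + int x * 1 = 0] (mod int k)"
      using h by (meson cong_add cong_mult cong_refl cong_sym cong_trans)
    also have "\<dots> \<longleftrightarrow> [int x = - A * h] (mod int k)"
      by (simp add: cong_iff_dvd_diff add.commute)
    also have "\<dots> \<longleftrightarrow> int (x mod k) = int r"
      by (simp add: cong_def r zmod_int)
    finally show ?thesis
      by simp
  qed
  then show ?thesis
    using card_residue_class[OF assms(1,2) r(2)] by simp
qed

text \<open>The gcd is the sum of the totients of its divisors \<open>k\<close>. For
  \<open>k\<close> coprime to \<open>g\<close> each of the two congruences has \<open>d / k\<close>
  solutions. For other \<open>k\<close>, solvability of both would make a nontrivial common factor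
  of \<open>k\<close> and \<open>g\<close> divide \<open>A\<close> and \<open>B\<close>, against
  \<open>unit\<close>.\<close>

lemma gcd_average:
  assumes d: "d \<ge> 1" and unit: "\<And>l. l dvd int d \<Longrightarrow> l dvd g \<Longrightarrow> l dvd A \<Longrightarrow> l dvd B \<Longrightarrow> is_unit l"
  shows "(\<Sum>x<d. \<Sum>y<d. real_of_int (gcd (gcd (A + int x * g) (B + int y * g)) (int d))) =
    (real d)\<^sup>2 * (\<Sum>k | k dvd d \<and> coprime (int k) g. real (totient k) / (real k)\<^sup>2)"
proof -
  have fin: "finite {k. k dvd d}"
    using d by simp
  define X where "X k A = {x. x < d \<and> int k dvd A + int x * g}" for k A
  have gcd_eq: "real_of_int (gcd (gcd a b) (int d)) =
      (\<Sum>k | k dvd d. real (totient k) * (of_bool (int k dvd a) * of_bool (int k dvd b)))" for a b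
  proof -
    define n where "n = nat (gcd (gcd a b) (int d))"
    have n: "int n = gcd (gcd a b) (int d)"
      by (simp add: n_def)
    have dvd: "k dvd n \<longleftrightarrow> k dvd d \<and> int k dvd a \<and> int k dvd b" for k
      unfolding int_dvd_int_iff[symmetric] n by auto
    have "real n = real (\<Sum>k | k dvd n. totient k)"
      by (simp only: totient_divisor_sum)
    also have "\<dots> = (\<Sum>k | k dvd n. real (totient k))"
      by simp
    also have "\<dots> = (\<Sum>k | k dvd d. real (totient k) * (of_bool (int k dvd a) * of_bool (int k dvd b)))"
      using fin by (intro sum.mono_neutral_cong_left) (auto simp: dvd)
    finally show ?thesis
      by (metis n of_int_of_nat_eq)
  qed
  have cardX: "(\<Sum>x<d. of_bool (int k dvd A + int x * g)) = real (card (X k A))" for k A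
    by (simp add: X_def of_bool_def sum.If_cases Int_def)
  have "(\<Sum>x<d. \<Sum>y<d. real_of_int (gcd (gcd (A + int x * g) (B + int y * g)) (int d))) =
    (\<Sum>x<d. \<Sum>y<d. \<Sum>k | k dvd d. real (totient k) * (of_bool (int k dvd A + int x * g) * of_bool (int k dvd B + int y * g)))"
    by (simp only: gcd_eq)
  also have "\<dots> = (\<Sum>x<d. \<Sum>k | k dvd d. \<Sum>y<d. real (totient k) * (of_bool (int k dvd A + int x * g) * of_bool (int k dvd B + int y * g)))"
    by (intro sum.cong refl sum.swap)
  also have "\<dots> = (\<Sum>k | k dvd d. \<Sum>x<d. \<Sum>y<d. real (totient k) * (of_bool (int k dvd A + int x * g) * of_bool (int k dvd B + int y * g)))"
    by (rule sum.swap)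
  also have "\<dots> = (\<Sum>k | k dvd d. real (totient k) * (real (card (X k A)) * real (card (X k B))))"
    unfolding sum_distrib_left[symmetric] cardX sum_distrib_right[symmetric] ..
  also have "\<dots> = (\<Sum>k | k dvd d \<and> coprime (int k) g. real (totient k) * (real (d div k) * real (d div k)))"
  proof (intro sum.mono_neutral_cong_right)
    show "\<forall>k\<in>{k. k dvd d} - {k. k dvd d \<and> coprime (int k) g}. real (totient k) * (real (card (X k A)) * real (card (X k B))) = 0"
    proof
      fix k assume k: "k \<in> {k. k dvd d} - {k. k dvd d \<and> coprime (int k) g}"
      define l where "l = gcd (int k) g"
      have l: "l dvd int k" "l dvd g" "\<not> is_unit l"
        using k by (auto simp: l_def)
      have "l dvd int d"
        using k l(1) dvd_trans by (metis (mono_tags, lifting) DiffD1 int_dvd_int_iff mem_Collect_eq)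
      have imp: "l dvd C" if "X k C \<noteq> {}" for C
      proof -
        obtain x where "int k dvd C + int x * g"
          using \<open>X k C \<noteq> {}\<close> by (auto simp: X_def)
        then have "l dvd C + int x * g"
          using l(1) dvd_trans by blast
        then show ?thesis
          using l(2) by (simp add: dvd_add_left_iff)
      qed
      then have "X k A = {} \<or> X k B = {}"
        using unit[OF \<open>l dvd int d\<close> l(2)] l(3) by blast
      then show "real (totient k) * (real (card (X k A)) * real (card (X k B))) = 0"
        by auto
    qed
    fix k assume "k \<in> {k. k dvd d \<and> coprime (int k) g}"
    then have k: "k > 0" "k dvd d" "coprime (int k) g"
      using d by (auto intro: dvd_pos_nat)
    show "real (totient k) * (real (card (X k A)) * real (card (X k B))) = real (totient k) * (real (d div k) * real (d div k))"
      unfolding X_def card_linear_congruence[OF k] ..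
  qed (use fin in auto)
  also have "\<dots> = (\<Sum>k | k dvd d \<and> coprime (int k) g. (real d)\<^sup>2 * (real (totient k) / (real k)\<^sup>2))"
    by (intro sum.cong refl) (auto simp: real_of_nat_div power2_eq_square)
  finally show ?thesis
    by (simp add: sum_distrib_left)
qed

text \<open>The divisors of \<open>d\<close> that are coprime to the gcd are closed under lcm, so
  their maximum is a multiple of all of them.\<close>

lemma divisors_d_abs:
  fixes \<delta> :: "'n::finite \<Rightarrow> int"
  assumes "d \<ge> 1"
  shows "{k. k dvd d_abs d \<delta>} = {k. k dvd d \<and> coprime (int k) (Gcd (insert (int d) (range \<delta>)))}"
proof -
  define g where "g = Gcd (insert (int d) (range \<delta>))"
  define S where "S = {k. k dvd d \<and> coprime (int k) g}"
  have fin: "finite S"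
    using assms by (auto simp: S_def intro: finite_subset[of _ "{k. k dvd d}"])
  have "1 \<in> S"
    by (simp add: S_def)
  then have M: "d_abs d \<delta> \<in> S"
    unfolding d_abs_def g_def[symmetric] S_def[symmetric] using fin by (intro Max_in) auto
  have "k dvd d_abs d \<delta>" if "k \<in> S" for k
  proof -
    have "lcm k (d_abs d \<delta>) dvd d"
      using that M by (simp add: S_def)
    moreover have "coprime (int (lcm k (d_abs d \<delta>))) g"
    proof -
      have "int (lcm k (d_abs d \<delta>)) dvd int k * int (d_abs d \<delta>)"
        by (metis int_dvd_int_iff lcm_least dvd_triv_left dvd_triv_right of_nat_mult)
      moreover have "coprime (int k * int (d_abs d \<delta>)) g"
        using that M by (simp add: S_def)
      ultimately show ?thesis
        using coprime_divisors dvd_refl by blast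
    qed
    ultimately have "lcm k (d_abs d \<delta>) \<in> S"
      by (simp add: S_def)
    then have "lcm k (d_abs d \<delta>) \<le> d_abs d \<delta>"
      unfolding d_abs_def g_def[symmetric] S_def[symmetric] using fin by (intro Max_ge) (auto simp: S_def g_def d_abs_def)
    moreover have "d_abs d \<delta> > 0"
      using M assms by (intro Nat.gr0I) (auto simp: S_def)
    moreover have "lcm k (d_abs d \<delta>) > 0"
      using \<open>lcm k (d_abs d \<delta>) dvd d\<close> assms by (intro Nat.gr0I) auto
    then have "d_abs d \<delta> \<le> lcm k (d_abs d \<delta>)"
      by (intro dvd_imp_le) auto
    ultimately show ?thesis
      by (metis dvd_lcm1 le_antisym)
  qed
  moreover have "k \<in> S" if "k dvd d_abs d \<delta>" for k
  proof -
    have "k dvd d"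
      using M that dvd_trans by (auto simp: S_def)
    moreover have "coprime (int k) g"
      using M that coprime_divisors[of "int k" "int (d_abs d \<delta>)" g g] by (simp add: S_def)
    ultimately show ?thesis
      by (simp add: S_def)
  qed
  ultimately show ?thesis
    unfolding g_def[symmetric] S_def by blast
qed

section \<open>Primitive vectors of the sublattices of \<open>\<int>\<^sup>2\<close>\<close>

context torus_cover
begin

text \<open>When the condition is expanded in characters, \<open>j\<close> contributes
  \<open>d^2\<close> if it annihilates \<open>A\<close> and \<open>B\<close> modulo
  \<open>d\<close>, and nothing otherwise. The number of such \<open>j\<close> is the gcd of
  \<open>A\<close>, \<open>B\<close> and \<open>d\<close>; one factor \<open>d\<close> is lost to
  the normalisation of the expansion.\<close>

lemma kernel_card:
  "card {(p, q). p < d \<and> q < d \<and> int d dvd int p * A + int q * B} = d * nat (gcd (gcd A B) (int d))"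
proof -
  let ?K = "{(p, q). p < d \<and> q < d \<and> int d dvd int p * A + int q * B}"
  let ?J = "{j. j < d \<and> int d dvd int j * A \<and> int d dvd int j * B}"
  have ind: "(of_bool (int d dvd m) :: complex) * of_nat d = (\<Sum>j<d. ech d (int j * m))" for m
    using ech_orthogonal[OF d_pos, of m] by simp
  have "of_nat d * of_nat (card ?K) = (\<Sum>p<d. \<Sum>q<d. of_bool (int d dvd int p * A + int q * B) * (of_nat d :: complex))"
  proof -
    have "?K = {x \<in> {..<d} \<times> {..<d}. int d dvd int (fst x) * A + int (snd x) * B}"
      by auto
    then have "of_nat (card ?K) = (\<Sum>x\<in>{..<d} \<times> {..<d}. of_bool (int d dvd int (fst x) * A + int (snd x) * B) :: complex)"
      by (simp add: of_bool_def sum.If_cases Int_def)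
    also have "\<dots> = (\<Sum>p<d. \<Sum>q<d. of_bool (int d dvd int p * A + int q * B))"
      by (simp only: sum.cartesian_product case_prod_unfold)
    finally show ?thesis
      by (simp add: sum_distrib_right[symmetric])
  qed
  also have "\<dots> = (\<Sum>p<d. \<Sum>q<d. \<Sum>j<d. ech d (int j * (int p * A + int q * B)))"
    by (simp only: ind)
  also have "\<dots> = (\<Sum>p<d. \<Sum>j<d. \<Sum>q<d. ech d (int j * (int p * A + int q * B)))"
    by (intro sum.cong refl sum.swap)
  also have "\<dots> = (\<Sum>j<d. \<Sum>p<d. \<Sum>q<d. ech d (int j * (int p * A + int q * B)))"
    by (rule sum.swap)
  also have "\<dots> = (\<Sum>j<d. (\<Sum>p<d. ech d (int p * (int j * A))) * (\<Sum>q<d. ech d (int q * (int j * B))))"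
  proof -
    have "ech d (int j * (int p * A + int q * B)) = ech d (int p * (int j * A)) * ech d (int q * (int j * B))" for j p q
      by (simp add: ech_add[symmetric] algebra_simps)
    then show ?thesis
      by (simp add: sum_product)
  qed
  also have "\<dots> = (\<Sum>j<d. if int d dvd int j * A \<and> int d dvd int j * B then of_nat d * of_nat d else 0)"
    unfolding ech_orthogonal[OF d_pos] by (intro sum.cong) auto
  also have "\<dots> = of_nat d * of_nat d * of_nat (card ?J)"
    by (simp add: sum.If_cases Int_def)
  finally have "(of_nat (card ?K) :: complex) = of_nat (d * card ?J)"
    using d_pos by simp
  then have "card ?K = d * card ?J"
    using of_nat_eq_iff by blast
  moreover have "card ?J = nat (gcd (gcd A B) (int d))"
  proof -
    let ?h = "gcd A B"
    have "int d dvd int j * A \<and> int d dvd int j * B \<longleftrightarrow> ordn ?h dvd j" for j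
    proof -
      have "int d dvd int j * A \<and> int d dvd int j * B \<longleftrightarrow> int d dvd gcd (int j * A) (int j * B)"
        by simp
      also have "\<dots> \<longleftrightarrow> int d dvd int j * ?h"
        using gcd_mult_distrib_int[of "int j" A B] by (simp only: abs_of_nat)
      also have "\<dots> \<longleftrightarrow> ordn ?h dvd j"
        by (simp only: ordn_dvd int_dvd_int_iff)
      finally show ?thesis .
    qed
    then have J: "?J = {x. x < d \<and> x mod ordn ?h = 0}"
      by (simp only: dvd_eq_mod_eq_0)
    have "int d div gcd ?h (int d) \<ge> 0"
      using ordn_pos[of ?h] unfolding ordn_def by linarith
    then have o: "int d = int (ordn ?h) * gcd ?h (int d)"
      by (simp add: ordn_def)
    define n where "n = nat (gcd ?h (int d))"
    have dn: "ordn ?h * n = d"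
      using arg_cong[OF o, of nat] by (simp only: nat_int nat_mult_distrib[OF of_nat_0_le_iff] n_def)
    have "card ?J = d div ordn ?h"
      unfolding J using ordn_pos[of ?h] by (intro card_residue_class) (auto intro: dvdI[OF dn[symmetric]])
    also have "d div ordn ?h = n"
      using nonzero_mult_div_cancel_left[of "ordn ?h" n] ordn_pos[of ?h] by (simp only: dn)
    finally show ?thesis
      by (simp only: n_def)
  qed
  ultimately show ?thesis
    by simp
qed

lemma vec_class: "cmod (vec (int p + int d * m) (int q + int d * n)) = cmod (vec (int p) (int q) + of_int m * (of_nat d * per1 x) + of_int n * (of_nat d * per2 x))"
  by (simp add: algebra_simps)

lemma vec_finite: "finite {(p, q). cmod (vec p q) < R}"
proof -
  have "crs (per1 x) (per2 x) > 0"
    using area_1 by simp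
  from lattice_count_bounds(1)[OF this, of 0 R] show ?thesis
    by simp
qed

text \<open>The solutions form \<open>d\<close> times the gcd many residue classes modulo
  \<open>d\<close>, each a translate of \<open>d\<close> times the lattice, of density
  \<open>1 / d^2\<close>. The zero vector is left out because it has no primitive direction.\<close>

lemma kernel_count_asymp:
  "((\<lambda>R. real (card {(p, q). (p, q) \<noteq> (0, 0) \<and> int d dvd p * A + q * B \<and> cmod (vec p q) < R}) / R\<^sup>2)
    \<longlongrightarrow> pi * real_of_int (gcd (gcd A B) (int d)) / real d) at_top"
proof -
  let ?K = "{(p, q). p < d \<and> q < d \<and> int d dvd int p * A + int q * B}"
  define C where "C R = (\<lambda>(p, q). {(m::int, n::int). cmod (vec (int p) (int q) + of_int m * (of_nat d * per1 x) + of_int n * (of_nat d * per2 x)) < R})" for R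
  define T where "T R = {(p, q). int d dvd p * A + q * B \<and> cmod (vec p q) < R}" for R
  have dpos: "int d > 0"
    using d_pos by simp
  have area: "crs (of_nat d * per1 x) (of_nat d * per2 x) = (real d)\<^sup>2"
    using area_1 crs_of_int(1)[of "int d"] crs_of_int(2)[of _ "int d"] by (simp add: power2_eq_square)
  then have area': "crs (of_nat d * per1 x) (of_nat d * per2 x) > 0"
    using d_pos by simp
  have finK: "finite ?K"
    by (rule finite_subset[of _ "{..<d} \<times> {..<d}"]) auto
  have finC: "finite (C R pq)" for R pq
    unfolding C_def using lattice_count_bounds(1)[OF area'] by (simp add: case_prod_unfold)
  have card_T: "card (T R) = (\<Sum>pq\<in>?K. card (C R pq))" for R
  proof -
    have "bij_betw (\<lambda>((p, q), (m, n)). (int p + int d * m, int q + int d * n)) (SIGMA pq:?K. C R pq) (T R)"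
    proof (rule bij_betwI')
      fix u w assume "u \<in> (SIGMA pq:?K. C R pq)" "w \<in> (SIGMA pq:?K. C R pq)"
      then obtain p q m n p' q' m' n' where uw: "u = ((p, q), (m, n))" "w = ((p', q'), (m', n'))" "p < d" "q < d" "p' < d" "q' < d"
        by auto
      have inj: "int r + int d * k = int r' + int d * k' \<longleftrightarrow> r = r' \<and> k = k'" if "r < d" "r' < d" for r r' k k'
      proof
        assume eq: "int r + int d * k = int r' + int d * k'"
        have "(int r + int d * k) mod int d = (int r' + int d * k') mod int d"
          using eq by simp
        then have "r = r'"
          using that by simp
        then show "r = r' \<and> k = k'"
          using eq dpos by simp
      qed auto
      show "((\<lambda>((p, q), (m, n)). (int p + int d * m, int q + int d * n)) u = (\<lambda>((p, q), (m, n)). (int p + int d * m, int q + int d * n)) w) = (u = w)"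
        using uw inj by auto
    next
      fix u assume "u \<in> (SIGMA pq:?K. C R pq)"
      then obtain p q m n where u: "u = ((p, q), (m, n))" "(p, q) \<in> ?K" "(m, n) \<in> C R (p, q)"
        by auto
      have "(int p + int d * m) * A + (int q + int d * n) * B = (int p * A + int q * B) + int d * (m * A + n * B)"
        by (simp add: algebra_simps)
      then have "int d dvd (int p + int d * m) * A + (int q + int d * n) * B"
        using u(2) by simp
      then show "(\<lambda>((p, q), (m, n)). (int p + int d * m, int q + int d * n)) u \<in> T R"
        using u(3) vec_class[of p m q n] by (simp add: u(1) T_def C_def)
    next
      fix w assume w: "w \<in> T R"
      obtain p q where pq: "w = (p, q)"
        by (cases w)
      define p0 q0 where "p0 = nat (p mod int d)" and "q0 = nat (q mod int d)"
      have p: "p = int p0 + int d * (p div int d)" "q = int q0 + int d * (q div int d)" "p0 < d" "q0 < d"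
        using dpos by (simp_all add: p0_def q0_def nat_less_iff)
      have "p * A + q * B = (int p0 * A + int q0 * B) + int d * ((p div int d) * A + (q div int d) * B)"
        by (subst p(1), subst p(2)) (simp add: algebra_simps)
      then have "int d dvd int p0 * A + int q0 * B"
        using w by (auto simp: T_def pq dvd_add_left_iff)
      moreover have "cmod (vec p q) = cmod (vec (int p0) (int q0) + of_int (p div int d) * (of_nat d * per1 x) + of_int (q div int d) * (of_nat d * per2 x))"
        unfolding vec_class[symmetric] p(1)[symmetric] p(2)[symmetric] ..
      then have "(p div int d, q div int d) \<in> C R (p0, q0)"
        using w by (simp add: T_def pq C_def)
      ultimately have mem: "((p0, q0), (p div int d, q div int d)) \<in> (SIGMA pq:?K. C R pq)"
        using p(3,4) by simp
      have eq: "w = (\<lambda>((p, q), (m, n)). (int p + int d * m, int q + int d * n)) ((p0, q0), (p div int d, q div int d))"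
        unfolding pq split_conv prod.inject using p(1,2) by (rule conjI)
      show "\<exists>u\<in>(SIGMA pq:?K. C R pq). w = (\<lambda>((p, q), (m, n)). (int p + int d * m, int q + int d * n)) u"
        by (intro bexI[of _ "((p0, q0), (p div int d, q div int d))"] eq mem)
    qed
    from bij_betw_same_card[OF this] have "card (T R) = card (SIGMA pq:?K. C R pq)"
      by (rule sym)
    also have "\<dots> = (\<Sum>pq\<in>?K. card (C R pq))"
      using finK finC by (intro card_SigmaI) auto
    finally show ?thesis .
  qed
  have "((\<lambda>R. \<Sum>pq\<in>?K. real (card (C R pq)) / R\<^sup>2) \<longlongrightarrow> (\<Sum>pq\<in>?K. pi / (real d)\<^sup>2)) at_top"
    using lattice_count_asymp[OF area'] unfolding C_def area by (intro tendsto_sum) (simp add: case_prod_unfold)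
  moreover have "(\<Sum>pq\<in>?K. pi / (real d)\<^sup>2) = pi * real_of_int (gcd (gcd A B) (int d)) / real d"
    using d_pos unfolding sum_constant kernel_card by (simp add: power2_eq_square)
  ultimately have "((\<lambda>R. real (card (T R)) / R\<^sup>2) \<longlongrightarrow> pi * real_of_int (gcd (gcd A B) (int d)) / real d) at_top"
    unfolding card_T by (simp add: sum_divide_distrib)
  moreover have "((\<lambda>R. 1 / R\<^sup>2) \<longlongrightarrow> (0::real)) at_top"
    by (intro tendsto_divide_0[OF tendsto_const] filterlim_at_top_imp_at_infinity filterlim_pow_at_top filterlim_ident) auto
  ultimately have "((\<lambda>R. real (card (T R)) / R\<^sup>2 - 1 / R\<^sup>2) \<longlongrightarrow> pi * real_of_int (gcd (gcd A B) (int d)) / real d - 0) at_top"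
    by (intro tendsto_diff)
  moreover have "\<forall>\<^sub>F R in at_top. real (card (T R)) / R\<^sup>2 - 1 / R\<^sup>2 =
     real (card {(p, q). (p, q) \<noteq> (0, 0) \<and> int d dvd p * A + q * B \<and> cmod (vec p q) < R}) / R\<^sup>2"
    using eventually_gt_at_top[of 0]
  proof eventually_elim
    case (elim R)
    have "T R = insert (0, 0) {(p, q). (p, q) \<noteq> (0, 0) \<and> int d dvd p * A + q * B \<and> cmod (vec p q) < R}"
      using elim by (auto simp: T_def)
    moreover have "finite {(p, q). (p, q) \<noteq> (0, 0) \<and> int d dvd p * A + q * B \<and> cmod (vec p q) < R}"
      by (rule finite_subset[OF _ vec_finite[of R]]) auto
    ultimately show ?case
      by (simp add: diff_divide_distrib[symmetric])
  qed
  ultimately show ?thesis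
    using Lim_transform_eventually by fastforce
qed

text \<open>One constant serves all positive \<open>R\<close>: below the length \<open>e\<close>
  there is no nonzero lattice vector to count, and above it the additive error \<open>K\<close> is
  at most \<open>K / e\<close> times \<open>R\<close>.\<close>

lemma prim_count_bound:
  obtains C where "C \<ge> 0" "\<And>R. R > 0 \<Longrightarrow> real (card {(p, q). coprime p q \<and> cmod (vec p q) < R}) \<le> C * R\<^sup>2"
proof -
  obtain e where e: "e > 0" "\<And>l. l \<in> \<Lambda> \<Longrightarrow> norm l < e \<Longrightarrow> l = 0"
    using lattice_discrete by blast
  define K where "K = norm (per1 x) + norm (per2 x)"
  have K: "K \<ge> 0"
    by (simp add: K_def)
  have "real (card {(p, q). coprime p q \<and> cmod (vec p q) < R}) \<le> pi * (1 + K / e)\<^sup>2 * R\<^sup>2" if R: "R > 0" for R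
  proof (cases "R < e")
    case True
    have "\<not> cmod (vec p q) < R" if "coprime p q" for p q
      using e(2)[OF vec_in_lattice, of p q] True prim_nonzero[OF prim_vec[OF that]] by auto
    then have emp: "{(p, q). coprime p q \<and> cmod (vec p q) < R} = {}"
      by blast
    show ?thesis
      unfolding emp by simp
  next
    case False
    have "real (card {(p, q). coprime p q \<and> cmod (vec p q) < R}) \<le> real (card {(p, q). cmod (vec p q) < R})"
      using vec_finite by (intro of_nat_mono card_mono) auto
    also have "\<dots> \<le> pi * (R + K)\<^sup>2"
      using lattice_count_bounds(2)[of "per1 x" "per2 x" R 0] area_1 R by (simp add: K_def)
    also have "\<dots> \<le> pi * (R * (1 + K / e))\<^sup>2"
    proof -
      have "K * e \<le> K * R"
        using False K by (intro mult_left_mono) auto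
      then have "K \<le> R * (K / e)"
        using e(1) by (simp add: field_simps)
      then show ?thesis
        using R K by (intro mult_left_mono power_mono) (auto simp: distrib_left)
    qed
    finally show ?thesis
      by (simp add: power_mult_distrib mult.commute mult.left_commute)
  qed
  then show ?thesis
    by (intro that[of "pi * (1 + K / e)\<^sup>2"]) auto
qed

text \<open>A nonzero vector of the kernel lies on the ray of a unique primitive vector and is there
  the multiple \<open>k + 1\<close> of \<open>ordn\<close> times that vector. Hence the kernel count
  is the sum of the primitive counts at \<open>R / (k + 1)\<close>.\<close>

lemma prim_kernel_count_asymp:
  "((\<lambda>R. real (card {(p, q). coprime p q \<and> real (ordn (p * A + q * B)) * cmod (vec p q) < R}) / R\<^sup>2)
    \<longlongrightarrow> 6 / pi * real_of_int (gcd (gcd A B) (int d)) / real d) at_top"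
proof -
  define P where "P R = {(p, q). coprime p q \<and> real (ordn (p * A + q * B)) * cmod (vec p q) < R}" for R
  define N where "N R = {(p, q). (p, q) \<noteq> (0, 0) \<and> int d dvd p * A + q * B \<and> cmod (vec p q) < R}" for R
  obtain C where C: "\<And>R. R > 0 \<Longrightarrow> real (card {(p, q). coprime p q \<and> cmod (vec p q) < R}) \<le> C * R\<^sup>2"
    using prim_count_bound by blast
  have finprim: "finite {(p, q). coprime p q \<and> cmod (vec p q) < R}" for R
    by (rule finite_subset[OF _ vec_finite[of R]]) auto
  have P_sub: "P R \<subseteq> {(p, q). coprime p q \<and> cmod (vec p q) < R}" for R
  proof -
    have "cmod v < R" if "real (ordn f) * cmod v < R" for f v
      using that ordn_pos[of f] mult_right_mono[of 1 "real (ordn f)" "cmod v"] by simp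
    then show ?thesis
      by (auto simp: P_def)
  qed
  \<comment> \<open>The multiplicity lowered by 1, to match a summation index that starts at
    0.\<close>
  define idx where "idx = (\<lambda>(p::int, q::int). nat (gcd p q) div ordn ((p div gcd p q) * A + (q div gcd p q) * B) - 1)"
  have fiber: "card {w \<in> N R. idx w = k} = card (P (R / real (Suc k)))" for R k
  proof -
    define \<Phi> where "\<Phi> = (\<lambda>(p, q). (int (Suc k) * int (ordn (p * A + q * B)) * p, int (Suc k) * int (ordn (p * A + q * B)) * q))"
    have \<Phi>: "\<Phi> (p, q) \<in> N R" "idx (\<Phi> (p, q)) = k" "gcd (fst (\<Phi> (p, q))) (snd (\<Phi> (p, q))) = int (Suc k) * int (ordn (p * A + q * B))"
      "fst (\<Phi> (p, q)) div gcd (fst (\<Phi> (p, q))) (snd (\<Phi> (p, q))) = p" "snd (\<Phi> (p, q)) div gcd (fst (\<Phi> (p, q))) (snd (\<Phi> (p, q))) = q"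
      if pq: "(p, q) \<in> P (R / real (Suc k))" for p q
    proof -
      let ?o = "ordn (p * A + q * B)"
      define c where "c = int (Suc k) * int ?o"
      have c: "c > 0"
        using ordn_pos[of "p * A + q * B"] by (simp add: c_def)
      have cop: "coprime p q" and len: "real ?o * cmod (vec p q) < R / real (Suc k)"
        using pq by (auto simp: P_def)
      have \<Phi>c: "\<Phi> (p, q) = (c * p, c * q)"
        by (simp add: \<Phi>_def c_def)
      have g: "gcd (c * p) (c * q) = c"
        using cop c by (simp add: gcd_mult_distrib_int[symmetric])
      show "gcd (fst (\<Phi> (p, q))) (snd (\<Phi> (p, q))) = int (Suc k) * int ?o"
        by (simp add: \<Phi>c g) (simp add: c_def)
      show "fst (\<Phi> (p, q)) div gcd (fst (\<Phi> (p, q))) (snd (\<Phi> (p, q))) = p" "snd (\<Phi> (p, q)) div gcd (fst (\<Phi> (p, q))) (snd (\<Phi> (p, q))) = q"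
        using c by (simp_all add: \<Phi>c g)
      have "nat c div ?o = Suc k"
        using ordn_pos[of "p * A + q * B"] by (simp add: c_def nat_mult_distrib del: of_nat_Suc)
      then show "idx (\<Phi> (p, q)) = k"
        using c by (simp add: \<Phi>c idx_def g)
      have "int d dvd c * (p * A + q * B)"
        by (simp add: ordn_dvd c_def)
      then have "int d dvd c * p * A + c * q * B"
        by (simp add: algebra_simps)
      moreover have "(c * p, c * q) \<noteq> (0, 0)"
        using c cop by auto
      moreover have "cmod (vec (c * p) (c * q)) < R"
      proof -
        have "vec (c * p) (c * q) = of_int c * vec p q"
          by (simp add: algebra_simps)
        then have "cmod (vec (c * p) (c * q)) = real (Suc k) * (real ?o * cmod (vec p q))"
          by (simp add: norm_mult c_def del: of_nat_Suc)
        then show ?thesis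
          using len by (simp add: pos_less_divide_eq mult.commute del: of_nat_Suc)
      qed
      ultimately show "\<Phi> (p, q) \<in> N R"
        using c by (auto simp: \<Phi>c N_def)
    qed
    have "bij_betw \<Phi> (P (R / real (Suc k))) {w \<in> N R. idx w = k}"
    proof (rule bij_betwI')
      fix u w assume uw: "u \<in> P (R / real (Suc k))" "w \<in> P (R / real (Suc k))"
      show "(\<Phi> u = \<Phi> w) = (u = w)"
        using uw \<Phi>(4,5) by (metis surj_pair)
    next
      fix u assume "u \<in> P (R / real (Suc k))"
      then show "\<Phi> u \<in> {w \<in> N R. idx w = k}"
        using \<Phi>(1,2) by (metis (mono_tags, lifting) mem_Collect_eq surj_pair)
    next
      fix w assume w: "w \<in> {w \<in> N R. idx w = k}"
      obtain p q where pq: "w = (p, q)"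
        by (cases w)
      define c where "c = gcd p q"
      define u v where "u = p div c" and "v = q div c"
      let ?o = "ordn (u * A + v * B)"
      have ne: "(p, q) \<noteq> (0, 0)" "int d dvd p * A + q * B" "cmod (vec p q) < R"
        using w by (auto simp: pq N_def)
      have c: "c > 0"
        using ne(1) by (auto simp: c_def)
      have p: "p = c * u" "q = c * v"
        by (simp_all add: c_def u_def v_def)
      have cop: "coprime u v"
        unfolding u_def v_def c_def using ne(1) by (intro div_gcd_coprime) auto
      have "int d dvd c * (u * A + v * B)"
        using ne(2) by (simp add: p algebra_simps)
      then have "int ?o dvd c"
        by (simp add: ordn_dvd)
      then obtain t where t: "c = int ?o * t"
        by (auto elim: dvdE)
      have t0: "t > 0"
        using c t by (metis of_nat_0_le_iff zero_less_mult_pos zero_less_mult_iff not_less)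
      have "idx w = nat t - 1"
      proof -
        have "nat c div ?o = nat t"
          using ordn_pos[of "u * A + v * B"] by (simp add: t nat_mult_distrib)
        then show ?thesis
          by (simp add: pq idx_def c_def[symmetric] u_def[symmetric] v_def[symmetric])
      qed
      then have "nat t - 1 = k" "0 < nat t"
        using w t0 by auto
      then have "nat t = Suc k"
        by linarith
      then have tk: "t = int (Suc k)"
        using t0 by simp
      then have w\<Phi>: "w = \<Phi> (u, v)"
        by (simp add: pq p \<Phi>_def t mult.commute)
      have "vec p q = of_int c * vec u v"
        by (simp add: p algebra_simps)
      then have "cmod (vec p q) = real (Suc k) * (real ?o * cmod (vec u v))"
        by (simp add: norm_mult t tk del: of_nat_Suc)
      then have "real ?o * cmod (vec u v) < R / real (Suc k)"
        using ne(3) by (simp add: pos_less_divide_eq mult.commute del: of_nat_Suc)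
      then have "(u, v) \<in> P (R / real (Suc k))"
        using cop by (simp add: P_def)
      then show "\<exists>u\<in>P (R / real (Suc k)). w = \<Phi> u"
        using w\<Phi> by blast
    qed
    from bij_betw_same_card[OF this] show ?thesis
      by (rule sym)
  qed
  have finN: "finite (N R)" for R
    unfolding N_def by (rule finite_subset[OF _ vec_finite[of R]]) auto
  have "((\<lambda>R. real (card (P R)) / R\<^sup>2) \<longlongrightarrow> (pi * real_of_int (gcd (gcd A B) (int d)) / real d) * 6 / pi\<^sup>2) at_top"
  proof (rule primitive_count_asymp[where N = "\<lambda>R. real (card (N R))" and C = C])
    fix R :: real assume R: "R > 0"
    show "real (card (P R)) \<le> C * R\<^sup>2"
      using C[OF R] card_mono[OF finprim P_sub, of R] by linarith
    have "(\<lambda>k. real (card (P (R / real (Suc k))))) sums (\<Sum>k\<in>idx ` N R. real (card (P (R / real (Suc k)))))"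
    proof (rule sums_finite)
      fix k assume "k \<notin> idx ` N R"
      then have emp: "{w \<in> N R. idx w = k} = {}"
        by blast
      show "real (card (P (R / real (Suc k)))) = 0"
        by (simp only: fiber[symmetric] emp card.empty of_nat_0)
    qed (use finN in simp)
    also have "(\<Sum>k\<in>idx ` N R. real (card (P (R / real (Suc k))))) = real (\<Sum>k\<in>idx ` N R. card {w \<in> N R. idx w = k})"
      by (simp only: fiber of_nat_sum)
    also have "(\<Sum>k\<in>idx ` N R. card {w \<in> N R. idx w = k}) = card (N R)"
      using sum.image_gen[OF finN, of "\<lambda>_. 1::nat" R idx] by simp
    finally show "(\<lambda>k. real (card (P (R / real (Suc k))))) sums real (card (N R))" .
  next
    show "((\<lambda>R. real (card (N R)) / R\<^sup>2) \<longlongrightarrow> pi * real_of_int (gcd (gcd A B) (int d)) / real d) at_top"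
      unfolding N_def by (rule kernel_count_asymp)
  qed simp
  moreover have "(pi * real_of_int (gcd (gcd A B) (int d)) / real d) * 6 / pi\<^sup>2 = 6 / pi * real_of_int (gcd (gcd A B) (int d)) / real d"
    by (simp add: power2_eq_square mult.commute)
  ultimately show ?thesis
    by (simp only: P_def)
qed

end

section \<open>A strong law for shift-equivariant functions\<close>

lemma lborel_integral_shift:
  fixes f :: "'a::euclidean_space \<Rightarrow> complex"
  assumes "f \<in> borel_measurable borel"
  shows "(\<integral>s. f (s + c) \<partial>lborel) = (\<integral>s. f s \<partial>lborel)"
proof -
  have "(\<integral>s. f s \<partial>lborel) = (\<integral>s. f s \<partial>distr lborel borel ((+) c))"
    by (simp only: lborel_distr_plus)
  also have "\<dots> = (\<integral>s. f (c + s) \<partial>lborel)"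
    using assms by (intro integral_distr) auto
  finally show ?thesis
    by (simp add: add.commute)
qed

text \<open>The integral of a \<open>d\<close>-periodic function over a window of length
  \<open>d\<close> does not depend on where the window starts. Here \<phi> is the coordinate along
  \<open>u\<close> and \<open>J\<close> a set invariant in that direction, so that the argument
  serves both coordinates of a square.\<close>

lemma slab_shift:
  fixes g :: "'a::euclidean_space \<Rightarrow> complex" and \<phi> :: "'a \<Rightarrow> real"
  assumes gm [measurable]: "g \<in> borel_measurable borel" and bd: "\<And>s. norm (g s) \<le> 1" and d: "d > 0"
    and per: "\<And>s. g (s + d *\<^sub>R u) = g s" and \<phi>: "\<And>s c. \<phi> (s + c *\<^sub>R u) = \<phi> s + c"
    and J: "\<And>s c. s + c *\<^sub>R u \<in> J \<longleftrightarrow> s \<in> J"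
    and Jm [measurable]: "J \<in> sets borel" and \<phi>m [measurable]: "\<phi> \<in> borel_measurable borel"
    and fin: "\<And>a b. emeasure lborel (J \<inter> {s. a \<le> \<phi> s \<and> \<phi> s < b}) < \<infinity>"
  shows "(\<integral>s. indicat_real (J \<inter> {s. 0 \<le> \<phi> s \<and> \<phi> s < d}) s *\<^sub>R g (s + c *\<^sub>R u) \<partial>lborel) =
    (\<integral>s. indicat_real (J \<inter> {s. 0 \<le> \<phi> s \<and> \<phi> s < d}) s *\<^sub>R g s \<partial>lborel)"
proof -
  define W where "W a b = J \<inter> {s. a \<le> \<phi> s \<and> \<phi> s < b}" for a b
  define I where "I a b = (\<integral>s. indicat_real (W a b) s *\<^sub>R g s \<partial>lborel)" for a b
  have Wm [measurable]: "W a b \<in> sets borel" for a b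
  proof -
    have "{s. a \<le> \<phi> s \<and> \<phi> s < b} = {s \<in> space borel. a \<le> \<phi> s \<and> \<phi> s < b}"
      by simp
    also have "\<dots> \<in> sets borel"
      by measurable
    finally show ?thesis
      unfolding W_def by auto
  qed
  have int: "integrable lborel (\<lambda>s. indicat_real (W a b) s *\<^sub>R g s)" for a b
  proof (rule integrableI_bounded_set[where A = "W a b" and B = 1])
    show "emeasure lborel (W a b) < \<infinity>"
      using fin by (simp add: W_def)
  qed (use bd in \<open>auto simp: indicator_def\<close>)
  have tr: "(\<integral>s. indicat_real (W a b) s *\<^sub>R g (s + c *\<^sub>R u) \<partial>lborel) = I (a + c) (b + c)" for a b c
  proof -
    have eq: "indicat_real (W a b) s *\<^sub>R g (s + c *\<^sub>R u) = indicat_real (W (a + c) (b + c)) (s + c *\<^sub>R u) *\<^sub>R g (s + c *\<^sub>R u)" for s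
      using \<phi> J by (auto simp: W_def indicator_def)
    have "(\<integral>s. indicat_real (W a b) s *\<^sub>R g (s + c *\<^sub>R u) \<partial>lborel) =
      (\<integral>s. indicat_real (W (a + c) (b + c)) (s + c *\<^sub>R u) *\<^sub>R g (s + c *\<^sub>R u) \<partial>lborel)"
      by (rule Bochner_Integration.integral_cong[OF refl eq])
    also have "\<dots> = I (a + c) (b + c)"
      unfolding I_def by (rule lborel_integral_shift) measurable
    finally show ?thesis .
  qed
  have perI: "I (a + d) (b + d) = I a b" for a b
    using tr[of a b d] by (simp add: per I_def)
  have perN: "I (a + real_of_int n * d) (b + real_of_int n * d) = I a b" for a b n
  proof (induction n rule: int_induct[where k = 0])
    case (step1 i)
    then show ?case
      using perI[of "a + real_of_int i * d" "b + real_of_int i * d"] by (simp add: algebra_simps)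
  next
    case (step2 i)
    then show ?case
      using perI[of "a + real_of_int (i - 1) * d" "b + real_of_int (i - 1) * d"] by (simp add: algebra_simps)
  qed simp
  have add: "I a b + I b e = I a e" if "a \<le> b" "b \<le> e" for a b e
  proof -
    have "I a b + I b e = (\<integral>s. indicat_real (W a b) s *\<^sub>R g s + indicat_real (W b e) s *\<^sub>R g s \<partial>lborel)"
      unfolding I_def by (rule Bochner_Integration.integral_add[symmetric, OF int int])
    also have "\<dots> = I a e"
      unfolding I_def using that by (intro Bochner_Integration.integral_cong) (auto simp: W_def indicator_def)
    finally show ?thesis .
  qed
  define n where "n = \<lfloor>c / d\<rfloor>"
  define r where "r = c - real_of_int n * d"
  have "real_of_int n \<le> c / d" "c / d < real_of_int n + 1"
    unfolding n_def by linarith+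
  then have r: "0 \<le> r" "r < d"
    using d by (simp_all add: r_def field_simps)
  have "I c (d + c) = I (r + real_of_int n * d) ((d + r) + real_of_int n * d)"
    by (simp add: r_def)
  also have "\<dots> = I r (d + r)"
    by (rule perN)
  also have "\<dots> = I r d + I d (d + r)"
    using r by (intro add[symmetric]) auto
  also have "I d (d + r) = I 0 r"
    using perI[of 0 r] by (simp add: add.commute)
  also have "I r d + I 0 r = I 0 d"
    using add[of 0 r d] r by (simp add: add.commute)
  finally have "I c (d + c) = I 0 d" .
  then show ?thesis
    using tr[of 0 d c] by (simp add: W_def I_def)
qed

text \<open>The domain of the displacements of one mark, in units of the periods. The side will be
  the degree \<open>d\<close>: one period multiplies the character by a \<open>d\<close>-th root of
  unity, and \<open>d\<close> periods leave it unchanged.\<close>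

definition torus_square :: "real \<Rightarrow> (real \<times> real) set" where
  "torus_square d = {0..<d} \<times> {0..<d}"

lemma torus_square_measurable [measurable]: "torus_square d \<in> sets borel"
  unfolding torus_square_def borel_prod[symmetric] by auto

lemma emeasure_box_product:
  "emeasure lborel ({a..<b} \<times> {c..<e} :: (real \<times> real) set) = emeasure lborel {a..<b} * emeasure lborel {c..<e}"
  unfolding lborel_prod[symmetric] by (rule lborel.emeasure_pair_measure_Times) auto

lemma emeasure_torus_square: "d \<ge> 0 \<Longrightarrow> emeasure lborel (torus_square d) = ennreal (d\<^sup>2)"
  by (simp add: torus_square_def emeasure_box_product ennreal_mult[symmetric] power2_eq_square)

lemma period_shift:
  fixes g :: "real \<times> real \<Rightarrow> complex"
  assumes gm [measurable]: "g \<in> borel_measurable borel" and bd: "\<And>s. norm (g s) \<le> 1" and d: "d > 0"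
    and per: "\<And>s. g (s + (d, 0)) = g s" "\<And>s. g (s + (0, d)) = g s"
  shows "(\<integral>s. indicat_real (torus_square d) s *\<^sub>R g (s + c) \<partial>lborel) =
    (\<integral>s. indicat_real (torus_square d) s *\<^sub>R g s \<partial>lborel)"
proof -
  obtain c1 c2 where c: "c = (c1, c2)"
    by (cases c)
  have Q1: "torus_square d = (UNIV \<times> {0..<d}) \<inter> {s. 0 \<le> fst s \<and> fst s < d}"
    and Q2: "torus_square d = ({0..<d} \<times> UNIV) \<inter> {s. 0 \<le> snd s \<and> snd s < d}"
    by (auto simp: torus_square_def)
  have fst_m: "fst \<in> borel_measurable (borel :: (real \<times> real) measure)" "snd \<in> borel_measurable (borel :: (real \<times> real) measure)"
    by (intro borel_measurable_continuous_onI continuous_intros)+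
  have "(\<integral>s. indicat_real (torus_square d) s *\<^sub>R (\<lambda>s. g (s + (0, c2))) (s + c1 *\<^sub>R (1, 0)) \<partial>lborel) =
    (\<integral>s. indicat_real (torus_square d) s *\<^sub>R (\<lambda>s. g (s + (0, c2))) s \<partial>lborel)"
    unfolding Q1
  proof (rule slab_shift)
    show "(\<lambda>s. g (s + (0, c2))) \<in> borel_measurable borel"
      by measurable
    show "g (s + d *\<^sub>R (1, 0) + (0, c2)) = g (s + (0, c2))" for s
      using per(1)[of "s + (0, c2)"] by (simp add: ac_simps)
    show "UNIV \<times> {0..<d} \<in> sets (borel :: (real \<times> real) measure)"
      unfolding borel_prod[symmetric] by auto
    show "emeasure lborel ((UNIV \<times> {0..<d}) \<inter> {s :: real \<times> real. a \<le> fst s \<and> fst s < b}) < \<infinity>" for a b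
    proof -
      have "(UNIV \<times> {0..<d}) \<inter> {s :: real \<times> real. a \<le> fst s \<and> fst s < b} = {a..<b} \<times> {0..<d}"
        by auto
      then show ?thesis
        using d by (cases "a \<le> b") (simp_all add: emeasure_box_product ennreal_mult_less_top)
    qed
  qed (use bd d fst_m in auto)
  moreover have "(\<integral>s. indicat_real (torus_square d) s *\<^sub>R g (s + c2 *\<^sub>R (0, 1)) \<partial>lborel) =
    (\<integral>s. indicat_real (torus_square d) s *\<^sub>R g s \<partial>lborel)"
    unfolding Q2
  proof (rule slab_shift)
    show "g (s + d *\<^sub>R (0, 1)) = g s" for s
      using per(2)[of s] by simp
    show "{0..<d} \<times> UNIV \<in> sets (borel :: (real \<times> real) measure)"
      unfolding borel_prod[symmetric] by auto
    show "emeasure lborel (({0..<d} \<times> UNIV) \<inter> {s :: real \<times> real. a \<le> snd s \<and> snd s < b}) < \<infinity>" for a b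
    proof -
      have "({0..<d} \<times> UNIV) \<inter> {s :: real \<times> real. a \<le> snd s \<and> snd s < b} = {0..<d} \<times> {a..<b}"
        by auto
      then show ?thesis
        using d by (cases "a \<le> b") (simp_all add: emeasure_box_product ennreal_mult_less_top)
    qed
  qed (use bd d fst_m in auto)
  ultimately show ?thesis
    by (simp add: c add.assoc)
qed

text \<open>Pairwise orthogonality of \<open>H v\<close> and \<open>H v'\<close> for non-parallel \<open>v, v'\<close>: translating by the solution of
  \<open>p \<tau> - q \<sigma> = 1\<close>, \<open>p' \<tau> - q' \<sigma> = 0\<close> multiplies the product by a nontrivial root of unity.\<close>

lemma strong_law_shift:
  fixes H :: "int \<Rightarrow> int \<Rightarrow> real \<times> real \<Rightarrow> complex" and V :: "nat \<Rightarrow> (int \<times> int) set"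
  assumes d: "d \<ge> 1" and e: "\<not> int d dvd e"
    and meas [measurable]: "\<And>p q. H p q \<in> borel_measurable borel" and bd: "\<And>p q s. norm (H p q s) \<le> 1"
    and equiv: "\<And>p q \<sigma> \<tau> \<sigma>' \<tau>' m. of_int p * \<tau>' - of_int q * \<sigma>' = real_of_int m \<Longrightarrow>
      H p q (\<sigma> + \<sigma>', \<tau> + \<tau>') = ech d (e * m) * H p q (\<sigma>, \<tau>)"
    and V: "\<And>k. finite (V k)" "\<And>k p q. (p, q) \<in> V k \<Longrightarrow> coprime p q" "\<And>k. real (card (V k)) \<le> C * (real k)\<^sup>2"
  shows "AE s in lborel. s \<in> torus_square (real d) \<longrightarrow> (\<lambda>k. (\<Sum>(p, q)\<in>V k. H p q s) / (real k)\<^sup>2) \<longlonglongrightarrow> 0"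
proof -
  let ?Q = "torus_square (real d)"
  have dpos: "real d > 0"
    using d by simp
  have per: "H p q (s + (real d, 0)) = H p q s" "H p q (s + (0, real d)) = H p q s" for p q s
  proof -
    have "ech d (e * (- q * int d)) = 1" "ech d (e * (p * int d)) = 1"
      using ech_eq_1_iff[OF d] by simp_all
    then show "H p q (s + (real d, 0)) = H p q s" "H p q (s + (0, real d)) = H p q s"
      using equiv[of p 0 q "real d" "- q * int d" "fst s" "snd s"] equiv[of p "real d" q 0 "p * int d" "fst s" "snd s"]
      by (cases s; simp)+
  qed
  have fin: "emeasure lborel ?Q < \<infinity>"
    by (simp add: emeasure_torus_square)
  have int: "integrable lborel (\<lambda>s. indicat_real ?Q s *\<^sub>R (H p q s * cnj (H p' q' s)))" for p q p' q'
  proof (rule integrableI_bounded_set[where A = ?Q and B = 1])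
    show "AE s in lborel. s \<in> ?Q \<longrightarrow> norm (indicat_real ?Q s *\<^sub>R (H p q s * cnj (H p' q' s))) \<le> 1"
      using bd[of p q] bd[of p' q'] by (intro AE_I2) (auto simp: norm_mult mult_le_one)
    show "(\<lambda>s. indicat_real ?Q s *\<^sub>R (H p q s * cnj (H p' q' s))) \<in> borel_measurable lborel"
      using borel_measurable_continuous_onI[OF continuous_on_cnj[OF continuous_on_id]]
      by (intro borel_measurable_scaleR borel_measurable_times measurable_compose[OF _ borel_measurable_continuous_onI[OF continuous_on_cnj[OF continuous_on_id]]]) auto
  qed (use fin in auto)
  define J where "J v v' = (\<integral>s. indicat_real ?Q s *\<^sub>R (H (fst v) (snd v) s * cnj (H (fst v') (snd v') s)) \<partial>lborel)" for v v'
  have J0: "J v v' = 0" if det: "fst v * snd v' - snd v * fst v' \<noteq> 0" for v v'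
  proof -
    obtain p q p' q' where vv: "v = (p, q)" "v' = (p', q')"
      by (cases v, cases v')
    \<comment> \<open>The displacement is parallel to \<open>(p', q')\<close> and normalised by the
      determinant, so the form of the second vector vanishes on it and that of the first equals
      1.\<close>
    define t where "t = 1 / real_of_int (p * q' - q * p')"
    define \<sigma>0 \<tau>0 where "\<sigma>0 = t * of_int p'" and "\<tau>0 = t * of_int q'"
    have "real_of_int (p * q' - q * p') \<noteq> 0"
      using det vv by (simp only: of_int_eq_0_iff fst_conv snd_conv not_False_eq_True)
    then have t1: "t * (of_int p * of_int q' - of_int q * of_int p') = 1"
      by (simp add: t_def)
    have s1: "of_int p * \<tau>0 - of_int q * \<sigma>0 = real_of_int 1"
      using t1 by (simp add: \<sigma>0_def \<tau>0_def algebra_simps)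
    have s2: "of_int p' * \<tau>0 - of_int q' * \<sigma>0 = real_of_int 0"
      by (simp add: \<sigma>0_def \<tau>0_def)
    define g where "g s = H p q s * cnj (H p' q' s)" for s
    have gm: "g \<in> borel_measurable borel"
      unfolding g_def
      by (intro borel_measurable_times measurable_compose[OF _ borel_measurable_continuous_onI[OF continuous_on_cnj[OF continuous_on_id]]]) auto
    have shift: "g (s + (\<sigma>0, \<tau>0)) = ech d e * g s" for s
      using equiv[OF s1, of "fst s" "snd s"] equiv[OF s2, of "fst s" "snd s"] by (cases s) (simp add: g_def)
    have "J v v' = (\<integral>s. indicat_real ?Q s *\<^sub>R g s \<partial>lborel)"
      by (simp add: J_def vv g_def)
    also have "\<dots> = (\<integral>s. indicat_real ?Q s *\<^sub>R g (s + (\<sigma>0, \<tau>0)) \<partial>lborel)"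
    proof (rule period_shift[symmetric])
      show "norm (g s) \<le> 1" for s
        using bd[of p q s] bd[of p' q' s] by (simp add: g_def norm_mult mult_le_one)
      show "g \<in> borel_measurable borel"
        by (rule gm)
    qed (use dpos per in \<open>simp_all add: g_def\<close>)
    also have "\<dots> = (\<integral>s. ech d e * (indicat_real ?Q s *\<^sub>R g s) \<partial>lborel)"
      by (simp add: shift)
    also have "\<dots> = ech d e * (\<integral>s. indicat_real ?Q s *\<^sub>R g s \<partial>lborel)"
      by (rule integral_mult_right_zero)
    also have "(\<integral>s. indicat_real ?Q s *\<^sub>R g s \<partial>lborel) = J v v'"
      by (simp add: J_def vv g_def)
    finally have "(1 - ech d e) * J v v' = 0"
      by (simp add: algebra_simps)
    then show ?thesis
      using ech_eq_1_iff[OF d] e by simp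
  qed
  have J_le: "norm (J v v') \<le> (real d)\<^sup>2" for v v'
  proof -
    have "norm (J v v') \<le> (\<integral>s. indicat_real ?Q s \<partial>lborel)"
      unfolding J_def
    proof (rule Bochner_Integration.integral_norm_bound_integral)
      show "integrable lborel (indicat_real ?Q)"
        using fin by (intro integrable_real_indicator) auto
      show "norm (indicat_real ?Q s *\<^sub>R (H (fst v) (snd v) s * cnj (H (fst v') (snd v') s))) \<le> indicat_real ?Q s" for s
        using bd[of "fst v" "snd v" s] bd[of "fst v'" "snd v'" s] by (auto simp: norm_mult indicator_def mult_le_one)
    qed (rule int)
    also have "\<dots> = (real d)\<^sup>2"
      by (simp add: measure_def emeasure_torus_square)
    finally show ?thesis .
  qed
  define S where "S k s = (\<Sum>(p, q)\<in>V k. H p q s)" for k s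
  have Sm [measurable]: "S k \<in> borel_measurable borel" for k
    unfolding S_def by (intro borel_measurable_sum) (auto simp: case_prod_unfold)
  have Ssq: "complex_of_real ((norm (S k s))\<^sup>2) = (\<Sum>v\<in>V k. \<Sum>v'\<in>V k. H (fst v) (snd v) s * cnj (H (fst v') (snd v') s))" for k s
    unfolding S_def complex_norm_square by (simp add: sum_product case_prod_unfold)
  have var: "(\<integral>s. indicat_real ?Q s * (norm (S k s))\<^sup>2 \<partial>lborel) \<le> 2 * C * (real d)\<^sup>2 * (real k)\<^sup>2"
    and int_S: "integrable lborel (\<lambda>s. indicat_real ?Q s * (norm (S k s))\<^sup>2)" for k
  proof -
    have eq: "complex_of_real (indicat_real ?Q s * (norm (S k s))\<^sup>2) =
       (\<Sum>v\<in>V k. \<Sum>v'\<in>V k. indicat_real ?Q s *\<^sub>R (H (fst v) (snd v) s * cnj (H (fst v') (snd v') s)))" for s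
      by (simp only: of_real_mult Ssq scaleR_conv_of_real sum_distrib_left)
    have intc: "integrable lborel (\<lambda>s. complex_of_real (indicat_real ?Q s * (norm (S k s))\<^sup>2))"
      unfolding eq by (intro Bochner_Integration.integrable_sum int)
    then show "integrable lborel (\<lambda>s. indicat_real ?Q s * (norm (S k s))\<^sup>2)"
      by (simp only: complex_of_real_integrable_eq)
    have "complex_of_real (\<integral>s. indicat_real ?Q s * (norm (S k s))\<^sup>2 \<partial>lborel) = (\<Sum>v\<in>V k. \<Sum>v'\<in>V k. J v v')"
      unfolding integral_complex_of_real[symmetric] eq J_def
      by (subst Bochner_Integration.integral_sum, intro Bochner_Integration.integrable_sum int, intro sum.cong refl Bochner_Integration.integral_sum int)
    then have "\<bar>\<integral>s. indicat_real ?Q s * (norm (S k s))\<^sup>2 \<partial>lborel\<bar> = norm (\<Sum>v\<in>V k. \<Sum>v'\<in>V k. J v v')"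
      by (simp only: norm_of_real[symmetric, where 'a = complex])
    also have "\<dots> \<le> (\<Sum>v\<in>V k. norm (\<Sum>v'\<in>V k. J v v'))"
      by (rule norm_sum)
    also have "\<dots> \<le> (\<Sum>v\<in>V k. 2 * (real d)\<^sup>2)"
    proof (rule sum_mono)
      fix v assume v: "v \<in> V k"
      \<comment> \<open>Coprime vectors with determinant 0 agree up to sign. In each row of the
        double sum at most two terms survive, so the second moment is O(k^2) instead of
        O(k^4).\<close>
      have par: "v' = v \<or> v' = (- fst v, - snd v)" if v': "v' \<in> V k" "fst v * snd v' - snd v * fst v' = 0" for v'
      proof -
        obtain p q p' q' where vv: "v = (p, q)" "v' = (p', q')"
          by (cases v, cases v')
        have cop: "coprime p q" "coprime p' q'" and eq: "p * q' = q * p'"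
          using V(2) v v' vv by auto
        have "p dvd q * p'" "p' dvd q' * p" "q dvd p * q'" "q' dvd p' * q"
          using eq by (metis dvd_triv_left mult.commute)+
        then have "p dvd p'" "p' dvd p" "q dvd q'" "q' dvd q"
          using cop by (simp_all add: coprime_dvd_mult_right_iff coprime_commute)
        then have ab: "\<bar>p\<bar> = \<bar>p'\<bar>" "\<bar>q\<bar> = \<bar>q'\<bar>"
          by (auto intro: zdvd_antisym_abs)
        show ?thesis
        proof (cases "p = 0 \<or> q = 0")
          case True
          then show ?thesis
            using ab cop vv by (auto simp: abs_eq_iff)
        next
          case False
          then show ?thesis
            using ab eq vv by (auto simp: abs_eq_iff)
        qed
      qed
      have "(\<Sum>v'\<in>V k. J v v') = (\<Sum>v'\<in>V k \<inter> {v, (- fst v, - snd v)}. J v v')"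
      proof (rule sum.mono_neutral_right)
        show "\<forall>v'\<in>V k - V k \<inter> {v, (- fst v, - snd v)}. J v v' = 0"
          using J0[of v] par by blast
      qed (use V(1) in auto)
      also have "norm \<dots> \<le> (\<Sum>v'\<in>V k \<inter> {v, (- fst v, - snd v)}. (real d)\<^sup>2)"
        by (intro order_trans[OF norm_sum] sum_mono J_le)
      also have "\<dots> \<le> 2 * (real d)\<^sup>2"
      proof -
        have "card (V k \<inter> {v, (- fst v, - snd v)}) \<le> card {v, (- fst v, - snd v)}"
          by (intro card_mono) auto
        also have "\<dots> \<le> 2"
          by (simp add: card_insert_if)
        finally show ?thesis
          by (simp add: mult_right_mono)
      qed
      finally show "norm (\<Sum>v'\<in>V k. J v v') \<le> 2 * (real d)\<^sup>2" .
    qed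
    also have "\<dots> = 2 * (real d)\<^sup>2 * real (card (V k))"
      by simp
    also have "\<dots> \<le> 2 * (real d)\<^sup>2 * (C * (real k)\<^sup>2)"
      by (intro mult_left_mono V(3)) auto
    finally show "(\<integral>s. indicat_real ?Q s * (norm (S k s))\<^sup>2 \<partial>lborel) \<le> 2 * C * (real d)\<^sup>2 * (real k)\<^sup>2"
      by (simp add: algebra_simps)
  qed
  define D where "D = 2 * C * (real d)\<^sup>2"
  \<comment> \<open>Divided by \<open>k^4\<close> the second moments are summable in
    \<open>k\<close>. Hence the series of squares converges almost everywhere, and its terms tend to
    0.\<close>
  have nn: "(\<integral>\<^sup>+ s. ennreal (indicat_real ?Q s * (norm (S k s))\<^sup>2 / (real k)^4) \<partial>lborel) \<le> ennreal (D / (real k)\<^sup>2)" for k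
  proof -
    have "integrable lborel (\<lambda>s. indicat_real ?Q s * (norm (S k s))\<^sup>2 / (real k)^4)"
      by (intro integrable_divide int_S)
    then have "(\<integral>\<^sup>+ s. ennreal (indicat_real ?Q s * (norm (S k s))\<^sup>2 / (real k)^4) \<partial>lborel) =
      ennreal (\<integral>s. indicat_real ?Q s * (norm (S k s))\<^sup>2 / (real k)^4 \<partial>lborel)"
      by (intro nn_integral_eq_integral) auto
    also have "(\<integral>s. indicat_real ?Q s * (norm (S k s))\<^sup>2 / (real k)^4 \<partial>lborel) = (\<integral>s. indicat_real ?Q s * (norm (S k s))\<^sup>2 \<partial>lborel) / (real k)^4"
      by (rule integral_divide_zero)
    also have "\<dots> \<le> (D * (real k)\<^sup>2) / (real k)^4"
      using var[of k] by (intro divide_right_mono) (auto simp: D_def)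
    also have "\<dots> = D / (real k)\<^sup>2"
      by (cases "k = 0") (simp_all add: power2_eq_square power4_eq_xxxx)
    finally show ?thesis
      by (simp add: ennreal_leI)
  qed
  have D0: "D \<ge> 0"
  proof -
    have "0 \<le> C * (real 1)\<^sup>2"
      using V(3)[of 1] by (meson of_nat_0_le_iff order_trans)
    then show ?thesis
      by (simp add: D_def)
  qed
  have "(\<integral>\<^sup>+ s. suminf (\<lambda>k. ennreal (indicat_real ?Q s * (norm (S k s))\<^sup>2 / (real k)^4)) \<partial>lborel) =
    suminf (\<lambda>k. \<integral>\<^sup>+ s. ennreal (indicat_real ?Q s * (norm (S k s))\<^sup>2 / (real k)^4) \<partial>lborel)"
    by (intro nn_integral_suminf) measurable
  also have "\<dots> \<le> suminf (\<lambda>k. ennreal (D / (real k)\<^sup>2))"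
    by (intro suminf_le nn) auto
  also have "\<dots> < \<infinity>"
  proof -
    have "summable (\<lambda>k. D * (1 / (real k)\<^sup>2))"
      using inverse_power_summable[of 2, where 'a = real] by (intro summable_mult) (simp add: inverse_eq_divide)
    then have "suminf (\<lambda>k. ennreal (D / (real k)\<^sup>2)) = ennreal (suminf (\<lambda>k. D / (real k)\<^sup>2))"
      using D0 by (intro suminf_ennreal2) auto
    then show ?thesis
      by simp
  qed
  finally have fin: "(\<integral>\<^sup>+ s. suminf (\<lambda>k. ennreal (indicat_real ?Q s * (norm (S k s))\<^sup>2 / (real k)^4)) \<partial>lborel) < \<infinity>" .
  have "(\<lambda>s. suminf (\<lambda>k. ennreal (indicat_real ?Q s * (norm (S k s))\<^sup>2 / (real k)^4))) \<in> borel_measurable lborel"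
    by measurable
  from nn_integral_PInf_AE[OF this] fin have "AE s in lborel. suminf (\<lambda>k. ennreal (indicat_real ?Q s * (norm (S k s))\<^sup>2 / (real k)^4)) \<noteq> \<infinity>"
    by simp
  then show ?thesis
  proof eventually_elim
    case (elim s)
    show ?case
    proof
      assume s: "s \<in> ?Q"
      have "summable (\<lambda>k. indicat_real ?Q s * (norm (S k s))\<^sup>2 / (real k)^4)"
        using elim by (intro summable_suminf_not_top) auto
      then have "(\<lambda>k. (norm (S k s) / (real k)\<^sup>2)\<^sup>2) \<longlonglongrightarrow> 0"
        using s by (auto dest!: summable_LIMSEQ_zero simp: power_divide)
      then have "(\<lambda>k. sqrt ((norm (S k s) / (real k)\<^sup>2)\<^sup>2)) \<longlonglongrightarrow> sqrt 0"
        by (rule tendsto_real_sqrt)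
      then have "(\<lambda>k. norm (S k s / (real k)\<^sup>2)) \<longlonglongrightarrow> 0"
        by (simp add: norm_divide norm_power)
      then show "(\<lambda>k. (\<Sum>(p, q)\<in>V k. H p q s) / (real k)\<^sup>2) \<longlonglongrightarrow> 0"
        unfolding S_def by (rule tendsto_norm_zero_cancel)
    qed
  qed
qed

section \<open>Almost every marked torus\<close>

lemma continuous_on_axis:
  fixes f :: "'a::topological_space \<Rightarrow> complex"
  assumes "continuous_on S f"
  shows "continuous_on S (\<lambda>s. axis i (f s))"
  unfolding axis_def
proof (rule continuous_on_vec_lambda)
  show "continuous_on S (\<lambda>s. if k = i then f s else 0)" for k
    using assms by (cases "k = i") auto
qed

text \<open>By Fubini and translation invariance in the marks, the measure of a slice of
  \<open>B\<close> times the area of the square is the integral of the displaced indicator, which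
  vanishes by \<open>hyp\<close>. Displacing one mark thus controls the whole parameter
  space.\<close>

lemma AE_shift_mark:
  fixes B :: "'n::finite marked_torus set"
  assumes Bm: "B \<in> sets borel" and d: "d > 0"
    and hyp: "\<And>a b P. AE s in lborel. s \<in> torus_square d \<longrightarrow>
      (a, b, P + axis i (of_real (fst s) * a + of_real (snd s) * b)) \<notin> B"
  shows "AE y in lborel. y \<notin> B"
proof -
  have slice: "AE P in lborel. (a, b, P) \<notin> B" for a b
  proof -
    define E where "E = {P. (a, b, P) \<in> B}"
    have Em [measurable]: "E \<in> sets borel"
    proof -
      have "(\<lambda>P. (a, b, P)) \<in> borel_measurable (borel :: (complex ^ 'n) measure)"
        by (intro borel_measurable_continuous_onI continuous_intros)
      from measurable_sets[OF this Bm] show ?thesis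
        by (simp add: E_def vimage_def)
    qed
    define t where "t s = (axis i (of_real (fst s) * a + of_real (snd s) * b) :: complex ^ 'n)" for s :: "real \<times> real"
    have "continuous_on UNIV t"
      unfolding t_def by (intro continuous_on_axis continuous_intros)
    then have tm [measurable]: "t \<in> borel_measurable borel"
      by (rule borel_measurable_continuous_onI)
    have "(\<integral>\<^sup>+ s. (\<integral>\<^sup>+ P. indicator (torus_square d) s * indicator E (P + t s) \<partial>lborel) \<partial>lborel) =
      (\<integral>\<^sup>+ P. (\<integral>\<^sup>+ s. indicator (torus_square d) s * indicator E (P + t s) \<partial>lborel) \<partial>lborel)"
      by (rule lborel_pair.Fubini') measurable
    also have "\<dots> = (\<integral>\<^sup>+ P. 0 \<partial>(lborel :: (complex ^ 'n) measure))"
    proof (rule nn_integral_cong)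
      fix P :: "complex ^ 'n"
      have "AE s in lborel. indicator (torus_square d) s * indicator E (P + t s) = (0 :: ennreal)"
        using hyp[of a b P] by eventually_elim (auto simp: indicator_def E_def t_def)
      then show "(\<integral>\<^sup>+ s. indicator (torus_square d) s * indicator E (P + t s) \<partial>lborel) = 0"
        by (subst nn_integral_0_iff_AE) auto
    qed
    finally have "(\<integral>\<^sup>+ s. (\<integral>\<^sup>+ P. indicator (torus_square d) s * indicator E (P + t s) \<partial>lborel) \<partial>lborel) = 0"
      by simp
    moreover have "(\<integral>\<^sup>+ P. indicator (torus_square d) s * indicator E (P + t s) \<partial>lborel) = indicator (torus_square d) s * emeasure lborel E" for s
    proof -
      have "(\<integral>\<^sup>+ P. indicator E (P + t s) \<partial>lborel) = (\<integral>\<^sup>+ P. indicator E P \<partial>distr lborel borel ((+) (t s)))"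
        by (subst nn_integral_distr) (auto simp: add.commute)
      also have "\<dots> = emeasure lborel E"
        by (subst lborel_distr_plus) simp
      finally show ?thesis
        by (simp add: nn_integral_cmult)
    qed
    ultimately have "emeasure lborel (torus_square d) * emeasure lborel E = 0"
      by (simp add: nn_integral_multc)
    then have "emeasure lborel E = 0"
      using d by (simp add: emeasure_torus_square)
    then have "AE P in lborel. P \<notin> E"
      by (intro AE_not_in) auto
    then show ?thesis
      by (simp add: E_def)
  qed
  have Bm2: "B \<in> sets (lborel \<Otimes>\<^sub>M (lborel \<Otimes>\<^sub>M lborel))"
    using Bm unfolding lborel_prod by simp
  have sets2: "{w. (a, w) \<notin> B} \<in> sets borel" for a
  proof -
    have "(\<lambda>w. (a, w)) \<in> borel_measurable (borel :: (complex \<times> (complex ^ 'n)) measure)"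
      by (intro borel_measurable_continuous_onI continuous_intros)
    from measurable_sets[OF this, of "- B"] Bm show ?thesis
      by (simp add: vimage_def)
  qed
  have slice2: "AE w in lborel. (a, w) \<notin> B" for a
  proof -
    have "AE w in lborel \<Otimes>\<^sub>M lborel. (a, w) \<notin> B"
      using slice[of a] sets2[of a] unfolding lborel_prod by (intro lborel_pair.AE_pair_measure[unfolded lborel_prod]) auto
    then show ?thesis
      unfolding lborel_prod .
  qed
  have "{w \<in> space (lborel \<Otimes>\<^sub>M (lborel \<Otimes>\<^sub>M lborel)). w \<notin> B} \<in> sets (lborel \<Otimes>\<^sub>M (lborel \<Otimes>\<^sub>M lborel))"
    using sets.compl_sets[OF Bm2] by (simp add: set_diff_eq)
  then have "AE y in lborel \<Otimes>\<^sub>M lborel. y \<notin> B"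
    using slice2 unfolding lborel_prod by (intro lborel_pair.AE_pair_measure[unfolded lborel_prod]) auto
  then show ?thesis
    unfolding lborel_prod .
qed

text \<open>The function \<open>heights\<close> for a torus without a cover, since the almost
  everywhere statements are made before \<alpha> is given.\<close>

definition mark_heights :: "('n::finite \<Rightarrow> int) \<Rightarrow> 'n marked_torus \<Rightarrow> complex \<Rightarrow> complex \<Rightarrow> int" where
  "mark_heights \<delta> x v z = (\<Sum>i\<in>UNIV. \<delta> i * \<lfloor>crs v (z - mark x i)\<rfloor>)"

definition lvec :: "'n::finite marked_torus \<Rightarrow> int \<Rightarrow> int \<Rightarrow> complex" where
  "lvec x p q = of_int p * per1 x + of_int q * per2 x"

text \<open>The average over the torus of the character \<open>j\<close> of the floor term. The
  fundamental domain is written by inequalities in \<open>z\<close> and the periods, which makes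
  joint measurability evident; for unit area it is the usual cell.\<close>

definition char_mean :: "nat \<Rightarrow> ('n::finite \<Rightarrow> int) \<Rightarrow> 'n marked_torus \<Rightarrow> int \<Rightarrow> int \<Rightarrow> int \<Rightarrow> complex" where
  "char_mean d \<delta> x j p q =
    (\<integral>z. indicat_real {z. 0 \<le> crs z (per2 x) \<and> crs z (per2 x) < 1 \<and> 0 \<le> crs (per1 x) z \<and> crs (per1 x) z < 1} z *\<^sub>R
      ech d (- j * mark_heights \<delta> x (lvec x p q) z) \<partial>lborel)"

text \<open>\<open>A\<close> and \<open>B\<close> are arbitrary integers here, which keeps the sum a
  function of the marked torus alone; a cover later inserts its own values.\<close>

definition char_sum :: "nat \<Rightarrow> ('n::finite \<Rightarrow> int) \<Rightarrow> int \<Rightarrow> int \<Rightarrow> int \<Rightarrow> 'n marked_torus \<Rightarrow> real \<Rightarrow> complex" where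
  "char_sum d \<delta> A B j x R = (\<Sum>(p, q) | coprime p q \<and> cmod (lvec x p q) < R.
     ech d (j * (p * A + q * B)) * char_mean d \<delta> x j p q)"

section \<open>Properties of the character means\<close>

lemma unit_cell:
  assumes "crs a b = 1"
  shows "{z. 0 \<le> crs z b \<and> crs z b < 1 \<and> 0 \<le> crs a z \<and> crs a z < 1} = cell a b"
  using cell_iff[of a b] assms by auto

lemma ech_measurable [measurable]:
  assumes "(\<lambda>s. real_of_int (f s)) \<in> borel_measurable M"
  shows "(\<lambda>s. ech d (f s)) \<in> borel_measurable M"
proof -
  have "cis \<in> borel_measurable borel"
    by (intro borel_measurable_continuous_onI continuous_on_cis continuous_on_id)
  then show ?thesis
    unfolding ech_def using assms by measurable
qed

lemma mark_heights_measurable: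
  fixes x :: "'s \<Rightarrow> 'n::finite marked_torus"
  assumes [measurable]: "\<And>i. (\<lambda>s. mark (x s) i) \<in> borel_measurable M" "v \<in> borel_measurable M" "z \<in> borel_measurable M"
  shows "(\<lambda>s. real_of_int (- j * mark_heights \<delta> (x s) (v s) (z s))) \<in> borel_measurable M"
  unfolding mark_heights_def of_int_mult of_int_sum by measurable

lemma char_mean_measurable:
  fixes x :: "'s \<Rightarrow> 'n::finite marked_torus"
  assumes [measurable]: "\<And>i. (\<lambda>s. mark (x s) i) \<in> borel_measurable M"
    "(\<lambda>s. per1 (x s)) \<in> borel_measurable M" "(\<lambda>s. per2 (x s)) \<in> borel_measurable M"
  shows "(\<lambda>s. char_mean d \<delta> (x s) j p q) \<in> borel_measurable M"
  unfolding char_mean_def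
proof (rule lborel.borel_measurable_lebesgue_integral)
  have [measurable]: "(\<lambda>w. real_of_int (- j * mark_heights \<delta> (x (fst w)) (lvec (x (fst w)) p q) (snd w))) \<in> borel_measurable (M \<Otimes>\<^sub>M lborel)"
    unfolding lvec_def by (intro mark_heights_measurable) measurable
  have [measurable]: "(\<lambda>w. indicat_real {z. 0 \<le> crs z (per2 (x (fst w))) \<and> crs z (per2 (x (fst w))) < 1 \<and> 0 \<le> crs (per1 (x (fst w))) z \<and> crs (per1 (x (fst w))) z < 1} (snd w)) \<in> borel_measurable (M \<Otimes>\<^sub>M lborel)"
    unfolding indicator_def mem_Collect_eq by measurable
  show "(\<lambda>(s, z). indicat_real {z. 0 \<le> crs z (per2 (x s)) \<and> crs z (per2 (x s)) < 1 \<and> 0 \<le> crs (per1 (x s)) z \<and> crs (per1 (x s)) z < 1} z *\<^sub>R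
      ech d (- j * mark_heights \<delta> (x s) (lvec (x s) p q) z)) \<in> borel_measurable (M \<Otimes>\<^sub>M lborel)"
    unfolding case_prod_unfold by measurable
qed

lemma char_mean_norm:
  assumes "crs (per1 x) (per2 x) = 1"
  shows "norm (char_mean d \<delta> x j p q) \<le> 1"
proof -
  have C: "{z. 0 \<le> crs z (per2 x) \<and> crs z (per2 x) < 1 \<and> 0 \<le> crs (per1 x) z \<and> crs (per1 x) z < 1} = cell (per1 x) (per2 x)"
    by (rule unit_cell[OF assms])
  have cm: "cell (per1 x) (per2 x) \<in> sets borel" "emeasure lborel (cell (per1 x) (per2 x)) = 1"
    using cell_borel emeasure_cell assms by auto
  have E: "(\<lambda>z. ech d (- j * mark_heights \<delta> x (lvec x p q) z)) \<in> borel_measurable borel"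
    by (intro ech_measurable mark_heights_measurable) auto
  have "norm (char_mean d \<delta> x j p q) \<le> (\<integral>z. indicat_real (cell (per1 x) (per2 x)) z \<partial>lborel)"
    unfolding char_mean_def C
  proof (rule Bochner_Integration.integral_norm_bound_integral)
    show "integrable lborel (\<lambda>z. indicat_real (cell (per1 x) (per2 x)) z *\<^sub>R ech d (- j * mark_heights \<delta> x (lvec x p q) z))"
    proof (rule integrableI_bounded_set[where A = "cell (per1 x) (per2 x)" and B = 1])
      show "(\<lambda>z. indicat_real (cell (per1 x) (per2 x)) z *\<^sub>R ech d (- j * mark_heights \<delta> x (lvec x p q) z)) \<in> borel_measurable lborel"
        using cm E by (intro borel_measurable_scaleR borel_measurable_indicator) auto
    qed (use cm in \<open>auto simp: indicator_def\<close>)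
  qed (use cm in auto)
  also have "\<dots> = 1"
    using cm by (simp add: measure_def)
  finally show ?thesis .
qed

text \<open>The displacement of mark \<open>i\<close> changes its height along \<open>(p, q)\<close>
  by the integer \<open>m\<close>, which passes through the floor. This is the equivariance that the
  strong law asks for.\<close>

lemma char_mean_shift:
  fixes x :: "'n::finite marked_torus"
  assumes area: "crs (per1 x) (per2 x) = 1" and m: "of_int p * \<tau>' - of_int q * \<sigma>' = real_of_int m"
  shows "char_mean d \<delta> (per1 x, per2 x, snd (snd x) + axis i (of_real (\<sigma> + \<sigma>') * per1 x + of_real (\<tau> + \<tau>') * per2 x)) j p q =
    ech d (j * \<delta> i * m) * char_mean d \<delta> (per1 x, per2 x, snd (snd x) + axis i (of_real \<sigma> * per1 x + of_real \<tau> * per2 x)) j p q"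
proof -
  let ?y = "(per1 x, per2 x, snd (snd x) + axis i (of_real \<sigma> * per1 x + of_real \<tau> * per2 x))"
  let ?y' = "(per1 x, per2 x, snd (snd x) + axis i (of_real (\<sigma> + \<sigma>') * per1 x + of_real (\<tau> + \<tau>') * per2 x))"
  let ?v = "lvec x p q"
  have v: "lvec ?y p q = ?v" "lvec ?y' p q = ?v"
    by (simp_all add: lvec_def)
  have cv: "crs ?v (of_real \<sigma>' * per1 x + of_real \<tau>' * per2 x) = real_of_int m"
  proof -
    have "crs ?v (of_real \<sigma>' * per1 x + of_real \<tau>' * per2 x) = of_int p * \<tau>' * crs (per1 x) (per2 x) - of_int q * \<sigma>' * crs (per1 x) (per2 x)"
      by (simp add: lvec_def crs_def algebra_simps)
    then show ?thesis
      using area m by simp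
  qed
  have h: "mark_heights \<delta> ?y' ?v z = mark_heights \<delta> ?y ?v z - \<delta> i * m" for z
  proof -
    have "\<lfloor>crs ?v (z - mark ?y' k)\<rfloor> = \<lfloor>crs ?v (z - mark ?y k)\<rfloor> - (if k = i then m else 0)" for k
    proof (cases "k = i")
      case True
      have "z - mark ?y' i = (z - mark ?y i) - (of_real \<sigma>' * per1 x + of_real \<tau>' * per2 x)"
        by (simp add: axis_def algebra_simps)
      then have "crs ?v (z - mark ?y' i) = crs ?v (z - mark ?y i) - real_of_int m"
        by (simp only: crs_linear(4)[of ?v "z - mark ?y i"] cv)
      then have "\<lfloor>crs ?v (z - mark ?y' i)\<rfloor> = \<lfloor>crs ?v (z - mark ?y i)\<rfloor> - m"
        by (simp only: floor_diff_of_int)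
      then show ?thesis
        using True by simp
    next
      case False
      then show ?thesis
        by (simp add: axis_def)
    qed
    then have "mark_heights \<delta> ?y' ?v z = (\<Sum>k\<in>UNIV. \<delta> k * (\<lfloor>crs ?v (z - mark ?y k)\<rfloor> - (if k = i then m else 0)))"
      by (simp only: mark_heights_def)
    also have "\<dots> = mark_heights \<delta> ?y ?v z - (\<Sum>k\<in>UNIV. \<delta> k * (if k = i then m else 0))"
      by (simp add: mark_heights_def right_diff_distrib sum_subtractf)
    also have "(\<Sum>k\<in>UNIV. \<delta> k * (if k = i then m else 0)) = \<delta> i * m"
      by (simp add: if_distrib[of "(*) _"] cong: if_cong)
    finally show ?thesis .
  qed
  have e: "ech d (- j * mark_heights \<delta> ?y' ?v z) = ech d (j * \<delta> i * m) * ech d (- j * mark_heights \<delta> ?y ?v z)" for z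
    unfolding h ech_add[symmetric] by (simp add: algebra_simps)
  show ?thesis
    unfolding char_mean_def v fst_conv snd_conv e
    by (simp add: integral_mult_right_zero[symmetric] del: integral_mult_right_zero)
qed

lemma rescale_components:
  "per1 (rescale_to_unit_area y) = of_real (1 / sqrt (torus_area y)) * per1 y"
  "per2 (rescale_to_unit_area y) = of_real (1 / sqrt (torus_area y)) * per2 y"
  "mark (rescale_to_unit_area y) i = of_real (1 / sqrt (torus_area y)) * mark y i"
proof -
  show "per1 (rescale_to_unit_area y) = of_real (1 / sqrt (torus_area y)) * per1 y"
    unfolding scaleR_conv_of_real[symmetric] by (simp add: rescale_to_unit_area_def)
  show "per2 (rescale_to_unit_area y) = of_real (1 / sqrt (torus_area y)) * per2 y"
    unfolding scaleR_conv_of_real[symmetric] by (simp add: rescale_to_unit_area_def)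
  show "mark (rescale_to_unit_area y) i = of_real (1 / sqrt (torus_area y)) * mark y i"
    unfolding scaleR_conv_of_real[symmetric] by (simp add: rescale_to_unit_area_def)
qed

lemma torus_area_crs: "torus_area y = crs (per1 y) (per2 y)"
  by (simp add: torus_area_def crs_def)

lemma rescale_area:
  assumes "torus_area y > 0"
  shows "crs (per1 (rescale_to_unit_area y)) (per2 (rescale_to_unit_area y)) = 1"
  unfolding rescale_components crs_simps torus_area_crs[symmetric] using assms by (simp add: field_simps)

text \<open>Within the displacements of mark \<open>i\<close> the strong law applies with
  \<open>e = j * \<delta> i\<close>, and \<open>AE_shift_mark\<close> collects these families of
  tori.\<close>

lemma char_sum_AE:
  fixes \<delta> :: "'n::finite \<Rightarrow> int"
  assumes d: "d \<ge> 1" and bad: "\<not> int d dvd j * \<delta> i"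
  shows "AE y in lborel. torus_area y > 0 \<longrightarrow>
    (\<lambda>k. char_sum d \<delta> A B j (rescale_to_unit_area y) (real k) / (real k)\<^sup>2) \<longlonglongrightarrow> 0"
proof -
  let ?r = "rescale_to_unit_area :: 'n marked_torus \<Rightarrow> 'n marked_torus"
  have m0 [measurable]: "(\<lambda>y :: 'n marked_torus. per1 y) \<in> borel_measurable borel" "(\<lambda>y :: 'n marked_torus. per2 y) \<in> borel_measurable borel"
    "\<And>i. (\<lambda>y :: 'n marked_torus. mark y i) \<in> borel_measurable borel"
    by (intro borel_measurable_continuous_onI continuous_intros)+
  have area_m [measurable]: "(\<lambda>y :: 'n marked_torus. torus_area y) \<in> borel_measurable borel"
    unfolding torus_area_crs by measurable
  have rm [measurable]: "(\<lambda>y. per1 (?r y)) \<in> borel_measurable borel" "(\<lambda>y. per2 (?r y)) \<in> borel_measurable borel"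
    "\<And>i. (\<lambda>y. mark (?r y) i) \<in> borel_measurable borel"
    unfolding rescale_components by measurable
  have cm [measurable]: "(\<lambda>y. char_mean d \<delta> (?r y) j p q) \<in> borel_measurable borel" for p q
    by (rule char_mean_measurable) measurable
  define f where "f k y = (if torus_area y > 0 then char_sum d \<delta> A B j (?r y) (real k) / (real k)\<^sup>2 else 0)" for k :: nat and y
  have fin: "finite {(p, q). cmod (lvec (?r y) p q) < R}" if "torus_area y > 0" for y R
    using lattice_count_bounds(1)[of "per1 (?r y)" "per2 (?r y)" 0 R] rescale_area[OF that] by (simp add: lvec_def)
  have fm [measurable]: "f k \<in> borel_measurable borel" for k
  proof (rule borel_measurable_LIMSEQ_metric)
    \<comment> \<open>The range of summation depends on \<open>y\<close>. Sums over a fixed box with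
      the range as a condition are measurable, and for large boxes they equal
      \<open>f k y\<close>.\<close>
    define G where "G M y = (if torus_area y > 0 then (\<Sum>w\<in>{-int M..int M} \<times> {-int M..int M}. if coprime (fst w) (snd w) \<and> cmod (lvec (?r y) (fst w) (snd w)) < real k
      then ech d (j * (fst w * A + snd w * B)) * char_mean d \<delta> (?r y) j (fst w) (snd w) else 0) / (real k)\<^sup>2 else 0)" for M y
    have "(\<lambda>y. cmod (lvec (?r y) p q)) \<in> borel_measurable borel" for p q
      unfolding lvec_def by measurable
    then show "G M \<in> borel_measurable borel" for M
      unfolding G_def by measurable
    fix y :: "'n marked_torus"
    show "(\<lambda>M. G M y) \<longlonglongrightarrow> f k y"
    proof (cases "torus_area y > 0")
      case True
      let ?W = "{(p, q). coprime p q \<and> cmod (lvec (?r y) p q) < real k}"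
      have finW: "finite ?W"
        by (rule finite_subset[OF _ fin[OF True, of "real k"]]) auto
      obtain M0 where M0: "\<And>w. w \<in> ?W \<Longrightarrow> nat \<bar>fst w\<bar> \<le> M0 \<and> nat \<bar>snd w\<bar> \<le> M0"
      proof
        fix w assume "w \<in> ?W"
        then have "nat \<bar>fst w\<bar> + nat \<bar>snd w\<bar> \<le> (\<Sum>w\<in>?W. nat \<bar>fst w\<bar> + nat \<bar>snd w\<bar>)"
          using finW by (intro member_le_sum) auto
        then show "nat \<bar>fst w\<bar> \<le> (\<Sum>w\<in>?W. nat \<bar>fst w\<bar> + nat \<bar>snd w\<bar>) \<and> nat \<bar>snd w\<bar> \<le> (\<Sum>w\<in>?W. nat \<bar>fst w\<bar> + nat \<bar>snd w\<bar>)"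
          by linarith
      qed
      have "G M y = f k y" if M: "M \<ge> M0" for M
      proof -
        have "?W \<subseteq> {-int M..int M} \<times> {-int M..int M}"
        proof
          fix w assume "w \<in> ?W"
          then have "nat \<bar>fst w\<bar> \<le> M \<and> nat \<bar>snd w\<bar> \<le> M"
            using M0 M by (meson order_trans)
          then show "w \<in> {-int M..int M} \<times> {-int M..int M}"
            by (cases w) auto
        qed
        then have "{w \<in> {-int M..int M} \<times> {-int M..int M}. coprime (fst w) (snd w) \<and> cmod (lvec (?r y) (fst w) (snd w)) < real k} = ?W"
          by auto
        then show ?thesis
          using True by (simp add: G_def f_def char_sum_def sum.inter_filter[symmetric] case_prod_unfold)
      qed
      then have "\<forall>\<^sub>F M in sequentially. G M y = f k y"
        by (auto simp: eventually_sequentially)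
      then show ?thesis
        by (rule tendsto_eventually)
    qed (simp add: G_def f_def)
  qed
  \<comment> \<open>Failure of convergence written with countable quantifiers, so that the set is
    Borel.\<close>
  define Bs where "Bs = {y. \<not> (\<forall>n. \<exists>K. \<forall>k\<ge>K. norm (f k y) < 1 / real (Suc n))}"
  have Bs: "y \<in> Bs \<longleftrightarrow> \<not> (\<lambda>k. f k y) \<longlonglongrightarrow> 0" for y
  proof -
    have "(\<forall>n. \<exists>K. \<forall>k\<ge>K. norm (f k y) < 1 / real (Suc n)) \<longleftrightarrow> (\<lambda>k. f k y) \<longlonglongrightarrow> 0"
    proof
      assume *: "\<forall>n. \<exists>K. \<forall>k\<ge>K. norm (f k y) < 1 / real (Suc n)"
      show "(\<lambda>k. f k y) \<longlonglongrightarrow> 0"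
      proof (rule LIMSEQ_I)
        fix r :: real assume "r > 0"
        then obtain n where "1 / real (Suc n) < r"
          using reals_Archimedean by (auto simp: inverse_eq_divide)
        then show "\<exists>no. \<forall>n\<ge>no. norm (f n y - 0) < r"
          using * by (metis diff_zero less_trans)
      qed
    next
      assume "(\<lambda>k. f k y) \<longlonglongrightarrow> 0"
      then show "\<forall>n. \<exists>K. \<forall>k\<ge>K. norm (f k y) < 1 / real (Suc n)"
        using LIMSEQ_D[of "\<lambda>k. f k y" 0] by simp
    qed
    then show ?thesis
      unfolding Bs_def mem_Collect_eq by (rule arg_cong[where f = Not])
  qed
  have "AE y in lborel. y \<notin> Bs"
  proof (rule AE_shift_mark[where d = "real d" and i = i])
    have "Bs = {y \<in> space borel. \<not> (\<forall>n. \<exists>K. \<forall>k\<ge>K. norm (f k y) < 1 / real (Suc n))}"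
      by (simp add: Bs_def)
    also have "\<dots> \<in> sets borel"
      by measurable
    finally show "Bs \<in> sets borel" .
    show "real d > 0"
      using d by simp
    fix a b :: complex and P :: "complex ^ 'n"
    show "AE s in lborel. s \<in> torus_square (real d) \<longrightarrow> (a, b, P + axis i (of_real (fst s) * a + of_real (snd s) * b)) \<notin> Bs"
    proof (cases "torus_area (a, b, P) > 0")
      case False
      then have "f k (a, b, w) = 0" for k w
        by (simp add: f_def torus_area_def)
      then show ?thesis
        by (intro AE_I2) (simp add: Bs)
    next
      case True
      define x where "x = ?r (a, b, P)"
      have area: "crs (per1 x) (per2 x) = 1"
        unfolding x_def by (rule rescale_area[OF True])
      define Y where "Y s = (a, b, P + axis i (of_real (fst s) * a + of_real (snd s) * b))" for s :: "real \<times> real"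
      \<comment> \<open>Displacing a mark leaves the area and hence the rescaling factor fixed, so
        the rescaled tori are again displacements of the one torus \<open>x\<close>.\<close>
      have aY: "torus_area (Y s) = torus_area (a, b, P)" for s
        by (simp add: Y_def torus_area_def)
      have rY: "?r (Y s) = (per1 x, per2 x, snd (snd x) + axis i (of_real (fst s) * per1 x + of_real (snd s) * per2 x))" for s
        unfolding rescale_to_unit_area_def aY x_def
        by (simp add: Y_def scaleR_add_right vec_eq_iff axis_def scaleR_conv_of_real[where 'a = complex] add_divide_distrib algebra_simps)
      define V where "V k = {(p, q). coprime p q \<and> cmod (lvec x p q) < real k}" for k :: nat
      define H where "H p q s = ech d (j * (p * A + q * B)) * char_mean d \<delta> (?r (Y s)) j p q" for p q s
      have lY: "lvec (?r (Y s)) p q = lvec x p q" for s p q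
        by (simp add: rY lvec_def)
      have "AE s in lborel. s \<in> torus_square (real d) \<longrightarrow> (\<lambda>k. (\<Sum>(p, q)\<in>V k. H p q s) / (real k)\<^sup>2) \<longlonglongrightarrow> 0"
      proof (rule strong_law_shift[OF d bad])
        show "H p q \<in> borel_measurable borel" for p q
        proof -
          have "continuous_on UNIV Y"
            unfolding Y_def by (intro continuous_intros continuous_on_axis)
          then have "Y \<in> borel_measurable borel"
            by (rule borel_measurable_continuous_onI)
          then have "(\<lambda>s. char_mean d \<delta> (?r (Y s)) j p q) \<in> borel_measurable borel"
            by (rule measurable_compose[OF _ cm])
          then show ?thesis
            unfolding H_def by measurable
        qed
        show "norm (H p q s) \<le> 1" for p q s
          using char_mean_norm[of "?r (Y s)" d \<delta> j p q] area by (simp add: H_def norm_mult rY)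
        show "H p q (\<sigma> + \<sigma>', \<tau> + \<tau>') = ech d (j * \<delta> i * m) * H p q (\<sigma>, \<tau>)"
          if "of_int p * \<tau>' - of_int q * \<sigma>' = real_of_int m" for p q \<sigma> \<tau> \<sigma>' \<tau>' m
          using char_mean_shift[OF area that, of d \<delta> i \<sigma> \<tau> j] by (simp add: H_def rY mult.left_commute)
        show "finite (V k)" for k
          unfolding V_def x_def by (rule finite_subset[OF _ fin[OF True, of "real k"]]) auto
        show "coprime p q" if "(p, q) \<in> V k" for k p q
          using that by (simp add: V_def)
        let ?K = "norm (per1 x) + norm (per2 x)"
        show "real (card (V k)) \<le> pi * (1 + ?K)\<^sup>2 * (real k)\<^sup>2" for k
        proof (cases "k = 0")
          case True
          then have "V k = {}"
            by (auto simp: V_def)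
          then show ?thesis by simp
        next
          case False
          have "real (card (V k)) \<le> real (card {(p, q). cmod (lvec x p q) < real k})"
            unfolding V_def x_def using fin[OF True] by (intro of_nat_mono card_mono) auto
          also have "\<dots> \<le> pi * (real k + ?K)\<^sup>2"
            using lattice_count_bounds(2)[of "per1 x" "per2 x" "real k" 0] area by (simp add: lvec_def)
          also have "\<dots> \<le> pi * ((1 + ?K) * real k)\<^sup>2"
          proof -
            have "?K * 1 \<le> ?K * real k"
              using False by (intro mult_left_mono) auto
            then show ?thesis
              by (intro mult_left_mono power_mono) (auto simp: algebra_simps)
          qed
          finally show ?thesis
            by (simp add: power_mult_distrib mult.assoc)
        qed
      qed
      then show ?thesis
      proof eventually_elim
        case (elim s)
        have "f k (Y s) = (\<Sum>(p, q)\<in>V k. H p q s) / (real k)\<^sup>2" for k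
          using True by (simp add: f_def aY char_sum_def lY V_def H_def)
        then show ?case
          using elim by (simp add: Bs Y_def[symmetric])
      qed
    qed
  qed
  then show ?thesis
    by eventually_elim (auto simp: Bs f_def)
qed

section \<open>Decoupling the characters\<close>

text \<open>Fourier inversion on \<int> / d.\<close>

lemma ech_expansion:
  fixes \<theta> :: "int \<Rightarrow> complex"
  assumes d: "d \<ge> 1" and per: "\<And>a b. [a = b] (mod int d) \<Longrightarrow> \<theta> a = \<theta> b"
  shows "\<theta> f = (\<Sum>j<d. \<Sum>r<d. \<theta> (int r) * ech d (int j * (f - int r))) / of_nat d"
proof -
  define r0 where "r0 = nat (f mod int d)"
  have r0: "int r0 = f mod int d" and r0d: "r0 < d"
    using d by (simp_all add: r0_def nat_less_iff)
  have iff: "int d dvd f - int r \<longleftrightarrow> r = r0" if "r < d" for r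
  proof -
    have "int d dvd f - int r \<longleftrightarrow> f mod int d = int r mod int d"
      by (simp add: mod_eq_dvd_iff)
    also have "\<dots> \<longleftrightarrow> int r0 = int r"
      using that by (simp add: r0)
    finally show ?thesis by auto
  qed
  have "(\<Sum>j<d. \<Sum>r<d. \<theta> (int r) * ech d (int j * (f - int r))) = (\<Sum>r<d. \<theta> (int r) * (\<Sum>j<d. ech d (int j * (f - int r))))"
    by (subst sum.swap) (simp only: sum_distrib_left)
  also have "\<dots> = (\<Sum>r<d. if r = r0 then \<theta> (int r) * of_nat d else 0)"
    by (intro sum.cong refl) (simp only: ech_orthogonal[OF d] iff lessThan_iff, simp)
  also have "\<dots> = \<theta> (int r0) * of_nat d"
    using r0d by simp
  also have "\<theta> (int r0) = \<theta> f"
    by (rule per) (simp add: r0 cong_def)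
  finally show ?thesis
    using d by simp
qed

lemma sum_swap_inner:
  "(\<Sum>s\<in>S. \<Sum>t\<in>T. \<Sum>j\<in>J. f s t j) = (\<Sum>j\<in>J. \<Sum>s\<in>S. \<Sum>t\<in>T. f s t j)"
proof -
  have "(\<Sum>t\<in>T. \<Sum>j\<in>J. f s t j) = (\<Sum>j\<in>J. \<Sum>t\<in>T. f s t j)" for s
    by (rule sum.swap)
  then show ?thesis
    by (simp only:) (rule sum.swap)
qed

context torus_cover
begin

definition gdelta :: int where
  "gdelta = Gcd (insert (int d) (range \<delta>))"

text \<open>By \<open>ordn_dvd\<close> the condition on \<open>f\<close> that \<open>d\<close>
  divides \<open>j * f\<close> is divisibility of \<open>f\<close> by the order of \<open>j\<close>.
  This passes from \<open>d\<close> and all \<delta> i to their gcd.\<close>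

lemma dvd_gdelta_iff: "int d dvd j * gdelta \<longleftrightarrow> (\<forall>i. int d dvd j * \<delta> i)"
proof
  assume *: "int d dvd j * gdelta"
  have "gdelta dvd \<delta> i" for i
    unfolding gdelta_def by (rule Gcd_dvd) simp
  then show "\<forall>i. int d dvd j * \<delta> i"
    using * by (meson dvd_trans mult_dvd_mono dvd_refl)
next
  assume *: "\<forall>i. int d dvd j * \<delta> i"
  have "int (ordn j) dvd \<delta> i" for i
    using * ordn_dvd[of "\<delta> i" j] by (simp add: mult.commute)
  moreover have "int (ordn j) dvd int d"
    using ordn_dvd[of "int d" j] by simp
  ultimately have "int (ordn j) dvd gdelta"
    unfolding gdelta_def by (intro Gcd_greatest) auto
  then show "int d dvd j * gdelta"
    using ordn_dvd[of gdelta j] by (simp add: mult.commute)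
qed

lemma mark_heights_eq: "mark_heights \<delta> x = heights"
  by (intro ext) (simp add: mark_heights_def heights_def)

lemma lvec_eq: "lvec x p q = vec p q"
  by (simp add: lvec_def)

text \<open>The length condition as a function of the monodromy alone; being of period
  \<open>d\<close>, it can be expanded in characters.\<close>

definition thr :: "real \<Rightarrow> real \<Rightarrow> int \<Rightarrow> complex" where
  "thr c R f = (if real (ordn f) * c < R then 1 else 0)"

lemma thr_cong: "[f = f'] (mod int d) \<Longrightarrow> thr c R f = thr c R f'"
  using ordn_cong[of f f'] by (simp add: thr_def)

lemma char_mean_eq:
  "char_mean d \<delta> x j p q = (\<integral>z. indicat_real fd z *\<^sub>R ech d (- j * heights (vec p q) z) \<partial>lborel)"
  unfolding char_mean_def unit_cell[OF area_1] fundamental_domain_cell mark_heights_eq lvec_eq ..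

lemma char_mean_good:
  assumes "int d dvd j * gdelta"
  shows "char_mean d \<delta> x j p q = 1"
proof -
  have dv: "int d dvd - j * heights v z" for v z
    unfolding heights_def sum_distrib_left
  proof (rule dvd_sum)
    fix i
    have "int d dvd (j * \<delta> i) * - \<lfloor>crs v (z - mark x i)\<rfloor>"
      using assms dvd_gdelta_iff by (blast intro: dvd_mult2)
    then show "int d dvd - j * (\<delta> i * \<lfloor>crs v (z - mark x i)\<rfloor>)"
      by (simp add: mult.assoc)
  qed
  have e: "ech d (- j * heights v z) = 1" for v z
    using ech_eq_1_iff[OF d_pos, of "- j * heights v z"] dv by blast
  have "char_mean d \<delta> x j p q = (\<integral>z. complex_of_real (indicat_real fd z) \<partial>lborel)"
    unfolding char_mean_eq e by (simp add: scaleR_conv_of_real)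
  also have "\<dots> = 1"
    by (subst integral_complex_of_real) (use fd_measure in simp)
  finally show ?thesis .
qed

text \<open>The length condition is expanded in characters and integrated over the torus. Only the
  floor term depends on the point, which leaves \<open>char_mean\<close>.\<close>

lemma measure_good_set:
  "complex_of_real (measure lborel (fd \<inter> good_set R p q)) =
    (\<Sum>j<d. \<Sum>r<d. (thr (cmod (vec p q)) R (int r) * ech d (- int j * int r) * ech d (int j * (p * gA + q * gB))) *
      char_mean d \<delta> x (int j) p q) / of_nat d"
proof -
  define m where "m = p * gA + q * gB"
  define I where "I j z = indicat_real fd z *\<^sub>R ech d (- int j * heights (vec p q) z)" for j z
  define c where "c j r = thr (cmod (vec p q)) R (int r) * ech d (- int j * int r) * ech d (int j * m)" for j r
  have E: "(\<lambda>z. ech d (- int j * heights (vec p q) z)) \<in> borel_measurable borel" for j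
    unfolding mark_heights_eq[symmetric] by (intro ech_measurable mark_heights_measurable) auto
  have int: "integrable lborel (I j)" for j
  proof (rule integrableI_bounded_set[where A = fd and B = 1])
    show "I j \<in> borel_measurable lborel"
      unfolding I_def using fd_measure E by (intro borel_measurable_scaleR borel_measurable_indicator) auto
  qed (use fd_measure in \<open>auto simp: indicator_def I_def\<close>)
  have pt: "complex_of_real (indicat_real (fd \<inter> good_set R p q) z) = (\<Sum>j<d. \<Sum>r<d. c j r * I j z) / of_nat d" for z
  proof (cases "z \<in> fd")
    case True
    then have "complex_of_real (indicat_real (fd \<inter> good_set R p q) z) = thr (cmod (vec p q)) R (m - heights (vec p q) z)"
      by (simp add: thr_def good_set_def indicator_def m_def)
    also have "\<dots> = (\<Sum>j<d. \<Sum>r<d. thr (cmod (vec p q)) R (int r) * ech d (int j * (m - heights (vec p q) z - int r))) / of_nat d"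
      by (rule ech_expansion[OF d_pos thr_cong])
    also have "(\<lambda>j r. thr (cmod (vec p q)) R (int r) * ech d (int j * (m - heights (vec p q) z - int r))) = (\<lambda>j r. c j r * I j z)"
    proof (intro ext)
      fix j r
      have "int j * (m - heights (vec p q) z - int r) = - int j * int r + (int j * m + - int j * heights (vec p q) z)"
        by (simp add: algebra_simps)
      then have "ech d (int j * (m - heights (vec p q) z - int r)) = ech d (- int j * int r) * (ech d (int j * m) * ech d (- int j * heights (vec p q) z))"
        by (simp only: ech_add)
      then show "thr (cmod (vec p q)) R (int r) * ech d (int j * (m - heights (vec p q) z - int r)) = c j r * I j z"
        using True by (simp add: c_def I_def)
    qed
    finally show ?thesis .
  next
    case False
    then show ?thesis
      by (simp add: I_def)
  qed
  have "complex_of_real (measure lborel (fd \<inter> good_set R p q)) = (\<integral>z. complex_of_real (indicat_real (fd \<inter> good_set R p q) z) \<partial>lborel)"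
    by (subst integral_complex_of_real) simp
  also have "\<dots> = (\<Sum>j<d. \<Sum>r<d. c j r * integral\<^sup>L lborel (I j)) / of_nat d"
    unfolding pt using int by (simp add: Bochner_Integration.integral_sum Bochner_Integration.integrable_sum)
  also have "(\<lambda>j. integral\<^sup>L lborel (I j)) = (\<lambda>j. char_mean d \<delta> x (int j) p q)"
    unfolding char_mean_eq I_def ..
  finally show ?thesis
    by (simp only: c_def m_def)
qed

text \<open>Summing over \<open>s\<close> and \<open>t\<close> kills a character \<open>j\<close>
  unless \<open>d\<close> divides the products of \<open>j * gdelta\<close> with \<open>p\<close>
  and with \<open>q\<close>, that is, by coprimality, \<open>j * gdelta\<close> itself. The
  surviving characters are those whose mean is 1 by \<open>char_mean_good\<close>.\<close>

lemma thr_average: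
  assumes cop: "coprime p q"
  shows "(\<Sum>s<d. \<Sum>t<d. thr c R (p * (gA + int s * gdelta) + q * (gB + int t * gdelta))) =
    of_nat d * (\<Sum>j<d. \<Sum>r<d. (thr c R (int r) * ech d (- int j * int r) * ech d (int j * (p * gA + q * gB))) *
      of_bool (int d dvd int j * gdelta))"
proof -
  define m where "m = p * gA + q * gB"
  define w where "w j r = thr c R (int r) * ech d (- int j * int r) * ech d (int j * m)" for j r
  define a where "a j = int j * gdelta" for j
  have "thr c R (p * (gA + int s * gdelta) + q * (gB + int t * gdelta)) =
    (\<Sum>j<d. \<Sum>r<d. w j r * (ech d (int s * (a j * p)) * ech d (int t * (a j * q)))) / of_nat d" for s t
  proof -
    let ?f = "p * (gA + int s * gdelta) + q * (gB + int t * gdelta)"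
    have "thr c R ?f = (\<Sum>j<d. \<Sum>r<d. thr c R (int r) * ech d (int j * (?f - int r))) / of_nat d"
      by (rule ech_expansion[OF d_pos thr_cong])
    also have "(\<lambda>j r. thr c R (int r) * ech d (int j * (?f - int r))) = (\<lambda>j r. w j r * (ech d (int s * (a j * p)) * ech d (int t * (a j * q))))"
    proof (intro ext)
      fix j r
      have "int j * (?f - int r) = - int j * int r + (int j * m + (int s * (a j * p) + int t * (a j * q)))"
        by (simp add: algebra_simps m_def a_def)
      then have "ech d (int j * (?f - int r)) = ech d (- int j * int r) * (ech d (int j * m) * (ech d (int s * (a j * p)) * ech d (int t * (a j * q))))"
        by (simp only: ech_add)
      then show "thr c R (int r) * ech d (int j * (?f - int r)) = w j r * (ech d (int s * (a j * p)) * ech d (int t * (a j * q)))"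
        by (simp add: w_def)
    qed
    finally show ?thesis .
  qed
  then have "(\<Sum>s<d. \<Sum>t<d. thr c R (p * (gA + int s * gdelta) + q * (gB + int t * gdelta))) =
    (\<Sum>s<d. \<Sum>t<d. \<Sum>j<d. \<Sum>r<d. w j r * (ech d (int s * (a j * p)) * ech d (int t * (a j * q)))) / of_nat d"
    by (simp only: sum_divide_distrib)
  also have "\<dots> = (\<Sum>j<d. \<Sum>r<d. \<Sum>s<d. \<Sum>t<d. w j r * (ech d (int s * (a j * p)) * ech d (int t * (a j * q)))) / of_nat d"
  proof (rule arg_cong[where f = "\<lambda>z. z / of_nat d"])
    let ?F = "\<lambda>s t j r. w j r * (ech d (int s * (a j * p)) * ech d (int t * (a j * q)))"
    have "(\<Sum>s<d. \<Sum>t<d. \<Sum>j<d. \<Sum>r<d. ?F s t j r) = (\<Sum>j<d. \<Sum>s<d. \<Sum>t<d. \<Sum>r<d. ?F s t j r)"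
      by (rule sum_swap_inner)
    also have "\<dots> = (\<Sum>j<d. \<Sum>r<d. \<Sum>s<d. \<Sum>t<d. ?F s t j r)"
      by (intro sum.cong refl sum_swap_inner)
    finally show "(\<Sum>s<d. \<Sum>t<d. \<Sum>j<d. \<Sum>r<d. ?F s t j r) = (\<Sum>j<d. \<Sum>r<d. \<Sum>s<d. \<Sum>t<d. ?F s t j r)" .
  qed
  also have "\<dots> = (\<Sum>j<d. \<Sum>r<d. w j r * ((\<Sum>s<d. ech d (int s * (a j * p))) * (\<Sum>t<d. ech d (int t * (a j * q))))) / of_nat d"
    unfolding sum_product by (simp only: sum_distrib_left)
  also have "\<dots> = (\<Sum>j<d. \<Sum>r<d. of_nat d * (of_nat d * (w j r * of_bool (int d dvd a j)))) / of_nat d"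
  proof -
    have iff: "int d dvd b * p \<and> int d dvd b * q \<longleftrightarrow> int d dvd b" for b
    proof
      assume "int d dvd b * p \<and> int d dvd b * q"
      then have "int d dvd gcd (b * p) (b * q)"
        by simp
      also have "gcd (b * p) (b * q) = \<bar>b\<bar>"
        using cop gcd_mult_distrib_int[of b p q] by simp
      finally show "int d dvd b" by simp
    qed auto
    have "(\<Sum>s<d. ech d (int s * (a j * p))) * (\<Sum>t<d. ech d (int t * (a j * q))) = of_nat d * (of_nat d * of_bool (int d dvd a j))" for j
      unfolding ech_orthogonal[OF d_pos] using iff[of "a j"] by auto
    then have "w j r * ((\<Sum>s<d. ech d (int s * (a j * p))) * (\<Sum>t<d. ech d (int t * (a j * q)))) = of_nat d * (of_nat d * (w j r * of_bool (int d dvd a j)))" for j r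
      by (simp only: mult.left_commute)
    then show ?thesis
      by (simp only:)
  qed
  also have "\<dots> = of_nat d * (\<Sum>j<d. \<Sum>r<d. w j r * of_bool (int d dvd a j))"
    using d_pos by (simp add: sum_distrib_left[symmetric])
  finally show ?thesis
    by (simp only: w_def a_def m_def)
qed

section \<open>Comparison of the area count with the shifted counts\<close>

definition area_count :: "real \<Rightarrow> real" where
  "area_count R = (\<Sum>(p, q) | coprime p q \<and> cmod (vec p q) < R. measure lborel (fd \<inter> good_set R p q))"

definition shifted_count :: "nat \<Rightarrow> nat \<Rightarrow> real \<Rightarrow> real" where
  "shifted_count s t R = real (card {(p, q). coprime p q \<and>
     real (ordn (p * (gA + int s * gdelta) + q * (gB + int t * gdelta))) * cmod (vec p q) < R})"

lemma prim_vec_finite: "finite {(p, q). coprime p q \<and> cmod (vec p q) < R}"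
  by (rule finite_subset[OF _ vec_finite[of R]]) auto

lemma ordn_cmod_le: "cmod v \<le> real (ordn f) * cmod v"
  using ordn_pos[of f] mult_right_mono[of 1 "real (ordn f)" "cmod v"] by simp

lemma thr_sum:
  fixes X :: "int \<Rightarrow> int \<Rightarrow> complex"
  shows "(\<Sum>(p, q) | coprime p q \<and> cmod (vec p q) < R. thr (cmod (vec p q)) R (f p q) * X p q) =
    (\<Sum>(p, q) | coprime p q \<and> real (ordn (f p q)) * cmod (vec p q) < R. X p q)"
proof -
  let ?V = "{(p, q). coprime p q \<and> cmod (vec p q) < R}"
  have "(\<Sum>(p, q)\<in>?V. thr (cmod (vec p q)) R (f p q) * X p q) =
      (\<Sum>w\<in>?V. if real (ordn (f (fst w) (snd w))) * cmod (vec (fst w) (snd w)) < R then X (fst w) (snd w) else 0)"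
    by (intro sum.cong refl) (auto simp: thr_def)
  also have "\<dots> = (\<Sum>w\<in>{w \<in> ?V. real (ordn (f (fst w) (snd w))) * cmod (vec (fst w) (snd w)) < R}. X (fst w) (snd w))"
    by (rule sum.inter_filter[OF prim_vec_finite, symmetric])
  also have "{w \<in> ?V. real (ordn (f (fst w) (snd w))) * cmod (vec (fst w) (snd w)) < R} =
      {(p, q). coprime p q \<and> real (ordn (f p q)) * cmod (vec p q) < R}"
    by (auto intro: le_less_trans[OF ordn_cmod_le])
  finally show ?thesis
    by (simp add: case_prod_unfold)
qed

text \<open>The two expansions agree on the characters with \<open>d\<close> dividing
  \<open>j * gdelta\<close>. What remains are character sums over the vectors shorter than
  \<open>R / ordn r\<close>, the length condition for the residue \<open>r\<close>.\<close>

lemma area_count_decomposition: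
  "complex_of_real (area_count R - (\<Sum>s<d. \<Sum>t<d. shifted_count s t R) / (real d)\<^sup>2) =
    (\<Sum>j<d. \<Sum>r<d. ech d (- int j * int r) * (if int d dvd int j * gdelta then 0
       else char_sum d \<delta> gA gB (int j) x (R / real (ordn (int r))))) / of_nat d"
proof -
  let ?V = "{(p, q). coprime p q \<and> cmod (vec p q) < R}"
  define w where "w p q j r = thr (cmod (vec p q)) R (int r) * ech d (- int j * int r) * ech d (int j * (p * gA + q * gB))" for p q j r
  define h where "h p q j = char_mean d \<delta> x (int j) p q" for p q j
  define b where "b j = (of_bool (int d dvd int j * gdelta) :: complex)" for j
  have 1: "complex_of_real (area_count R) = (\<Sum>(p, q)\<in>?V. (\<Sum>j<d. \<Sum>r<d. w p q j r * h p q j) / of_nat d)"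
    unfolding area_count_def of_real_sum case_prod_unfold by (simp only: measure_good_set w_def h_def)
  have shifted: "complex_of_real (shifted_count s t R) =
      (\<Sum>(p, q)\<in>?V. thr (cmod (vec p q)) R (p * (gA + int s * gdelta) + q * (gB + int t * gdelta)))" for s t
    using thr_sum[of R "\<lambda>p q. p * (gA + int s * gdelta) + q * (gB + int t * gdelta)" "\<lambda>_ _. 1"]
    by (simp add: shifted_count_def case_prod_unfold)
  have "complex_of_real (\<Sum>s<d. \<Sum>t<d. shifted_count s t R) =
      (\<Sum>(p, q)\<in>?V. \<Sum>s<d. \<Sum>t<d. thr (cmod (vec p q)) R (p * (gA + int s * gdelta) + q * (gB + int t * gdelta)))"
    unfolding of_real_sum shifted case_prod_unfold by (rule sum_swap_inner)
  also have "\<dots> = (\<Sum>(p, q)\<in>?V. of_nat d * (\<Sum>j<d. \<Sum>r<d. w p q j r * b j))"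
    by (intro sum.cong refl) (auto simp only: thr_average w_def b_def split: prod.splits)
  finally have 2: "complex_of_real (\<Sum>s<d. \<Sum>t<d. shifted_count s t R) = (\<Sum>(p, q)\<in>?V. of_nat d * (\<Sum>j<d. \<Sum>r<d. w p q j r * b j))" .
  have "complex_of_real (area_count R - (\<Sum>s<d. \<Sum>t<d. shifted_count s t R) / (real d)\<^sup>2) =
      (\<Sum>(p, q)\<in>?V. (\<Sum>j<d. \<Sum>r<d. w p q j r * h p q j) / of_nat d) - (\<Sum>(p, q)\<in>?V. of_nat d * (\<Sum>j<d. \<Sum>r<d. w p q j r * b j)) / (of_nat d)\<^sup>2"
    unfolding of_real_diff of_real_divide 1 2 by simp
  also have "\<dots> = (\<Sum>(p, q)\<in>?V. (\<Sum>j<d. \<Sum>r<d. w p q j r * (h p q j - b j)) / of_nat d)"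
    using d_pos by (simp add: sum_divide_distrib case_prod_unfold sum_subtractf[symmetric] right_diff_distrib diff_divide_distrib power2_eq_square)
  also have "\<dots> = (\<Sum>j<d. \<Sum>r<d. \<Sum>(p, q)\<in>?V. w p q j r * (h p q j - b j)) / of_nat d"
    unfolding sum_divide_distrib[symmetric] case_prod_unfold
    by (rule arg_cong[where f = "\<lambda>z. z / of_nat d", OF sum_swap_inner[symmetric]])
  also have "\<dots> = (\<Sum>j<d. \<Sum>r<d. ech d (- int j * int r) * (if int d dvd int j * gdelta then 0
       else char_sum d \<delta> gA gB (int j) x (R / real (ordn (int r))))) / of_nat d"
  proof -
    have "(\<Sum>(p, q)\<in>?V. w p q j r * (h p q j - b j)) = ech d (- int j * int r) * (if int d dvd int j * gdelta then 0
       else char_sum d \<delta> gA gB (int j) x (R / real (ordn (int r))))" for j r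
    proof (cases "int d dvd int j * gdelta")
      case True
      then have "h p q j - b j = 0" for p q
        by (simp add: h_def b_def char_mean_good)
      then show ?thesis
        using True by simp
    next
      case False
      have V: "{(p, q). coprime p q \<and> real (ordn (int r)) * cmod (vec p q) < R} = {(p, q). coprime p q \<and> cmod (lvec x p q) < R / real (ordn (int r))}"
        using ordn_pos[of "int r"] by (auto simp: lvec_eq pos_less_divide_eq mult.commute)
      have "(\<Sum>(p, q)\<in>?V. w p q j r * (h p q j - b j)) =
          ech d (- int j * int r) * (\<Sum>(p, q)\<in>?V. thr (cmod (vec p q)) R (int r) * (ech d (int j * (p * gA + q * gB)) * char_mean d \<delta> x (int j) p q))"
        using False unfolding sum_distrib_left by (intro sum.cong refl) (auto simp: w_def h_def b_def)
      also have "\<dots> = ech d (- int j * int r) * char_sum d \<delta> gA gB (int j) x (R / real (ordn (int r)))"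
        unfolding thr_sum V char_sum_def ..
      finally show ?thesis
        using False by simp
    qed
    then show ?thesis
      by (simp only:)
  qed
  finally show ?thesis .
qed

end

section \<open>The limit of the cylinder area sum\<close>

context torus_cover
begin

text \<open>The terms have modulus at most 1, so passing from \<open>R\<close> to the next integer
  changes the sum by at most the number of lattice vectors in a ring of width at most 1. By the
  lattice point asymptotics this number is o(R^2).\<close>

lemma char_sum_tendsto_real:
  assumes lim: "(\<lambda>k. char_sum d \<delta> A B j x (real k) / (real k)\<^sup>2) \<longlonglongrightarrow> 0"
  shows "((\<lambda>R. norm (char_sum d \<delta> A B j x R) / R\<^sup>2) \<longlongrightarrow> 0) at_top"
proof (rule tendsto_sandwich[where f = "\<lambda>_. 0"])
  define S where "S R = char_sum d \<delta> A B j x R" for R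
  define C where "C R = real (card {(p, q). cmod (vec p q) < R})" for R
  define k where "k R = nat \<lceil>R\<rceil>" for R :: real
  have k: "R \<le> real (k R)" "R > 0 \<Longrightarrow> real (k R) < R + 1" for R
    unfolding k_def by linarith+
  have klim: "filterlim k sequentially at_top"
    unfolding filterlim_at_top
  proof
    fix Z :: nat
    show "\<forall>\<^sub>F R in at_top. Z \<le> k R"
      using eventually_ge_at_top[of "real Z"]
    proof eventually_elim
      case (elim R)
      then show ?case
        using k(1)[of R] by linarith
    qed
  qed
  have ratio: "((\<lambda>R. real (k R) / R) \<longlongrightarrow> 1) at_top"
  proof (rule tendsto_sandwich)
    show "\<forall>\<^sub>F R in at_top. 1 \<le> real (k R) / R"
      using eventually_gt_at_top[of "0 :: real"] by eventually_elim (simp add: k(1))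
    show "\<forall>\<^sub>F R in at_top. real (k R) / R \<le> 1 + 1 / R"
      using eventually_gt_at_top[of "0 :: real"] by eventually_elim (use k(2) less_imp_le in \<open>auto simp: field_simps\<close>)
    have "((\<lambda>R::real. 1 / R) \<longlongrightarrow> 0) at_top"
      by (intro tendsto_divide_0[OF tendsto_const] filterlim_at_top_imp_at_infinity filterlim_ident)
    from tendsto_add[OF tendsto_const this, of 1] show "((\<lambda>R::real. 1 + 1 / R) \<longlongrightarrow> 1) at_top"
      by simp
  qed auto
  have Clim: "((\<lambda>R. C R / R\<^sup>2) \<longlongrightarrow> pi) at_top"
    using lattice_count_asymp[of "per1 x" "per2 x" 0] area_1 by (simp add: C_def)
  have klimR: "filterlim (\<lambda>R. real (k R)) at_top at_top"
    by (rule filterlim_compose[OF filterlim_real_sequentially klim])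
  have S0: "((\<lambda>R. norm (S (real (k R))) / (real (k R))\<^sup>2) \<longlongrightarrow> 0) at_top"
  proof -
    have "(\<lambda>m. norm (S (real m)) / (real m)\<^sup>2) \<longlonglongrightarrow> 0"
      using tendsto_norm[OF lim] by (simp add: S_def norm_divide norm_power)
    then show ?thesis
      by (rule filterlim_compose[OF _ klim])
  qed
  have "((\<lambda>R. norm (S (real (k R))) / (real (k R))\<^sup>2 * (real (k R) / R)\<^sup>2 + (C (real (k R)) / (real (k R))\<^sup>2 * (real (k R) / R)\<^sup>2 - C R / R\<^sup>2)) \<longlongrightarrow> 0 * 1\<^sup>2 + (pi * 1\<^sup>2 - pi)) at_top"
    by (intro tendsto_intros S0 ratio Clim filterlim_compose[OF Clim klimR])
  then show "((\<lambda>R. norm (S (real (k R))) / (real (k R))\<^sup>2 * (real (k R) / R)\<^sup>2 + (C (real (k R)) / (real (k R))\<^sup>2 * (real (k R) / R)\<^sup>2 - C R / R\<^sup>2)) \<longlongrightarrow> 0) at_top"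
    by simp
  show "\<forall>\<^sub>F R in at_top. norm (char_sum d \<delta> A B j x R) / R\<^sup>2 \<le>
      norm (S (real (k R))) / (real (k R))\<^sup>2 * (real (k R) / R)\<^sup>2 + (C (real (k R)) / (real (k R))\<^sup>2 * (real (k R) / R)\<^sup>2 - C R / R\<^sup>2)"
    using eventually_gt_at_top[of "0 :: real"]
  proof eventually_elim
    case (elim R)
    let ?K = "real (k R)"
    have K: "R \<le> ?K" "?K > 0"
      using k(1)[of R] elim by linarith+
    let ?V = "\<lambda>R. {(p, q). coprime p q \<and> cmod (vec p q) < R}" and ?W = "\<lambda>R. {(p, q). cmod (vec p q) < R}"
    let ?X = "\<lambda>(p, q). ech d (j * (p * A + q * B)) * char_mean d \<delta> x j p q"
    have Veq: "S R = sum ?X (?V R)" for R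
      by (simp add: S_def char_sum_def lvec_eq)
    have sub: "?V R \<subseteq> ?V ?K" "?W R \<subseteq> ?W ?K" "?V ?K - ?V R \<subseteq> ?W ?K - ?W R"
      using K(1) by auto
    have diff: "S ?K - S R = sum ?X (?V ?K - ?V R)"
      unfolding Veq by (rule sum_diff[OF prim_vec_finite sub(1), symmetric])
    have "norm (S ?K - S R) \<le> (\<Sum>w\<in>?V ?K - ?V R. 1)"
      unfolding diff
      using char_mean_norm[OF area_1, of d \<delta> j] by (intro sum_norm_le) (auto simp: norm_mult)
    also have "\<dots> = real (card (?V ?K - ?V R))"
      by simp
    also have "\<dots> \<le> real (card (?W ?K - ?W R))"
      using sub(3) vec_finite[of ?K] by (intro of_nat_mono card_mono) auto
    also have "\<dots> = C ?K - C R"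
      unfolding C_def using sub(2) vec_finite[of R] vec_finite[of ?K]
      by (subst card_Diff_subset) (auto simp: of_nat_diff card_mono)
    finally have "norm (S ?K - S R) \<le> C ?K - C R" .
    then have "norm (S R) \<le> norm (S ?K) + (C ?K - C R)"
      using norm_triangle_ineq2[of "S R" "S ?K"] by (simp add: norm_minus_commute)
    then have "norm (S R) / R\<^sup>2 \<le> (norm (S ?K) + (C ?K - C R)) / R\<^sup>2"
      by (rule divide_right_mono) simp
    also have "\<dots> = norm (S ?K) / ?K\<^sup>2 * (?K / R)\<^sup>2 + (C ?K / ?K\<^sup>2 * (?K / R)\<^sup>2 - C R / R\<^sup>2)"
      using K(2) by (simp add: power_divide add_divide_distrib diff_divide_distrib)
    finally show ?case
      by (simp add: S_def)
  qed
qed auto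

text \<open>The shifted counts have density 6 / (pi d) times a gcd, and the average of these gcds is
  the totient sum. The factor 1 / 2 of the area formula, R^2 = d L^2 and the division by pi turn
  this into 3 / pi^2.\<close>

theorem cylinder_area_limit:
  assumes lim: "\<And>j. j < d \<Longrightarrow> \<not> int d dvd int j * gdelta \<Longrightarrow>
    (\<lambda>k. char_sum d \<delta> gA gB (int j) x (real k) / (real k)\<^sup>2) \<longlonglongrightarrow> 0"
  shows "((\<lambda>L. cylinder_area_sum x \<alpha> L / (pi * L\<^sup>2)) \<longlongrightarrow>
    3 / pi\<^sup>2 * (\<Sum>k | k dvd d_abs d \<delta>. real (totient k) / (real k)\<^sup>2)) at_top"
proof -
  define T where "T R = (\<Sum>s<d. \<Sum>t<d. shifted_count s t R) / (real d)\<^sup>2" for R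
  define \<Sigma> where "\<Sigma> = (\<Sum>k | k dvd d_abs d \<delta>. real (totient k) / (real k)\<^sup>2)"
  define E where "E j r R = (if int d dvd int j * gdelta then 0 else norm (char_sum d \<delta> gA gB (int j) x (R / real (ordn (int r)))))" for j r R
  have "((\<lambda>R. shifted_count s t R / R\<^sup>2) \<longlongrightarrow> 6 / pi * real_of_int (gcd (gcd (gA + int s * gdelta) (gB + int t * gdelta)) (int d)) / real d) at_top" for s t
    unfolding shifted_count_def by (rule prim_kernel_count_asymp)
  then have "((\<lambda>R. (\<Sum>s<d. \<Sum>t<d. shifted_count s t R / R\<^sup>2) / (real d)\<^sup>2) \<longlongrightarrow>
      (\<Sum>s<d. \<Sum>t<d. 6 / pi * real_of_int (gcd (gcd (gA + int s * gdelta) (gB + int t * gdelta)) (int d)) / real d) / (real d)\<^sup>2) at_top"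
    by (intro tendsto_divide[OF tendsto_sum[OF tendsto_sum] tendsto_const]) (use d_pos in auto)
  moreover have "(\<Sum>s<d. \<Sum>t<d. 6 / pi * real_of_int (gcd (gcd (gA + int s * gdelta) (gB + int t * gdelta)) (int d)) / real d) / (real d)\<^sup>2 = 6 / (pi * real d) * \<Sigma>"
  proof -
    have "(\<Sum>s<d. \<Sum>t<d. real_of_int (gcd (gcd (gA + int s * gdelta) (gB + int t * gdelta)) (int d))) = (real d)\<^sup>2 * \<Sigma>"
      unfolding \<Sigma>_def divisors_d_abs[OF d_pos] gdelta_def[symmetric]
    \<comment> \<open>Surjectivity of \<alpha> enters here: \<open>gA\<close>, \<open>gB\<close>,
      \<open>gdelta\<close> and \<open>d\<close> have no common factor.\<close>
    proof (rule gcd_average[OF d_pos])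
      fix l assume "l dvd int d" "l dvd gdelta" "l dvd gA" "l dvd gB"
      moreover from this have "l dvd \<delta> i" for i
        unfolding gdelta_def by (meson Gcd_dvd dvd_trans insertI2 rangeI)
      ultimately show "is_unit l"
        using monodromy_generates by blast
    qed
    then have "(\<Sum>s<d. \<Sum>t<d. 6 / pi * real_of_int (gcd (gcd (gA + int s * gdelta) (gB + int t * gdelta)) (int d)) / real d) = 6 / pi * ((real d)\<^sup>2 * \<Sigma>) / real d"
      by (simp only: sum_divide_distrib[symmetric] sum_distrib_left[symmetric])
    then show ?thesis
      using d_pos by (simp add: field_simps)
  qed
  moreover have "(\<lambda>R. (\<Sum>s<d. \<Sum>t<d. shifted_count s t R / R\<^sup>2) / (real d)\<^sup>2) = (\<lambda>R. T R / R\<^sup>2)"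
    by (intro ext) (simp add: T_def sum_divide_distrib[symmetric])
  ultimately have Tlim: "((\<lambda>R. T R / R\<^sup>2) \<longlongrightarrow> 6 / (pi * real d) * \<Sigma>) at_top"
    by simp
  have Elim: "((\<lambda>R. E j r R / R\<^sup>2) \<longlongrightarrow> 0) at_top" if "j < d" for j r
  proof (cases "int d dvd int j * gdelta")
    case False
    define n where "n = real (ordn (int r))"
    have n: "n > 0"
      using ordn_pos[of "int r"] by (simp add: n_def)
    have "((\<lambda>R. norm (char_sum d \<delta> gA gB (int j) x (R / n)) / (R / n)\<^sup>2) \<longlongrightarrow> 0) at_top"
    proof (rule filterlim_compose[OF char_sum_tendsto_real[OF lim[OF that False]]])
      have "filterlim (\<lambda>R. inverse n * R) at_top at_top"
        using n by (intro filterlim_tendsto_pos_mult_at_top[OF tendsto_const] filterlim_ident) auto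
      then show "filterlim (\<lambda>R. R / n) at_top at_top"
        by (simp add: field_simps)
    qed
    from tendsto_mult[OF this tendsto_const, of "inverse (n\<^sup>2)"] show ?thesis
      using False n by (simp add: E_def n_def[symmetric] power_divide field_simps)
  qed (simp add: E_def)
  have diff: "\<bar>area_count R - T R\<bar> \<le> (\<Sum>j<d. \<Sum>r<d. E j r R)" for R
  proof -
    have "\<bar>area_count R - T R\<bar> = norm (complex_of_real (area_count R - T R))"
      by (simp only: norm_of_real)
    also have "\<dots> = norm (\<Sum>j<d. \<Sum>r<d. ech d (- int j * int r) * (if int d dvd int j * gdelta then 0
       else char_sum d \<delta> gA gB (int j) x (R / real (ordn (int r))))) / real d"
      unfolding T_def area_count_decomposition by (simp add: norm_divide)
    also have "\<dots> \<le> (\<Sum>j<d. \<Sum>r<d. E j r R) / real d"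
      by (intro divide_right_mono sum_norm_le) (auto simp: E_def norm_mult)
    also have "\<dots> \<le> (\<Sum>j<d. \<Sum>r<d. E j r R) / 1"
      using d_pos by (intro divide_left_mono sum_nonneg) (auto simp: E_def)
    finally show ?thesis by simp
  qed
  have "((\<lambda>R. (area_count R - T R) / R\<^sup>2) \<longlongrightarrow> 0) at_top"
  proof (rule Lim_null_comparison)
    show "\<forall>\<^sub>F R in at_top. norm ((area_count R - T R) / R\<^sup>2) \<le> (\<Sum>j<d. \<Sum>r<d. E j r R / R\<^sup>2)"
    proof (rule always_eventually, rule allI)
      fix R :: real
      have "norm ((area_count R - T R) / R\<^sup>2) \<le> (\<Sum>j<d. \<Sum>r<d. E j r R) / R\<^sup>2"
        using diff[of R] by (simp add: divide_right_mono)
      then show "norm ((area_count R - T R) / R\<^sup>2) \<le> (\<Sum>j<d. \<Sum>r<d. E j r R / R\<^sup>2)"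
        by (simp only: sum_divide_distrib)
    qed
    have "((\<lambda>R. \<Sum>j<d. \<Sum>r<d. E j r R / R\<^sup>2) \<longlongrightarrow> (\<Sum>j<d. \<Sum>r<d. 0)) at_top"
      by (intro tendsto_sum Elim) auto
    then show "((\<lambda>R. \<Sum>j<d. \<Sum>r<d. E j r R / R\<^sup>2) \<longlongrightarrow> 0) at_top"
      by simp
  qed
  from tendsto_add[OF this Tlim] have Nlim: "((\<lambda>R. area_count R / R\<^sup>2) \<longlongrightarrow> 6 / (pi * real d) * \<Sigma>) at_top"
    by (simp add: add_divide_distrib[symmetric])
  have sd: "sqrt (real d) > 0"
    using d_pos by simp
  have "filterlim (\<lambda>L. sqrt (real d) * L) at_top at_top"
    using sd by (intro filterlim_tendsto_pos_mult_at_top[OF tendsto_const] filterlim_ident) auto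
  then have "filterlim (\<lambda>L. L * sqrt (real d)) at_top at_top"
    by (simp only: mult.commute)
  from filterlim_compose[OF Nlim this]
  have "((\<lambda>L. area_count (L * sqrt (real d)) / (L * sqrt (real d))\<^sup>2) \<longlongrightarrow> 6 / (pi * real d) * \<Sigma>) at_top" .
  from tendsto_mult[OF tendsto_const this, of "real d / (2 * pi)"]
  have "((\<lambda>L. real d / (2 * pi) * (area_count (L * sqrt (real d)) / (L * sqrt (real d))\<^sup>2)) \<longlongrightarrow> 3 / pi\<^sup>2 * \<Sigma>) at_top"
    using d_pos by (simp add: power2_eq_square)
  moreover have "cylinder_area_sum x \<alpha> L / (pi * L\<^sup>2) = real d / (2 * pi) * (area_count (L * sqrt (real d)) / (L * sqrt (real d))\<^sup>2)" for L
    unfolding cylinder_area_sum_eq[OF refl] area_count_def[symmetric]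
    using d_pos by (simp add: power_mult_distrib)
  ultimately show ?thesis
    by (simp only: \<Sigma>_def)
qed

end

section \<open>Moving the marked points\<close>

text \<open>A solution of \<open>h z = w\<close> is a fixed point of the contraction that sends
  \<open>z\<close> to \<open>z - h z + w\<close>. The lower Lipschitz bound
  \<open>1 - \<kappa>\<close> gives injectivity and a continuous inverse.\<close>

lemma near_identity_homeomorphism:
  fixes h :: "complex \<Rightarrow> complex"
  assumes \<kappa>: "\<kappa> < 1" and lip: "\<And>z w. norm (h z - h w - (z - w)) \<le> \<kappa> * norm (z - w)"
  shows "bij h" "continuous_on UNIV h" "continuous_on UNIV (inv_into UNIV h)"
proof -
  have \<kappa>0: "\<kappa> \<ge> 0"
    using lip[of 1 0] norm_ge_zero[of "h 1 - h 0 - (1 - 0)"] by (simp del: norm_ge_zero)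
  have low: "(1 - \<kappa>) * norm (z - w) \<le> norm (h z - h w)" for z w
    using norm_triangle_ineq2[of "z - w" "h z - h w"] lip[of z w] norm_minus_commute[of "z - w" "h z - h w"]
    unfolding left_diff_distrib mult_1_left by linarith
  have up: "norm (h z - h w) \<le> (1 + \<kappa>) * norm (z - w)" for z w
    using norm_triangle_ineq[of "z - w" "h z - h w - (z - w)"] lip[of z w]
    unfolding distrib_right mult_1_left by (simp only: add_diff_cancel_left' diff_add_cancel add.commute[of "z - w"])
  have "inj h"
  proof (rule injI)
    fix z w assume "h z = h w"
    then have "(1 - \<kappa>) * norm (z - w) \<le> 0"
      using low[of z w] by simp
    then show "z = w"
      using \<kappa> by (simp add: mult_le_0_iff)
  qed
  moreover have "surj h"
    unfolding surj_def
  proof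
    fix w
    have "\<exists>!z. z - h z + w = z"
    proof (rule banach_fix_type[OF \<kappa>0 \<kappa>], intro allI)
      show "dist (z - h z + w) (z' - h z' + w) \<le> \<kappa> * dist z z'" for z z'
      proof -
        have "dist (z - h z + w) (z' - h z' + w) = norm (h z - h z' - (z - z'))"
          by (subst norm_minus_commute) (simp add: dist_norm algebra_simps)
        then show ?thesis
          using lip[of z z'] by (simp add: dist_norm)
      qed
    qed
    then show "\<exists>z. w = h z"
      by (auto simp: algebra_simps)
  qed
  ultimately show b: "bij h"
    by (simp add: bij_def)
  show "continuous_on UNIV h"
  proof (rule lipschitz_on_continuous_on)
    show "(1 + \<kappa>)-lipschitz_on UNIV h"
      using up \<kappa>0 by (intro lipschitz_onI) (auto simp: dist_norm)
  qed
  show "continuous_on UNIV (inv_into UNIV h)"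
  proof (rule lipschitz_on_continuous_on)
    have "norm (inv_into UNIV h z - inv_into UNIV h w) \<le> 1 / (1 - \<kappa>) * norm (z - w)" for z w
      using low[of "inv_into UNIV h z" "inv_into UNIV h w"] b \<kappa> by (simp add: bij_is_surj surj_f_inv_f field_simps)
    then show "(1 / (1 - \<kappa>))-lipschitz_on UNIV (inv_into UNIV h)"
      using \<kappa> by (intro lipschitz_onI) (auto simp: dist_norm)
  qed
qed

text \<open>Points of the torus are cosets, so the map induced by \<open>h\<close> is
  \<open>image h\<close>, and continuity is tested on the plane by the quotient property.\<close>

lemma continuous_map_torus:
  assumes "continuous_on UNIV h" "\<And>z. h ` torus_pt y z = torus_pt x (h z)"
  shows "continuous_map (torus_topology y) (torus_topology x) (image h)"
proof -
  have "continuous_map euclidean (torus_topology x) (torus_pt x \<circ> h)"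
    using continuous_map_compose[of euclidean euclidean h "torus_topology x" "torus_pt x"]
      assms(1) quotient_imp_continuous_map[OF quotient_map_torus_pt[of x]] by simp
  moreover have "torus_pt x \<circ> h = image h \<circ> torus_pt y"
    using assms(2) by (simp add: fun_eq_iff)
  ultimately show ?thesis
    using continuous_compose_quotient_map_eq[OF quotient_map_torus_pt] by metis
qed

lemma homeomorphic_map_punctured:
  assumes h: "bij h" "continuous_on UNIV h" "continuous_on UNIV (inv_into UNIV h)"
    and per: "\<And>z. h ` torus_pt y z = torus_pt x (h z)" and marks: "\<And>i. h (mark y i) = mark x i"
  shows "homeomorphic_map (punctured_torus y) (punctured_torus x) (image h)"
proof -
  note inj = bij_is_inj[OF h(1)] and surj = bij_is_surj[OF h(1)]
  have per': "inv_into UNIV h ` torus_pt x w = torus_pt y (inv_into UNIV h w)" for w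
    using per[of "inv_into UNIV h w"] inj surj by (metis image_inv_f_f surj_f_inv_f)
  have hm: "homeomorphic_map (torus_topology y) (torus_topology x) (image h)"
    using continuous_map_torus[OF h(2) per] continuous_map_torus[OF h(3) per'] inj surj
    by (intro homeomorphic_maps_imp_map[where g = "image (inv_into UNIV h)"]) (simp add: homeomorphic_maps_def image_f_inv_f)
  have "image h ` (topspace (torus_topology y) \<inter> - marked_pts y) = topspace (torus_topology x) \<inter> - marked_pts x"
  proof -
    have "image h ` marked_pts y = marked_pts x"
      by (simp add: marked_pts_def image_image per marks)
    moreover have "image h ` (A - B) = image h ` A - image h ` B" for A B
      using inj by (intro image_set_diff) (simp add: inj_image_eq_iff inj_def)
    ultimately show ?thesis
      using homeomorphic_imp_surjective_map[OF hm] by (simp add: Diff_eq[symmetric])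
  qed
  then show ?thesis
    unfolding punctured_torus_def by (rule homeomorphic_map_subtopologies[OF hm])
qed

section \<open>Transport of covers along a deformation\<close>

context torus_cover
begin

text \<open>The radius \<open>2 * r\<close> leaves room for a circle of radius \<open>r\<close> that
  is perturbed by less than \<open>r\<close>.\<close>

lemma punctured_disc:
  assumes "p \<in> punct"
  shows "\<forall>\<^sub>F r in at_right 0. \<forall>z. z \<noteq> p \<longrightarrow> dist p z \<le> 2 * r \<longrightarrow> z \<in> U"
proof -
  have "finite (punct \<inter> ball p 1 - {p})"
    using punct_finite_bounded[of "ball p 1"] by simp
  then obtain e where e: "e > 0" "\<And>q. q \<in> punct \<inter> ball p 1 - {p} \<Longrightarrow> e \<le> dist p q"
    using finite_set_avoid[of "punct \<inter> ball p 1 - {p}" p] by blast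
  have "z \<in> U" if "r < min e 1 / 2" "z \<noteq> p" "dist p z \<le> 2 * r" for r z
    using e(2)[of z] that by (force simp: U_def)
  then show ?thesis
    using e(1) by (auto simp: eventually_at_right_field intro!: exI[of _ "min e 1 / 2"])
qed

text \<open>The linear homotopy from the circle to the perturbed one stays off \<open>p\<close>,
  because the perturbation is smaller than \<open>r\<close>. On the square of the homotopy the
  diagonal is split in two ways, and the two sides traced by the end points coincide since
  \<open>e 0 = e 1\<close>.\<close>

lemma perturbed_circle:
  assumes disc: "\<And>z. z \<noteq> p \<Longrightarrow> dist p z \<le> 2 * r \<Longrightarrow> z \<in> U" and r: "r > 0" and \<kappa>: "\<kappa> < 1"
    and e: "continuous_on {0..1} e" "\<And>t. norm (e t) \<le> \<kappa> * r" "e 0 = e 1"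
  shows "cyc_val (path_chain (pr \<circ> (\<lambda>t. circ p r t + e t))) = cyc_val (path_chain (pr \<circ> circ p r))"
proof -
  define Q where "Q = {0..1::real} \<times> {0..1::real}"
  define k where "k w = circ p r (snd w) + of_real (fst w) * e (snd w)" for w :: "real \<times> real"
  have conv: "convex Q"
    unfolding Q_def by (intro convex_Times convex_real_interval)
  have kU: "k w \<in> U" if "w \<in> Q" for w
  proof (rule disc)
    have w: "0 \<le> fst w" "fst w \<le> 1"
      using that by (auto simp: Q_def)
    have "norm (of_real (fst w) * e (snd w)) \<le> 1 * (\<kappa> * r)"
      unfolding norm_mult using w e(2) by (intro mult_mono) auto
    moreover have "\<kappa> * r < r"
      using \<kappa> r by simp
    ultimately have small: "norm (of_real (fst w) * e (snd w)) < r"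
      by linarith
    have c: "norm (of_real r * cis (2 * pi * snd w)) = r"
      using r by (simp add: norm_mult)
    have dist: "dist p (k w) = norm (of_real r * cis (2 * pi * snd w) + of_real (fst w) * e (snd w))"
      by (subst dist_commute) (simp add: dist_norm k_def circ_def add.assoc)
    show "dist p (k w) \<le> 2 * r"
      using norm_triangle_ineq[of "of_real r * cis (2 * pi * snd w)" "of_real (fst w) * e (snd w)"] small c dist by linarith
    have "dist p (k w) > 0"
      using norm_diff_ineq[of "of_real r * cis (2 * pi * snd w)" "of_real (fst w) * e (snd w)"] small c dist by linarith
    then show "k w \<noteq> p"
      by auto
  qed
  have "continuous_on Q k"
    unfolding k_def circ_def Q_def
    by (intro continuous_intros continuous_on_compose2[OF e(1)] continuous_on_compose2[OF continuous_on_cis]) auto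
  then have "continuous_map (top_of_set Q) (top_of_set U) k"
    using kU by (auto simp: image_subset_iff)
  from continuous_map_compose[OF this continuous_pr[of U]]
  have f: "continuous_map (top_of_set Q) X (pr \<circ> k)"
    by simp
  have up: "unit_path (top_of_set Q) (linepath u v)" if "u \<in> Q" "v \<in> Q" for u v
    using unit_path_linepath[OF conv that] .
  have Q: "(0, 0) \<in> Q" "(0, 1) \<in> Q" "(1, 0) \<in> Q" "(1, 1) \<in> Q"
    by (auto simp: Q_def)
  define T where "T u v = path_val ((pr \<circ> k) \<circ> linepath u v)" for u v
  have "[T (0, 0) (1, 1) = T (0, 0) (0, 1) + T (0, 1) (1, 1)] (mod int d)"
    unfolding T_def
    by (rule path_val_convex[OF conv f up[OF Q(1,2)] up[OF Q(2,4)] up[OF Q(1,4)]]) (simp_all add: linepath_0' linepath_1')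
  moreover have "[T (0, 0) (1, 1) = T (0, 0) (1, 0) + T (1, 0) (1, 1)] (mod int d)"
    unfolding T_def
    by (rule path_val_convex[OF conv f up[OF Q(1,3)] up[OF Q(3,4)] up[OF Q(1,4)]]) (simp_all add: linepath_0' linepath_1')
  moreover have "(pr \<circ> k) \<circ> linepath (0, 1) (1, 1) = (pr \<circ> k) \<circ> linepath (0, 0) (1, 0)"
    using e(3) by (simp add: fun_eq_iff k_def linepath_def circ_def)
  then have "T (0, 1) (1, 1) = T (0, 0) (1, 0)"
    by (simp add: T_def)
  ultimately have "[T (0, 0) (0, 1) + T (0, 0) (1, 0) = T (1, 0) (1, 1) + T (0, 0) (1, 0)] (mod int d)"
    by (simp add: cong_def add.commute)
  then have *: "[path_val ((pr \<circ> k) \<circ> linepath (0, 0) (0, 1)) = path_val ((pr \<circ> k) \<circ> linepath (1, 0) (1, 1))] (mod int d)"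
    unfolding cong_add_rcancel T_def .
  have eqs: "(pr \<circ> k) \<circ> linepath (0, 0) (0, 1) = pr \<circ> circ p r" "(pr \<circ> k) \<circ> linepath (1, 0) (1, 1) = pr \<circ> (\<lambda>t. circ p r t + e t)"
    by (simp_all add: fun_eq_iff k_def linepath_def)
  have paths: "unit_path X ((pr \<circ> k) \<circ> linepath (0, 0) (0, 1))" "unit_path X ((pr \<circ> k) \<circ> linepath (1, 0) (1, 1))"
    by (rule continuous_map_compose[OF up f]; rule Q)+
  have closed: "(pr \<circ> circ p r) 0 = (pr \<circ> circ p r) 1" "(pr \<circ> (\<lambda>t. circ p r t + e t)) 0 = (pr \<circ> (\<lambda>t. circ p r t + e t)) 1"
    using e(3) by (simp_all add: circ_def)
  note vals = path_val_closed[OF paths(1)[unfolded eqs] closed(1)] path_val_closed[OF paths(2)[unfolded eqs] closed(2)]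
  have "[cyc_val (path_chain (pr \<circ> (\<lambda>t. circ p r t + e t))) = cyc_val (path_chain (pr \<circ> circ p r))] (mod int d)"
    using cong_sym[OF *] unfolding eqs vals(1,3) .
  then show ?thesis
    using cyc_val_range[OF vals(2)] cyc_val_range[OF vals(4)] unfolding atLeastLessThan_iff
    by (intro cong_less_imp_eq_int) (elim conjE, assumption)+
qed

end

text \<open>The homomorphism is pulled back along the isomorphism of homology induced by
  \<open>h\<close>. A small circle around a mark of \<open>y\<close> goes to a slightly perturbed
  circle around the mark of \<open>x\<close>, so the local monodromy persists.\<close>

lemma locus_transport:
  fixes x y :: "'n::finite marked_torus"
  assumes d: "1 \<le> d" and loc: "(x, \<alpha>) \<in> cyclic_cover_locus d \<delta>" and area: "torus_area y = 1"
    and \<kappa>: "\<kappa> < 1" and lip: "\<And>z w. norm (h z - h w - (z - w)) \<le> \<kappa> * norm (z - w)"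
    and per: "\<And>z. h ` torus_pt y z = torus_pt x (h z)" and marks: "\<And>i. h (mark y i) = mark x i"
  shows "\<exists>\<alpha>'. (y, \<alpha>') \<in> cyclic_cover_locus d \<delta>"
proof -
  interpret torus_cover x \<alpha> d \<delta>
    using d loc by unfold_locales
  let ?f = "image h" and ?Y = "punctured_torus y"
  define \<phi> where "\<phi> = hom_induced 1 ?Y {} X {} ?f"
  define \<alpha>' where "\<alpha>' = restrict (\<alpha> \<circ> \<phi>) (carrier (H1 y))"
  note homeo = near_identity_homeomorphism[OF \<kappa> lip]
  have hm: "homeomorphic_map ?Y X ?f"
    by (rule homeomorphic_map_punctured[OF homeo per marks])
  have iso: "\<phi> \<in> iso (H1 y) (H1 x)"
    unfolding \<phi>_def by (rule homeomorphic_map_homology_iso[OF hm])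
  have hom: "\<phi> \<in> hom (H1 y) (H1 x)" and im: "\<phi> ` carrier (H1 y) = carrier (H1 x)"
    using iso by (auto simp: iso_def bij_betw_def)
  have a: "\<alpha> \<in> hom (H1 x) (integer_mod_group d)" "\<alpha> ` carrier (H1 x) = carrier (integer_mod_group d)"
    using alpha_epi by (auto simp: epi_def)
  have "\<alpha> \<circ> \<phi> \<in> hom (H1 y) (integer_mod_group d)"
    using hom a(1) by (rule Group.hom_compose)
  then have "\<alpha>' \<in> hom (H1 y) (integer_mod_group d)"
    unfolding \<alpha>'_def by (rule group.hom_restrict[rotated]) (simp_all add: group_relative_homology_group)
  moreover have "\<alpha>' ` carrier (H1 y) = carrier (integer_mod_group d)"
    unfolding \<alpha>'_def a(2)[symmetric] im[symmetric] by (auto simp: image_image)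
  ultimately have epi: "\<alpha>' \<in> epi (H1 y) (integer_mod_group d) \<inter> extensional (carrier (H1 y))"
    by (simp add: epi_def \<alpha>'_def)
  have unit: "unit_area_marked_torus y"
    unfolding unit_area_marked_torus_def
  proof
    show "inj (\<lambda>i. torus_pt y (mark y i))"
    proof (rule injI)
      fix i j assume "torus_pt y (mark y i) = torus_pt y (mark y j)"
      then have "torus_pt x (mark x i) = torus_pt x (mark x j)"
        using per[of "mark y i"] per[of "mark y j"] by (simp add: marks)
      then show "i = j"
        using marks_inj[of j i] by (simp add: pr_eq_iff)
    qed
  qed (rule area)
  have "has_local_monodromy y \<alpha>' \<delta>"
    unfolding has_local_monodromy_def
  proof
    fix i
    have pp: "mark x i \<in> punct"
      unfolding punct_iff by (rule exI[of _ i]) simp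
    have "\<forall>\<^sub>F r in at_right 0. r > (0::real)"
      by (simp add: eventually_at_right_less)
    moreover have "\<forall>\<^sub>F r in at_right 0. cyc_val (path_chain (small_loop x i r)) = \<delta> i"
      using loc by (auto simp: cyclic_cover_locus_def has_local_monodromy_def cyc_val_def)
    ultimately show "\<forall>\<^sub>F r in at_right 0. \<alpha>' (h1_class y (path_chain (small_loop y i r))) = \<delta> i"
      using punctured_disc[OF pp]
    proof eventually_elim
      case (elim r)
      define e where "e t = h (mark y i + of_real r * cis (2 * pi * t)) - (mark x i + of_real r * cis (2 * pi * t))" for t
      have circ: "?f (small_loop y i r t) = (pr \<circ> (\<lambda>t. circ (mark x i) r t + e t)) t" for t
        by (simp add: small_loop_def per e_def circ_def)
      have "cyc_val (path_chain (pr \<circ> (\<lambda>t. circ (mark x i) r t + e t))) = cyc_val (path_chain (pr \<circ> circ (mark x i) r))"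
      proof (rule perturbed_circle)
        show "z \<in> U" if "z \<noteq> mark x i" "dist (mark x i) z \<le> 2 * r" for z
          using elim(3) that by blast
        show "r > 0" "\<kappa> < 1"
          by fact+
        show "continuous_on {0..1} e"
          unfolding e_def
          by (intro continuous_intros continuous_on_compose2[OF homeo(2)] continuous_on_compose2[OF continuous_on_cis]) auto
        show "norm (e t) \<le> \<kappa> * r" for t
          using lip[of "mark y i + of_real r * cis (2 * pi * t)" "mark y i"] elim(1) by (simp add: e_def marks norm_mult algebra_simps)
        show "e 0 = e 1"
          by (simp add: e_def)
      qed
      also have "pr \<circ> circ (mark x i) r = small_loop x i r"
        by (simp add: fun_eq_iff small_loop_def circ_def)
      finally have val: "cyc_val (path_chain (?f \<circ> small_loop y i r)) = \<delta> i"
        using elim(2) circ by (simp add: comp_def)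
      have loopU: "pr (mark x i + of_real r * cis (2 * pi * t) + e t) \<in> topspace X" for t
      proof -
        have "norm (e t) \<le> \<kappa> * r"
          using lip[of "mark y i + of_real r * cis (2 * pi * t)" "mark y i"] elim(1) by (simp add: e_def marks norm_mult algebra_simps)
        moreover have "\<kappa> * r < r"
          using \<kappa> elim(1) by simp
        moreover have "norm (of_real r * cis (2 * pi * t)) = r"
          using elim(1) by (simp add: norm_mult)
        moreover have dist: "dist (mark x i) (mark x i + of_real r * cis (2 * pi * t) + e t) = norm (of_real r * cis (2 * pi * t) + e t)"
          by (subst dist_commute) (simp add: dist_norm add.assoc)
        ultimately have "dist (mark x i) (mark x i + of_real r * cis (2 * pi * t) + e t) \<le> 2 * r" "dist (mark x i) (mark x i + of_real r * cis (2 * pi * t) + e t) > 0"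
          using norm_triangle_ineq[of "of_real r * cis (2 * pi * t)" "e t"] norm_diff_ineq[of "of_real r * cis (2 * pi * t)" "e t"] by linarith+
        then show ?thesis
          using elim(3) by auto
      qed
      have "small_loop y i r t \<in> topspace ?Y" for t
      proof -
        have "?f (small_loop y i r t) \<in> ?f ` topspace ?Y"
          using loopU[of t] homeomorphic_imp_surjective_map[OF hm] by (simp add: circ circ_def)
        then show ?thesis
          using bij_is_inj[OF homeo(1)] by (auto simp: inj_image_eq_iff)
      qed
      moreover have "continuous_map (top_of_set {0..1}) (torus_topology y) (small_loop y i r)"
      proof -
        have "continuous_map (top_of_set {0..1}) euclidean (circ (mark y i) r)"
          using continuous_circ[of "{0..1}" "mark y i" r] by simp
        from continuous_map_compose[OF this quotient_imp_continuous_map[OF quotient_map_torus_pt]]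
        show ?thesis
          by (simp add: comp_def circ_def small_loop_def[abs_def])
      qed
      ultimately have path: "unit_path ?Y (small_loop y i r)"
        unfolding punctured_torus_def by (auto simp: continuous_map_in_subtopology)
      have cyc: "singular_relcycle 1 ?Y {} (path_chain (small_loop y i r))"
        using singular_chain_path_chain[OF path] chain_boundary_path_chain[of "small_loop y i r"]
        by (simp add: singular_cycle small_loop_def del: One_nat_def)
      have "\<phi> (h1_class y (path_chain (small_loop y i r))) = h1_class x (path_chain (?f \<circ> small_loop y i r))"
        using hom_induced_chain_map[OF homeomorphic_imp_continuous_map[OF hm] _ cyc, of "{}"]
        by (simp add: \<phi>_def h1_class_def chain_map_path_chain[simplified])
      moreover have "h1_class y (path_chain (small_loop y i r)) \<in> carrier (H1 y)"
        using cyc carrier_relative_homology_group[of 1 ?Y "{}"] by (auto simp: h1_class_def)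
      ultimately show ?case
        using val by (simp add: \<alpha>'_def cyc_val_def)
    qed
  qed
  with epi unit show ?thesis
    unfolding cyclic_cover_locus_def by blast
qed

section \<open>Deformation of nearby marked tori\<close>

lemma infdist_translate: "infdist (l + z) ((+) l ` S) = infdist z S" for l z :: "'a::real_normed_vector"
  by (simp add: infdist_def image_image dist_norm)

lemma torus_pt_eq: "torus_pt y z = range (\<lambda>(m, n). z + (of_int m * per1 y + of_int n * per2 y))"
  unfolding torus_pt_def period_lattice_def by (force simp: image_iff)

context torus_cover
begin

text \<open>Only finitely many lattice vectors come near the difference of two marks. The number 2
  in \<open>W\<close> makes the minimum exist and bounds \<epsilon> by 1.\<close>

lemma marks_separated:
  obtains \<epsilon> where "0 < \<epsilon>" "\<epsilon> \<le> 1" "\<And>i j l. i \<noteq> j \<Longrightarrow> l \<in> \<Lambda> \<Longrightarrow> 2 * \<epsilon> \<le> norm (mark x j - mark x i - l)"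
proof -
  define S where "S i j = (\<lambda>l. norm (mark x j - mark x i - l)) ` (\<Lambda> \<inter> ball (mark x j - mark x i) 2)" for i j
  define W where "W = insert 2 (\<Union>(i, j)\<in>{(i, j). i \<noteq> j}. S i j)"
  have fin: "finite W"
    unfolding W_def S_def using lattice_finite_bounded[OF bounded_ball] by auto
  have pos: "w > 0" if "w \<in> W" for w
  proof (cases "w = 2")
    case False
    then obtain i j l where ij: "i \<noteq> j" "l \<in> \<Lambda>" "w = norm (mark x j - mark x i - l)"
      using \<open>w \<in> W\<close> by (auto simp: W_def S_def)
    have "mark x j - mark x i \<noteq> l"
      using ij(1,2) marks_inj[of j i] by auto
    then show ?thesis
      using ij(3) by simp
  qed simp
  define \<epsilon> where "\<epsilon> = Min W / 2"
  have mem: "2 \<in> W"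
    by (simp add: W_def)
  have "Min W \<in> W"
    using fin mem by (intro Min_in) auto
  then have "0 < \<epsilon>"
    using pos by (simp add: \<epsilon>_def)
  moreover have le2: "Min W \<le> 2"
    using fin mem by (rule Min_le)
  moreover have "2 * \<epsilon> \<le> norm (mark x j - mark x i - l)" if l: "i \<noteq> j" "l \<in> \<Lambda>" for i j l
  proof (cases "norm (mark x j - mark x i - l) < 2")
    case True
    then have "norm (mark x j - mark x i - l) \<in> S i j"
      using l by (auto simp: S_def dist_norm)
    then have "norm (mark x j - mark x i - l) \<in> W"
      using l by (auto simp: W_def)
    then show ?thesis
      using fin Min_le by (simp add: \<epsilon>_def)
  qed (use le2 in \<open>simp add: \<epsilon>_def\<close>)
  ultimately show thesis
    using that[of \<epsilon>] by (simp add: \<epsilon>_def)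
qed

text \<open>
  The real-linear map that carries the periods of \<open>y\<close> to those of \<open>x\<close> is corrected by periodic bumps
  around the marked points; for \<open>y\<close> close to \<open>x\<close> the result differs from the identity by a contraction.
\<close>

lemma near_identity_deformation:
  obtains \<eta> where "\<eta> > 0" "\<And>y. torus_area y = 1 \<Longrightarrow> dist y x < \<eta> \<Longrightarrow>
    \<exists>h. (\<forall>z w. norm (h z - h w - (z - w)) \<le> 1 / 2 * norm (z - w)) \<and>
      (\<forall>z. h ` torus_pt y z = torus_pt x (h z)) \<and> (\<forall>i. h (mark y i) = mark x i)"
proof -
  obtain \<epsilon> where \<epsilon>: "0 < \<epsilon>" "\<epsilon> \<le> 1" and sep: "\<And>i j l. i \<noteq> j \<Longrightarrow> l \<in> \<Lambda> \<Longrightarrow> 2 * \<epsilon> \<le> norm (mark x j - mark x i - l)"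
    using marks_separated by blast
  define B where "B = 1 + norm x"
  define N where "N = real CARD('n)"
  \<comment> \<open>With this choice the deviation from the identity has Lipschitz constant at most
    1 / 5 from the linear part and 3 / 10 from the \<open>N\<close> bumps together, in total the
    required 1 / 2.\<close>
  define \<eta> where "\<eta> = \<epsilon> / (10 * N * B\<^sup>2)"
  have B: "B \<ge> 1"
    by (simp add: B_def)
  have B2: "B \<le> B\<^sup>2" "1 \<le> B\<^sup>2"
    using B by (simp_all add: power2_eq_square mult_le_cancel_left1 mult_le_cancel_left2 one_le_power[of B 2, simplified power2_eq_square])
  have N: "N \<ge> 1"
    by (simp add: N_def Suc_le_eq)
  have NB: "N * B\<^sup>2 \<ge> 1"
    using N B2 mult_mono[of 1 N 1 "B\<^sup>2"] by simp
  have \<eta>: "\<eta> > 0"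
    using \<epsilon> N B by (simp add: \<eta>_def)
  have \<eta>N: "10 * N * B\<^sup>2 * \<eta> = \<epsilon>"
    using N B by (simp add: \<eta>_def)
  have \<eta>1: "\<eta> \<le> 1"
    unfolding \<eta>_def using \<epsilon> NB by (subst pos_divide_le_eq) (auto simp: mult.assoc)
  have B\<eta>: "10 * (B\<^sup>2 * \<eta>) \<le> \<epsilon>"
    using \<eta>N N B2 \<eta> mult_right_mono[of 1 N "10 * (B\<^sup>2 * \<eta>)"] by (simp add: mult.assoc mult.left_commute)
  have B\<eta>': "B * \<eta> \<le> B\<^sup>2 * \<eta>" "\<eta> \<le> B\<^sup>2 * \<eta>"
    using B2 \<eta> mult_right_mono[of _ "B\<^sup>2" \<eta>] by fastforce+
  show thesis
  proof (rule that[OF \<eta>])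
    fix y :: "'n marked_torus"
    assume area: "torus_area y = 1" and near: "dist y x < \<eta>"
    define a where "a = per1 y"
    define b where "b = per2 y"
    define a0 where "a0 = per1 x"
    define b0 where "b0 = per2 x"
    have comp: "norm (fst u) \<le> norm u" "norm (fst (snd u)) \<le> norm u" "norm (snd (snd u) $ i) \<le> norm u" for u :: "'n marked_torus" and i
    proof -
      have s: "norm (snd u) \<le> norm u" "norm (fst (snd u)) \<le> norm (snd u)" "norm (snd (snd u)) \<le> norm (snd u)"
        using norm_snd_le[of "snd u" "fst u"] norm_fst_le[of "fst (snd u)" "snd (snd u)"] norm_snd_le[of "snd (snd u)" "fst (snd u)"] by simp_all
      show "norm (fst u) \<le> norm u"
        using norm_fst_le[of "fst u" "snd u"] by simp
      show "norm (fst (snd u)) \<le> norm u" "norm (snd (snd u) $ i) \<le> norm u"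
        using s Finite_Cartesian_Product.norm_nth_le[of "snd (snd u)" i] by linarith+
    qed
    have nearx: "norm (a0 - a) \<le> \<eta>" "norm (b0 - b) \<le> \<eta>" "norm (mark x i - mark y i) \<le> \<eta>" for i
      using comp(1)[of "x - y"] comp(2)[of "x - y"] comp(3)[of "x - y" i] near
      by (simp_all add: a_def b_def a0_def b0_def dist_norm norm_minus_commute[of y])
    have ny: "norm y \<le> B"
      using norm_triangle_ineq2[of y x] near \<eta>1 by (simp add: B_def dist_norm)
    have bnd: "norm a \<le> B" "norm b \<le> B" "norm (mark y i) \<le> B" for i
      using comp[of y] ny order_trans unfolding a_def b_def by blast+
    have ab: "crs a b = 1"
      using area by (simp add: torus_area_def crs_def a_def b_def)
    have ba: "crs b a = - 1"
      using ab crs_commute[of b a] by simp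
    \<comment> \<open>\<open>crs z b\<close> and \<open>crs a z\<close> are the coordinates of
      \<open>z\<close> in the basis \<open>a\<close>, \<open>b\<close> of area 1.\<close>
    define M where "M z = of_real (crs z b) * a0 + of_real (crs a z) * b0" for z
    have Mdiff: "M z - M w = M (z - w)" for z w
      by (simp add: M_def crs_linear algebra_simps)
    have Madd: "M (z + w) = M z + M w" for z w
      by (simp add: M_def crs_linear algebra_simps)
    have coord: "z = of_real (crs z b) * a + of_real (crs a z) * b" for z
    proof -
      have "of_real (crs z b) * a + of_real (crs a z) * b = of_real (crs a b) * z"
        by (simp add: complex_eq_iff crs_alt algebra_simps)
      then show ?thesis
        using ab by simp
    qed
    have crs_le: "\<bar>crs u v\<bar> \<le> norm u * norm v" for u v
      using abs_Im_le_cmod[of "cnj u * v"] by (simp add: crs_def norm_mult)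
    have MI: "norm (M z - z) \<le> 2 * (B * \<eta>) * norm z" for z
    proof -
      have "M z - z = of_real (crs z b) * (a0 - a) + of_real (crs a z) * (b0 - b)"
        by (subst (3) coord) (simp add: M_def algebra_simps)
      then have "norm (M z - z) \<le> \<bar>crs z b\<bar> * norm (a0 - a) + \<bar>crs a z\<bar> * norm (b0 - b)"
        by (metis norm_triangle_ineq norm_mult norm_of_real)
      also have "\<dots> \<le> (norm z * B) * \<eta> + (B * norm z) * \<eta>"
      proof (intro add_mono mult_mono)
        show "\<bar>crs z b\<bar> \<le> norm z * B"
          by (rule order_trans[OF crs_le mult_left_mono]) (use bnd in auto)
        show "\<bar>crs a z\<bar> \<le> B * norm z"
          by (rule order_trans[OF crs_le mult_right_mono]) (use bnd in auto)
      qed (use nearx B in auto)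
      finally show ?thesis
        by (simp add: algebra_simps)
    qed
    define c where "c i = mark x i - M (mark y i)" for i
    have c: "norm (c i) \<le> 3 * (B\<^sup>2 * \<eta>)" for i
    proof -
      have "c i = (mark x i - mark y i) - (M (mark y i) - mark y i)"
        by (simp add: c_def)
      then have "norm (c i) \<le> norm (mark x i - mark y i) + norm (M (mark y i) - mark y i)"
        by (simp only: norm_triangle_ineq4)
      also have "\<dots> \<le> \<eta> + 2 * (B * \<eta>) * B"
        by (rule add_mono[OF nearx(3) order_trans[OF MI mult_left_mono[OF bnd(3)]]]) (use B \<eta> in simp)
      also have "2 * (B * \<eta>) * B = 2 * (B\<^sup>2 * \<eta>)"
        by (simp add: power2_eq_square)
      finally show ?thesis
        using B\<eta>'(2) by linarith
    qed
    \<comment> \<open>A tent of height 1 and radius \<epsilon> around the orbit of a mark: periodic,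
      and Lipschitz with constant 1 / \<epsilon>.\<close>
    define bump where "bump i z = max 0 (1 - infdist z (torus_pt y (mark y i)) / \<epsilon>)" for i z
    define h where "h z = M z + (\<Sum>i\<in>UNIV. of_real (bump i z) * c i)" for z
    have bump_lip: "\<bar>bump i z - bump i w\<bar> \<le> norm (z - w) / \<epsilon>" for i z w
    proof -
      have "\<bar>bump i z - bump i w\<bar> \<le> \<bar>infdist z (torus_pt y (mark y i)) / \<epsilon> - infdist w (torus_pt y (mark y i)) / \<epsilon>\<bar>"
        unfolding bump_def by linarith
      also have "\<dots> = \<bar>infdist z (torus_pt y (mark y i)) - infdist w (torus_pt y (mark y i))\<bar> / \<epsilon>"
        using \<epsilon> by (simp add: diff_divide_distrib[symmetric])
      also have "\<dots> \<le> norm (z - w) / \<epsilon>"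
        using \<epsilon> infdist_triangle_abs[of z "torus_pt y (mark y i)" w] by (intro divide_right_mono) (auto simp: dist_norm)
      finally show ?thesis .
    qed
    have mem: "mark y i \<in> torus_pt y (mark y i)" for i
    proof -
      have "mark y i = (case (0, 0) of (m, n) \<Rightarrow> mark y i + (of_int m * per1 y + of_int n * per2 y))"
        by simp
      then show ?thesis
        unfolding torus_pt_eq by (rule range_eqI)
    qed
    have bump_self: "bump i (mark y i) = 1" for i
      using mem[of i] by (simp add: bump_def)
    \<comment> \<open>The separation 2 \<epsilon> is known for \<open>x\<close> only. Transferring
      it to \<open>y\<close> costs a factor 6 / 5 from \<open>M\<close> and at most 3 \<epsilon> / 5
      from the two corrections \<open>c\<close>, which still leaves \<epsilon>.\<close>
    have bump_other: "bump i (mark y j) = 0" if ij: "i \<noteq> j" for i j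
    proof -
      have "\<epsilon> \<le> dist (mark y j) w" if w: "w \<in> torus_pt y (mark y i)" for w
      proof -
        obtain m n :: int where w: "w = mark y i + (of_int m * a + of_int n * b)"
          using w by (auto simp: torus_pt_eq a_def b_def)
        define v where "v = mark y j - w"
        have "M (of_int m * a + of_int n * b) = of_int m * a0 + of_int n * b0"
          using ab ba crs_simps by (simp add: M_def crs_linear)
        then have "M v = M (mark y j) - M (mark y i) - (of_int m * a0 + of_int n * b0)"
          by (simp add: v_def w Mdiff[symmetric] Madd)
        then have Mv: "(mark x j - mark x i - (of_int m * a0 + of_int n * b0)) = M v + (c j - c i)"
          by (simp add: c_def)
        have "of_int m * a0 + of_int n * b0 \<in> \<Lambda>"
          unfolding a0_def b0_def by (rule vec_in_lattice)
        then have "2 * \<epsilon> \<le> norm (M v + (c j - c i))"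
          using sep[OF ij] Mv by metis
        also have "\<dots> \<le> norm (M v) + (norm (c j) + norm (c i))"
          using norm_triangle_ineq[of "M v" "c j - c i"] norm_triangle_ineq4[of "c j" "c i"] by linarith
        also have "norm (M v) \<le> norm v + norm (M v - v)"
          using norm_triangle_ineq[of v "M v - v"] by simp
        also have "norm (M v - v) \<le> 1 / 5 * norm v"
          using MI[of v] mult_right_mono[of "2 * (B * \<eta>)" "1 / 5" "norm v"] B\<eta> B\<eta>' \<epsilon>(2) by simp
        finally have "2 * \<epsilon> \<le> 6 / 5 * norm v + (norm (c j) + norm (c i))"
          by simp
        then show ?thesis
          using c[of i] c[of j] B\<eta> \<epsilon>(1) by (simp add: v_def dist_norm)
      qed
      then have "\<epsilon> \<le> infdist (mark y j) (torus_pt y (mark y i))"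
        using mem[of i] by (auto simp: infdist_def intro!: cINF_greatest)
      then show ?thesis
        using \<epsilon> by (simp add: bump_def pos_le_divide_eq)
    qed
    have "h (mark y j) = mark x j" for j
    proof -
      have "(\<Sum>i\<in>UNIV. of_real (bump i (mark y j)) * c i) = (\<Sum>i\<in>UNIV. if i = j then c i else 0)"
        using bump_self bump_other by (intro sum.cong) auto
      then show ?thesis
        by (simp add: h_def c_def)
    qed
    moreover have "norm (h z - h w - (z - w)) \<le> 1 / 2 * norm (z - w)" for z w
    proof -
      have "h z - h w - (z - w) = (M (z - w) - (z - w)) + (\<Sum>i\<in>UNIV. of_real (bump i z - bump i w) * c i)"
        by (simp add: h_def Mdiff[symmetric] sum_subtractf left_diff_distrib)
      then have "norm (h z - h w - (z - w)) \<le> norm (M (z - w) - (z - w)) + norm (\<Sum>i\<in>UNIV. of_real (bump i z - bump i w) * c i)"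
        by (simp only: norm_triangle_ineq)
      also have "norm (\<Sum>i\<in>UNIV. of_real (bump i z - bump i w) * c i) \<le> (\<Sum>i\<in>(UNIV :: 'n set). norm (z - w) / \<epsilon> * (3 * (B\<^sup>2 * \<eta>)))"
      proof (rule sum_norm_le)
        fix i
        show "norm (of_real (bump i z - bump i w) * c i) \<le> norm (z - w) / \<epsilon> * (3 * (B\<^sup>2 * \<eta>))"
          unfolding norm_mult norm_of_real using bump_lip[of i z w] c[of i] \<epsilon> by (intro mult_mono) auto
      qed
      also have "(\<Sum>i\<in>(UNIV :: 'n set). norm (z - w) / \<epsilon> * (3 * (B\<^sup>2 * \<eta>))) = 3 / 10 * norm (z - w)"
      proof -
        have "(\<Sum>i\<in>(UNIV :: 'n set). norm (z - w) / \<epsilon> * (3 * (B\<^sup>2 * \<eta>))) = 3 / 10 * norm (z - w) * (10 * N * B\<^sup>2 * \<eta>) / \<epsilon>"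
          by (simp add: N_def)
        then show ?thesis
          using \<eta>N \<epsilon> by simp
      qed
      also have "norm (M (z - w) - (z - w)) \<le> 1 / 5 * norm (z - w)"
        using MI[of "z - w"] mult_right_mono[of "2 * (B * \<eta>)" "1 / 5" "norm (z - w)"] B\<eta> B\<eta>' \<epsilon>(2) by simp
      finally show ?thesis
        by simp
    qed
    moreover have "h ` torus_pt y z = torus_pt x (h z)" for z
    proof -
      have "h (z + (of_int m * a + of_int n * b)) = h z + (of_int m * a0 + of_int n * b0)" for m n :: int
      proof -
        let ?l = "of_int m * a + of_int n * b"
        have tr: "(+) ?l ` torus_pt y q = torus_pt y q" for q
        proof -
          have "(+) ?l ` torus_pt y q = torus_pt y (?l + q)"
            unfolding torus_pt_def image_image by (simp add: add.assoc)
          also have "\<dots> = torus_pt y q"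
          proof -
            have shift: "?l + q + (of_int (fst w) * a + of_int (snd w) * b) = q + (of_int (fst w + m) * a + of_int (snd w + n) * b)" for w
              by (simp add: algebra_simps)
            have "torus_pt y (?l + q) = (\<lambda>w. q + (of_int (fst w) * a + of_int (snd w) * b)) ` (\<lambda>w. (fst w + m, snd w + n)) ` UNIV"
              unfolding torus_pt_eq image_image a_def[symmetric] b_def[symmetric] case_prod_unfold fst_conv snd_conv shift ..
            moreover have "(\<lambda>w. (fst w + m, snd w + n)) ` UNIV = (UNIV :: (int \<times> int) set)"
              by (rule surjI[where f = "\<lambda>w. (fst w - m, snd w - n)"]) simp
            ultimately show ?thesis
              by (simp add: torus_pt_eq a_def b_def case_prod_unfold)
          qed
          finally show ?thesis .
        qed
        have "infdist (z + ?l) (torus_pt y q) = infdist z (torus_pt y q)" for q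
          using infdist_translate[of ?l z "torus_pt y q"] tr by (simp add: add.commute)
        then have "bump i (z + ?l) = bump i z" for i
          by (simp add: bump_def)
        moreover have "M ?l = of_int m * a0 + of_int n * b0"
          using ab ba crs_simps by (simp add: M_def crs_linear)
        then have "M (z + ?l) = M z + (of_int m * a0 + of_int n * b0)"
          using Madd[of z ?l] by (simp only:)
        ultimately show ?thesis
          by (simp add: h_def)
      qed
      then show ?thesis
        unfolding torus_pt_eq image_image a_def[symmetric] b_def[symmetric] a0_def[symmetric] b0_def[symmetric]
        by (simp add: case_prod_unfold)
    qed
    ultimately show "\<exists>h. (\<forall>z w. norm (h z - h w - (z - w)) \<le> 1 / 2 * norm (z - w)) \<and>
      (\<forall>z. h ` torus_pt y z = torus_pt x (h z)) \<and> (\<forall>i. h (mark y i) = mark x i)"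
      by blast
  qed
qed

end

section \<open>The Siegel--Veech constant\<close>

lemma locus_neighbourhood:
  fixes \<delta> :: "'n::finite \<Rightarrow> int"
  assumes d: "1 \<le> d" and ne: "cyclic_cover_locus d \<delta> \<noteq> {}"
  obtains S :: "'n marked_torus set" where "open S" "S \<noteq> {}"
    "\<And>y. y \<in> S \<Longrightarrow> torus_area y > 0 \<and> (\<exists>\<alpha>. (rescale_to_unit_area y, \<alpha>) \<in> cyclic_cover_locus d \<delta>)"
proof -
  obtain x \<alpha> where loc: "(x, \<alpha>) \<in> cyclic_cover_locus d \<delta>"
    using ne by auto
  interpret torus_cover x \<alpha> d \<delta>
    using d loc by unfold_locales
  obtain \<eta> where \<eta>: "\<eta> > 0" and def: "\<And>y. torus_area y = 1 \<Longrightarrow> dist y x < \<eta> \<Longrightarrow>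
    \<exists>h. (\<forall>z w. norm (h z - h w - (z - w)) \<le> 1 / 2 * norm (z - w)) \<and>
      (\<forall>z. h ` torus_pt y z = torus_pt x (h z)) \<and> (\<forall>i. h (mark y i) = mark x i)"
    using near_identity_deformation by blast
  let ?r = "rescale_to_unit_area :: 'n marked_torus \<Rightarrow> 'n marked_torus"
  define P where "P = {y :: 'n marked_torus. 0 < torus_area y}"
  have "open P"
    unfolding P_def torus_area_def by (intro open_Collect_less continuous_intros)
  moreover have "continuous_on P ?r"
    unfolding rescale_to_unit_area_def P_def torus_area_def by (intro continuous_intros) auto
  ultimately have "open (P \<inter> ?r -` ball x \<eta>)"
    by (intro continuous_open_preimage) auto
  moreover have "x \<in> P \<inter> ?r -` ball x \<eta>"
    using area_1 \<eta> by (simp add: P_def torus_area_crs rescale_to_unit_area_def)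
  then have "P \<inter> ?r -` ball x \<eta> \<noteq> {}"
    by blast
  moreover have "torus_area y > 0 \<and> (\<exists>\<alpha>. (?r y, \<alpha>) \<in> cyclic_cover_locus d \<delta>)" if y: "y \<in> P \<inter> ?r -` ball x \<eta>" for y
  proof
    show pos: "torus_area y > 0"
      using y by (simp add: P_def)
    have area: "torus_area (?r y) = 1"
      using rescale_area[OF pos] by (simp add: torus_area_crs)
    have "dist (?r y) x < \<eta>"
      using y by (simp add: dist_commute)
    from def[OF area this] obtain h where h: "\<And>z w. norm (h z - h w - (z - w)) \<le> 1 / 2 * norm (z - w)"
      "\<And>z. h ` torus_pt (?r y) z = torus_pt x (h z)" "\<And>i. h (mark (?r y) i) = mark x i"
      by blast
    show "\<exists>\<alpha>. (?r y, \<alpha>) \<in> cyclic_cover_locus d \<delta>"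
      by (rule locus_transport[OF d loc area _ h]) simp
  qed
  ultimately show thesis
    using that by blast
qed

lemma AE_lborel_open:
  fixes S :: "'a::euclidean_space set"
  assumes AE: "AE y in lborel. Q y" and S: "open S" "S \<noteq> {}"
  shows "\<exists>y\<in>S. Q y"
proof (rule ccontr)
  assume *: "\<not> (\<exists>y\<in>S. Q y)"
  obtain N where N: "N \<in> null_sets lborel" "{y. \<not> Q y} \<subseteq> N"
    using AE unfolding eventually_ae_filter by auto
  have "negligible N"
    using N(1) by (simp add: negligible_iff_null_sets null_sets_completionI)
  moreover have "S \<subseteq> N"
    using * N(2) by blast
  ultimately show False
    using open_not_negligible[OF S] negligible_subset by blast
qed

lemma has_c_area_unique:
  fixes \<delta> :: "'n::finite \<Rightarrow> int"
  assumes d: "1 \<le> d" and ne: "cyclic_cover_locus d \<delta> \<noteq> {}"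
    and c: "has_c_area d \<delta> c" "has_c_area d \<delta> c'"
  shows "c = c'"
proof -
  obtain S :: "'n marked_torus set" where S: "open S" "S \<noteq> {}"
    and loc: "\<And>y. y \<in> S \<Longrightarrow> torus_area y > 0 \<and> (\<exists>\<alpha>. (rescale_to_unit_area y, \<alpha>) \<in> cyclic_cover_locus d \<delta>)"
    using locus_neighbourhood[OF d ne] by blast
  let ?Q = "\<lambda>y c. torus_area y > 0 \<longrightarrow> (\<forall>\<alpha>. (rescale_to_unit_area y, \<alpha>) \<in> cyclic_cover_locus d \<delta> \<longrightarrow>
    ((\<lambda>L. cylinder_area_sum (rescale_to_unit_area y) \<alpha> L / (pi * L\<^sup>2)) \<longlongrightarrow> c) at_top)"
  have "AE y in lborel. ?Q y c \<and> ?Q y c'"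
    using c unfolding has_c_area_def almost_every_cover_def by (rule AE_conjI)
  from AE_lborel_open[OF this S] obtain y where "y \<in> S" "?Q y c" "?Q y c'"
    by blast
  with loc[of y] obtain \<alpha> where
    "((\<lambda>L. cylinder_area_sum (rescale_to_unit_area y) \<alpha> L / (pi * L\<^sup>2)) \<longlongrightarrow> c) at_top"
    "((\<lambda>L. cylinder_area_sum (rescale_to_unit_area y) \<alpha> L / (pi * L\<^sup>2)) \<longlongrightarrow> c') at_top"
    by blast
  then show ?thesis
    by (rule tendsto_unique[OF trivial_limit_at_top_linorder])
qed

text \<open>The exceptional sets for all \<open>A\<close>, \<open>B\<close>, \<open>j\<close> and
  \<open>i\<close> are countably many, so one null set serves every cover of a torus outside it;
  \<open>gA\<close> and \<open>gB\<close> are inserted afterwards.\<close>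

lemma has_c_area_totient_sum:
  fixes \<delta> :: "'n::finite \<Rightarrow> int"
  assumes d: "1 \<le> d"
  shows "has_c_area d \<delta> (3 / pi\<^sup>2 * (\<Sum>k | k dvd d_abs d \<delta>. real (totient k) / (real k)\<^sup>2))"
proof -
  let ?r = "rescale_to_unit_area :: 'n marked_torus \<Rightarrow> 'n marked_torus"
  let ?L = "\<lambda>A B j y. (\<lambda>k. char_sum d \<delta> A B j (?r y) (real k) / (real k)\<^sup>2) \<longlonglongrightarrow> 0"
  have "AE y in lborel. \<not> int d dvd j * \<delta> i \<longrightarrow> torus_area y > 0 \<longrightarrow> ?L A B j y" for A B j i
  proof (cases "int d dvd j * \<delta> i")
    case False
    from char_sum_AE[where d = d and j = j and \<delta> = \<delta> and i = i and A = A and B = B, OF d False] show ?thesis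
      by eventually_elim blast
  qed simp
  then have "AE y in lborel. \<forall>A B j i. \<not> int d dvd j * \<delta> i \<longrightarrow> torus_area y > 0 \<longrightarrow> ?L A B j y"
    by (simp only: AE_all_countable) simp
  then show ?thesis
    unfolding has_c_area_def almost_every_cover_def
  proof eventually_elim
    case (elim y)
    show ?case
    proof (intro impI allI)
      fix \<alpha>
      assume pos: "torus_area y > 0" and loc: "(?r y, \<alpha>) \<in> cyclic_cover_locus d \<delta>"
      interpret torus_cover "?r y" \<alpha> d \<delta>
        using d loc by unfold_locales
      show "((\<lambda>L. cylinder_area_sum (?r y) \<alpha> L / (pi * L\<^sup>2)) \<longlongrightarrow>
          3 / pi\<^sup>2 * (\<Sum>k | k dvd d_abs d \<delta>. real (totient k) / (real k)\<^sup>2)) at_top"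
        using elim pos dvd_gdelta_iff by (intro cylinder_area_limit) blast
    qed
  qed
qed

theorem corollary6:
  fixes d :: nat and \<delta> :: "'n::finite \<Rightarrow> int"
  assumes "1 \<le> d" and "2 \<le> CARD('n)" and "cyclic_cover_locus d \<delta> \<noteq> {}"
  shows "has_c_area d \<delta> (c_area d \<delta>) \<and>
         c_area d \<delta> = 3 / pi\<^sup>2 * (\<Sum>k | k dvd d_abs d \<delta>. real (totient k) / (real k)\<^sup>2) \<and>
         c_area d \<delta> = 3 / pi\<^sup>2 *
           dirichlet_conv (\<lambda>m. Id_pow (- 2) m * real (totient m)) (\<lambda>_. 1) (d_abs d \<delta>)"
proof -
  note has = has_c_area_totient_sum[OF assms(1), of \<delta>]
  have "c_area d \<delta> = 3 / pi\<^sup>2 * (\<Sum>k | k dvd d_abs d \<delta>. real (totient k) / (real k)\<^sup>2)"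
    unfolding c_area_def
    by (rule the_equality[where P = "has_c_area d \<delta>", OF has]) (rule has_c_area_unique[OF assms(1,3) _ has])
  moreover have "Id_pow (- 2) k * real (totient k) * 1 = real (totient k) / (real k)\<^sup>2" for k
    by (simp add: Id_pow_def power_int_minus divide_inverse mult.commute)
  ultimately show ?thesis
    using has by (simp add: dirichlet_conv_def)
qed

end
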